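(* Let $n\ge 1$ and let $X=X^{n,n+1}_{n+2}$ be the blow-up of $\mathbb{P}^n\times\mathbb{P}^{n+1}$ in $n+2$ points in general position. The monoid of effective divisor classes on $X$ is generated by the following classes: (G0) $E_i$, for every $i\in\{1,\dots,n+2\}$; (G1) $H_1-\sum_{i\in I}E_i$, for every $I\subset\{1,\dots,n+2\}$ with $|I|=n$; (G2) $H_2-\sum_{i\in I}E_i$, for every $I\subset\{1,\dots,n+2\}$ with $|I|=n+1$. In particular, writing a class as $D=d_1H_1+d_2H_2-\sum_{i=1}^{n+2}m_iE_i$, the effective cone $\operatorname{Eff}(X)$ has the following defining inequalities: (I0) $d_j\ge 0$ for every $j\in\{1,2\}$; (I1) $d_1+d_2\ge m_i$ for every $i\in\{1,\dots,n+2\}$; (I2) $nd_1+(n+1)d_2\ge\sum_{i\in I}m_i$ for every $I\subseteq\{1,\dots,n+2\}$ with $|I|\in\{n+1,n+2\}$.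
   Context: We work over an algebraically closed field of characteristic zero. $H_1$ and $H_2$ denote the pullbacks to $X$ of the hyperplane classes of $\mathbb{P}^n$ and $\mathbb{P}^{n+1}$ respectively, and $E_i$ denotes the exceptional divisor over the $i$-th blown-up point; $\{H_1,H_2,E_1,\dots,E_{n+2}\}$ is a basis of $N^1(X)$. A divisor class is effective if it contains an effective divisor; the effective cone is the convex cone in $N^1(X)_{\mathbb{R}}$ generated by effective classes. *)

theory Defs
  imports
    Complex_Main
    "HOL-Library.Poly_Mapping"
    "HOL-Computational_Algebra.Polynomial"
    "HOL-Computational_Algebra.Fraction_Field"
    "HOL-Algebra.Ideal"
    "HOL-Algebra.Generated_Rings"
    "HOL-Algebra.Free_Abelian_Groups"
begin

text \<open>
  An integral separated scheme \<open>X\<close> of finite type over a field is determined by its function field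
  \<open>K\<close> together with the set of the local rings of its points, regarded as subrings of \<open>K\<close>
  (Zariski's models; the Chevalley schemes of EGA I, section 8). Varieties are represented below by
  this set of local rings: a variety is a set of subrings of a fixed ambient field, and a point of
  it is identified with its local ring.
\<close>

section \<open>Rings inside a field\<close>

definition ring_on :: "'f::field set \<Rightarrow> 'f ring" where
  "ring_on A = \<lparr>carrier = A, monoid.mult = (*), one = 1, ring.zero = 0, add = (+)\<rparr>"

definition localization :: "'f::field set \<Rightarrow> 'f set \<Rightarrow> 'f set" where
  "localization A q = {a / s | a s. a \<in> A \<and> s \<in> A - q}"

definition spec_local_rings :: "'f::field set \<Rightarrow> 'f set set" where
  "spec_local_rings A = {localization A q | q. primeideal q (ring_on A)}"

definition nonunits :: "'f::field set \<Rightarrow> 'f set" where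
  "nonunits R = {a \<in> R. a = 0 \<or> inverse a \<notin> R}"

text \<open>For a local domain (as all points of a variety are), this says that the Krull dimension is 1.\<close>

definition one_dimensional_local :: "'f::field set \<Rightarrow> bool" where
  "one_dimensional_local R \<longleftrightarrow>
     {q. primeideal q (ring_on R)} = {{0}, nonunits R} \<and> nonunits R \<noteq> {0}"

definition uniformizer :: "'f::field set \<Rightarrow> 'f \<Rightarrow> bool" where
  "uniformizer R t \<longleftrightarrow> t \<in> R \<and> t \<noteq> 0 \<and> nonunits R = {t * a | a. a \<in> R}"

text \<open>The normalized valuation of a discrete valuation ring, on nonzero elements of its fraction field.\<close>

definition ord_at :: "'f::field set \<Rightarrow> 'f \<Rightarrow> int" where
  "ord_at R f = (THE k. \<exists>t u. uniformizer R t \<and> u \<in> R - nonunits R \<and> f = t powi k * u)"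


section \<open>Divisors on a variety that is regular in codimension one\<close>

text \<open>The local ring of the generic point is the function field, and it contains all the others.\<close>

definition function_field :: "'f::field set set \<Rightarrow> 'f set" where
  "function_field X = \<Union>X"

text \<open>A prime divisor is identified with (the local ring of) its generic point.\<close>

definition prime_divisors :: "'f::field set set \<Rightarrow> 'f set set" where
  "prime_divisors X = {R \<in> X. one_dimensional_local R}"

abbreviation Div :: "'f::field set set \<Rightarrow> ('f set \<Rightarrow>\<^sub>0 int) monoid" where
  "Div X \<equiv> free_Abelian_group (prime_divisors X)"

text \<open>
  The Weil divisor with prescribed coefficients. It is only applied to coefficient functions coming
  from Cartier divisors, for which only finitely many coefficients are nonzero.
\<close>

definition weil_divisor :: "'f::field set set \<Rightarrow> ('f set \<Rightarrow> int) \<Rightarrow> 'f set \<Rightarrow>\<^sub>0 int" where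
  "weil_divisor X v = Abs_poly_mapping (\<lambda>R. if R \<in> prime_divisors X then v R else 0)"

definition principal_divisor :: "'f::field set set \<Rightarrow> 'f \<Rightarrow> 'f set \<Rightarrow>\<^sub>0 int" where
  "principal_divisor X f = weil_divisor X (\<lambda>R. ord_at R f)"

definition principal_divisors :: "'f::field set set \<Rightarrow> ('f set \<Rightarrow>\<^sub>0 int) set" where
  "principal_divisors X = principal_divisor X ` (function_field X - {0})"

text \<open>
  The group of divisor classes. For the blow-ups considered here, which are smooth, projective and
  rational, linear and numerical equivalence agree, so that this group is \<open>Pic(X) = N\<^sup>1(X)\<close>.
\<close>

definition Cl :: "'f::field set set \<Rightarrow> ('f set \<Rightarrow>\<^sub>0 int) set monoid" where
  "Cl X = Div X Mod principal_divisors X"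

definition divisor_class :: "'f::field set set \<Rightarrow> ('f set \<Rightarrow>\<^sub>0 int) \<Rightarrow> ('f set \<Rightarrow>\<^sub>0 int) set" where
  "divisor_class X D = principal_divisors X #>\<^bsub>Div X\<^esub> D"

definition effective_divisors :: "'f::field set set \<Rightarrow> ('f set \<Rightarrow>\<^sub>0 int) set" where
  "effective_divisors X = {D \<in> carrier (Div X). \<forall>R. 0 \<le> Poly_Mapping.lookup D R}"

definition effective_classes :: "'f::field set set \<Rightarrow> ('f set \<Rightarrow>\<^sub>0 int) set set" where
  "effective_classes X = {\<alpha> \<in> carrier (Cl X). \<exists>D \<in> effective_divisors X. D \<in> \<alpha>}"

inductive_set submonoid_generated :: "('a, 'b) monoid_scheme \<Rightarrow> 'a set \<Rightarrow> 'a set" for G S where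
  one: "\<one>\<^bsub>G\<^esub> \<in> submonoid_generated G S"
| incl: "a \<in> S \<Longrightarrow> a \<in> submonoid_generated G S"
| mult: "\<lbrakk>a \<in> submonoid_generated G S; b \<in> submonoid_generated G S\<rbrakk>
          \<Longrightarrow> a \<otimes>\<^bsub>G\<^esub> b \<in> submonoid_generated G S"

text \<open>
  \<open>N\<^sup>1(X)\<close> tensored with the reals: real divisors modulo real linear combinations of principal
  divisors. The class of a real divisor is the set of all real divisors equivalent to it.
\<close>

definition real_divisor :: "('f set \<Rightarrow>\<^sub>0 int) \<Rightarrow> 'f set \<Rightarrow> real" where
  "real_divisor D R = of_int (Poly_Mapping.lookup D R)"

definition real_divisor_class :: "'f::field set set \<Rightarrow> ('f set \<Rightarrow> real) \<Rightarrow> ('f set \<Rightarrow> real) set" where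
  "real_divisor_class X D =
     {\<lambda>R. D R + (\<Sum>f\<in>F. c f * real_divisor (principal_divisor X f) R) | F c.
        finite F \<and> F \<subseteq> function_field X - {0}}"

definition effective_cone :: "'f::field set set \<Rightarrow> ('f set \<Rightarrow> real) set set" where
  "effective_cone X =
     {real_divisor_class X (\<lambda>R. \<Sum>D\<in>\<D>. c D * real_divisor D R) | \<D> c.
        finite \<D> \<and> \<D> \<subseteq> effective_divisors X \<and> (\<forall>D\<in>\<D>. 0 \<le> c D)}"


section \<open>Products of two projective spaces\<close>

text \<open>
  The ambient field is the field of fractions of the polynomial ring in the homogeneous coordinates
  \<open>x\<^sub>0, x\<^sub>1, \<dots>\<close> (the variables with even index) and \<open>y\<^sub>0, y\<^sub>1, \<dots>\<close> (those with odd index). The function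
  field of the product of projective spaces is the subfield generated by the quotients
  \<open>x\<^sub>k / x\<^sub>i\<close> and \<open>y\<^sub>k / y\<^sub>j\<close>.
\<close>

type_synonym 'k ambient = "((nat \<Rightarrow>\<^sub>0 nat) \<Rightarrow>\<^sub>0 'k) fract"

definition const :: "'k::field \<Rightarrow> 'k ambient" where
  "const c = Fraction_Field.Fract (Poly_Mapping.single 0 c) 1"

definition variable :: "nat \<Rightarrow> 'k::field ambient" where
  "variable v = Fraction_Field.Fract (Poly_Mapping.single (Poly_Mapping.single v 1) 1) 1"

definition x_coord :: "nat \<Rightarrow> 'k::field ambient" where
  "x_coord i = variable (2 * i)"

definition y_coord :: "nat \<Rightarrow> 'k::field ambient" where
  "y_coord j = variable (2 * j + 1)"

text \<open>The coordinate ring of the affine chart of \<open>\<P>\<^sup>n \<times> \<P>\<^sup>m\<close> where \<open>x\<^sub>i\<close> and \<open>y\<^sub>j\<close> do not vanish.\<close>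

definition chart :: "nat \<Rightarrow> nat \<Rightarrow> nat \<Rightarrow> nat \<Rightarrow> 'k::field ambient set" where
  "chart n m i j = generate_ring (ring_on UNIV)
     (range const \<union> {x_coord k / x_coord i | k. k \<le> n} \<union> {y_coord k / y_coord j | k. k \<le> m})"

text \<open>
  Closed points are given by homogeneous coordinates; only the first \<open>n + 1\<close> and \<open>m + 1\<close> entries
  are relevant.
\<close>

type_synonym 'k point = "(nat \<Rightarrow> 'k) \<times> (nat \<Rightarrow> 'k)"

definition is_point :: "nat \<Rightarrow> nat \<Rightarrow> 'k::field point \<Rightarrow> bool" where
  "is_point n m p \<longleftrightarrow> (\<exists>i\<le>n. fst p i \<noteq> 0) \<and> (\<exists>j\<le>m. snd p j \<noteq> 0)"

definition in_chart :: "nat \<Rightarrow> nat \<Rightarrow> 'k::field point \<Rightarrow> bool" where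
  "in_chart i j p \<longleftrightarrow> fst p i \<noteq> 0 \<and> snd p j \<noteq> 0"

definition point_ideal :: "nat \<Rightarrow> nat \<Rightarrow> nat \<Rightarrow> nat \<Rightarrow> 'k::field point \<Rightarrow> 'k ambient set" where
  "point_ideal n m i j p = genideal (ring_on (chart n m i j))
     ({x_coord k / x_coord i - const (fst p k / fst p i) | k. k \<le> n} \<union>
      {y_coord k / y_coord j - const (snd p k / snd p j) | k. k \<le> m})"


section \<open>The blow-up in finitely many points\<close>

text \<open>The ideal, in a chart, of the reduced subscheme consisting of the points \<open>P 1, \<dots>, P r\<close>.\<close>

definition points_ideal ::
    "nat \<Rightarrow> nat \<Rightarrow> nat \<Rightarrow> (nat \<Rightarrow> 'k::field point) \<Rightarrow> nat \<Rightarrow> nat \<Rightarrow> 'k ambient set" where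
  "points_ideal n m r P i j =
     chart n m i j \<inter> (\<Inter>l \<in> {l \<in> {1..r}. in_chart i j (P l)}. point_ideal n m i j (P l))"

text \<open>
  The blow-up of \<open>Spec A\<close> along an ideal \<open>I\<close> is covered by the spectra of the affine blow-up
  algebras \<open>A[I/f]\<close>, where \<open>f\<close> runs through the nonzero elements of \<open>I\<close>.
\<close>

definition blowup_algebra :: "'f::field set \<Rightarrow> 'f set \<Rightarrow> 'f \<Rightarrow> 'f set" where
  "blowup_algebra A I f = generate_ring (ring_on UNIV) (A \<union> {g / f | g. g \<in> I})"

definition blowup :: "nat \<Rightarrow> nat \<Rightarrow> nat \<Rightarrow> (nat \<Rightarrow> 'k::field point) \<Rightarrow> 'k ambient set set" where
  "blowup n m r P =
     (\<Union>i\<in>{..n}. \<Union>j\<in>{..m}. \<Union>f \<in> points_ideal n m r P i j - {0}.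
        spec_local_rings (blowup_algebra (chart n m i j) (points_ideal n m r P i j) f))"

definition lies_over :: "nat \<Rightarrow> nat \<Rightarrow> 'k::field ambient set \<Rightarrow> 'k point \<Rightarrow> bool" where
  "lies_over n m R p \<longleftrightarrow>
     (\<exists>i\<le>n. \<exists>j\<le>m. in_chart i j p \<and> chart n m i j \<subseteq> R \<and>
        nonunits R \<inter> chart n m i j = point_ideal n m i j p)"

definition exceptional_divisor ::
    "nat \<Rightarrow> nat \<Rightarrow> 'k::field ambient set set \<Rightarrow> 'k point \<Rightarrow> 'k ambient set \<Rightarrow>\<^sub>0 int" where
  "exceptional_divisor n m X p = frag_of (THE R. R \<in> prime_divisors X \<and> lies_over n m R p)"

text \<open>
  The pullbacks of the hyperplanes \<open>x\<^sub>0 = 0\<close> and \<open>y\<^sub>0 = 0\<close>. A local equation of the former at a point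
  of \<open>X\<close> is \<open>x\<^sub>0 / x\<^sub>i\<close>, where \<open>i\<close> is such that the point maps to the chart \<open>x\<^sub>i \<noteq> 0\<close>; two
  choices of \<open>i\<close> differ by a unit of the local ring.
\<close>

definition hyperplane_pullback1 ::
    "nat \<Rightarrow> 'k::field ambient set set \<Rightarrow> 'k ambient set \<Rightarrow>\<^sub>0 int" where
  "hyperplane_pullback1 n X = weil_divisor X
     (\<lambda>R. ord_at R (x_coord 0 / x_coord (SOME i. i \<le> n \<and> (\<forall>k\<le>n. x_coord k / x_coord i \<in> R))))"

definition hyperplane_pullback2 ::
    "nat \<Rightarrow> 'k::field ambient set set \<Rightarrow> 'k ambient set \<Rightarrow>\<^sub>0 int" where
  "hyperplane_pullback2 m X = weil_divisor X
     (\<lambda>R. ord_at R (y_coord 0 / y_coord (SOME j. j \<le> m \<and> (\<forall>k\<le>m. y_coord k / y_coord j \<in> R))))"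


section \<open>General position\<close>

text \<open>
  The parameter space of configurations is \<open>(\<P>\<^sup>n \<times> \<P>\<^sup>m)\<^sup>r\<close>. Its open subsets are given as sets of
  tuples of homogeneous coordinates, by the nonvanishing of some member of a set of multihomogeneous
  polynomials. The variables \<open>(l, Inl i)\<close> and \<open>(l, Inr j)\<close> are the coordinates \<open>x\<^sub>i\<close> and \<open>y\<^sub>j\<close> of the
  \<open>l\<close>-th point.
\<close>

type_synonym 'k config_poly = "(nat \<times> (nat + nat) \<Rightarrow>\<^sub>0 nat) \<Rightarrow>\<^sub>0 'k"

definition config_eval :: "(nat \<Rightarrow> 'k::field point) \<Rightarrow> 'k config_poly \<Rightarrow> 'k" where
  "config_eval P F = (\<Sum>e\<in>Poly_Mapping.keys F. Poly_Mapping.lookup F e *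
     (\<Prod>(l, z)\<in>Poly_Mapping.keys e.
        (case z of Inl i \<Rightarrow> fst (P l) i | Inr j \<Rightarrow> snd (P l) j) ^ Poly_Mapping.lookup e (l, z)))"

definition multihomogeneous :: "nat \<Rightarrow> nat \<Rightarrow> nat \<Rightarrow> 'k::field config_poly \<Rightarrow> bool" where
  "multihomogeneous n m r F \<longleftrightarrow>
     (\<exists>a b. \<forall>e\<in>Poly_Mapping.keys F.
        Poly_Mapping.keys e \<subseteq> {1..r} \<times> (Inl ` {..n} \<union> Inr ` {..m}) \<and>
        (\<forall>l\<in>{1..r}. (\<Sum>i\<le>n. Poly_Mapping.lookup e (l, Inl i)) = a l \<and>
                   (\<Sum>j\<le>m. Poly_Mapping.lookup e (l, Inr j)) = b l))"

definition configurations :: "nat \<Rightarrow> nat \<Rightarrow> nat \<Rightarrow> (nat \<Rightarrow> 'k::field point) set" where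
  "configurations n m r = {P. \<forall>l\<in>{1..r}. is_point n m (P l)}"

definition zariski_open :: "nat \<Rightarrow> nat \<Rightarrow> nat \<Rightarrow> (nat \<Rightarrow> 'k::field point) set \<Rightarrow> bool" where
  "zariski_open n m r U \<longleftrightarrow>
     (\<exists>S. (\<forall>F\<in>S. multihomogeneous n m r F) \<and>
        U = {P \<in> configurations n m r. \<exists>F\<in>S. config_eval P F \<noteq> 0})"

text \<open>A property holds for points in general position if it holds on a nonempty open set of configurations.\<close>

definition holds_in_general_position ::
    "nat \<Rightarrow> nat \<Rightarrow> nat \<Rightarrow> ((nat \<Rightarrow> 'k::field point) \<Rightarrow> bool) \<Rightarrow> bool" where
  "holds_in_general_position n m r Q \<longleftrightarrow> (\<exists>U. zariski_open n m r U \<and> U \<noteq> {} \<and> (\<forall>P\<in>U. Q P))"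

end

theory Submission
  imports Defs "Jordan_Normal_Form.Determinant"
begin

text \<open>
  The coordinates on \<open>X\<close> are those of the product of projective spaces, so divisors on \<open>X\<close> are
  studied through bihomogeneous forms in \<open>x\<^sub>0, \<dots>, x\<^sub>n\<close> and \<open>y\<^sub>0, \<dots>, y\<^sub>n\<^sub>+\<^sub>1\<close>. The prime divisors
  of \<open>X\<close> are of two kinds: the strict transforms of the zero sets of irreducible forms \<open>p\<close>, and
  the exceptional divisors \<open>E\<^sub>l\<close>. Their valuations are the exponent of \<open>p\<close> in a form and the
  multiplicity of a form at the \<open>l\<close>-th point (\<open>prime_divisors_X\<close>). To see that there are no
  others, take a point of the blow-up whose local ring \<open>R\<close> has dimension one. If \<open>R\<close> does not lie
  over a blown-up point, it is a local ring of the product, and factoring any nonunit produces an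
  irreducible form that is a nonunit of \<open>R\<close>; if it does, \<open>R\<close> is a local ring of the algebra
  obtained from a chart by dividing the local coordinates at the point by one of them, \<open>w\<close>, which
  is then an equation of the exceptional divisor. In both cases \<open>R\<close> is compared with the valuation
  ring, which is a local ring of the same algebra, by \<open>one_dimensional_eq_vring\<close>.

  The function field consists of the quotients of two forms of the same bidegree. Hence every form
  of bidegree \<open>(d, e)\<close> has a divisor of class \<open>d H\<^sub>1 + e H\<^sub>2\<close>, and since irreducible polynomials
  are prime (\<open>irreducible_imp_prime_mpoly\<close>), the strict transform of an irreducible form of
  bidegree \<open>(d, e)\<close> with multiplicities \<open>m\<^sub>l\<close> has class \<open>d H\<^sub>1 + e H\<^sub>2 - \<Sum> m\<^sub>l E\<^sub>l\<close>
  (\<open>pdiv_form_equiv\<close>, \<open>pdiv_bprime\<close>). So the theorem is about the bidegrees and multiplicities of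
  forms.

  These satisfy \<open>m\<^sub>l \<le> d + e\<close>, because a multiplicity is at most the total degree, and
  \<open>\<Sum> m\<^sub>l \<le> n d + (n + 1) e\<close>: through the \<open>n + 2\<close> points and a further general point there passes a
  rational curve of bidegree \<open>(n, n + 1)\<close>, and a form that does not vanish on it has at most
  \<open>n d + (n + 1) e\<close> zeros there, counted with multiplicity (\<open>curve_inequality\<close>). Conversely, a
  nonnegative vector \<open>m\<close> with these two properties is a sum of \<open>d\<close> indicator functions of sets of
  size at most \<open>n\<close> and \<open>e\<close> indicator functions of sets of size at most \<open>n + 1\<close>
  (\<open>split_into_indicators\<close>), which writes the class as a sum of classes \<open>H\<^sub>1 - \<Sum> E\<^sub>i\<close> over at most
  \<open>n\<close> points and \<open>H\<^sub>2 - \<Sum> E\<^sub>i\<close> over at most \<open>n + 1\<close> points; enlarging the sets costs only classes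
  \<open>E\<^sub>i\<close>. The generators are effective because through \<open>n\<close> points of \<open>\<P>\<^sup>n\<close>, and through \<open>n + 1\<close>
  points of \<open>\<P>\<^sup>n\<^sup>+\<^sup>1\<close>, there passes a hyperplane.

  The cone is treated in the same way with real coefficients. Splitting works over the reals, and
  conversely each inequality comes from a linear functional on divisors that vanishes on principal
  divisors and is nonnegative on prime divisors by the two bounds above
  (\<open>effective_imp_inequality\<close>).

  The configurations for which this argument works are those where every \<open>n + 1\<close> of the first
  components and all \<open>n + 2\<close> second components are linearly independent. This is the nonvanishing
  of a product of minors, which is multihomogeneous and not identically zero.
\<close>

section \<open>Evaluation of polynomials\<close>

hide_const (open) up_ring.monom up_ring.coeff Coset.order module.smult

definition Cst :: "'k::zero \<Rightarrow> ('v \<Rightarrow>\<^sub>0 nat) \<Rightarrow>\<^sub>0 'k" where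
  "Cst c = Poly_Mapping.single 0 c"

definition Var :: "'v \<Rightarrow> ('v \<Rightarrow>\<^sub>0 nat) \<Rightarrow>\<^sub>0 'k::{zero,one}" where
  "Var v = Poly_Mapping.single (Poly_Mapping.single v 1) 1"

definition power_product :: "('v \<Rightarrow> 'a::comm_ring_1) \<Rightarrow> ('v \<Rightarrow>\<^sub>0 nat) \<Rightarrow> 'a" where
  "power_product \<phi> e = (\<Prod>v\<in>Poly_Mapping.keys e. \<phi> v ^ Poly_Mapping.lookup e v)"

definition peval ::
    "('k::comm_ring_1 \<Rightarrow> 'a::comm_ring_1) \<Rightarrow> ('v \<Rightarrow> 'a) \<Rightarrow> (('v \<Rightarrow>\<^sub>0 nat) \<Rightarrow>\<^sub>0 'k) \<Rightarrow> 'a" where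
  "peval h \<phi> F = (\<Sum>e\<in>Poly_Mapping.keys F. h (Poly_Mapping.lookup F e) * power_product \<phi> e)"

text \<open>
  Ring homomorphisms as a predicate on functions: they are composed and iterated with changing
  rings of coefficients, and two homomorphisms on polynomials are compared by their values on
  constants and variables (\<open>rhom_eqI\<close>). Most identities between substitutions below are proved in
  this way.
\<close>

definition rhom :: "('a::comm_ring_1 \<Rightarrow> 'b::comm_ring_1) \<Rightarrow> bool" where
  "rhom h \<longleftrightarrow> h 1 = 1 \<and> (\<forall>a b. h (a + b) = h a + h b) \<and> (\<forall>a b. h (a * b) = h a * h b)"

lemma rhom_1: "rhom h \<Longrightarrow> h 1 = 1"
  and rhom_add: "rhom h \<Longrightarrow> h (a + b) = h a + h b"
  and rhom_mult: "rhom h \<Longrightarrow> h (a * b) = h a * h b"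
  by (auto simp: rhom_def)

lemma rhom_0: "rhom h \<Longrightarrow> h 0 = 0"
  using rhom_add[of h 0 0] by simp

lemma rhom_power: "rhom h \<Longrightarrow> h (a ^ n) = h a ^ n"
  by (induction n) (auto simp: rhom_1 rhom_mult)

lemma rhom_uminus: "rhom h \<Longrightarrow> h (- a) = - h a"
  using rhom_add[of h a "- a"] by (simp add: rhom_0 eq_neg_iff_add_eq_0 add.commute)

lemma rhom_diff: "rhom h \<Longrightarrow> h (a - b) = h a - h b"
  using rhom_add[of h a "- b"] by (simp add: rhom_uminus)

lemma rhom_sum: "rhom h \<Longrightarrow> h (sum f A) = (\<Sum>x\<in>A. h (f x))"
  by (induction A rule: infinite_finite_induct) (auto simp: rhom_0 rhom_add)

lemma rhom_prod: "rhom h \<Longrightarrow> h (prod f A) = (\<Prod>x\<in>A. h (f x))"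
  by (induction A rule: infinite_finite_induct) (auto simp: rhom_1 rhom_mult)

lemma rhom_compose: "rhom f \<Longrightarrow> rhom g \<Longrightarrow> rhom (\<lambda>x. f (g x))"
  by (auto simp: rhom_def)

lemma rhom_id: "rhom (\<lambda>x. x)"
  by (auto simp: rhom_def)

lemma rhom_dvd: "rhom h \<Longrightarrow> a dvd b \<Longrightarrow> h a dvd h b"
  by (auto simp: dvd_def rhom_mult)

lemma rhom_Cst: "rhom (Cst :: 'k::comm_ring_1 \<Rightarrow> _)"
  by (auto simp: rhom_def Cst_def single_add mult_single)

lemma rhom_const_poly: "rhom (\<lambda>a. [:a:])"
  by (auto simp: rhom_def one_pCons)

lemma rhom_poly: "rhom (\<lambda>p. poly p a)"
  by (auto simp: rhom_def)

lemma rhom_map_poly: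
  assumes "rhom h" shows "rhom (map_poly h)"
proof -
  have 1: "coeff (map_poly h p) n = h (coeff p n)" for p n
    by (simp add: coeff_map_poly rhom_0[OF assms])
  show ?thesis
    unfolding rhom_def
    by (auto simp: poly_eq_iff 1 rhom_add[OF assms] coeff_mult rhom_sum[OF assms] rhom_mult[OF assms]
      coeff_map_poly rhom_0[OF assms] rhom_1[OF assms])
qed

lemma Cst_0 [simp]: "Cst 0 = 0" by (simp add: Cst_def)
lemma Cst_1 [simp]: "Cst 1 = (1 :: _ \<Rightarrow>\<^sub>0 'k::zero_neq_one)" by (simp add: Cst_def)
lemma Cst_eq_iff [simp]: "Cst a = Cst b \<longleftrightarrow> a = b"
  by (simp add: Cst_def inj_eq)
lemma Cst_eq_0_iff [simp]: "Cst a = 0 \<longleftrightarrow> a = 0"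
  using Cst_eq_iff[of a 0] by (simp del: Cst_eq_iff)

lemma power_product_superset:
  assumes "finite A" "Poly_Mapping.keys e \<subseteq> A"
  shows "power_product \<phi> e = (\<Prod>v\<in>A. \<phi> v ^ Poly_Mapping.lookup e v)"
  unfolding power_product_def
  by (rule prod.mono_neutral_left) (use assms in \<open>auto simp: in_keys_iff\<close>)

lemma power_product_add: "power_product \<phi> (e + e') = power_product \<phi> e * power_product \<phi> e'"
proof -
  let ?A = "Poly_Mapping.keys e \<union> Poly_Mapping.keys e'"
  have "power_product \<phi> (e + e') = (\<Prod>v\<in>?A. \<phi> v ^ Poly_Mapping.lookup (e + e') v)"
    by (rule power_product_superset) (use keys_add[of e e'] in auto)
  also have "\<dots> = power_product \<phi> e * power_product \<phi> e'"
    using power_product_superset[of ?A e \<phi>] power_product_superset[of ?A e' \<phi>]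
    by (simp add: lookup_add power_add prod.distrib)
  finally show ?thesis .
qed

lemma power_product_0 [simp]: "power_product \<phi> 0 = 1"
  by (simp add: power_product_def)

lemma power_product_single: "power_product \<phi> (Poly_Mapping.single v k) = \<phi> v ^ k"
  by (cases "k = 0") (auto simp: power_product_def)

lemma sum_singles: "(\<Sum>e\<in>Poly_Mapping.keys F. Poly_Mapping.single e (Poly_Mapping.lookup F e)) = F"
proof (rule poly_mapping_eqI)
  fix k
  show "Poly_Mapping.lookup (\<Sum>e\<in>Poly_Mapping.keys F. Poly_Mapping.single e (Poly_Mapping.lookup F e)) k
     = Poly_Mapping.lookup F k"
    by (cases "k \<in> Poly_Mapping.keys F")
      (auto simp: lookup_sum lookup_single when_def in_keys_iff sum.delta)
qed

text \<open>
  Every monomial is a product of a constant and variables; this is what makes induction over the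
  way a polynomial is built from constants and variables possible.
\<close>

lemma single_power_product:
  "Poly_Mapping.single e (c::'k::comm_ring_1) = Cst c * power_product Var e"
proof -
  have 1: "Poly_Mapping.single (Poly_Mapping.single v k) (1::'k) = Var v ^ k" for v :: 'a and k
  proof (induction k)
    case (Suc k)
    have "Poly_Mapping.single (Poly_Mapping.single v (Suc k)) (1::'k)
       = Poly_Mapping.single (Poly_Mapping.single v 1) 1 * Poly_Mapping.single (Poly_Mapping.single v k) 1"
      by (simp add: mult_single flip: single_add)
    then show ?case using Suc by (simp add: Var_def)
  qed simp
  have 2: "Poly_Mapping.single (\<Sum>v\<in>A. f v) (1::'k) = (\<Prod>v\<in>A. Poly_Mapping.single (f v) 1)"
    if "finite A" for A and f :: "'a \<Rightarrow> 'a \<Rightarrow>\<^sub>0 nat"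
    using that
  proof induction
    case (insert x F)
    then show ?case by (simp add: mult_single flip: insert.IH)
  qed simp
  have "Poly_Mapping.single e (1::'k) = power_product Var e"
    unfolding power_product_def
    by (subst (1) sum_singles[of e, symmetric]) (simp add: 1 2)
  then have "power_product Var e = Poly_Mapping.single e (1::'k)" by simp
  then show ?thesis by (simp add: Cst_def mult_single)
qed

definition in_vars :: "'v set \<Rightarrow> (('v \<Rightarrow>\<^sub>0 nat) \<Rightarrow>\<^sub>0 'k::zero) \<Rightarrow> bool" where
  "in_vars V F \<longleftrightarrow> (\<forall>e\<in>Poly_Mapping.keys F. Poly_Mapping.keys e \<subseteq> V)"

lemma in_vars_induct [consumes 1, case_names Cst Var add mult]:
  fixes F :: "('v \<Rightarrow>\<^sub>0 nat) \<Rightarrow>\<^sub>0 'k::comm_ring_1"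
  assumes "in_vars V F"
    and C: "\<And>c. P (Cst c)" and V: "\<And>v. v \<in> V \<Longrightarrow> P (Var v)"
    and A: "\<And>F G. P F \<Longrightarrow> P G \<Longrightarrow> P (F + G)"
    and M: "\<And>F G. P F \<Longrightarrow> P G \<Longrightarrow> P (F * G)"
  shows "P F"
proof -
  have 1: "P 1" using C[of 1] by simp
  have 0: "P 0" using C[of 0] by simp
  have P: "P (F ^ k)" if "P F" for F k
    by (induction k) (auto intro: 1 M that)
  have Pr: "P (\<Prod>v\<in>A. f v)" if "\<And>v. v \<in> A \<Longrightarrow> P (f v)" for A and f :: "'v \<Rightarrow> _"
    using that by (induction A rule: infinite_finite_induct) (auto intro: 1 M)
  have S: "P (\<Sum>v\<in>A. f v)" if "\<And>v. v \<in> A \<Longrightarrow> P (f v)" for A and f :: "('v \<Rightarrow>\<^sub>0 nat) \<Rightarrow> _"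
    using that by (induction A rule: infinite_finite_induct) (auto intro: 0 A)
  have "P (\<Sum>e\<in>Poly_Mapping.keys F. Poly_Mapping.single e (Poly_Mapping.lookup F e))"
    using assms(1)
    by (intro S) (auto simp: single_power_product power_product_def in_vars_def intro!: M C Pr P V)
  then show ?thesis by (simp add: sum_singles)
qed

lemma mpoly_induct [case_names Cst Var add mult]:
  fixes F :: "('v \<Rightarrow>\<^sub>0 nat) \<Rightarrow>\<^sub>0 'k::comm_ring_1"
  assumes "\<And>c. P (Cst c)" and "\<And>v. P (Var v)"
    and "\<And>F G. P F \<Longrightarrow> P G \<Longrightarrow> P (F + G)"
    and "\<And>F G. P F \<Longrightarrow> P G \<Longrightarrow> P (F * G)"
  shows "P F"
proof -
  have "in_vars UNIV F" by (simp add: in_vars_def)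
  then show ?thesis by (induction rule: in_vars_induct) (auto intro: assms)
qed

lemma peval_superset:
  assumes "rhom h" "finite A" "Poly_Mapping.keys F \<subseteq> A"
  shows "peval h \<phi> F = (\<Sum>e\<in>A. h (Poly_Mapping.lookup F e) * power_product \<phi> e)"
  unfolding peval_def
  by (rule sum.mono_neutral_left) (use assms in \<open>auto simp: in_keys_iff rhom_0\<close>)

lemma peval_single: "rhom h \<Longrightarrow> peval h \<phi> (Poly_Mapping.single e c) = h c * power_product \<phi> e"
  by (cases "c = 0") (auto simp: peval_def rhom_0)

lemma peval_Cst [simp]: "rhom h \<Longrightarrow> peval h \<phi> (Cst c) = h c"
  by (simp add: Cst_def peval_single)

lemma peval_Var [simp]: "rhom h \<Longrightarrow> peval h \<phi> (Var v) = \<phi> v"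
  by (simp add: Var_def peval_single rhom_1 power_product_single)

lemma peval_add: 
  assumes "rhom h" shows "peval h \<phi> (F + G) = peval h \<phi> F + peval h \<phi> G"
proof -
  let ?A = "Poly_Mapping.keys F \<union> Poly_Mapping.keys G"
  have "peval h \<phi> (F + G) = (\<Sum>e\<in>?A. h (Poly_Mapping.lookup (F + G) e) * power_product \<phi> e)"
    by (rule peval_superset[OF assms]) (use keys_add[of F G] in auto)
  also have "\<dots> = peval h \<phi> F + peval h \<phi> G"
    using peval_superset[OF assms, of ?A F \<phi>] peval_superset[OF assms, of ?A G \<phi>]
    by (simp add: lookup_add rhom_add[OF assms] sum.distrib distrib_right)
  finally show ?thesis .
qed

lemma peval_sum:
  assumes "rhom h" shows "peval h \<phi> (sum f A) = (\<Sum>x\<in>A. peval h \<phi> (f x))"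
  by (induction A rule: infinite_finite_induct)
    (auto simp: peval_add[OF assms], auto simp: peval_def)

lemma peval_mult:
  assumes "rhom h" shows "peval h \<phi> (F * G) = peval h \<phi> F * peval h \<phi> G"
proof -
  let ?s = "\<lambda>F e. Poly_Mapping.single e (Poly_Mapping.lookup F e)"
  have "peval h \<phi> (F * G) = peval h \<phi> ((\<Sum>e\<in>Poly_Mapping.keys F. ?s F e) * (\<Sum>e\<in>Poly_Mapping.keys G. ?s G e))"
    by (simp add: sum_singles)
  also have "\<dots> = (\<Sum>e\<in>Poly_Mapping.keys F. \<Sum>e'\<in>Poly_Mapping.keys G. peval h \<phi> (?s F e) * peval h \<phi> (?s G e'))"
    by (auto simp: sum_product peval_sum[OF assms] mult_single peval_single[OF assms] rhom_mult[OF assms] power_product_add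
      intro!: sum.cong)
  also have "\<dots> = peval h \<phi> (\<Sum>e\<in>Poly_Mapping.keys F. ?s F e) * peval h \<phi> (\<Sum>e\<in>Poly_Mapping.keys G. ?s G e)"
    by (simp add: sum_product peval_sum[OF assms])
  finally show ?thesis by (simp add: sum_singles)
qed

lemma rhom_peval: "rhom h \<Longrightarrow> rhom (peval h \<phi>)"
  using peval_Cst[of h \<phi> 1]
  by (simp add: rhom_def[of "peval h \<phi>"] peval_add peval_mult rhom_1)

lemma rhom_eqI:
  fixes f g :: "(('v \<Rightarrow>\<^sub>0 nat) \<Rightarrow>\<^sub>0 'k::comm_ring_1) \<Rightarrow> 'a::comm_ring_1"
  assumes "rhom f" "rhom g" "\<And>c. f (Cst c) = g (Cst c)" "\<And>v. f (Var v) = g (Var v)"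
  shows "f F = g F"
  by (induction F rule: mpoly_induct) (auto simp: assms rhom_add rhom_mult)

lemma peval_eq:
  fixes f :: "(('v \<Rightarrow>\<^sub>0 nat) \<Rightarrow>\<^sub>0 'k::comm_ring_1) \<Rightarrow> 'a::comm_ring_1"
  assumes "rhom f" "rhom h" "\<And>c. f (Cst c) = h c" "\<And>v. f (Var v) = \<phi> v"
  shows "f F = peval h \<phi> F"
  by (rule rhom_eqI) (auto simp: assms rhom_peval)

lemma rhom_peval_comp:
  assumes "rhom g" "rhom h"
  shows "g (peval h \<phi> F) = peval (\<lambda>c. g (h c)) (\<lambda>v. g (\<phi> v)) F"
  by (rule peval_eq) (auto simp: assms rhom_peval rhom_compose[OF assms(1)])

lemma peval_Cst_Var: "peval Cst Var F = F"
  by (rule peval_eq[symmetric]) (auto simp: rhom_id rhom_Cst)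

section \<open>Gradings\<close>

definition wdeg :: "('v \<Rightarrow> nat) \<Rightarrow> ('v \<Rightarrow>\<^sub>0 nat) \<Rightarrow> nat" where
  "wdeg w e = (\<Sum>v\<in>Poly_Mapping.keys e. Poly_Mapping.lookup e v * w v)"

definition homog :: "('v \<Rightarrow> nat) \<Rightarrow> nat \<Rightarrow> (('v \<Rightarrow>\<^sub>0 nat) \<Rightarrow>\<^sub>0 'k::comm_ring_1) \<Rightarrow> bool" where
  "homog w d F \<longleftrightarrow> (\<forall>e\<in>Poly_Mapping.keys F. wdeg w e = d)"

text \<open>
  The substitution \<open>v \<mapsto> v T\<^bsup>w v\<^esup>\<close>. It turns the homogeneous components of a polynomial into the
  coefficients of a polynomial in \<open>T\<close>, so that degrees and homogeneity can be read off in a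
  univariate polynomial ring over a domain.
\<close>

definition grade :: "('v \<Rightarrow> nat) \<Rightarrow> (('v \<Rightarrow>\<^sub>0 nat) \<Rightarrow>\<^sub>0 'k::comm_ring_1) \<Rightarrow> (('v \<Rightarrow>\<^sub>0 nat) \<Rightarrow>\<^sub>0 'k) poly" where
  "grade w = peval (\<lambda>c. [:Cst c:]) (\<lambda>v. monom (Var v) (w v))"

lemma rhom_Cst_poly: "rhom (\<lambda>c. [:Cst c:])"
  using rhom_compose[OF rhom_const_poly rhom_Cst] .

lemma rhom_grade: "rhom (grade w)"
  unfolding grade_def by (rule rhom_peval) (rule rhom_Cst_poly)

lemma grade_Cst [simp]: "grade w (Cst c) = [:Cst c:]"
  by (simp add: grade_def rhom_Cst_poly)

lemma grade_Var [simp]: "grade w (Var v) = monom (Var v) (w v)"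
  by (simp add: grade_def rhom_Cst_poly)

lemma grade_altdef:
  "grade w F = (\<Sum>e\<in>Poly_Mapping.keys F. monom (Poly_Mapping.single e (Poly_Mapping.lookup F e)) (wdeg w e))"
proof -
  have "power_product (\<lambda>v. monom (Var v) (w v)) e
      = monom (power_product Var e :: ('a \<Rightarrow>\<^sub>0 nat) \<Rightarrow>\<^sub>0 'b) (wdeg w e)" for e
  proof -
    have "(\<Prod>v\<in>A. monom (Var v :: ('a \<Rightarrow>\<^sub>0 nat) \<Rightarrow>\<^sub>0 'b) (w v) ^ f v) = monom (\<Prod>v\<in>A. Var v ^ f v) (\<Sum>v\<in>A. f v * w v)" for A f
      by (induction A rule: infinite_finite_induct) (auto simp: monom_power mult_monom mult.commute)
    then show ?thesis by (simp add: power_product_def wdeg_def)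
  qed
  then show ?thesis
    unfolding grade_def peval_def
    by (intro sum.cong refl, subst single_power_product) (simp add: smult_monom)
qed

lemma lookup_coeff_grade:
  "Poly_Mapping.lookup (coeff (grade w F) d) e = (if wdeg w e = d then Poly_Mapping.lookup F e else 0)"
proof -
  have "Poly_Mapping.lookup (coeff (grade w F) d) e
     = (\<Sum>e'\<in>Poly_Mapping.keys F. if e' = e then (if wdeg w e = d then Poly_Mapping.lookup F e else 0) else 0)"
    unfolding grade_altdef coeff_sum lookup_sum
    by (rule sum.cong) (auto simp: lookup_single when_def)
  also have "\<dots> = (if wdeg w e = d then Poly_Mapping.lookup F e else 0)"
    by (simp add: in_keys_iff)
  finally show ?thesis .
qed

lemma poly_grade_1: "poly (grade w F) 1 = F"
proof -
  have "poly (grade w F) 1 = peval Cst Var F"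
    by (rule peval_eq) (auto simp: rhom_Cst poly_monom intro: rhom_compose[OF rhom_poly rhom_grade])
  then show ?thesis by (simp add: peval_Cst_Var)
qed

lemma grade_eq_0_iff [simp]: "grade w F = 0 \<longleftrightarrow> F = 0"
  by (metis poly_0 poly_grade_1 rhom_0 rhom_grade)

lemma homog_iff_grade: "homog w d F \<longleftrightarrow> grade w F = monom F d"
proof
  assume "homog w d F"
  then show "grade w F = monom F d"
    by (intro poly_eqI poly_mapping_eqI)
      (force simp: lookup_coeff_grade homog_def in_keys_iff)
next
  assume "grade w F = monom F d"
  then have *: "Poly_Mapping.lookup (coeff (grade w F) d') e = Poly_Mapping.lookup (coeff (monom F d) d') e" for d' e
    by simp
  show "homog w d F"
    unfolding homog_def
  proof
    fix e assume "e \<in> Poly_Mapping.keys F"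
    then show "wdeg w e = d"
      using *[of "wdeg w e" e] by (auto simp: lookup_coeff_grade in_keys_iff split: if_splits)
  qed
qed

lemma homog_0 [simp]: "homog w d 0" by (simp add: homog_def)

lemma homog_Cst: "homog w 0 (Cst c)"
  by (simp add: homog_iff_grade monom_0)

lemma homog_1: "homog w 0 1"
  using homog_Cst[of w 1] by simp

lemma homog_Var: "homog w (w v) (Var v)"
  by (simp add: homog_iff_grade)

lemma homog_add: "homog w d F \<Longrightarrow> homog w d G \<Longrightarrow> homog w d (F + G)"
  by (auto simp: homog_iff_grade rhom_add[OF rhom_grade] add_monom)

lemma homog_uminus: "homog w d F \<Longrightarrow> homog w d (- F)"
  by (simp add: homog_def)

lemma homog_diff: "homog w d F \<Longrightarrow> homog w d G \<Longrightarrow> homog w d (F - G)"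
  using homog_add[of w d F "- G"] by (simp add: homog_uminus)

lemma homog_mult: "homog w a F \<Longrightarrow> homog w b G \<Longrightarrow> homog w (a + b) (F * G)"
  by (auto simp: homog_iff_grade rhom_mult[OF rhom_grade] mult_monom)

lemma homog_power: "homog w a F \<Longrightarrow> homog w (k * a) (F ^ k)"
  by (induction k) (auto intro: homog_mult homog_1)

lemma homog_unique: "homog w a F \<Longrightarrow> homog w b F \<Longrightarrow> F \<noteq> 0 \<Longrightarrow> a = b"
  unfolding homog_def by (metis keys_eq_empty ex_in_conv poly_mapping_eqI lookup_zero in_keys_iff)

text \<open>
  Both the order at \<open>0\<close> and the degree are additive and the order is at most the degree; for a
  monomial they agree, hence they agree for each factor.
\<close>

lemma factors_of_monom:
  fixes p q :: "'a::idom poly"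
  assumes "p * q = monom c d" "c \<noteq> 0"
  shows "\<exists>a b x y. p = monom x a \<and> q = monom y b \<and> a + b = d"
proof -
  have mon: "p = monom (coeff p (degree p)) (degree p)" if "order 0 p = degree p" "p \<noteq> 0" for p :: "'a poly"
  proof -
    have "[:- 0, 1:] ^ degree p dvd p" using order_1[of 0 p] that by simp
    then obtain r where r: "p = [:0, 1:] ^ degree p * r" by (auto simp: dvd_def)
    then have "r \<noteq> 0" using that by auto
    then have "degree p = degree p + degree r"
      by (subst (1) r) (simp add: degree_mult_eq degree_power_eq)
    then obtain z where "r = [:z:]" by (metis add_cancel_right_right degree_eq_zeroE)
    then have "p = smult z ([:0, 1:] ^ degree p)"
      by (subst r) simp
    then have "p = monom z (degree p)" by (simp add: monom_altdef)
    then show ?thesis by (metis coeff_monom)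
  qed
  have nz: "p * q \<noteq> 0" using assms by (simp add: monom_eq_0_iff)
  then have nz': "p \<noteq> 0" "q \<noteq> 0" by auto
  have "order 0 p + order 0 q = d" 
    using order_mult[OF nz, of 0] assms by simp
  moreover have "degree p + degree q = d"
    using assms degree_mult_eq[OF nz'] by (simp add: degree_monom_eq)
  ultimately have "order 0 p = Polynomial.degree p" "order 0 q = Polynomial.degree q"
    using order_degree[OF nz'(1), of 0] order_degree[OF nz'(2), of 0] by linarith+
  then show ?thesis
    using mon[OF _ nz'(1)] mon[OF _ nz'(2)] \<open>Polynomial.degree p + Polynomial.degree q = d\<close> by blast
qed

text \<open>
  Being homogeneous means that \<open>grade\<close> yields a monomial in \<open>T\<close>, and factors of monomials are
  monomials. This fact is used for the bigrading of forms and, with weights \<open>0\<close> and \<open>1\<close>, for the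
  property of containing only certain variables.
\<close>

lemma homog_factor:
  fixes F G :: "('v::linorder \<Rightarrow>\<^sub>0 nat) \<Rightarrow>\<^sub>0 'k::idom"
  assumes "homog w d (F * G)" "F * G \<noteq> 0"
  shows "\<exists>a b. homog w a F \<and> homog w b G \<and> a + b = d"
proof -
  have "grade w F * grade w G = monom (F * G) d"
    using assms(1) by (simp add: homog_iff_grade rhom_mult[OF rhom_grade])
  from factors_of_monom[OF this assms(2)] obtain a b x y
    where *: "grade w F = monom x a" "grade w G = monom y b" "a + b = d" by auto
  have "x = F" "y = G"
    using poly_grade_1[of w F] poly_grade_1[of w G] * by (auto simp: poly_monom)
  then show ?thesis using * by (auto simp: homog_iff_grade)
qed

lemma peval_homog_scale:
  assumes "homog w d F" "rhom h"
  shows "peval h (\<lambda>v. c ^ w v * \<phi> v) F = c ^ d * peval h \<phi> F"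
proof -
  have hm: "h (Poly_Mapping.lookup F e) * power_product (\<lambda>v. c ^ w v * \<phi> v) e
     = c ^ d * (h (Poly_Mapping.lookup F e) * power_product \<phi> e)" if "e \<in> Poly_Mapping.keys F" for e
  proof -
    have "power_product (\<lambda>v. c ^ w v * \<phi> v) e = c ^ wdeg w e * power_product \<phi> e"
      unfolding power_product_def wdeg_def power_mult_distrib prod.distrib power_sum
      by (simp add: mult.commute flip: power_mult)
    then show ?thesis using assms that by (simp add: homog_def)
  qed
  then show ?thesis by (simp add: peval_def sum_distrib_left)
qed

abbreviation wd :: "('v \<Rightarrow> nat) \<Rightarrow> (('v \<Rightarrow>\<^sub>0 nat) \<Rightarrow>\<^sub>0 'k::comm_ring_1) \<Rightarrow> nat" where
  "wd w F \<equiv> Polynomial.degree (grade w F)"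

lemma wd_mult:
  fixes F G :: "('v::linorder \<Rightarrow>\<^sub>0 nat) \<Rightarrow>\<^sub>0 'k::idom"
  shows "F \<noteq> 0 \<Longrightarrow> G \<noteq> 0 \<Longrightarrow> wd w (F * G) = wd w F + wd w G"
  by (simp add: rhom_mult[OF rhom_grade] degree_mult_eq)

lemma wd_homog: "homog w d F \<Longrightarrow> F \<noteq> 0 \<Longrightarrow> wd w F = d"
  by (simp add: homog_iff_grade degree_monom_eq)

lemma wdeg_le_wd: "e \<in> Poly_Mapping.keys F \<Longrightarrow> wdeg w e \<le> wd w F"
  by (rule le_degree) (metis (mono_tags) lookup_coeff_grade in_keys_iff lookup_zero)

lemma wdeg_eq_0_iff: "wdeg w e = 0 \<longleftrightarrow> (\<forall>v\<in>Poly_Mapping.keys e. w v = 0)"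
  by (auto simp: wdeg_def in_keys_iff)

lemma in_vars_iff_homog: "in_vars V F \<longleftrightarrow> homog (\<lambda>v. if v \<in> V then 0 else 1) 0 F"
  unfolding homog_def in_vars_def wdeg_eq_0_iff by auto

lemma in_vars_Cst [simp]: "in_vars V (Cst (c :: 'k::comm_ring_1))"
  by (simp add: in_vars_iff_homog homog_Cst)

lemma in_vars_0 [simp]: "in_vars V (0 :: _ \<Rightarrow>\<^sub>0 'k::comm_ring_1)" and in_vars_1 [simp]: "in_vars V (1 :: _ \<Rightarrow>\<^sub>0 'k::comm_ring_1)"
  by (simp_all add: in_vars_iff_homog homog_1)

lemma in_vars_Var [simp]: "v \<in> V \<Longrightarrow> in_vars V (Var v :: _ \<Rightarrow>\<^sub>0 'k::comm_ring_1)"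
  using homog_Var[of "\<lambda>v. if v \<in> V then 0 else 1" v] by (simp add: in_vars_iff_homog)

lemma in_vars_add: "in_vars V F \<Longrightarrow> in_vars V G \<Longrightarrow> in_vars V (F + G)"
  and in_vars_diff: "in_vars V F \<Longrightarrow> in_vars V G \<Longrightarrow> in_vars V (F - G)"
  for F G :: "_ \<Rightarrow>\<^sub>0 'k::comm_ring_1"
  by (simp_all add: in_vars_iff_homog homog_add homog_diff)

lemma in_vars_mult: "in_vars V F \<Longrightarrow> in_vars V G \<Longrightarrow> in_vars V (F * G)"
  for F G :: "_ \<Rightarrow>\<^sub>0 'k::comm_ring_1"
  using homog_mult[of _ 0 F 0 G] by (auto simp add: in_vars_iff_homog)

lemma in_vars_power: "in_vars V F \<Longrightarrow> in_vars V (F ^ k)"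
  for F :: "_ \<Rightarrow>\<^sub>0 'k::comm_ring_1"
  by (induction k) (auto intro: in_vars_mult)

lemma in_vars_factor:
  fixes F G :: "('v::linorder \<Rightarrow>\<^sub>0 nat) \<Rightarrow>\<^sub>0 'k::idom"
  assumes "in_vars V (F * G)" "F * G \<noteq> 0"
  shows "in_vars V F" "in_vars V G"
  using homog_factor[of _ 0 F G] assms by (auto simp: in_vars_iff_homog)

lemma in_vars_mono: "in_vars V F \<Longrightarrow> V \<subseteq> W \<Longrightarrow> in_vars W F"
  by (auto simp: in_vars_def)

lemma finite_in_vars: "\<exists>V. finite V \<and> in_vars V F"
  by (rule exI[of _ "\<Union>e\<in>Poly_Mapping.keys F. Poly_Mapping.keys e"]) (auto simp: in_vars_def)

lemma in_vars_empty: "in_vars {} F \<Longrightarrow> \<exists>c. F = Cst c"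
proof -
  assume "in_vars {} F"
  then have "Poly_Mapping.lookup F k = 0" if "k \<noteq> 0" for k
    using that by (metis in_vars_def subset_empty keys_eq_empty in_keys_iff)
  then have "F = Cst (Poly_Mapping.lookup F 0)"
    by (intro poly_mapping_eqI) (auto simp: Cst_def lookup_single when_def)
  then show ?thesis ..
qed

section \<open>Unique factorization in polynomial rings\<close>

type_synonym 'k mpoly = "(nat \<Rightarrow>\<^sub>0 nat) \<Rightarrow>\<^sub>0 'k"

abbreviation tdeg :: "'k::comm_ring_1 mpoly \<Rightarrow> nat" where
  "tdeg \<equiv> wd (\<lambda>_. 1)"

lemma tdeg_eq_0_imp_Cst:
  fixes F :: "'k::comm_ring_1 mpoly"
  assumes "tdeg F = 0" shows "\<exists>c. F = Cst c"
proof -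
  have "in_vars {} F"
    unfolding in_vars_def
  proof
    fix e assume "e \<in> Poly_Mapping.keys F"
    then have "wdeg (\<lambda>_. 1) e = 0"
      using wdeg_le_wd[of e F "\<lambda>_. 1"] assms by simp
    then show "Poly_Mapping.keys e \<subseteq> {}" by (auto simp: wdeg_eq_0_iff)
  qed
  then show ?thesis by (rule in_vars_empty)
qed

lemma is_unit_Cst: "c \<noteq> 0 \<Longrightarrow> (Cst c :: 'k::field mpoly) dvd 1"
  using rhom_mult[OF rhom_Cst, of c "inverse c"] by (auto simp: dvd_def intro!: exI[of _ "Cst (inverse c)"])

lemma unit_iff_tdeg:
  fixes F :: "'k::field mpoly"
  assumes "F \<noteq> 0" shows "F dvd 1 \<longleftrightarrow> tdeg F = 0"
proof
  assume "F dvd 1"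
  then obtain G where G: "1 = F * G" by (auto simp: dvd_def)
  then have "G \<noteq> 0" by auto
  with assms have "tdeg F + tdeg G = tdeg (1 :: 'k mpoly)"
    using wd_mult[of F G "\<lambda>_. 1"] G by simp
  then show "tdeg F = 0" by (simp add: rhom_1[OF rhom_grade])
next
  assume "tdeg F = 0"
  then show "F dvd 1" using tdeg_eq_0_imp_Cst[of F] assms is_unit_Cst by force
qed

lemma irreducible_factor_exists:
  fixes F :: "'k::field mpoly"
  assumes "F \<noteq> 0" "\<not> F dvd 1"
  shows "\<exists>p. irreducible p \<and> p dvd F"
  using assms
proof (induction "tdeg F" arbitrary: F rule: less_induct)
  case less
  show ?case
  proof (cases "irreducible F")
    case False
    with less.prems obtain a b where ab: "F = a * b" "\<not> a dvd 1" "\<not> b dvd 1"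
      by (auto simp: irreducible_def)
    then have nz: "a \<noteq> 0" "b \<noteq> 0" using less.prems by auto
    then have "tdeg a < tdeg F"
      using ab unit_iff_tdeg[of b] by (simp add: wd_mult)
    from less.hyps[OF this nz(1) ab(2)] show ?thesis using ab by auto
  qed auto
qed

text \<open>
  A polynomial as a univariate polynomial in the variable \<open>v\<close> whose coefficients are polynomials
  in the other variables, kept in the same ring so that the number of variables can vary in an
  induction.
\<close>

definition uni :: "nat \<Rightarrow> 'k::comm_ring_1 mpoly \<Rightarrow> 'k mpoly poly" where
  "uni v = peval (\<lambda>c. [:Cst c:]) (\<lambda>u. if u = v then [:0, 1:] else [:Var u:])"

lemma rhom_uni: "rhom (uni v)"
  unfolding uni_def by (rule rhom_peval) (rule rhom_Cst_poly)

lemma uni_Cst [simp]: "uni v (Cst c) = [:Cst c:]"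
  and uni_Var: "uni v (Var u) = (if u = v then [:0, 1:] else [:Var u:])"
  by (simp_all add: uni_def rhom_Cst_poly)

lemma poly_uni: "poly (uni v F) (Var v) = F"
  by (rule rhom_eqI[of "\<lambda>F. poly (uni v F) (Var v)" "\<lambda>F. F"])
    (auto intro: rhom_id rhom_compose[OF rhom_poly rhom_uni] simp: uni_Var)

lemma uni_eq_0_iff [simp]: "uni v F = 0 \<longleftrightarrow> F = 0"
  by (metis poly_0 poly_uni rhom_0 rhom_uni)

lemma uni_const:
  assumes "in_vars V F" "v \<notin> V" shows "uni v F = [:F:]"
  using assms(1)
  by (induction rule: in_vars_induct) (use assms(2) in \<open>auto simp: uni_Var rhom_add[OF rhom_uni] rhom_mult[OF rhom_uni]\<close>)

lemma in_vars_coeff_uni: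
  assumes "in_vars (insert v V) F" shows "in_vars V (coeff (uni v F) i)"
  using assms
proof (induction arbitrary: i rule: in_vars_induct)
  case (Var u)
  then show ?case by (auto simp: uni_Var coeff_pCons split: nat.splits)
next
  case (mult F G)
  have "in_vars V (\<Sum>i\<in>A. f i)" if "\<And>i. in_vars V (f i)" for A :: "nat set" and f :: "nat \<Rightarrow> 'a mpoly"
    using that by (induction A rule: infinite_finite_induct) (auto intro: in_vars_add)
  then show ?case using mult by (auto simp: rhom_mult[OF rhom_uni] coeff_mult in_vars_mult)
qed (auto simp: rhom_add[OF rhom_uni] in_vars_add coeff_pCons split: nat.splits)

lemma dvd_iff_coeff_uni:
  fixes p F :: "'k::field mpoly"
  assumes "in_vars V p" "v \<notin> V"
  shows "p dvd F \<longleftrightarrow> (\<forall>i. p dvd coeff (uni v F) i)"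
proof -
  have "p dvd F \<longleftrightarrow> [:p:] dvd uni v F"
    using rhom_dvd[OF rhom_uni, of p F v] rhom_dvd[OF rhom_poly, of "[:p:]" "uni v F" "Var v"] uni_const[OF assms]
    by (auto simp: poly_uni)
  then show ?thesis by (simp add: const_poly_dvd_iff)
qed

text \<open>
  Irreducible elements of the polynomial ring in the variables \<open>V\<close> are prime. Being irreducible
  may be tested in the big ring, since factors of a polynomial in \<open>V\<close> involve only variables in
  \<open>V\<close> (\<open>in_vars_factor\<close>).
\<close>

definition factorial_vars :: "nat set \<Rightarrow> 'k::field mpoly itself \<Rightarrow> bool" where
  "factorial_vars V _ \<longleftrightarrow> (\<forall>f g h :: 'k mpoly. in_vars V f \<longrightarrow> in_vars V g \<longrightarrow> in_vars V h \<longrightarrow>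
     irreducible f \<longrightarrow> f dvd g * h \<longrightarrow> f dvd g \<or> f dvd h)"

text \<open>
  Gauss's lemma: if \<open>p\<close>, constant in \<open>v\<close>, divided neither factor, take in each the first
  coefficient that it does not divide. In the coefficient of the product at the sum of these
  indices, all terms but the product of these two coefficients are divisible by \<open>p\<close>.
\<close>

lemma irreducible_lift:
  fixes p :: "'k::field mpoly"
  assumes fac: "factorial_vars V TYPE('k mpoly)" and v: "v \<notin> V"
    and p: "in_vars V p" "irreducible p"
    and GH: "in_vars (insert v V) G" "in_vars (insert v V) H" "p dvd G * H"
  shows "p dvd G \<or> p dvd H"
proof (rule ccontr)
  assume neg: "\<not> (p dvd G \<or> p dvd H)"
  let ?g = "coeff (uni v G)" and ?h = "coeff (uni v H)"
  define i where "i = (LEAST i. \<not> p dvd ?g i)"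
  define j where "j = (LEAST j. \<not> p dvd ?h j)"
  have ex: "\<exists>i. \<not> p dvd ?g i" "\<exists>j. \<not> p dvd ?h j"
    using neg dvd_iff_coeff_uni[OF p(1) v] by blast+
  have i: "\<not> p dvd ?g i" "\<And>k. k < i \<Longrightarrow> p dvd ?g k"
    unfolding i_def using LeastI_ex[OF ex(1)] not_less_Least by blast+
  have j: "\<not> p dvd ?h j" "\<And>k. k < j \<Longrightarrow> p dvd ?h k"
    unfolding j_def using LeastI_ex[OF ex(2)] not_less_Least by blast+
  have "p dvd coeff (uni v (G * H)) (i + j)"
    using GH(3) dvd_iff_coeff_uni[OF p(1) v] by blast
  also have "coeff (uni v (G * H)) (i + j) = (\<Sum>k\<le>i + j. ?g k * ?h (i + j - k))"
    by (simp add: rhom_mult[OF rhom_uni] coeff_mult)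
  also have "\<dots> = ?g i * ?h j + (\<Sum>k\<in>{..i + j} - {i}. ?g k * ?h (i + j - k))"
    by (subst sum.remove[of _ i]) auto
  finally have "p dvd ?g i * ?h j + (\<Sum>k\<in>{..i + j} - {i}. ?g k * ?h (i + j - k))" .
  moreover have "p dvd (\<Sum>k\<in>{..i + j} - {i}. ?g k * ?h (i + j - k))"
  proof (rule dvd_sum)
    fix k assume k: "k \<in> {..i + j} - {i}"
    show "p dvd ?g k * ?h (i + j - k)"
      by (cases "k < i") (use i j k in \<open>auto intro: dvd_mult dvd_mult2\<close>)
  qed
  ultimately have "p dvd ?g i * ?h j" using dvd_add_left_iff by blast
  then show False
    using fac[unfolded factorial_vars_def] p i(1) j(1) GH in_vars_coeff_uni by blast
qed

text \<open>
  The irreducible factors of \<open>a\<close>, being prime also after adjoining \<open>v\<close>, can be cancelled one by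
  one from \<open>Q\<close> or from \<open>R\<close>. This replaces the passage to primitive parts over the field of
  fractions.
\<close>

lemma strip_constants:
  fixes a F Q R :: "'k::field mpoly"
  assumes fac: "factorial_vars V TYPE('k mpoly)" and v: "v \<notin> V"
    and "in_vars V a" "a \<noteq> 0" "a * F = Q * R" "F \<noteq> 0"
    and "in_vars (insert v V) Q" "in_vars (insert v V) R"
  shows "\<exists>a1 a2 Q' R'. a = a1 * a2 \<and> Q = a1 * Q' \<and> R = a2 * R' \<and> F = Q' * R'"
  using assms(3-)
proof (induction "tdeg a" arbitrary: a Q R rule: less_induct)
  case less
  show ?case
  proof (cases "a dvd 1")
    case True
    then obtain b where b: "1 = a * b" by (auto simp: dvd_def)
    have 1: "Q = a * (b * Q)" using b by (metis mult.assoc mult_1)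
    have 2: "F = b * Q * R" using b less.prems(3) by (metis mult.assoc mult.commute mult_1)
    show ?thesis
      by (rule exI[of _ a], rule exI[of _ 1], rule exI[of _ "b * Q"], rule exI[of _ R]) (use 1 2 in auto)
  next
    case False
    then obtain p b where p: "irreducible p" "a = p * b"
      using irreducible_factor_exists[of a] less.prems(2) by (auto simp: dvd_def)
    have nz: "p \<noteq> 0" "b \<noteq> 0" using p less.prems(2) by auto
    have V: "in_vars V p" "in_vars V b" using in_vars_factor[of V p b] less.prems(1,2) p by auto
    have lt: "tdeg b < tdeg a"
      using unit_iff_tdeg[OF nz(1)] p nz by (auto simp: wd_mult irreducible_def)
    have QR: "Q \<noteq> 0" "R \<noteq> 0" using less.prems by auto
    have "p dvd Q * R" using less.prems(3) p by (metis dvd_triv_left mult.assoc)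
    then consider "p dvd Q" | "p dvd R"
      using irreducible_lift[OF fac v V(1) p(1) less.prems(5,6)] by blast
    then show ?thesis
    proof cases
      case 1
      then obtain Q1 where Q1: "Q = p * Q1" by (auto simp: dvd_def)
      have "b * F = Q1 * R" using less.prems(3) Q1 p nz by (simp add: mult.assoc)
      moreover have "in_vars (insert v V) Q1" using in_vars_factor[of _ p Q1] Q1 QR less.prems by auto
      ultimately obtain a1 a2 Q' R' where "b = a1 * a2" "Q1 = a1 * Q'" "R = a2 * R'" "F = Q' * R'"
        using less.hyps[OF lt V(2) nz(2) _ less.prems(4) _ less.prems(6), of Q1] by blast
      then show ?thesis
        by (intro exI[of _ "p * a1"] exI[of _ a2] exI[of _ Q'] exI[of _ R']) (simp add: Q1 p mult.assoc)
    next
      case 2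
      then obtain R1 where R1: "R = p * R1" by (auto simp: dvd_def)
      have "b * F = Q * R1" using less.prems(3) R1 p nz by (simp add: mult.assoc mult.left_commute)
      moreover have "in_vars (insert v V) R1" using in_vars_factor[of _ p R1] R1 QR less.prems by auto
      ultimately obtain a1 a2 Q' R' where "b = a1 * a2" "Q = a1 * Q'" "R1 = a2 * R'" "F = Q' * R'"
        using less.hyps[OF lt V(2) nz(2) _ less.prems(4,5)] by blast
      then show ?thesis
        by (intro exI[of _ a1] exI[of _ "p * a2"] exI[of _ Q'] exI[of _ R']) (simp add: R1 p ac_simps)
    qed
  qed
qed

lemma irreducible_dvd_after_strip:
  fixes a f g W :: "'k::field mpoly"
  assumes fac: "factorial_vars V TYPE('k mpoly)" and v: "v \<notin> V"
    and a: "in_vars V a" "a \<noteq> 0" and eq: "a * g = f * W"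
    and f: "irreducible f" "in_vars (insert v V) f" "\<not> in_vars V f" 
    and g: "in_vars (insert v V) g"
  shows "f dvd g"
proof (cases "g = 0")
  case False
  have fnz: "f \<noteq> 0" using f by (auto simp: irreducible_def)
  have "a * g \<noteq> 0" using a False by simp
  moreover have "in_vars (insert v V) (a * g)"
    using in_vars_mult[OF in_vars_mono[OF a(1)] g] by blast
  ultimately have W: "in_vars (insert v V) W" using in_vars_factor[of _ f W] eq by simp
  obtain a1 a2 f' W' where *: "a = a1 * a2" "f = a1 * f'" "W = a2 * W'" "g = f' * W'"
    using strip_constants[OF fac v a eq False f(2) W] by blast
  have "a1 dvd 1 \<or> f' dvd 1" using * f(1) by (auto simp: irreducible_def)
  then show ?thesis
  proof
    assume "a1 dvd 1"
    then obtain c where c: "1 = a1 * c" by (auto simp: dvd_def)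
    have "f * c = f' * (a1 * c)" by (simp add: *(2) ac_simps)
    then have "f' = f * c" using c by simp
    then have "f dvd f'" by simp
    then show ?thesis using * by auto
  next
    assume "f' dvd 1"
    then have "f' \<noteq> 0" "tdeg f' = 0" using unit_iff_tdeg[of f'] * fnz by auto
    then obtain c where "f' = Cst c" using tdeg_eq_0_imp_Cst by blast
    moreover have "in_vars V a1" using in_vars_factor[of V a1 a2] a * by auto
    ultimately have "in_vars V f" using * by (auto intro: in_vars_mult)
    then show ?thesis using f by simp
  qed
qed auto

text \<open>
  The ideal generated by \<open>f\<close> and \<open>g\<close> is principal up to coefficients free of \<open>v\<close>: dividing by an
  element \<open>r\<close> of least degree in \<open>v\<close>, after multiplication by a power of its leading coefficient,
  leaves no remainder.
\<close>

lemma pseudo_remainder: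
  fixes f g r z :: "'k::field mpoly"
  assumes v: "v \<notin> V" and V: "in_vars (insert v V) f" "in_vars (insert v V) g"
  defines "J \<equiv> {u * f + w * g | u w. in_vars (insert v V) u \<and> in_vars (insert v V) w}"
  assumes r: "r \<in> J" "r \<noteq> 0"
    and min: "\<And>s. s \<in> J \<Longrightarrow> s \<noteq> 0 \<Longrightarrow> Polynomial.degree (uni v r) \<le> Polynomial.degree (uni v s)"
    and z: "z \<in> J"
  shows "\<exists>a q. in_vars V a \<and> a \<noteq> 0 \<and> a * z = q * r"
  using z
proof (induction "Polynomial.degree (uni v z)" arbitrary: z rule: less_induct)
  case less
  show ?case
  proof (cases "z = 0")
    case True
    then show ?thesis by (intro exI[of _ 1] exI[of _ 0]) auto
  next
    case False
    let ?d = "\<lambda>z. Polynomial.degree (uni v z)"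
    let ?k = "?d z - ?d r"
    let ?l = "lead_coeff (uni v z)" and ?m = "lead_coeff (uni v r)"
    have JV: "in_vars (insert v V) s" if "s \<in> J" for s
      using that V by (auto simp: J_def intro: in_vars_add in_vars_mult)
    have le: "?d r \<le> ?d z" using min less.prems False by simp
    have l: "in_vars V ?l" "in_vars V ?m" using JV less.prems r in_vars_coeff_uni by blast+
    define z' where "z' = ?m * z - (?l * Var v ^ ?k) * r"
    have mono: "in_vars (insert v V) s" if "in_vars V s" for s :: "'k mpoly"
      using in_vars_mono[OF that] by blast
    have J1: "s * t \<in> J" if st: "t \<in> J" "in_vars (insert v V) s" for s t
    proof -
      obtain u w where "t = u * f + w * g" "in_vars (insert v V) u" "in_vars (insert v V) w"
        using st by (auto simp: J_def)
      then show ?thesis unfolding J_def using st(2)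
        by (intro CollectI exI[of _ "s * u"] exI[of _ "s * w"]) (auto simp: algebra_simps intro: in_vars_mult)
    qed
    have J2: "s - t \<in> J" if st: "s \<in> J" "t \<in> J" for s t
    proof -
      obtain u w u' w' where "t = u * f + w * g" "in_vars (insert v V) u" "in_vars (insert v V) w"
         "s = u' * f + w' * g" "in_vars (insert v V) u'" "in_vars (insert v V) w'"
        using st by (auto simp: J_def)
      then show ?thesis unfolding J_def 
        by (intro CollectI exI[of _ "u' - u"] exI[of _ "w' - w"]) (auto simp: algebra_simps intro: in_vars_diff)
    qed
    have z'J: "z' \<in> J"
      unfolding z'_def by (intro J2 J1 less.prems r in_vars_mult in_vars_power mono l in_vars_Var) auto
    have uz': "uni v z' = smult ?m (uni v z) - smult ?l (monom 1 ?k * uni v r)"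
    proof -
      have "uni v ?m = [:?m:]" "uni v ?l = [:?l:]" using uni_const[OF _ v] l by blast+
      then show ?thesis
        by (simp add: z'_def rhom_diff[OF rhom_uni] rhom_mult[OF rhom_uni] rhom_power[OF rhom_uni] uni_Var
          monom_altdef mult.assoc)
    qed
    have "Polynomial.degree (monom 1 ?k * uni v r) = ?d z"
      using r(2) le by (subst degree_mult_eq) (auto simp: degree_monom_eq)
    then have "?d z' \<le> ?d z"
      unfolding uz' by (intro degree_diff_le) (metis degree_smult_le)+
    moreover have "coeff (uni v z') (?d z) = 0"
      using le by (simp add: uz' coeff_monom_mult)
    ultimately have "z' = 0 \<or> ?d z' < ?d z"
      by (metis leading_coeff_0_iff le_neq_implies_less uni_eq_0_iff)
    then obtain a q where aq: "in_vars V a" "a \<noteq> 0" "a * z' = q * r"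
    proof
      assume "z' = 0"
      then show ?thesis using that[of 1 0] by simp
    next
      assume "?d z' < ?d z"
      then show ?thesis using less.hyps[of z'] z'J that by blast
    qed
    have "(a * ?m) * z = (q + a * (?l * Var v ^ ?k)) * r"
      using aq(3) by (simp add: z'_def algebra_simps)
    then show ?thesis
      using aq l r(2) by (intro exI[of _ "a * ?m"] exI[of _ "q + a * (?l * Var v ^ ?k)"]) (auto intro: in_vars_mult)
  qed
qed

text \<open>
  Let \<open>r = u f + w g\<close> have least degree in \<open>v\<close> among the nonzero elements of the ideal \<open>(f, g)\<close>.
  Up to factors free of \<open>v\<close>, it divides both \<open>f\<close> and \<open>g\<close>. As \<open>f\<close> is irreducible, either \<open>r\<close> is a
  multiple of \<open>f\<close> and then \<open>f\<close> divides \<open>g\<close>, or \<open>r\<close> is free of \<open>v\<close>, and then \<open>f\<close> divides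
  \<open>r h = u f h + w g h\<close>, hence \<open>h\<close>.
\<close>

lemma factorial_vars_insert:
  assumes fac: "factorial_vars V TYPE('k::field mpoly)" and v: "v \<notin> V"
  shows "factorial_vars (insert v V) TYPE('k mpoly)"
  unfolding factorial_vars_def
proof (intro allI impI)
  fix f g h :: "'k mpoly"
  let ?V = "insert v V"
  assume V: "in_vars ?V f" "in_vars ?V g" "in_vars ?V h" and f: "irreducible f" and dvd: "f dvd g * h"
  show "f dvd g \<or> f dvd h"
  proof (cases "in_vars V f")
    case True
    then show ?thesis using irreducible_lift[OF fac v True f V(2,3) dvd] by simp
  next
    case fV: False
    let ?J = "{u * f + w * g | u w. in_vars ?V u \<and> in_vars ?V w}"
    have fJ: "f \<in> ?J" by (rule CollectI, rule exI[of _ 1], rule exI[of _ 0]) simp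
    have gJ: "g \<in> ?J" by (rule CollectI, rule exI[of _ 0], rule exI[of _ 1]) simp
    have fnz: "f \<noteq> 0" using f by (auto simp: irreducible_def)
    obtain r where r: "r \<in> ?J" "r \<noteq> 0"
      and min: "\<And>s. s \<in> ?J \<Longrightarrow> s \<noteq> 0 \<Longrightarrow> Polynomial.degree (uni v r) \<le> Polynomial.degree (uni v s)"
      using ex_has_least_nat[of "\<lambda>r. r \<in> ?J \<and> r \<noteq> 0" f "\<lambda>s. Polynomial.degree (uni v s)"] fJ fnz by blast
    obtain u w where uw: "r = u * f + w * g" "in_vars ?V u" "in_vars ?V w"
      using r by blast
    have rV: "in_vars ?V r" using uw V by (auto intro: in_vars_add in_vars_mult)
    obtain a q where a: "in_vars V a" "a \<noteq> 0" "a * f = q * r"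
      using pseudo_remainder[OF v V(1,2) r min fJ] by blast
    obtain b q2 where b: "in_vars V b" "b \<noteq> 0" "b * g = q2 * r"
      using pseudo_remainder[OF v V(1,2) r min gJ] by blast
    have "q * r \<noteq> 0" using a fnz by (metis mult_eq_0_iff)
    moreover have "in_vars ?V (a * f)" using in_vars_mult[OF in_vars_mono[OF a(1)] V(1)] by blast
    ultimately have qV: "in_vars ?V q" using in_vars_factor(1)[of _ q r] a by simp
    obtain a1 a2 q' r' where *: "a = a1 * a2" "q = a1 * q'" "r = a2 * r'" "f = q' * r'"
      using strip_constants[OF fac v a fnz qV rV] by blast
    have a2: "in_vars V a2" using in_vars_factor[of V a1 a2] a * by auto
    have "q' dvd 1 \<or> r' dvd 1" using * f by (auto simp: irreducible_def)
    then show ?thesis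
    proof
      assume "q' dvd 1"
      then obtain c where c: "1 = q' * c" by (auto simp: dvd_def)
      have "f * c = r' * (q' * c)" by (simp add: *(4) ac_simps)
      then have "r' = f * c" using c by simp
      then have "b * g = f * (q2 * a2 * c)"
        using b(3) *(3) by (simp add: ac_simps)
      then show ?thesis using irreducible_dvd_after_strip[OF fac v b(1,2) _ f V(1) fV V(2)] by blast
    next
      assume "r' dvd 1"
      moreover have "r' \<noteq> 0" using * fnz by auto
      ultimately obtain c where "r' = Cst c" using unit_iff_tdeg[of r'] tdeg_eq_0_imp_Cst by blast
      then have rV': "in_vars V r" using * a2 by (auto intro: in_vars_mult)
      obtain t where t: "g * h = f * t" using dvd by (auto simp: dvd_def)
      have "r * h = f * (u * h + w * t)" using t by (simp add: uw algebra_simps)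
      then show ?thesis using irreducible_dvd_after_strip[OF fac v rV' r(2) _ f V(1) fV V(3)] by blast
    qed
  qed
qed

text \<open>
  Finitely many polynomials involve only finitely many variables, so the variables can be adjoined
  one at a time.
\<close>

theorem irreducible_imp_prime_mpoly:
  fixes f :: "'k::field mpoly"
  assumes f: "irreducible f" shows "prime_elem f"
proof -
  have fac: "factorial_vars V TYPE('k mpoly)" if "finite V" for V
    using that
  proof (induction V rule: finite_induct)
    case empty
    have "f dvd 1" if f: "in_vars {} f" "irreducible f" for f :: "'k mpoly"
    proof -
      obtain c where "f = Cst c" using in_vars_empty[OF f(1)] ..
      then show ?thesis using is_unit_Cst[of c] f(2) by (cases "c = 0") auto
    qed
    then show ?case unfolding factorial_vars_def by (auto simp: irreducible_def)
  qed (rule factorial_vars_insert)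
  show ?thesis
    unfolding prime_elem_def
  proof (intro conjI allI impI)
    fix g h assume "f dvd g * h"
    obtain V1 V2 V3 where "finite V1" "in_vars V1 f" "finite V2" "in_vars V2 g" "finite V3" "in_vars V3 h"
      using finite_in_vars by meson
    then have *: "finite (V1 \<union> V2 \<union> V3)" "in_vars (V1 \<union> V2 \<union> V3) f"
        "in_vars (V1 \<union> V2 \<union> V3) g" "in_vars (V1 \<union> V2 \<union> V3) h"
      by (auto elim: in_vars_mono)
    show "f dvd g \<or> f dvd h"
      by (rule fac[OF *(1), unfolded factorial_vars_def, rule_format, OF *(2-4) f \<open>f dvd g * h\<close>])
  qed (use f in \<open>auto simp: irreducible_def\<close>)
qed

section \<open>Local rings inside a field\<close>

definition is_subring :: "'f::field set \<Rightarrow> bool" where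
  "is_subring A \<longleftrightarrow> 1 \<in> A \<and> (\<forall>a\<in>A. \<forall>b\<in>A. a - b \<in> A \<and> a * b \<in> A)"

lemma is_subringD:
  assumes "is_subring A"
  shows "1 \<in> A" "0 \<in> A" "a \<in> A \<Longrightarrow> b \<in> A \<Longrightarrow> a * b \<in> A"
    "a \<in> A \<Longrightarrow> b \<in> A \<Longrightarrow> a - b \<in> A" "a \<in> A \<Longrightarrow> - a \<in> A" "a \<in> A \<Longrightarrow> b \<in> A \<Longrightarrow> a + b \<in> A"
proof -
  note A = assms[unfolded is_subring_def]
  show 1: "1 \<in> A" and 0: "0 \<in> A" and "a \<in> A \<Longrightarrow> b \<in> A \<Longrightarrow> a * b \<in> A"
    and d: "\<And>a b. a \<in> A \<Longrightarrow> b \<in> A \<Longrightarrow> a - b \<in> A"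
    using A by (auto, metis diff_self)
  show m: "- a \<in> A" if "a \<in> A" for a using d[OF 0 that] by simp
  show "a + b \<in> A" if "a \<in> A" "b \<in> A" using d[OF that(1) m[OF that(2)]] by simp
qed

lemma is_subring_power: "is_subring A \<Longrightarrow> a \<in> A \<Longrightarrow> a ^ k \<in> A"
  by (induction k) (auto intro: is_subringD)

lemma is_subring_sum: "is_subring A \<Longrightarrow> (\<And>i. i \<in> S \<Longrightarrow> f i \<in> A) \<Longrightarrow> sum f S \<in> A"
  by (induction S rule: infinite_finite_induct) (auto intro: is_subringD)

lemma is_subring_prod: "is_subring A \<Longrightarrow> (\<And>i. i \<in> S \<Longrightarrow> f i \<in> A) \<Longrightarrow> prod f S \<in> A"
  by (induction S rule: infinite_finite_induct) (auto intro: is_subringD)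

lemma cring_ring_on:
  assumes "is_subring A" shows "cring (ring_on A)"
proof (rule cringI)
  note A = is_subringD[OF assms]
  show "abelian_group (ring_on A)"
  proof (rule abelian_groupI)
    fix x assume "x \<in> carrier (ring_on A)"
    then show "\<exists>y\<in>carrier (ring_on A). y \<oplus>\<^bsub>ring_on A\<^esub> x = \<zero>\<^bsub>ring_on A\<^esub>"
      using A by (intro bexI[of _ "- x"]) (auto simp: ring_on_def)
  qed (auto simp: ring_on_def A)
  show "comm_monoid (ring_on A)"
    by (rule comm_monoidI) (auto simp: ring_on_def A)
qed (auto simp: ring_on_def algebra_simps)

lemma ring_on_simps [simp]:
  "carrier (ring_on A) = A" "x \<otimes>\<^bsub>ring_on A\<^esub> y = x * y" "x \<oplus>\<^bsub>ring_on A\<^esub> y = x + y"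
  "\<one>\<^bsub>ring_on A\<^esub> = 1" "\<zero>\<^bsub>ring_on A\<^esub> = 0"
  by (simp_all add: ring_on_def)

lemma a_inv_ring_on:
  assumes "is_subring A" "x \<in> A" shows "\<ominus>\<^bsub>ring_on A\<^esub> x = - x"
proof -
  interpret cring "ring_on A" by (rule cring_ring_on[OF assms(1)])
  show ?thesis using is_subringD(5)[OF assms] assms(2) by (intro minus_equality) auto
qed

lemma is_subring_UNIV: "is_subring UNIV" by (simp add: is_subring_def)

definition ideal_in :: "'f::field set \<Rightarrow> 'f set \<Rightarrow> bool" where
  "ideal_in q A \<longleftrightarrow> q \<subseteq> A \<and> 0 \<in> q \<and> (\<forall>a\<in>q. \<forall>b\<in>q. a + b \<in> q) \<and> (\<forall>a\<in>A. \<forall>x\<in>q. a * x \<in> q)"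

definition prime_in :: "'f::field set \<Rightarrow> 'f set \<Rightarrow> bool" where
  "prime_in q A \<longleftrightarrow> ideal_in q A \<and> 1 \<notin> q \<and> (\<forall>a\<in>A. \<forall>b\<in>A. a * b \<in> q \<longrightarrow> a \<in> q \<or> b \<in> q)"

lemma ideal_ring_on_iff:
  assumes "is_subring A" shows "ideal q (ring_on A) \<longleftrightarrow> ideal_in q A"
proof
  interpret cring "ring_on A" by (rule cring_ring_on[OF assms])
  assume "ideal q (ring_on A)"
  then interpret ideal q "ring_on A" .
  show "ideal_in q A"
    unfolding ideal_in_def using a_subset zero_closed a_closed I_l_closed
    by (auto simp: additive_subgroup.zero_closed[OF is_additive_subgroup, simplified])
next
  interpret cring "ring_on A" by (rule cring_ring_on[OF assms])
  assume q: "ideal_in q A"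
  have neg: "- x \<in> q" if "x \<in> q" for x
    using q that is_subringD(1,5)[OF assms] by (metis ideal_in_def mult_minus1)
  show "ideal q (ring_on A)"
  proof (rule idealI)
    show "subgroup q (add_monoid (ring_on A))"
    proof (rule group.subgroupI[OF a_group])
      fix a assume a: "a \<in> q"
      then have "inv\<^bsub>add_monoid (ring_on A)\<^esub> a = - a"
        unfolding a_inv_def[symmetric] using q by (intro a_inv_ring_on assms) (auto simp: ideal_in_def)
      then show "inv\<^bsub>add_monoid (ring_on A)\<^esub> a \<in> q" using neg[OF a] by simp
    qed (use q in \<open>auto simp: ideal_in_def\<close>)
  next
    fix a x assume "a \<in> q" "x \<in> carrier (ring_on A)"
    then have "x * a \<in> q" using q by (simp add: ideal_in_def)
    then show "x \<otimes>\<^bsub>ring_on A\<^esub> a \<in> q" "a \<otimes>\<^bsub>ring_on A\<^esub> x \<in> q" by (simp_all add: mult.commute)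
  qed (rule ring_axioms)
qed

lemma primeideal_ring_on_iff:
  assumes "is_subring A" shows "primeideal q (ring_on A) \<longleftrightarrow> prime_in q A"
proof -
  have "primeideal q (ring_on A) \<longleftrightarrow> ideal q (ring_on A) \<and> A \<noteq> q \<and> (\<forall>a\<in>A. \<forall>b\<in>A. a * b \<in> q \<longrightarrow> a \<in> q \<or> b \<in> q)"
    using cring_ring_on[OF assms] by (auto simp: primeideal_def primeideal_axioms_def)
  also have "\<dots> \<longleftrightarrow> prime_in q A"
  proof -
    have "A \<noteq> q \<longleftrightarrow> 1 \<notin> q" if "ideal_in q A"
    proof -
      have "A \<subseteq> q" if "1 \<in> q"
      proof
        fix x assume "x \<in> A"
        then have "x * 1 \<in> q" using \<open>ideal_in q A\<close> that unfolding ideal_in_def by blast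
        then show "x \<in> q" by simp
      qed
      moreover have "q \<subseteq> A" using that by (simp add: ideal_in_def)
      ultimately show ?thesis using is_subringD(1)[OF assms] by blast
    qed
    then show ?thesis unfolding ideal_ring_on_iff[OF assms] prime_in_def by blast
  qed
  finally show ?thesis .
qed

definition is_local :: "'f::field set \<Rightarrow> bool" where
  "is_local R \<longleftrightarrow> is_subring R \<and> (\<forall>a\<in>nonunits R. \<forall>b\<in>nonunits R. a + b \<in> nonunits R)"

text \<open>
  The local rings of \<open>Spec B\<close>, as subrings of a field, without mention of prime ideals: such a
  ring is local, contains \<open>B\<close>, and consists of fractions whose denominators are units in it
  (\<open>spec_local_rings_iff\<close>). In this form it is easy to replace \<open>B\<close> by another ring with the same
  localization.
\<close>

definition local_of :: "'f::field set \<Rightarrow> 'f set \<Rightarrow> bool" where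
  "local_of B R \<longleftrightarrow> is_local R \<and> B \<subseteq> R \<and> (\<forall>f\<in>R. \<exists>a\<in>B. \<exists>s\<in>B. s \<notin> nonunits R \<and> f = a / s)"

lemma nonunits_mult:
  assumes "is_subring R" "a \<in> R" "x \<in> nonunits R"
  shows "a * x \<in> nonunits R"
proof -
  have "a * x \<in> R" using assms by (auto simp: nonunits_def intro: is_subringD)
  moreover have "inverse x \<in> R" if "a * x \<noteq> 0" "inverse (a * x) \<in> R"
  proof -
    have "inverse x = a * inverse (a * x)" using that by (simp add: field_simps)
    then show ?thesis using that assms is_subringD by metis
  qed
  ultimately show ?thesis using assms(3) by (auto simp: nonunits_def)
qed

lemma unit_divide:
  assumes "is_subring R" "a \<in> R" "s \<in> R" "s \<notin> nonunits R"
  shows "a / s \<in> R" "s \<noteq> 0"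
  using assms by (auto simp: nonunits_def divide_inverse intro: is_subringD)

lemma one_notin_nonunits: "is_subring R \<Longrightarrow> 1 \<notin> nonunits R"
  by (auto simp: nonunits_def is_subringD)

lemma prime_nonunits_Int:
  assumes R: "is_local R" and B: "is_subring B" "B \<subseteq> R"
  shows "prime_in (B \<inter> nonunits R) B"
proof -
  have sR: "is_subring R" using R by (simp add: is_local_def)
  have 1: "a \<in> nonunits R \<or> b \<in> nonunits R" if "a \<in> R" "b \<in> R" "a * b \<in> nonunits R" for a b
  proof (rule ccontr)
    assume "\<not> ?thesis"
    then have "inverse a \<in> R" "inverse b \<in> R" "a \<noteq> 0" "b \<noteq> 0" using that by (auto simp: nonunits_def)
    then have "inverse (a * b) \<in> R" "a * b \<noteq> 0" using is_subringD(3)[OF sR] by (auto simp: inverse_mult_distrib)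
    then show False using that by (auto simp: nonunits_def)
  qed
  show ?thesis
    unfolding prime_in_def ideal_in_def
    using R B 1 nonunits_mult[OF sR] one_notin_nonunits[OF sR] is_subringD[OF B(1)] is_subringD[OF sR]
    by (auto simp: is_local_def subset_iff nonunits_def[of R] intro: is_subringD(3)[OF B(1)])
qed

lemma spec_local_rings_iff:
  assumes B: "is_subring B"
  shows "R \<in> spec_local_rings B \<longleftrightarrow> local_of B R"
proof
  assume "R \<in> spec_local_rings B"
  then obtain q where q: "prime_in q B" and R: "R = localization B q"
    by (auto simp: spec_local_rings_def primeideal_ring_on_iff[OF B])
  note Bs = is_subringD[OF B]
  have qB: "q \<subseteq> B" "0 \<in> q" "1 \<notin> q" using q by (auto simp: prime_in_def ideal_in_def)
  have RI: "a / s \<in> R" if "a \<in> B" "s \<in> B" "s \<notin> q" for a s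
    using that by (auto simp: R localization_def)
  have RE: "\<exists>a s. a \<in> B \<and> s \<in> B \<and> s \<notin> q \<and> x = a / s" if "x \<in> R" for x
    using that by (auto simp: R localization_def)
  have BR: "B \<subseteq> R" using RI[OF _ Bs(1) qB(3)] by force
  have mulq: "s * t \<notin> q" if "s \<in> B" "t \<in> B" "s \<notin> q" "t \<notin> q" for s t
    using q that by (auto simp: prime_in_def)
  have ne: "s \<noteq> 0" if "s \<notin> q" for s using that qB by auto
  have sR: "is_subring R"
    unfolding is_subring_def
  proof (intro conjI ballI)
    show "1 \<in> R" using BR Bs by auto
    fix x y assume "x \<in> R" "y \<in> R"
    then obtain a s b t where *: "a \<in> B" "s \<in> B" "s \<notin> q" "x = a / s" "b \<in> B" "t \<in> B" "t \<notin> q" "y = b / t"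
      using RE by metis
    have "x - y = (a * t - b * s) / (s * t)" "x * y = (a * b) / (s * t)"
      using * ne by (auto simp: field_simps)
    moreover have "s * t \<notin> q" using mulq * by blast
    ultimately show "x - y \<in> R" "x * y \<in> R" using * by (auto intro!: RI Bs)
  qed
  have nu: "nonunits R = {a / s | a s. a \<in> q \<and> s \<in> B \<and> s \<notin> q}"
  proof (intro Set.set_eqI iffI)
    fix x assume x: "x \<in> nonunits R"
    then have "x \<in> R" by (simp add: nonunits_def)
    then obtain a s where *: "a \<in> B" "s \<in> B" "s \<notin> q" "x = a / s" using RE by blast
    have "a \<in> q"
    proof (rule ccontr)
      assume "a \<notin> q"
      then have "inverse x \<in> R" "x \<noteq> 0" using * RI[of s a] ne by auto
      then show False using x by (auto simp: nonunits_def)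
    qed
    then show "x \<in> {a / s | a s. a \<in> q \<and> s \<in> B \<and> s \<notin> q}" using * by auto
  next
    fix x assume "x \<in> {a / s | a s. a \<in> q \<and> s \<in> B \<and> s \<notin> q}"
    then obtain a s where *: "a \<in> q" "s \<in> B" "s \<notin> q" "x = a / s" by auto
    then have "x \<in> R" using RI qB by auto
    moreover have False if "x \<noteq> 0" "inverse x \<in> R"
    proof -
      obtain b t where bt: "b \<in> B" "t \<in> B" "t \<notin> q" "inverse x = b / t" using RE \<open>inverse x \<in> R\<close> by blast
      then have "s * t = b * a" using * \<open>x \<noteq> 0\<close> ne[OF bt(3)] ne[OF *(3)] by (auto simp: field_simps)
      also have "\<dots> \<in> q" using q bt * by (auto simp: prime_in_def ideal_in_def)
      finally show False using mulq * bt by auto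
    qed
    ultimately show "x \<in> nonunits R" by (auto simp: nonunits_def)
  qed
  have loc: "is_local R"
    unfolding is_local_def
  proof (intro conjI ballI sR)
    fix x y assume "x \<in> nonunits R" "y \<in> nonunits R"
    then obtain a s b t where *: "a \<in> q" "s \<in> B" "s \<notin> q" "x = a / s" "b \<in> q" "t \<in> B" "t \<notin> q" "y = b / t"
      unfolding nu by blast
    have "x + y = (t * a + s * b) / (s * t)" using * ne by (auto simp: field_simps)
    moreover have "t * a + s * b \<in> q" using * q by (auto simp: prime_in_def ideal_in_def)
    ultimately show "x + y \<in> nonunits R" unfolding nu using * mulq Bs(3) by blast
  qed
  have "s \<notin> nonunits R" if "s \<in> B" "s \<notin> q" for s
    using RI[of 1 s] that Bs ne by (auto simp: nonunits_def divide_inverse)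
  then show "local_of B R"
    unfolding local_of_def using loc BR RE by metis
next
  assume "local_of B R"
  then have R: "is_local R" "B \<subseteq> R" "\<And>f. f \<in> R \<Longrightarrow> \<exists>a\<in>B. \<exists>s\<in>B. s \<notin> nonunits R \<and> f = a / s"
    by (auto simp: local_of_def)
  have sR: "is_subring R" using R by (simp add: is_local_def)
  have "R = localization B (B \<inter> nonunits R)"
    using R(2,3) unit_divide[OF sR] by (fastforce simp: localization_def)
  then show "R \<in> spec_local_rings B"
    using prime_nonunits_Int[OF R(1) B R(2)] by (auto simp: spec_local_rings_def primeideal_ring_on_iff[OF B])
qed

lemma local_of_mono:
  assumes "local_of C R" "C \<subseteq> B" "B \<subseteq> R" shows "local_of B R"
  using assms unfolding local_of_def by blast

lemma is_subring_generate: "is_subring (generate_ring (ring_on UNIV) S)"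
proof -
  let ?G = "generate_ring (ring_on UNIV) S"
  have neg: "- a \<in> ?G" if "a \<in> ?G" for a
    using generate_ring.a_inv[OF that] by (simp add: a_inv_ring_on[OF is_subring_UNIV])
  show ?thesis
    unfolding is_subring_def
    using generate_ring.one[of "ring_on UNIV" S] generate_ring.eng_mult[of _ "ring_on UNIV" S]
      generate_ring.eng_add[of _ "ring_on UNIV" S] neg
    by simp (metis diff_conv_add_uminus)
qed

lemma generate_ring_on_induct [consumes 1, case_names one incl diff mult]:
  assumes "h \<in> generate_ring (ring_on (UNIV :: 'f::field set)) S"
    and "Q 1" "\<And>h. h \<in> S \<Longrightarrow> Q h"
    and "\<And>a b. Q a \<Longrightarrow> Q b \<Longrightarrow> Q (a - b)" "\<And>a b. Q a \<Longrightarrow> Q b \<Longrightarrow> Q (a * b)"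
  shows "Q h"
  using assms(1)
proof (induction rule: generate_ring.induct)
  have 0: "Q 0" using assms(4)[OF assms(2,2)] by simp
  have neg: "Q (- a)" if "Q a" for a using assms(4)[OF 0 that] by simp
  {
    case (a_inv h) then show ?case using neg by (simp add: a_inv_ring_on[OF is_subring_UNIV])
  next
    case (eng_add a b) then show ?case using assms(4)[OF _ neg, of a b] by simp
  }
qed (use assms in auto)

lemma generate_ring_on_subset:
  assumes "is_subring A" "S \<subseteq> A" shows "generate_ring (ring_on UNIV) S \<subseteq> A"
proof
  fix h assume "h \<in> generate_ring (ring_on UNIV) S"
  then show "h \<in> A" by (induction rule: generate_ring_on_induct) (use assms in \<open>auto intro: is_subringD\<close>)
qed

section \<open>Discrete valuations\<close>

text \<open>
  The values at \<open>0\<close> are arbitrary, so the valuation axioms are restricted to nonzero arguments.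
  The field \<open>L\<close> is a subfield of the ambient type, later the function field of the product.
\<close>

locale discrete_valuation =
  fixes L :: "'f::field set" and \<nu> :: "'f \<Rightarrow> int"
  assumes L: "is_subring L" and L_inv: "a \<in> L \<Longrightarrow> inverse a \<in> L"
    and nu_mult: "a \<in> L \<Longrightarrow> b \<in> L \<Longrightarrow> a \<noteq> 0 \<Longrightarrow> b \<noteq> 0 \<Longrightarrow> \<nu> (a * b) = \<nu> a + \<nu> b"
    and nu_diff: "a \<in> L \<Longrightarrow> b \<in> L \<Longrightarrow> a \<noteq> 0 \<Longrightarrow> b \<noteq> 0 \<Longrightarrow> a - b \<noteq> 0 \<Longrightarrow> min (\<nu> a) (\<nu> b) \<le> \<nu> (a - b)"
    and nu_surj: "\<exists>t\<in>L. t \<noteq> 0 \<and> \<nu> t = 1"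
begin

definition vring :: "'f set" where "vring = {f \<in> L. f = 0 \<or> 0 \<le> \<nu> f}"

lemma nu_1: "\<nu> 1 = 0"
  using nu_mult[of 1 1] is_subringD(1)[OF L] by simp

lemma nu_inverse: "a \<in> L \<Longrightarrow> a \<noteq> 0 \<Longrightarrow> \<nu> (inverse a) = - \<nu> a"
  using nu_mult[of a "inverse a"] L_inv nu_1 by simp

lemma nu_divide: "a \<in> L \<Longrightarrow> b \<in> L \<Longrightarrow> a \<noteq> 0 \<Longrightarrow> b \<noteq> 0 \<Longrightarrow> \<nu> (a / b) = \<nu> a - \<nu> b"
  by (simp add: divide_inverse nu_mult nu_inverse L_inv)

lemma L_divide: "a \<in> L \<Longrightarrow> b \<in> L \<Longrightarrow> a / b \<in> L"
  by (simp add: divide_inverse is_subringD(3)[OF L] L_inv)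

lemma nu_power: "a \<in> L \<Longrightarrow> a \<noteq> 0 \<Longrightarrow> \<nu> (a ^ k) = int k * \<nu> a"
  by (induction k) (auto simp: nu_1 nu_mult is_subring_power[OF L] algebra_simps)

lemma nu_minus_1: "\<nu> (- 1) = 0"
  using nu_mult[of "- 1" "- 1"] is_subringD(1,5)[OF L] nu_1 by force

lemma nu_uminus: "a \<in> L \<Longrightarrow> a \<noteq> 0 \<Longrightarrow> \<nu> (- a) = \<nu> a"
  using nu_mult[of "- 1" a] is_subringD(1,5)[OF L] nu_minus_1 by simp

lemma nu_add: "a \<in> L \<Longrightarrow> b \<in> L \<Longrightarrow> a \<noteq> 0 \<Longrightarrow> b \<noteq> 0 \<Longrightarrow> a + b \<noteq> 0 \<Longrightarrow> min (\<nu> a) (\<nu> b) \<le> \<nu> (a + b)"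
  using nu_diff[of a "- b"] is_subringD(5)[OF L] by (simp add: nu_uminus)

lemma vring_subring: "is_subring vring"
  unfolding is_subring_def
proof (intro conjI ballI)
  show "1 \<in> vring" using is_subringD(1)[OF L] nu_1 by (simp add: vring_def)
  fix a b assume *: "a \<in> vring" "b \<in> vring"
  show "a * b \<in> vring"
    using * is_subringD(3)[OF L, of a b] nu_mult[of a b]
    by (cases "a = 0"; cases "b = 0") (auto simp: vring_def)
  have ab: "a \<in> L" "b \<in> L" "a - b \<in> L" using * is_subringD(4)[OF L, of a b] by (auto simp: vring_def)
  show "a - b \<in> vring"
    using * ab nu_diff[OF ab(1,2)] nu_uminus[OF ab(2)]
    by (cases "a = 0"; cases "b = 0"; cases "a - b = 0") (auto simp: vring_def)
qed

lemma vring_iff: "f \<in> vring \<longleftrightarrow> f \<in> L \<and> (f = 0 \<or> 0 \<le> \<nu> f)"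
  by (simp add: vring_def)

lemma nonunits_vring_iff: "f \<in> nonunits vring \<longleftrightarrow> f \<in> L \<and> (f = 0 \<or> 1 \<le> \<nu> f)"
  by (auto simp: nonunits_def vring_iff nu_inverse L_inv)

lemma vring_local: "is_local vring"
  unfolding is_local_def
proof (intro conjI ballI vring_subring)
  fix a b assume *: "a \<in> nonunits vring" "b \<in> nonunits vring"
  have ab: "a \<in> L" "b \<in> L" "a + b \<in> L" using * is_subringD(6)[OF L, of a b] by (auto simp: nonunits_vring_iff)
  show "a + b \<in> nonunits vring"
    using * ab nu_add[OF ab(1,2)]
    by (cases "a = 0"; cases "b = 0"; cases "a + b = 0") (auto simp: nonunits_vring_iff)
qed

text \<open>
  A nonzero prime ideal contains some \<open>x \<noteq> 0\<close>; for any nonunit \<open>y\<close> a sufficiently high power is a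
  multiple of \<open>x\<close>, so the prime ideal contains \<open>y\<close>.
\<close>

lemma vring_one_dimensional: "one_dimensional_local vring"
proof -
  obtain t where t: "t \<in> L" "t \<noteq> 0" "\<nu> t = 1" using nu_surj by auto
  have p0: "prime_in {0} vring"
    using is_subringD(2)[OF vring_subring] by (auto simp: prime_in_def ideal_in_def)
  have pN: "prime_in (nonunits vring) vring"
    using prime_nonunits_Int[OF vring_local vring_subring subset_refl]
    by (simp add: Int_absorb1 nonunits_def)
  have pq: "q = nonunits vring" if q: "prime_in q vring" and "q \<noteq> {0}" for q
  proof
    have qi: "q \<subseteq> vring" "0 \<in> q" "1 \<notin> q" "\<And>a x. a \<in> vring \<Longrightarrow> x \<in> q \<Longrightarrow> a * x \<in> q"
      "\<And>a b. a \<in> vring \<Longrightarrow> b \<in> vring \<Longrightarrow> a * b \<in> q \<Longrightarrow> a \<in> q \<or> b \<in> q"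
      using q by (auto simp: prime_in_def ideal_in_def)
    show "q \<subseteq> nonunits vring"
    proof
      fix x assume x: "x \<in> q"
      have "inverse x \<notin> vring" if "x \<noteq> 0"
        using qi(4)[OF _ x, of "inverse x"] qi(3) that by auto
      then show "x \<in> nonunits vring" using x qi(1) unfolding nonunits_def by blast
    qed
    obtain x where x: "x \<in> q" "x \<noteq> 0" using \<open>q \<noteq> {0}\<close> qi(2) by auto
    then have xL: "x \<in> L" "0 \<le> \<nu> x" using qi(1) by (auto simp: vring_iff)
    show "nonunits vring \<subseteq> q"
    proof
      fix y assume y: "y \<in> nonunits vring"
      show "y \<in> q"
      proof (cases "y = 0")
        case False
        then have yL: "y \<in> L" "1 \<le> \<nu> y" using y by (auto simp: nonunits_vring_iff)
        define k where "k = nat (\<nu> x)"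
        have yk: "y ^ k \<in> L" "\<nu> (y ^ k) = int k * \<nu> y"
          using is_subring_power[OF L yL(1)] nu_power[OF yL(1) False] by auto
        have "y ^ k / x \<in> vring"
        proof -
          have "\<nu> x \<le> int k * \<nu> y" using xL yL mult_left_mono[of 1 "\<nu> y" "int k"] by (simp add: k_def)
          then show ?thesis using yk x xL False by (auto simp: vring_iff nu_divide L_divide)
        qed
        then have "y ^ k / x * x \<in> q" using qi(4) x by blast
        then have *: "y ^ k \<in> q" using x by simp
        have yv: "y \<in> vring" using y by (auto simp: nonunits_def)
        have "y \<in> q" if "y ^ k \<in> q" for k
          using that
        proof (induction k)
          case (Suc k)
          then show ?case using qi(5)[OF yv is_subring_power[OF vring_subring yv, of k]] by auto
        qed (use qi in auto)
        then show ?thesis using * .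
      qed (use qi in auto)
    qed
  qed
  have "{q. primeideal q (ring_on vring)} = {{0}, nonunits vring}"
    unfolding primeideal_ring_on_iff[OF vring_subring]
  proof (intro Set.set_eqI iffI)
    fix q assume "q \<in> {q. prime_in q vring}"
    then show "q \<in> {{0}, nonunits vring}" using pq[of q] by (cases "q = {0}") simp_all
  next
    fix q assume "q \<in> {{0}, nonunits vring}"
    then have "q = {0} \<or> q = nonunits vring" by simp
    then show "q \<in> {q. prime_in q vring}" using p0 pN by (elim disjE) simp_all
  qed
  moreover have "t \<in> nonunits vring" using t by (simp add: nonunits_vring_iff)
  then have "nonunits vring \<noteq> {0}" using t(2) by force
  ultimately show ?thesis unfolding one_dimensional_local_def by (rule conjI)
qed

lemma uniformizer_vring: "uniformizer vring t \<longleftrightarrow> t \<in> L \<and> t \<noteq> 0 \<and> \<nu> t = 1"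
proof
  assume t: "uniformizer vring t"
  obtain u where u: "u \<in> L" "u \<noteq> 0" "\<nu> u = 1" using nu_surj by auto
  have tv: "t \<in> vring" "t \<noteq> 0" "nonunits vring = {t * a | a. a \<in> vring}" using t by (auto simp: uniformizer_def)
  have tL: "t \<in> L" using tv by (simp add: vring_iff)
  have "t = t * 1" by simp
  then have "t \<in> nonunits vring" using tv is_subringD(1)[OF vring_subring] by blast
  then have "1 \<le> \<nu> t" using tv by (auto simp: nonunits_vring_iff)
  moreover have "u \<in> nonunits vring" using u by (simp add: nonunits_vring_iff)
  then obtain a where a: "u = t * a" "a \<in> vring" using tv by auto
  then have "\<nu> u = \<nu> t + \<nu> a" "0 \<le> \<nu> a" using u nu_mult[OF tL] tv by (auto simp: vring_iff)
  ultimately show "t \<in> L \<and> t \<noteq> 0 \<and> \<nu> t = 1" using u tL tv by simp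
next
  assume t: "t \<in> L \<and> t \<noteq> 0 \<and> \<nu> t = 1"
  have "nonunits vring = {t * a | a. a \<in> vring}"
  proof (intro Set.set_eqI iffI)
    fix x assume "x \<in> nonunits vring"
    then have "x = t * (x / t)" "x / t \<in> vring" using t
      by (simp, cases "x = 0", auto simp: nonunits_vring_iff vring_iff L_divide nu_divide)
    then show "x \<in> {t * a | a. a \<in> vring}" by blast
  next
    fix x assume "x \<in> {t * a | a. a \<in> vring}"
    then obtain a where "x = t * a" "a \<in> vring" by auto
    then show "x \<in> nonunits vring" using t
      by (cases "a = 0") (auto simp: nonunits_vring_iff vring_iff nu_mult is_subringD(2,3)[OF L])
  qed
  then show "uniformizer vring t" using t by (auto simp: uniformizer_def vring_iff)
qed

lemma L_powi: "t \<in> L \<Longrightarrow> t powi k \<in> L"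
  by (auto simp: power_int_def is_subring_power[OF L] L_inv)

lemma nu_powi: "t \<in> L \<Longrightarrow> t \<noteq> 0 \<Longrightarrow> \<nu> (t powi k) = k * \<nu> t"
  by (auto simp: power_int_def nu_power nu_inverse L_inv)

lemma ord_at_vring:
  assumes f: "f \<in> L" "f \<noteq> 0" shows "ord_at vring f = \<nu> f"
  unfolding ord_at_def
proof (rule the_equality)
  obtain t where t: "t \<in> L" "t \<noteq> 0" "\<nu> t = 1" using nu_surj by auto
  let ?u = "f / t powi \<nu> f"
  have "?u \<in> L" "\<nu> ?u = 0" "?u \<noteq> 0"
    using t f nu_divide[OF f(1) L_powi[OF t(1)], of "\<nu> f"] by (auto simp: L_divide L_powi nu_powi)
  then have "?u \<in> vring - nonunits vring" by (auto simp: vring_iff nonunits_vring_iff)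
  then show "\<exists>t u. uniformizer vring t \<and> u \<in> vring - nonunits vring \<and> f = t powi \<nu> f * u"
    using t by (intro exI[of _ t] exI[of _ ?u]) (auto simp: uniformizer_vring)
next
  fix k assume "\<exists>t u. uniformizer vring t \<and> u \<in> vring - nonunits vring \<and> f = t powi k * u"
  then obtain t u where *: "uniformizer vring t" "u \<in> vring - nonunits vring" "f = t powi k * u" by blast
  then have "t \<in> L" "t \<noteq> 0" "\<nu> t = 1" "u \<in> L" "u \<noteq> 0" "\<nu> u = 0"
    by (auto simp: uniformizer_vring nonunits_vring_iff vring_iff)
  then show "k = \<nu> f" using *(3) by (simp add: nu_mult L_powi nu_powi)
qed

text \<open>
  Here \<open>w\<close> plays the role of a local equation of the prime divisor on \<open>Spec C\<close>: it generates the
  prime ideal of elements of positive value and is a nonunit of \<open>R\<close>. Hence an element of \<open>C\<close> that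
  is a unit of \<open>R\<close> has value \<open>0\<close>, and \<open>R\<close> is contained in the valuation ring. The elements of \<open>R\<close>
  of positive value then form a nonzero prime ideal, which must be the maximal ideal as \<open>R\<close> has
  dimension one. So elements of value \<open>0\<close> in \<open>C\<close> are units of \<open>R\<close>, which gives the other
  inclusion.
\<close>

lemma one_dimensional_eq_vring:
  assumes R: "one_dimensional_local R" "local_of C R" and V: "local_of C vring"
    and C: "is_subring C" and w: "w \<in> C" "w \<noteq> 0" "w \<in> nonunits R" "\<nu> w \<ge> 1"
    and dv: "\<And>c. c \<in> C \<Longrightarrow> c \<noteq> 0 \<Longrightarrow> \<nu> c \<ge> 1 \<Longrightarrow> c / w \<in> C"
  shows "R = vring"
proof -
  have lR: "is_local R" "C \<subseteq> R" and fr: "\<And>f. f \<in> R \<Longrightarrow> \<exists>a\<in>C. \<exists>s\<in>C. s \<notin> nonunits R \<and> f = a / s"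
    using R(2) by (auto simp: local_of_def)
  have sR: "is_subring R" using lR by (simp add: is_local_def)
  have CV: "C \<subseteq> vring" and frV: "\<And>f. f \<in> vring \<Longrightarrow> \<exists>a\<in>C. \<exists>s\<in>C. s \<notin> nonunits vring \<and> f = a / s"
    using V by (auto simp: local_of_def)
  have RV: "R \<subseteq> vring"
  proof
    fix f assume "f \<in> R"
    then obtain a s where as: "a \<in> C" "s \<in> C" "s \<notin> nonunits R" "f = a / s" using fr by blast
    have "s \<notin> nonunits vring"
    proof
      assume s: "s \<in> nonunits vring"
      have "s \<noteq> 0" using as is_subringD(2)[OF sR] by (auto simp: nonunits_def)
      then have "1 \<le> \<nu> s" using s by (auto simp: nonunits_vring_iff)
      then have "s / w \<in> R" using dv as(2) \<open>s \<noteq> 0\<close> lR by blast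
      then have "s / w * w \<in> nonunits R" using nonunits_mult[OF sR] w by blast
      then show False using as w by simp
    qed
    then show "f \<in> vring" using unit_divide(1)[OF vring_subring, of a s] as CV by auto
  qed
  have "R \<inter> nonunits vring \<in> {q. primeideal q (ring_on R)}"
    unfolding primeideal_ring_on_iff[OF sR] mem_Collect_eq
    by (rule prime_nonunits_Int[OF vring_local sR RV])
  then have "R \<inter> nonunits vring = {0} \<or> R \<inter> nonunits vring = nonunits R"
    using R(1) unfolding one_dimensional_local_def by (metis insertE singletonD)
  moreover have "w \<in> R \<inter> nonunits vring" using w lR CV by (auto simp: nonunits_vring_iff vring_iff)
  then have "R \<inter> nonunits vring \<noteq> {0}" using w(2) by (metis singletonD)
  ultimately have q: "R \<inter> nonunits vring = nonunits R" by simp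
  have "vring \<subseteq> R"
  proof
    fix f assume "f \<in> vring"
    then obtain a s where as: "a \<in> C" "s \<in> C" "s \<notin> nonunits vring" "f = a / s" using frV by blast
    then have "s \<notin> nonunits R" using q by blast
    then show "f \<in> R" using unit_divide(1)[OF sR, of a s] as lR by auto
  qed
  with RV show ?thesis by auto
qed

end

section \<open>Valuations of the polynomial ring\<close>

definition emb :: "'k::field mpoly \<Rightarrow> 'k ambient" where
  "emb F = Fraction_Field.Fract F 1"

lemma rhom_emb: "rhom emb"
  by (auto simp: rhom_def emb_def One_fract_def)

lemma emb_eq_iff [simp]: "emb F = emb G \<longleftrightarrow> F = G"
  by (simp add: emb_def eq_fract)

lemma emb_eq_0_iff [simp]: "emb F = 0 \<longleftrightarrow> F = 0"
  using emb_eq_iff[of F 0] by (simp add: rhom_0[OF rhom_emb] del: emb_eq_iff)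

lemma emb_Cst: "emb (Cst c) = const c" by (simp add: emb_def Cst_def const_def)
lemma emb_Var: "emb (Var v) = variable v" by (simp add: emb_def Var_def variable_def)

lemmas emb_hom = rhom_add[OF rhom_emb] rhom_mult[OF rhom_emb] rhom_diff[OF rhom_emb]
  rhom_1[OF rhom_emb] rhom_0[OF rhom_emb] rhom_power[OF rhom_emb] rhom_uminus[OF rhom_emb]

lemma rhom_constant: "rhom (const :: 'k::field \<Rightarrow> _)"
  using rhom_compose[OF rhom_emb rhom_Cst] by (simp add: emb_Cst)

lemmas const_hom = rhom_add[OF rhom_constant] rhom_mult[OF rhom_constant] rhom_diff[OF rhom_constant]
  rhom_1[OF rhom_constant] rhom_0[OF rhom_constant] rhom_power[OF rhom_constant] rhom_uminus[OF rhom_constant]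

lemma const_eq_0_iff [simp]: "const c = 0 \<longleftrightarrow> c = (0 :: 'k::field)"
  using emb_eq_0_iff[of "Cst c"] by (simp add: emb_Cst)

lemma const_inverse: "const (inverse c) = inverse (const (c :: 'k::field))"
proof (cases "c = 0")
  case False
  then have "const c * const (inverse c) = 1" by (simp add: const_hom flip: rhom_mult[OF rhom_constant])
  then show ?thesis by (simp add: inverse_unique)
qed (simp add: const_hom)

lemma const_divide: "const (a / b) = const a / const (b :: 'k::field)"
  by (simp add: divide_inverse const_hom const_inverse)

lemma variable_nonzero [simp]: "variable v \<noteq> (0 :: 'k::field ambient)"
proof -
  have "(Var v :: 'k mpoly) \<noteq> 0"
  proof
    assume "(Var v :: 'k mpoly) = 0"
    then have "peval (\<lambda>c::'k. c) (\<lambda>_. 1) (Var v) = 0" by (simp add: peval_def)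
    then show False by (simp add: rhom_id)
  qed
  then show ?thesis using emb_eq_0_iff[of "Var v :: 'k mpoly"] by (simp add: emb_Var)
qed

lemma x_coord_nonzero [simp]: "x_coord i \<noteq> (0 :: 'k::field ambient)"
  and y_coord_nonzero [simp]: "y_coord i \<noteq> (0 :: 'k::field ambient)"
  by (simp_all add: x_coord_def y_coord_def)

lemma Var_nonzero [simp]: "Var v \<noteq> (0 :: 'k::field mpoly)"
  by (metis emb_eq_0_iff emb_Var variable_nonzero)

lemma emb_eq_peval: "emb F = peval const variable F"
  by (rule peval_eq) (auto simp: rhom_emb rhom_constant emb_Cst emb_Var)

lemma ambient_cases: obtains G H where "f = emb G / emb H" "H \<noteq> 0"
proof -
  obtain G H where "f = Fraction_Field.Fract G H" "H \<noteq> 0" by (cases f)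
  then have "f = emb G / emb H" by (simp add: emb_def)
  then show ?thesis using that \<open>H \<noteq> 0\<close> by blast
qed

text \<open>
  Valuations that are nonnegative on polynomials and trivial on constants. Natural numbers suffice
  because all valuations used here are nonnegative on all polynomials in the homogeneous
  coordinates.
\<close>

definition is_val :: "('k::field mpoly \<Rightarrow> nat) \<Rightarrow> bool" where
  "is_val v \<longleftrightarrow> (\<forall>F G. F \<noteq> 0 \<longrightarrow> G \<noteq> 0 \<longrightarrow> v (F * G) = v F + v G) \<and>
     (\<forall>F G. F \<noteq> 0 \<longrightarrow> G \<noteq> 0 \<longrightarrow> F - G \<noteq> 0 \<longrightarrow> min (v F) (v G) \<le> v (F - G)) \<and>
     (\<forall>c. c \<noteq> 0 \<longrightarrow> v (Cst c) = 0)"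

lemma is_valD:
  assumes "is_val v"
  shows "F \<noteq> 0 \<Longrightarrow> G \<noteq> 0 \<Longrightarrow> v (F * G) = v F + v G"
    "F \<noteq> 0 \<Longrightarrow> G \<noteq> 0 \<Longrightarrow> F - G \<noteq> 0 \<Longrightarrow> min (v F) (v G) \<le> v (F - G)"
    "c \<noteq> 0 \<Longrightarrow> v (Cst c) = 0"
  using assms by (auto simp: is_val_def)

lemma is_val_1: "is_val v \<Longrightarrow> v 1 = 0"
  using is_valD(3)[of v 1] by simp

lemma is_val_power: "is_val v \<Longrightarrow> F \<noteq> 0 \<Longrightarrow> v (F ^ k) = k * v F"
  by (induction k) (auto simp: is_val_1 is_valD)

definition vK :: "('k::field mpoly \<Rightarrow> nat) \<Rightarrow> 'k ambient \<Rightarrow> int" where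
  "vK v f = (THE k. \<exists>G H. G \<noteq> 0 \<and> H \<noteq> 0 \<and> f = emb G / emb H \<and> k = int (v G) - int (v H))"

lemma vK_quotient:
  assumes v: "is_val v" and "G \<noteq> 0" "H \<noteq> 0"
  shows "vK v (emb G / emb H) = int (v G) - int (v H)"
  unfolding vK_def
proof (rule the_equality)
  fix k assume "\<exists>G' H'. G' \<noteq> 0 \<and> H' \<noteq> 0 \<and> emb G / emb H = emb G' / emb H' \<and> k = int (v G') - int (v H')"
  then obtain G' H' where *: "G' \<noteq> 0" "H' \<noteq> 0" "emb G / emb H = emb G' / emb H'" "k = int (v G') - int (v H')"
    by blast
  then have "emb (G * H') = emb (G' * H)" using assms by (simp add: emb_hom field_simps)
  then have "v G + v H' = v G' + v H"
    using is_valD(1)[OF v] * assms by (metis emb_eq_iff)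
  then show "k = int (v G) - int (v H)" using * by simp
qed (use assms in blast)

lemma vK_mult:
  assumes v: "is_val v" and "f \<noteq> 0" "g \<noteq> 0" shows "vK v (f * g) = vK v f + vK v g"
proof -
  obtain G H G' H' where *: "f = emb G / emb H" "H \<noteq> 0" "g = emb G' / emb H'" "H' \<noteq> 0"
    using ambient_cases by metis
  then have nz: "G \<noteq> 0" "G' \<noteq> 0" using assms by (auto simp: emb_hom)
  have "f * g = emb (G * G') / emb (H * H')" using * by (simp add: emb_hom)
  then show ?thesis
    using * nz by (simp add: vK_quotient[OF v] is_valD(1)[OF v])
qed

lemma vK_diff:
  assumes v: "is_val v" and "f \<noteq> 0" "g \<noteq> 0" "f - g \<noteq> 0" shows "min (vK v f) (vK v g) \<le> vK v (f - g)"
proof -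
  obtain G H G' H' where *: "f = emb G / emb H" "H \<noteq> 0" "g = emb G' / emb H'" "H' \<noteq> 0"
    using ambient_cases by metis
  then have nz: "G \<noteq> 0" "G' \<noteq> 0" using assms by (auto simp: emb_hom)
  have fg: "f - g = emb (G * H' - G' * H) / emb (H * H')" using * by (simp add: emb_hom diff_frac_eq)
  then have "emb (G * H' - G' * H) \<noteq> 0" using assms(4) by (metis div_0)
  then have "G * H' - G' * H \<noteq> 0" by simp
  then show ?thesis
    using * nz fg is_valD(2)[OF v, of "G * H'" "G' * H"]
    by (simp add: vK_quotient[OF v] is_valD(1)[OF v])
qed

section \<open>The valuations of a prime polynomial and of a point\<close>

definition pmult :: "'k::field mpoly \<Rightarrow> 'k mpoly \<Rightarrow> nat" where
  "pmult p F = (GREATEST k. p ^ k dvd F)"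

lemma pmult_split:
  assumes p: "prime_elem p" and F: "F \<noteq> (0 :: 'k::field mpoly)"
  shows "\<exists>G. F = p ^ pmult p F * G \<and> \<not> p dvd G"
proof -
  have pnz: "p \<noteq> 0" "\<not> p dvd 1" using p by (auto simp: prime_elem_def)
  then have tp: "tdeg p \<noteq> 0" using unit_iff_tdeg by blast
  have bound: "k \<le> tdeg F" if d: "p ^ k dvd F" for k
  proof -
    obtain G where G: "F = p ^ k * G" using d by (auto simp: dvd_def)
    have *: "tdeg (p ^ k) = k * tdeg p"
      by (induction k) (auto simp: wd_mult pnz rhom_1[OF rhom_grade])
    have "tdeg F = tdeg (p ^ k) + tdeg G" using G F pnz by (simp add: wd_mult)
    then have "tdeg F = k * tdeg p + tdeg G" by (simp only: *)
    then show ?thesis using tp by (cases "tdeg p") auto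
  qed
  have 1: "p ^ pmult p F dvd F"
    unfolding pmult_def by (rule GreatestI_nat[of _ 0 "tdeg F"]) (use bound in auto)
  then obtain G where G: "F = p ^ pmult p F * G" by (auto simp: dvd_def)
  have "\<not> p dvd G"
  proof
    assume "p dvd G"
    then have "p ^ Suc (pmult p F) dvd F" by (subst G) (metis mult_dvd_mono dvd_refl power_Suc2)
    then have "Suc (pmult p F) \<le> pmult p F"
      unfolding pmult_def[of p F] by (intro Greatest_le_nat[of _ _ "tdeg F"]) (use bound in \<open>auto simp: pmult_def\<close>)
    then show False by simp
  qed
  then show ?thesis using G by blast
qed

lemma pmult_unique:
  assumes p: "prime_elem p" and F: "F = p ^ k * G" "\<not> p dvd G"
  shows "pmult p F = k"
proof -
  have pnz: "p \<noteq> 0" using p by (auto simp: prime_elem_def)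
  have "p ^ i dvd F \<Longrightarrow> i \<le> k" for i
  proof (rule ccontr)
    assume "p ^ i dvd F" "\<not> i \<le> k"
    then have "p ^ Suc k dvd p ^ k * G" using F by (metis not_less_eq_eq power_le_dvd)
    then have "p dvd G" using pnz by (simp add: dvd_def mult.assoc mult.left_commute)
    then show False using F by simp
  qed
  then show ?thesis unfolding pmult_def by (intro Greatest_equality) (use F in auto)
qed

lemma pmult_mult:
  assumes p: "prime_elem p" and "F \<noteq> 0" "G \<noteq> 0"
  shows "pmult p (F * G) = pmult p F + pmult p G"
proof -
  obtain F' G' where *: "F = p ^ pmult p F * F'" "\<not> p dvd F'" "G = p ^ pmult p G * G'" "\<not> p dvd G'"
    using pmult_split[OF p] assms by metis
  have "F * G = (p ^ pmult p F * F') * (p ^ pmult p G * G')" using *(1,3) by metis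
  then have "F * G = p ^ (pmult p F + pmult p G) * (F' * G')" by (simp add: power_add ac_simps)
  moreover have "\<not> p dvd F' * G'" using p *(2,4) unfolding prime_elem_def by blast
  ultimately show ?thesis by (rule pmult_unique[OF p])
qed

lemma pmult_ge_iff:
  assumes p: "prime_elem p" and F: "F \<noteq> 0"
  shows "k \<le> pmult p F \<longleftrightarrow> p ^ k dvd F"
proof -
  obtain G where G: "F = p ^ pmult p F * G" "\<not> p dvd G" using pmult_split[OF assms] by blast
  have pnz: "p \<noteq> 0" using p by (auto simp: prime_elem_def)
  show ?thesis
  proof
    assume "k \<le> pmult p F"
    then show "p ^ k dvd F" by (subst G(1)) (simp add: le_imp_power_dvd dvd_mult2)
  next
    assume kd: "p ^ k dvd F"
    show "k \<le> pmult p F"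
    proof (rule ccontr)
      assume "\<not> k \<le> pmult p F"
      then have "p ^ Suc (pmult p F) dvd p ^ pmult p F * G" using kd G(1) by (metis not_less_eq_eq power_le_dvd)
      then have "p dvd G" using pnz by (simp add: dvd_def mult.assoc mult.left_commute)
      then show False using G by simp
    qed
  qed
qed

lemma is_val_pmult:
  assumes p: "prime_elem (p :: 'k::field mpoly)" shows "is_val (pmult p)"
  unfolding is_val_def
proof (intro conjI allI impI)
  fix F G :: "'k mpoly" assume FG: "F \<noteq> 0" "G \<noteq> 0" "F - G \<noteq> 0"
  show "min (pmult p F) (pmult p G) \<le> pmult p (F - G)"
    using pmult_ge_iff[OF p FG(1), of "min (pmult p F) (pmult p G)"] pmult_ge_iff[OF p FG(2), of "min (pmult p F) (pmult p G)"]
    by (subst pmult_ge_iff[OF p FG(3)]) (simp add: dvd_diff)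
next
  fix c :: 'k assume "c \<noteq> 0"
  then have "\<not> p dvd Cst c" using is_unit_Cst[of c] p by (meson dvd_trans prime_elem_def)
  then show "pmult p (Cst c) = 0" by (intro pmult_unique[OF p, of _ _ "Cst c"]) auto
qed (rule pmult_mult[OF p])

text \<open>
  The Taylor expansion at \<open>w\<close>, that is \<open>F(w + T z)\<close> with \<open>z\<close> the vector of the variables. The
  order in \<open>T\<close> is the multiplicity at \<open>w\<close>. For a bihomogeneous \<open>F\<close> this is also the multiplicity
  at the point with homogeneous coordinates \<open>w\<close>, since rescaling the coordinates changes \<open>F\<close> only
  by a factor.
\<close>

definition shift :: "(nat \<Rightarrow> 'k::field) \<Rightarrow> 'k mpoly \<Rightarrow> 'k mpoly poly" where
  "shift w = peval (\<lambda>c. [:Cst c:]) (\<lambda>v. [:Cst (w v), Var v:])"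

definition ptmult :: "(nat \<Rightarrow> 'k::field) \<Rightarrow> 'k mpoly \<Rightarrow> nat" where
  "ptmult w F = Polynomial.order 0 (shift w F)"

lemma rhom_shift: "rhom (shift w)"
  unfolding shift_def by (rule rhom_peval) (rule rhom_Cst_poly)

lemma shift_Cst [simp]: "shift w (Cst c) = [:Cst c:]"
  and shift_Var [simp]: "shift w (Var v) = [:Cst (w v), Var v:]"
  by (simp_all add: shift_def rhom_Cst_poly)

lemma shift_eq_0_iff [simp]: "shift w F = 0 \<longleftrightarrow> F = 0"
proof
  assume 0: "shift w F = 0"
  have "F = peval Cst (\<lambda>v. Var v - Cst (w v)) (poly (shift w F) 1)"
    by (rule rhom_eqI[of "\<lambda>F. F"])
      (auto intro!: rhom_id rhom_compose[OF rhom_peval] rhom_compose[OF rhom_poly rhom_shift] rhom_Cst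
        simp: rhom_Cst peval_add)
  then show "F = 0" using 0 by (simp add: peval_def)
qed (simp add: rhom_0[OF rhom_shift])

lemma ptmult_ge_iff: "F \<noteq> 0 \<Longrightarrow> k \<le> ptmult w F \<longleftrightarrow> [:0, 1:] ^ k dvd shift w F"
  using order_divides[of 0 k "shift w F"] by (simp add: ptmult_def)

lemma is_val_ptmult: "is_val (ptmult (w :: nat \<Rightarrow> 'k::field))"
  unfolding is_val_def
proof (intro conjI allI impI)
  fix F G :: "'k mpoly" assume FG: "F \<noteq> 0" "G \<noteq> 0" "F - G \<noteq> 0"
  show "min (ptmult w F) (ptmult w G) \<le> ptmult w (F - G)"
    using ptmult_ge_iff[OF FG(1), of "min (ptmult w F) (ptmult w G)" w] ptmult_ge_iff[OF FG(2), of "min (ptmult w F) (ptmult w G)" w]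
    by (subst ptmult_ge_iff[OF FG(3)]) (simp add: rhom_diff[OF rhom_shift] dvd_diff)
next
  fix F G :: "'k mpoly" assume FG: "F \<noteq> 0" "G \<noteq> 0"
  then show "ptmult w (F * G) = ptmult w F + ptmult w G"
    unfolding ptmult_def rhom_mult[OF rhom_shift] by (intro order_mult) simp
next
  fix c :: 'k assume "c \<noteq> 0"
  then show "ptmult w (Cst c) = 0" by (simp add: ptmult_def order_0I)
qed

lemma poly_shift_0: "poly (shift w F) 0 = Cst (peval (\<lambda>c. c) w F)"
  by (rule rhom_eqI[of "\<lambda>F. poly (shift w F) 0"])
    (auto intro: rhom_id rhom_compose[OF rhom_poly rhom_shift] rhom_compose[OF rhom_Cst rhom_peval]
      simp: peval_Cst[OF rhom_id] peval_Var[OF rhom_id])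

lemma ptmult_pos_iff:
  assumes "F \<noteq> 0" shows "1 \<le> ptmult w F \<longleftrightarrow> peval (\<lambda>c. c) w F = 0"
  using order_gt_0_iff[of "shift w F" 0] assms by (simp add: ptmult_def poly_shift_0 Suc_le_eq)

lemma degree_shift_le: "Polynomial.degree (shift w F) \<le> tdeg F"
proof -
  have pp: "Polynomial.degree (power_product (\<lambda>v. [:Cst (w v), Var v:]) e) \<le> wdeg (\<lambda>_. 1) e" for e
  proof -
    have "Polynomial.degree (\<Prod>v\<in>A. [:Cst (w v), Var v:] ^ f v) \<le> (\<Sum>v\<in>A. f v)" for A :: "nat set" and f
    proof (induction A rule: infinite_finite_induct)
      case (insert v A)
      have "Polynomial.degree ([:Cst (w v), Var v:] ^ f v) \<le> f v"
        using degree_power_le[of "[:Cst (w v), Var v:]" "f v"] by (auto intro: order_trans)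
      then show ?case using insert by (auto intro: order_trans[OF degree_mult_le])
    qed auto
    then show ?thesis by (simp add: power_product_def wdeg_def)
  qed
  show ?thesis
    unfolding shift_def peval_def
  proof (rule degree_sum_le)
    fix e assume e: "e \<in> Poly_Mapping.keys F"
    have "Polynomial.degree ([:Cst (Poly_Mapping.lookup F e):] * power_product (\<lambda>v. [:Cst (w v), Var v:]) e)
       \<le> wdeg (\<lambda>_. 1) e"
      using pp[of e] by (auto intro: order_trans[OF degree_smult_le])
    then show "Polynomial.degree ([:Cst (Poly_Mapping.lookup F e):] * power_product (\<lambda>v. [:Cst (w v), Var v:]) e) \<le> tdeg F"
      using wdeg_le_wd[OF e] by (rule order_trans)
  qed simp
qed

lemma ptmult_le_tdeg: "F \<noteq> 0 \<Longrightarrow> ptmult w F \<le> tdeg F"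
  unfolding ptmult_def by (rule order_trans[OF order_degree degree_shift_le]) simp

lemma peval_cong_vars:
  assumes "rhom h" "in_vars V F" "\<And>v. v \<in> V \<Longrightarrow> \<phi> v = \<psi> v" shows "peval h \<phi> F = peval h \<psi> F"
  using assms(2) by (induction rule: in_vars_induct) (auto simp: assms peval_add peval_mult)

section \<open>The function field and the charts\<close>

text \<open>
  Even variables are the coordinates \<open>x\<close>, odd ones the coordinates \<open>y\<close>.
\<close>

definition pcoord :: "'k point \<Rightarrow> nat \<Rightarrow> 'k" where
  "pcoord p v = (if even v then fst p (v div 2) else snd p (v div 2))"

abbreviation wx :: "nat \<Rightarrow> nat" where "wx \<equiv> \<lambda>v. if even v then 1 else 0"
abbreviation wy :: "nat \<Rightarrow> nat" where "wy \<equiv> \<lambda>v. if even v then 0 else 1"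
abbreviation xv :: "nat \<Rightarrow> 'k::field mpoly" where "xv i \<equiv> Var (2 * i)"
abbreviation yv :: "nat \<Rightarrow> 'k::field mpoly" where "yv j \<equiv> Var (Suc (2 * j))"

lemma emb_xv: "emb (xv i) = x_coord i" and emb_yv: "emb (yv i) = y_coord i"
  by (simp_all add: x_coord_def y_coord_def emb_Var)

lemma emb_xv_yv [simp]: "emb (xv i) = x_coord i" "emb (Var (Suc (2 * i))) = y_coord i"
  by (rule emb_xv, rule emb_yv)

lemma emb_monomial: "emb (xv i ^ a * yv j ^ b) = x_coord i ^ a * y_coord j ^ b"
  by (simp add: emb_hom)

text \<open>
  The description of the prime divisors of the blow-up holds for any finite number of distinct
  points; distinctness is expressed by a nonvanishing \<open>2 \<times> 2\<close> minor in one of the two components.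
\<close>

locale blowup_points =
  fixes n m r :: nat and P :: "nat \<Rightarrow> 'k::field point"
  assumes n: "1 \<le> n" and m: "1 \<le> m"
    and pts: "l \<in> {1..r} \<Longrightarrow> is_point n m (P l)"
    and distinct: "l \<in> {1..r} \<Longrightarrow> l' \<in> {1..r} \<Longrightarrow> l \<noteq> l' \<Longrightarrow>
      (\<exists>k\<le>n. \<exists>k'\<le>n. fst (P l) k * fst (P l') k' \<noteq> fst (P l) k' * fst (P l') k) \<or>
      (\<exists>k\<le>m. \<exists>k'\<le>m. snd (P l) k * snd (P l') k' \<noteq> snd (P l) k' * snd (P l') k)"
begin

definition XV :: "nat set" where
  "XV = {2 * i | i. i \<le> n} \<union> {2 * j + 1 | j. j \<le> m}"

text \<open>
  Forms of bidegree \<open>(a, b)\<close> in the coordinates of the product.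
\<close>

definition bih :: "nat \<Rightarrow> nat \<Rightarrow> 'k mpoly \<Rightarrow> bool" where
  "bih a b F \<longleftrightarrow> homog wx a F \<and> homog wy b F \<and> in_vars XV F"

lemma xv_XV: "i \<le> n \<Longrightarrow> 2 * i \<in> XV" and yv_XV: "j \<le> m \<Longrightarrow> Suc (2 * j) \<in> XV"
  by (auto simp: XV_def)

lemma bih_xv: "i \<le> n \<Longrightarrow> bih 1 0 (xv i)"
  using homog_Var[of wx "2 * i", where 'b='k] homog_Var[of wy "2 * i", where 'b='k] by (auto simp: bih_def xv_XV)

lemma bih_yv: "j \<le> m \<Longrightarrow> bih 0 1 (yv j)"
  using homog_Var[of wx "Suc (2 * j)", where 'b='k] homog_Var[of wy "Suc (2 * j)", where 'b='k] by (auto simp: bih_def yv_XV)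

lemma bih_Cst: "bih 0 0 (Cst c)"
  by (simp add: bih_def homog_Cst)

lemma bih_1: "bih 0 0 1"
  using bih_Cst[of 1] by simp

lemma bih_0: "bih a b 0"
  by (simp add: bih_def)

lemma bih_mult: "bih a b F \<Longrightarrow> bih a' b' G \<Longrightarrow> bih (a + a') (b + b') (F * G)"
  by (auto simp: bih_def intro: homog_mult in_vars_mult)

lemma bih_Cst_mult: "bih a b F \<Longrightarrow> bih a b (Cst c * F)"
  using bih_mult[OF bih_Cst, of a b F c] by simp

lemma bih_diff: "bih a b F \<Longrightarrow> bih a b G \<Longrightarrow> bih a b (F - G)"
  by (auto simp: bih_def intro: homog_diff in_vars_diff)

lemma bih_add: "bih a b F \<Longrightarrow> bih a b G \<Longrightarrow> bih a b (F + G)"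
  by (auto simp: bih_def intro: homog_add in_vars_add)

lemma bih_power: "bih a b F \<Longrightarrow> bih (k * a) (k * b) (F ^ k)"
  by (auto simp: bih_def intro: homog_power in_vars_power)

lemma bih_factor:
  assumes "bih a b (F * G)" "F * G \<noteq> 0"
  obtains a1 b1 a2 b2 where "bih a1 b1 F" "bih a2 b2 G" "a = a1 + a2" "b = b1 + b2"
  using homog_factor[of wx a F G] homog_factor[of wy b F G] in_vars_factor[of XV F G] assms that
  unfolding bih_def by metis

lemma bih_unique: "bih a b F \<Longrightarrow> bih a' b' F \<Longrightarrow> F \<noteq> 0 \<Longrightarrow> a = a' \<and> b = b'"
  using homog_unique unfolding bih_def by blast

lemma bih_tdeg:
  assumes "bih a b F" "F \<noteq> 0" shows "tdeg F = a + b"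
proof -
  have "homog (\<lambda>_. 1) (a + b) F"
    unfolding homog_def
  proof
    fix e assume e: "e \<in> Poly_Mapping.keys F"
    then have "wdeg wx e = a" "wdeg wy e = b" using assms by (auto simp: bih_def homog_def)
    moreover have "wdeg (\<lambda>_. 1) e = wdeg wx e + wdeg wy e"
      unfolding wdeg_def sum.distrib[symmetric] by (rule sum.cong) auto
    ultimately show "wdeg (\<lambda>_. 1) e = a + b" by simp
  qed
  then show ?thesis using assms(2) by (rule wd_homog)
qed

text \<open>
  The function field of the product.
\<close>

definition L :: "'k ambient set" where
  "L = {emb G / emb H | G H. \<exists>a b. bih a b G \<and> bih a b H \<and> H \<noteq> 0}"

lemma L_I: "bih a b G \<Longrightarrow> bih a b H \<Longrightarrow> H \<noteq> 0 \<Longrightarrow> emb G / emb H \<in> L"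
  by (auto simp: L_def)

lemma L_E:
  assumes "f \<in> L" obtains a b G H where "bih a b G" "bih a b H" "H \<noteq> 0" "f = emb G / emb H"
  using assms by (auto simp: L_def)

lemma L_subring: "is_subring L"
  unfolding is_subring_def
proof (intro conjI ballI)
  show "1 \<in> L" using L_I[OF bih_1 bih_1] by (simp add: emb_hom)
  fix f g assume "f \<in> L" "g \<in> L"
  then obtain a b G H a' b' G' H' where *: "bih a b G" "bih a b H" "H \<noteq> 0" "f = emb G / emb H"
    "bih a' b' G'" "bih a' b' H'" "H' \<noteq> 0" "g = emb G' / emb H'" by (metis L_E)
  have "f - g = emb (G * H' - G' * H) / emb (H * H')" "f * g = emb (G * G') / emb (H * H')"
    using * by (simp_all add: emb_hom diff_frac_eq)
  moreover have "bih (a + a') (b + b') (G * H' - G' * H)" "bih (a + a') (b + b') (G * G')"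
    "bih (a + a') (b + b') (H * H')" "H * H' \<noteq> 0"
    using bih_mult[of a b G a' b' H'] bih_mult[of a' b' G' a b H] bih_mult[of a b G a' b' G'] bih_mult[of a b H a' b' H'] *
    by (auto intro: bih_diff simp: add.commute)
  ultimately show "f - g \<in> L" "f * g \<in> L" using L_I by metis+
qed

lemma L_inverse:
  assumes "f \<in> L" shows "inverse f \<in> L"
proof (cases "f = 0")
  case False
  obtain a b G H where *: "bih a b G" "bih a b H" "H \<noteq> 0" "f = emb G / emb H" using L_E[OF assms] .
  then have "G \<noteq> 0" using False by (auto simp: emb_hom)
  then show ?thesis using L_I[OF *(2,1)] * by simp
qed (use assms in simp)

lemma L_const: "const c \<in> L"
  using L_I[OF bih_Cst[of c] bih_1] by (simp add: emb_hom emb_Cst)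

lemma L_discrete_valuation:
  assumes "is_val v" "\<exists>t\<in>L. t \<noteq> 0 \<and> vK v t = 1"
  shows "discrete_valuation L (vK v)"
  using assms by unfold_locales (auto simp: L_subring L_inverse vK_mult vK_diff)

abbreviation A :: "nat \<Rightarrow> nat \<Rightarrow> 'k ambient set" where "A \<equiv> chart n m"

lemma A_subring: "is_subring (A i j)"
  unfolding chart_def by (rule is_subring_generate)

lemma A_const: "const c \<in> A i j"
  and A_x: "k \<le> n \<Longrightarrow> x_coord k / x_coord i \<in> A i j"
  and A_y: "k \<le> m \<Longrightarrow> y_coord k / y_coord j \<in> A i j"
  unfolding chart_def by (auto intro!: generate_ring.incl)

text \<open>
  Dehomogenization: the values at which a form is evaluated to obtain the corresponding function
  on the chart \<open>(i, j)\<close>.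
\<close>

definition dehom :: "nat \<Rightarrow> nat \<Rightarrow> nat \<Rightarrow> 'k ambient" where
  "dehom i j v = (if even v then x_coord (v div 2) / x_coord i else y_coord (v div 2) / y_coord j)"

lemma dehom_scale: "variable v = x_coord i ^ wx v * (y_coord j ^ wy v * dehom i j v)"
  by (auto simp: dehom_def x_coord_def y_coord_def)

lemma emb_dehom:
  assumes "bih a b F"
  shows "emb F = x_coord i ^ a * y_coord j ^ b * peval const (dehom i j) F"
proof -
  have "emb F = peval const (\<lambda>v. x_coord i ^ wx v * (y_coord j ^ wy v * dehom i j v)) F"
    by (simp only: emb_eq_peval dehom_scale[symmetric])
  then show ?thesis
    using assms peval_homog_scale[of wx a F const "x_coord i" "\<lambda>v. y_coord j ^ wy v * dehom i j v"]
      peval_homog_scale[of wy b F const "y_coord j" "dehom i j"]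
    by (simp add: bih_def rhom_constant mult.assoc)
qed

lemma peval_dehom_in_A: "in_vars XV F \<Longrightarrow> peval const (dehom i j) F \<in> A i j"
proof (induction rule: in_vars_induct)
  case (Var v)
  then show ?case by (auto simp: XV_def dehom_def rhom_constant intro: A_x A_y)
qed (auto simp: rhom_constant peval_add peval_mult A_const intro: is_subringD(3,6)[OF A_subring])

lemma A_I: "bih a b G \<Longrightarrow> emb G / (x_coord i ^ a * y_coord j ^ b) \<in> A i j"
  using emb_dehom[of a b G i j] peval_dehom_in_A[of G i j] by (simp add: bih_def)

text \<open>
  Functions on a chart are forms divided by the monomial in the two nonvanishing coordinates of
  the same bidegree. The functions of this shape are closed under subtraction because both can be
  brought to a common bidegree by multiplying with powers of \<open>x\<^sub>i\<close> and \<open>y\<^sub>j\<close>.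
\<close>

lemma A_E:
  assumes "f \<in> A i j" "i \<le> n" "j \<le> m"
  shows "\<exists>a b G. bih a b G \<and> f = emb G / (x_coord i ^ a * y_coord j ^ b)"
  using assms(1) unfolding chart_def
proof (induction rule: generate_ring_on_induct)
  case one
  then show ?case using bih_1 by (intro exI[of _ 0] exI[of _ 0] exI[of _ 1]) (simp add: emb_hom)
next
  case (incl h)
  then consider c where "h = const c" | k where "k \<le> n" "h = x_coord k / x_coord i" | k where "k \<le> m" "h = y_coord k / y_coord j"
    by auto
  then show ?case
  proof cases
    case 1
    then show ?thesis using bih_Cst by (intro exI[of _ 0] exI[of _ 0] exI[of _ "Cst c"]) (simp add: emb_Cst)
  next
    case 2
    then show ?thesis using bih_xv
      by (intro exI[of _ 1] exI[of _ 0] exI[of _ "xv k"]) simp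
  next
    case 3
    then show ?thesis using bih_yv emb_yv[of k]
      by (intro exI[of _ 0] exI[of _ 1] exI[of _ "yv k"]) simp
  qed
next
  case (mult f g)
  then obtain a b G a' b' G' where *: "bih a b G" "f = emb G / (x_coord i ^ a * y_coord j ^ b)"
    "bih a' b' G'" "g = emb G' / (x_coord i ^ a' * y_coord j ^ b')" by blast
  then show ?case
    by (intro exI[of _ "a + a'"] exI[of _ "b + b'"] exI[of _ "G * G'"])
      (auto simp: emb_hom power_add intro: bih_mult)
next
  case (diff f g)
  then obtain a b G a' b' G' where *: "bih a b G" "f = emb G / (x_coord i ^ a * y_coord j ^ b)"
    "bih a' b' G'" "g = emb G' / (x_coord i ^ a' * y_coord j ^ b')" by blast
  define S :: "nat \<Rightarrow> nat \<Rightarrow> 'k mpoly" where "S = (\<lambda>a b. xv i ^ a * yv j ^ b)"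
  have s: "bih a b (S a b)" for a b
    using bih_mult[OF bih_power[OF bih_xv[OF assms(2)], of a] bih_power[OF bih_yv[OF assms(3)], of b]]
    by (simp add: S_def)
  have eS: "emb (S a b) = x_coord i ^ a * y_coord j ^ b" for a b
    unfolding S_def by (rule emb_monomial)
  have "bih (a + a') (b + b') (G * S a' b' - G' * S a b)"
    using bih_mult[OF *(1) s[of a' b']] bih_mult[OF *(3) s[of a b]] by (intro bih_diff) (simp_all add: add.commute)
  moreover have "f - g = emb (G * S a' b' - G' * S a b) / (x_coord i ^ (a + a') * y_coord j ^ (b + b'))"
    by (simp add: * emb_hom power_add diff_frac_eq eS ac_simps)
  ultimately show ?case by blast
qed

lemma x_in_L: "k \<le> n \<Longrightarrow> i \<le> n \<Longrightarrow> x_coord k / x_coord i \<in> L"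
  using L_I[OF bih_xv bih_xv, of k i] by simp

lemma y_in_L: "k \<le> m \<Longrightarrow> i \<le> m \<Longrightarrow> y_coord k / y_coord i \<in> L"
  using L_I[OF bih_yv bih_yv, of k i] emb_yv[of k] emb_yv[of i] by simp

lemma A_subset_L: "i \<le> n \<Longrightarrow> j \<le> m \<Longrightarrow> A i j \<subseteq> L"
  unfolding chart_def
  by (rule generate_ring_on_subset[OF L_subring]) (auto intro: x_in_L y_in_L L_const)

lemma L_frac_A:
  assumes "f \<in> L" shows "\<exists>a\<in>A i j. \<exists>s\<in>A i j. s \<noteq> 0 \<and> f = a / s"
proof -
  obtain a b G H where *: "bih a b G" "bih a b H" "H \<noteq> 0" "f = emb G / emb H" using L_E[OF assms] .
  then have "f = (emb G / (x_coord i ^ a * y_coord j ^ b)) / (emb H / (x_coord i ^ a * y_coord j ^ b))"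
    "emb H / (x_coord i ^ a * y_coord j ^ b) \<noteq> 0" by auto
  then show ?thesis using A_I[OF *(1)] A_I[OF *(2)] by blast
qed

section \<open>The valuation of a prime divisor of the product\<close>

definition bprime :: "nat \<Rightarrow> nat \<Rightarrow> 'k mpoly \<Rightarrow> bool" where
  "bprime d e p \<longleftrightarrow> irreducible p \<and> bih d e p"

lemma bprime_prime: "bprime d e p \<Longrightarrow> prime_elem p"
  by (simp add: bprime_def irreducible_imp_prime_mpoly)

lemma prime_tdeg: "prime_elem p \<Longrightarrow> tdeg p \<noteq> 0" for p :: "'k mpoly"
  using unit_iff_tdeg[of p] by (auto simp: prime_elem_def)

lemma prime_avoids_variable:
  fixes p :: "'k mpoly"
  assumes p: "prime_elem p" and uv: "u \<noteq> v" shows "\<not> p dvd Var u \<or> \<not> p dvd Var v"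
proof (rule ccontr)
  assume "\<not> ?thesis"
  then obtain a b where ab: "Var u = p * a" "Var v = p * b" by (auto simp: dvd_def)
  have pt: "tdeg p \<noteq> 0" using prime_tdeg[OF p] .
  have nz: "p \<noteq> 0" "a \<noteq> 0" "b \<noteq> 0" using ab Var_nonzero by (metis mult_eq_0_iff)+
  have t: "tdeg (Var v :: 'k mpoly) = 1" for v by (simp add: degree_monom_eq)
  have "tdeg p + tdeg a = 1" "tdeg p + tdeg b = 1"
    using wd_mult[OF nz(1,2), of "\<lambda>_. 1"] wd_mult[OF nz(1,3), of "\<lambda>_. 1"] t[of u] t[of v] unfolding ab by auto
  then have "tdeg a = 0" "tdeg b = 0" using pt by linarith+
  then obtain c c' where c: "a = Cst c" "b = Cst c'" using tdeg_eq_0_imp_Cst by blast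
  have "Cst c' * Var u = Cst c * (Var v :: 'k mpoly)" using ab c by (simp add: ac_simps)
  then have "peval (\<lambda>c. c) (\<lambda>x. if x = u then 1 else 0) (Cst c' * Var u)
     = peval (\<lambda>c. c) (\<lambda>x. if x = u then 1 else 0) (Cst c * (Var v :: 'k mpoly))"
    by simp
  then have "c' = 0" using uv by (simp add: peval_mult[OF rhom_id] peval_Cst[OF rhom_id] peval_Var[OF rhom_id])
  then show False using nz c by simp
qed

lemma bprime_avoids_x: "bprime d e p \<Longrightarrow> \<exists>i\<le>n. \<not> p dvd xv i"
  using prime_avoids_variable[OF bprime_prime, of d e p "2 * 0" "2 * 1"] n by auto

lemma bprime_avoids_y: "bprime d e p \<Longrightarrow> \<exists>j\<le>m. \<not> p dvd yv j"
  using prime_avoids_variable[OF bprime_prime, of d e p "Suc (2 * 0)" "Suc (2 * 1)"] m by auto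

lemma vK_A:
  assumes v: "is_val v" "v (xv i) = 0" "v (yv j) = 0" and G: "G \<noteq> 0"
  shows "vK v (emb G / (x_coord i ^ a * y_coord j ^ b)) = int (v G)"
proof -
  have "v (xv i ^ a * yv j ^ b) = 0"
    using v is_valD(1)[OF v(1), of "xv i ^ a" "yv j ^ b"] is_val_power[OF v(1), of "xv i" a] is_val_power[OF v(1), of "yv j" b]
    by simp
  then show ?thesis
    unfolding emb_monomial[symmetric] using vK_quotient[OF v(1) G, of "xv i ^ a * yv j ^ b"] by simp
qed

lemma vK_A_nonneg:
  assumes v: "is_val v" "v (xv i) = 0" "v (yv j) = 0" and f: "f \<in> A i j" "f \<noteq> 0" "i \<le> n" "j \<le> m"
  shows "0 \<le> vK v f"
proof -
  obtain a b G where *: "bih a b G" "f = emb G / (x_coord i ^ a * y_coord j ^ b)"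
    using A_E[OF f(1,3,4)] by blast
  then have "G \<noteq> 0" using f(2) by (auto simp: emb_hom)
  then show ?thesis using vK_A[OF v, of G a b] * by simp
qed

lemma pmult_self: "prime_elem p \<Longrightarrow> pmult p p = 1"
  by (rule pmult_unique[of _ _ _ 1]) (auto simp: prime_elem_def)

lemma pmult_eq_0_iff: "prime_elem p \<Longrightarrow> F \<noteq> 0 \<Longrightarrow> pmult p F = 0 \<longleftrightarrow> \<not> p dvd F"
  using pmult_ge_iff[of p F 1] by auto

text \<open>
  An irreducible polynomial can divide only one variable, so as \<open>n, m \<ge> 1\<close> there is a chart
  meeting the zero set of the form.
\<close>

lemma bprime_good_chart:
  assumes p: "bprime d e p"
  obtains i j where "i \<le> n" "j \<le> m" "pmult p (xv i) = 0" "pmult p (yv j) = 0"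
  using bprime_avoids_x[OF p] bprime_avoids_y[OF p] pmult_eq_0_iff[OF bprime_prime[OF p], OF Var_nonzero] by blast

lemma bprime_local_equation:
  assumes p: "bprime d e p" and ij: "pmult p (xv i) = 0" "pmult p (yv j) = 0"
  shows "vK (pmult p) (emb p / (x_coord i ^ d * y_coord j ^ e)) = 1"
  using vK_A[OF is_val_pmult[OF bprime_prime[OF p]] ij, of p d e] pmult_self[OF bprime_prime[OF p]] bprime_prime[OF p]
  by (auto simp: prime_elem_def)

lemma bprime_valuation:
  assumes p: "bprime d e p" shows "discrete_valuation L (vK (pmult p))"
proof (rule L_discrete_valuation[OF is_val_pmult[OF bprime_prime[OF p]]])
  obtain i j where ij: "i \<le> n" "j \<le> m" "pmult p (xv i) = 0" "pmult p (yv j) = 0" using bprime_good_chart[OF p] .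
  let ?t = "emb p / (x_coord i ^ d * y_coord j ^ e)"
  have "?t \<in> L" using A_I[of d e p i j] A_subset_L[OF ij(1,2)] p by (auto simp: bprime_def)
  moreover have "?t \<noteq> 0" using bprime_prime[OF p] by (auto simp: prime_elem_def)
  ultimately show "\<exists>t\<in>L. t \<noteq> 0 \<and> vK (pmult p) t = 1" using bprime_local_equation[OF p ij(3,4)] by blast
qed

definition R_prime :: "'k mpoly \<Rightarrow> 'k ambient set" where
  "R_prime p = discrete_valuation.vring L (vK (pmult p))"

lemma R_prime_iff: "bprime d e p \<Longrightarrow> f \<in> R_prime p \<longleftrightarrow> f \<in> L \<and> (f = 0 \<or> 0 \<le> vK (pmult p) f)"
  unfolding R_prime_def by (rule discrete_valuation.vring_iff[OF bprime_valuation])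

lemma A_subset_R_prime:
  assumes p: "bprime d e p" and ij: "i \<le> n" "j \<le> m" "pmult p (xv i) = 0" "pmult p (yv j) = 0"
  shows "A i j \<subseteq> R_prime p"
proof
  fix f assume f: "f \<in> A i j"
  have "f \<in> L" using f A_subset_L[OF ij(1,2)] by blast
  then show "f \<in> R_prime p"
    using vK_A_nonneg[OF is_val_pmult[OF bprime_prime[OF p]] ij(3,4) f _ ij(1,2)]
    unfolding R_prime_iff[OF p] by blast
qed

text \<open>
  In a quotient of two forms of equal bidegree with nonnegative value, the powers of \<open>p\<close> in the
  denominator cancel. The remaining denominator has value \<open>0\<close>, so after division by a monomial in
  \<open>x\<^sub>i\<close> and \<open>y\<^sub>j\<close> it is a function on the chart that is a unit of the valuation ring.
\<close>

lemma R_prime_local_of: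
  assumes p: "bprime d e p" and ij: "i \<le> n" "j \<le> m" "pmult p (xv i) = 0" "pmult p (yv j) = 0"
  shows "local_of (A i j) (R_prime p)"
  unfolding local_of_def
proof (intro conjI ballI A_subset_R_prime[OF assms])
  interpret discrete_valuation L "vK (pmult p)" by (rule bprime_valuation[OF p])
  have pr: "prime_elem p" by (rule bprime_prime[OF p])
  note iv = is_val_pmult[OF pr]
  show "is_local (R_prime p)" unfolding R_prime_def by (rule vring_local)
  fix f assume fR: "f \<in> R_prime p"
  show "\<exists>a\<in>A i j. \<exists>s\<in>A i j. s \<notin> nonunits (R_prime p) \<and> f = a / s"
  proof (cases "f = 0")
    case True
    then show ?thesis
      using is_subringD(1,2)[OF A_subring] one_notin_nonunits[OF vring_subring]
      by (intro bexI[of _ 0] bexI[of _ 1]) (auto simp: R_prime_def)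
  next
    case False
    have fL: "f \<in> L" "0 \<le> vK (pmult p) f" using fR False by (auto simp: R_prime_iff[OF p])
    obtain a b G H where *: "bih a b G" "bih a b H" "H \<noteq> 0" "f = emb G / emb H" using L_E[OF fL(1)] .
    then have G: "G \<noteq> 0" using False by (auto simp: emb_hom)
    let ?k = "pmult p H"
    obtain H' where H': "H = p ^ ?k * H'" "\<not> p dvd H'" using pmult_split[OF pr *(3)] by blast
    have "?k \<le> pmult p G" using fL(2) vK_quotient[OF iv G *(3)] * by simp
    then obtain G' where G': "G = p ^ ?k * G'" using pmult_ge_iff[OF pr G] by (auto simp: dvd_def)
    obtain a1 b1 a2 b2 where 1: "bih a1 b1 (p ^ ?k)" "bih a2 b2 H'" "a = a1 + a2" "b = b1 + b2"
      using bih_factor[of a b "p ^ ?k" H'] * H' by metis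
    obtain a3 b3 a4 b4 where 2: "bih a3 b3 (p ^ ?k)" "bih a4 b4 G'" "a = a3 + a4" "b = b3 + b4"
      using bih_factor[of a b "p ^ ?k" G'] * G G' by metis
    have nz: "p ^ ?k \<noteq> 0" "H' \<noteq> 0" "G' \<noteq> 0" using *(3) H' G G' by (metis mult_zero_left mult_zero_right)+
    have "a4 = a2" "b4 = b2" using bih_unique[OF 1(1) 2(1) nz(1)] 1 2 by auto
    then have G'b: "bih a2 b2 G'" using 2 by simp
    let ?a = "emb G' / (x_coord i ^ a2 * y_coord j ^ b2)" and ?s = "emb H' / (x_coord i ^ a2 * y_coord j ^ b2)"
    have "f = emb G' / emb H'"
    proof -
      have "emb G = emb (p ^ ?k) * emb G'" "emb H = emb (p ^ ?k) * emb H'"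
        by (metis G' emb_hom(2), metis H'(1) emb_hom(2))
      then show ?thesis using nz *(4) by simp
    qed
    then have f: "f = ?a / ?s" by simp
    have "vK (pmult p) ?s = 0"
      using vK_A[OF iv ij(3,4) nz(2)] H'(2) pmult_eq_0_iff[OF pr nz(2)] by simp
    moreover have "?s \<noteq> 0" using nz by simp
    ultimately have "?s \<notin> nonunits (R_prime p)" unfolding R_prime_def by (simp add: nonunits_vring_iff)
    then show ?thesis using f A_I[OF G'b] A_I[OF 1(2)] by blast
  qed
qed

lemma A_divide_prime:
  assumes p: "bprime d e p" and ij: "i \<le> n" "j \<le> m" "pmult p (xv i) = 0" "pmult p (yv j) = 0"
    and c: "c \<in> A i j" "c \<noteq> 0" "1 \<le> vK (pmult p) c"
  shows "c / (emb p / (x_coord i ^ d * y_coord j ^ e)) \<in> A i j"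
proof -
  have pr: "prime_elem p" by (rule bprime_prime[OF p])
  obtain a b G where G: "bih a b G" "c = emb G / (x_coord i ^ a * y_coord j ^ b)"
    using A_E[OF c(1) ij(1,2)] by blast
  then have Gnz: "G \<noteq> 0" using c(2) by (auto simp: emb_hom)
  have "1 \<le> pmult p G" using c(3) vK_A[OF is_val_pmult[OF pr] ij(3,4) Gnz] G by simp
  then obtain G' where G': "G = p * G'" using pmult_ge_iff[OF pr Gnz, of 1] by (auto simp: dvd_def)
  obtain a1 b1 a2 b2 where 1: "bih a1 b1 p" "bih a2 b2 G'" "a = a1 + a2" "b = b1 + b2"
    using bih_factor[of a b p G'] G Gnz G' by metis
  have "p \<noteq> 0" using pr by (auto simp: prime_elem_def)
  then have "a1 = d" "b1 = e" using bih_unique[OF 1(1)] p by (auto simp: bprime_def)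
  then have "c / (emb p / (x_coord i ^ d * y_coord j ^ e)) = emb G' / (x_coord i ^ a2 * y_coord j ^ b2)"
    using G(2) G' 1(3,4) \<open>p \<noteq> 0\<close> by (simp add: emb_hom power_add)
  then show ?thesis using A_I[OF 1(2)] by simp
qed

end

lemma pcoord_simps [simp]: "pcoord p (2 * i) = fst p i" "pcoord p (Suc (2 * j)) = snd p j"
  by (simp_all add: pcoord_def)

lemma is_subring_poly:
  assumes "is_subring C" "w \<in> C" "\<And>i. coeff p i \<in> C" shows "poly p w \<in> C"
  unfolding poly_altdef using assms by (intro is_subring_sum is_subringD(3) is_subring_power) auto

context blowup_points
begin

section \<open>The valuation of an exceptional divisor\<close>

abbreviation mult_pt :: "nat \<Rightarrow> 'k mpoly \<Rightarrow> nat" where "mult_pt l \<equiv> ptmult (pcoord (P l))"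

text \<open>
  Affine coordinates on a chart, centred at the \<open>l\<close>-th point. Those with \<open>v = 2 i\<close> and
  \<open>v = 2 j + 1\<close> are zero. They generate the maximal ideal of the point, and \<open>gens\<close> is that set of
  generators in the shape in which it occurs in the ideal of the point.
\<close>

definition u_coord :: "nat \<Rightarrow> nat \<Rightarrow> nat \<Rightarrow> nat \<Rightarrow> 'k ambient" where
  "u_coord l i j v = (if even v then x_coord (v div 2) / x_coord i - const (fst (P l) (v div 2) / fst (P l) i)
     else y_coord (v div 2) / y_coord j - const (snd (P l) (v div 2) / snd (P l) j))"

definition gens :: "nat \<Rightarrow> nat \<Rightarrow> nat \<Rightarrow> 'k ambient set" where
  "gens l i j = {x_coord k / x_coord i - const (fst (P l) k / fst (P l) i) | k. k \<le> n} \<union>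
      {y_coord k / y_coord j - const (snd (P l) k / snd (P l) j) | k. k \<le> m}"

lemma gens_eq: "gens l i j = u_coord l i j ` XV"
proof -
  have "XV = (\<lambda>i. 2 * i) ` {..n} \<union> (\<lambda>j. Suc (2 * j)) ` {..m}"
    by (auto simp: XV_def)
  then have "u_coord l i j ` XV = (\<lambda>k. u_coord l i j (2 * k)) ` {..n} \<union> (\<lambda>k. u_coord l i j (Suc (2 * k))) ` {..m}"
    by (simp add: image_Un image_image)
  then show ?thesis unfolding gens_def u_coord_def by (simp add: setcompr_eq_image atMost_def)
qed

lemma u_coord_in_A: "v \<in> XV \<Longrightarrow> u_coord l i j v \<in> A i j"
  by (auto simp: XV_def u_coord_def intro!: is_subringD(4)[OF A_subring] A_x A_y A_const)

lemma gens_subset_A: "gens l i j \<subseteq> A i j"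
  unfolding gens_eq using u_coord_in_A by auto

text \<open>
  One of the affine charts of the blow-up of a single point: the one in which the total transform
  of the maximal ideal is generated by \<open>w\<close>.
\<close>

definition C :: "nat \<Rightarrow> nat \<Rightarrow> nat \<Rightarrow> 'k ambient \<Rightarrow> 'k ambient set" where
  "C l i j w = generate_ring (ring_on UNIV) (A i j \<union> {g / w | g. g \<in> gens l i j})"

lemma C_subring: "is_subring (C l i j w)" unfolding C_def by (rule is_subring_generate)

lemma A_subset_C: "A i j \<subseteq> C l i j w" and gens_C: "g \<in> gens l i j \<Longrightarrow> g / w \<in> C l i j w"
  unfolding C_def by (auto intro: generate_ring.incl)

context
  fixes l i j :: nat
  assumes l: "l \<in> {1..r}" and ij: "i \<le> n" "j \<le> m" and ch: "in_chart i j (P l)"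
begin

lemma mult_pt_chart: "mult_pt l (xv i) = 0" "mult_pt l (yv j) = 0"
  using ch ptmult_pos_iff[of "xv i" "pcoord (P l)"] ptmult_pos_iff[of "yv j" "pcoord (P l)"]
  by (auto simp: in_chart_def peval_Var[OF rhom_id])

lemma vK_u_coord:
  assumes v: "v \<in> XV" and nz: "u_coord l i j v \<noteq> 0" shows "vK (mult_pt l) (u_coord l i j v) = 1"
proof -
  consider k where "k \<le> n" "v = 2 * k" | k where "k \<le> m" "v = Suc (2 * k)" using v by (auto simp: XV_def)
  then obtain F a b where F: "u_coord l i j v = emb F / (x_coord i ^ a * y_coord j ^ b)"
    "bih a b F" "a + b = 1" "peval (\<lambda>c. c) (pcoord (P l)) F = 0"
  proof cases
    case 1
    let ?c = "fst (P l) k / fst (P l) i"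
    have "u_coord l i j v = emb (xv k - Cst ?c * xv i) / (x_coord i ^ 1 * y_coord j ^ 0)"
      using 1 by (simp add: u_coord_def emb_hom emb_Cst diff_divide_distrib)
    moreover have "bih 1 0 (xv k - Cst ?c * xv i)"
      using 1 ij by (intro bih_diff bih_Cst_mult bih_xv)
    moreover have "peval (\<lambda>c. c) (pcoord (P l)) (xv k - Cst ?c * xv i) = 0"
      using ch by (simp add: rhom_diff[OF rhom_peval[OF rhom_id]] peval_mult[OF rhom_id] peval_Cst[OF rhom_id]
        peval_Var[OF rhom_id] in_chart_def)
    ultimately show ?thesis using that by fastforce
  next
    case 2
    let ?c = "snd (P l) k / snd (P l) j"
    have "u_coord l i j v = emb (yv k - Cst ?c * yv j) / (x_coord i ^ 0 * y_coord j ^ 1)"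
      using 2 by (simp add: u_coord_def emb_hom emb_Cst diff_divide_distrib)
    moreover have "bih 0 1 (yv k - Cst ?c * yv j)"
      using 2 ij by (intro bih_diff bih_Cst_mult bih_yv)
    moreover have "peval (\<lambda>c. c) (pcoord (P l)) (yv k - Cst ?c * yv j) = 0"
      using ch by (simp add: rhom_diff[OF rhom_peval[OF rhom_id]] peval_mult[OF rhom_id] peval_Cst[OF rhom_id]
        peval_Var[OF rhom_id] in_chart_def)
    ultimately show ?thesis using that by fastforce
  qed
  have Fnz: "F \<noteq> 0" using F(1) nz by (auto simp: emb_hom)
  have "1 \<le> mult_pt l F" using F(4) ptmult_pos_iff[OF Fnz] by blast
  moreover have "mult_pt l F \<le> 1" using ptmult_le_tdeg[OF Fnz] bih_tdeg[OF F(2) Fnz] F(3) by simp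
  ultimately have "mult_pt l F = 1" by simp
  then show ?thesis using vK_A[OF is_val_ptmult mult_pt_chart Fnz] F(1) by simp
qed

lemma u_coord_nonzero:
  assumes v: "v \<noteq> 2 * i" "v \<noteq> Suc (2 * j)" shows "u_coord l i j v \<noteq> 0"
proof
  assume 0: "u_coord l i j v = 0"
  obtain c u where c: "u \<noteq> v" "Var v - Cst c * Var u = (0 :: 'k mpoly)"
  proof (cases "even v")
    case True
    let ?c = "fst (P l) (v div 2) / fst (P l) i"
    have "x_coord (v div 2) = const ?c * x_coord i"
      using 0 True by (simp add: u_coord_def divide_eq_eq)
    moreover have "emb (Var v :: 'k mpoly) = x_coord (v div 2)"
      using True emb_xv_yv(1)[of "v div 2"] by simp
    ultimately have "emb (Var v - Cst ?c * xv i) = 0"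
      by (simp add: emb_hom emb_Cst)
    then show ?thesis using that[of "2 * i" ?c] v by simp
  next
    case False
    let ?c = "snd (P l) (v div 2) / snd (P l) j"
    have "y_coord (v div 2) = const ?c * y_coord j"
      using 0 False by (simp add: u_coord_def divide_eq_eq)
    moreover have "emb (Var v :: 'k mpoly) = y_coord (v div 2)"
      using False emb_xv_yv(2)[of "v div 2"] by simp
    ultimately have "emb (Var v - Cst ?c * yv j) = 0"
      by (simp add: emb_hom emb_Cst)
    then show ?thesis using that[of "Suc (2 * j)" ?c] v by simp
  qed
  have "peval (\<lambda>c. c) (\<lambda>x. if x = v then 1 else 0) (Var v - Cst c * Var u :: 'k mpoly) = 0"
    unfolding c(2) by (simp add: peval_def)
  then show False
    using c(1) by (simp add: rhom_diff[OF rhom_peval[OF rhom_id]] peval_mult[OF rhom_id] peval_Cst[OF rhom_id]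
        peval_Var[OF rhom_id])
qed

lemma gens_nonzero: "\<exists>w\<in>gens l i j. w \<noteq> 0"
proof -
  obtain k where k: "k \<le> n" "k \<noteq> i" using n by (cases "i = 0") auto
  then have "u_coord l i j (2 * k) \<noteq> 0" by (intro u_coord_nonzero) presburger+
  then show ?thesis unfolding gens_eq using xv_XV[OF k(1)] by blast
qed

lemma vK_gens: "w \<in> gens l i j \<Longrightarrow> w \<noteq> 0 \<Longrightarrow> vK (mult_pt l) w = 1"
  unfolding gens_eq using vK_u_coord by blast

lemma pt_discrete_valuation: "discrete_valuation L (vK (mult_pt l))"
  using gens_nonzero vK_gens gens_subset_A A_subset_L[OF ij]
  by (intro L_discrete_valuation[OF is_val_ptmult]) blast

text \<open>
  In the Taylor expansion of a function of multiplicity at least \<open>e\<close>, each term is a product of at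
  least \<open>e\<close> local coordinates, each of which is \<open>w\<close> times an element of the algebra \<open>C\<close>.
\<close>

lemma taylor:
  assumes f: "f \<in> A i j" "f \<noteq> 0" and e: "int e \<le> vK (mult_pt l) f" and w: "w \<in> gens l i j" "w \<noteq> 0"
  shows "f / w ^ e \<in> C l i j w"
proof -
  obtain a b G where G: "bih a b G" "f = emb G / (x_coord i ^ a * y_coord j ^ b)"
    using A_E[OF f(1) ij] by blast
  then have Gnz: "G \<noteq> 0" using f(2) by (auto simp: emb_hom)
  have fG: "f = peval const (dehom i j) G" using emb_dehom[OF G(1), of i j] G(2) by simp
  have "e \<le> mult_pt l G" using e vK_A[OF is_val_ptmult mult_pt_chart Gnz] G(2) by simp
  then obtain Q where Q: "shift (pcoord (P l)) G = [:0, 1:] ^ e * Q"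
    using ptmult_ge_iff[OF Gnz] by (auto simp: dvd_def)
  let ?lx = "fst (P l) i" and ?ly = "snd (P l) j"
  have lnz: "?lx \<noteq> 0" "?ly \<noteq> 0" using ch by (auto simp: in_chart_def)
  define lam where "lam v = (if even v then ?lx else ?ly)" for v :: nat
  define \<eta> where "\<eta> v = (if v \<in> XV then const (lam v) * (u_coord l i j v / w) else 0)" for v
  \<comment> \<open>substituting \<open>w\<close> for the expansion parameter and the quotients \<open>u\<^sub>v / w\<close> for the directions returns \<open>f\<close>, up to the scaling of homogeneous coordinates\<close>
  define H where "H = peval const \<eta>"
  have rH: "rhom H" unfolding H_def by (rule rhom_peval[OF rhom_constant])
  have HC: "H F \<in> C l i j w" for F :: "'k mpoly"
  proof (induction F rule: mpoly_induct)
    case (Cst c)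
    then show ?case by (simp add: H_def rhom_constant subsetD[OF A_subset_C A_const])
  next
    case (Var v)
    have "u_coord l i j v / w \<in> C l i j w" if "v \<in> XV" using that gens_C unfolding gens_eq by blast
    then show ?case using A_const[of "lam v" i j] A_subset_C[of i j l w] is_subringD(2,3)[OF C_subring]
      by (auto simp: H_def rhom_constant \<eta>_def simp del: times_divide_eq_right)
  qed (auto simp: rhom_add[OF rH] rhom_mult[OF rH] intro: is_subringD[OF C_subring])
  let ?g = "\<lambda>F. poly (map_poly H (shift (pcoord (P l)) F)) w"
  have rg: "rhom ?g" by (intro rhom_compose[OF rhom_poly] rhom_compose[OF rhom_map_poly[OF rH]] rhom_shift)
  have mp: "map_poly H [:c, d:] = [:H c, H d:]" for c d
    by (rule poly_eqI) (simp add: coeff_map_poly rhom_0[OF rH] coeff_pCons split: nat.splits)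
  have "?g G = peval const (\<lambda>v. const (pcoord (P l) v) + w * \<eta> v) G"
    by (rule peval_eq[OF rg rhom_constant])
      (simp_all add: mp map_poly_pCons rhom_0[OF rH], simp_all add: H_def rhom_constant)
  also have "\<dots> = peval const (\<lambda>v. const ?lx ^ wx v * (const ?ly ^ wy v * dehom i j v)) G"
  proof (rule peval_cong_vars[OF rhom_constant])
    show "in_vars XV G" using G by (simp add: bih_def)
    fix v assume "v \<in> XV"
    then show "const (pcoord (P l) v) + w * \<eta> v = const ?lx ^ wx v * (const ?ly ^ wy v * dehom i j v)"
      using w(2) lnz by (auto simp: \<eta>_def lam_def u_coord_def dehom_def pcoord_def const_divide right_diff_distrib)
  qed
  also have "\<dots> = const ?lx ^ a * (const ?ly ^ b * f)"
    using G(1) peval_homog_scale[of wx a G const "const ?lx" "\<lambda>v. const ?ly ^ wy v * dehom i j v"]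
      peval_homog_scale[of wy b G const "const ?ly" "dehom i j"]
    by (simp add: bih_def rhom_constant fG)
  finally have 1: "?g G = const ?lx ^ a * (const ?ly ^ b * f)" .
  have "map_poly H [:0, 1:] = [:0, 1:]" by (simp add: mp rhom_0[OF rH] rhom_1[OF rH])
  then have "?g G = w ^ e * poly (map_poly H Q) w"
    unfolding Q rhom_mult[OF rhom_map_poly[OF rH]] rhom_power[OF rhom_map_poly[OF rH]] by simp
  then have 2: "w ^ e * poly (map_poly H Q) w = const ?lx ^ a * (const ?ly ^ b * f)"
    using 1 by simp
  define D where "D = const ?lx ^ a * const ?ly ^ b"
  have kD: "const (inverse (?lx ^ a * ?ly ^ b)) = inverse D"
    by (simp only: const_inverse const_hom D_def)
  have "D \<noteq> 0" using lnz by (simp add: D_def)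
  moreover have "w ^ e * poly (map_poly H Q) w = D * f" using 2 by (simp add: D_def mult.assoc)
  ultimately have "f / w ^ e = const (inverse (?lx ^ a * ?ly ^ b)) * poly (map_poly H Q) w"
    unfolding kD using w(2) by (simp add: field_simps)
  moreover have "w \<in> C l i j w" using w gens_subset_A A_subset_C by blast
  then have "poly (map_poly H Q) w \<in> C l i j w"
    by (intro is_subring_poly C_subring) (auto simp: coeff_map_poly rhom_0[OF rH] HC)
  moreover have "const (inverse (?lx ^ a * ?ly ^ b)) \<in> C l i j w" using A_const A_subset_C by blast
  ultimately show ?thesis using is_subringD(3)[OF C_subring] by simp
qed

end

definition R_pt :: "nat \<Rightarrow> 'k ambient set" where
  "R_pt l = discrete_valuation.vring L (vK (mult_pt l))"

lemma pt_chart: "l \<in> {1..r} \<Longrightarrow> \<exists>i\<le>n. \<exists>j\<le>m. in_chart i j (P l)"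
  using pts[of l] by (auto simp: is_point_def in_chart_def)

lemma pt_valuation: "l \<in> {1..r} \<Longrightarrow> discrete_valuation L (vK (mult_pt l))"
  using pt_chart pt_discrete_valuation by blast

lemma R_pt_iff: "l \<in> {1..r} \<Longrightarrow> f \<in> R_pt l \<longleftrightarrow> f \<in> L \<and> (f = 0 \<or> 0 \<le> vK (mult_pt l) f)"
  unfolding R_pt_def by (rule discrete_valuation.vring_iff[OF pt_valuation])

lemma nonunits_R_pt_iff: "l \<in> {1..r} \<Longrightarrow> f \<in> nonunits (R_pt l) \<longleftrightarrow> f \<in> L \<and> (f = 0 \<or> 1 \<le> vK (mult_pt l) f)"
  unfolding R_pt_def by (rule discrete_valuation.nonunits_vring_iff[OF pt_valuation])

lemma nonunits_R_prime_iff: "bprime d e p \<Longrightarrow> f \<in> nonunits (R_prime p) \<longleftrightarrow> f \<in> L \<and> (f = 0 \<or> 1 \<le> vK (pmult p) f)"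
  unfolding R_prime_def by (rule discrete_valuation.nonunits_vring_iff[OF bprime_valuation])

lemma R_pt_subring: "l \<in> {1..r} \<Longrightarrow> is_subring (R_pt l)"
  unfolding R_pt_def by (rule discrete_valuation.vring_subring[OF pt_valuation])

lemma R_pt_local: "l \<in> {1..r} \<Longrightarrow> is_local (R_pt l)"
  unfolding R_pt_def by (rule discrete_valuation.vring_local[OF pt_valuation])

lemma A_subset_R_pt:
  assumes l: "l \<in> {1..r}" and ij: "i \<le> n" "j \<le> m" and ch: "in_chart i j (P l)"
  shows "A i j \<subseteq> R_pt l"
proof
  fix f assume f: "f \<in> A i j"
  have "f \<in> L" using f A_subset_L[OF ij] by blast
  then show "f \<in> R_pt l"
    using vK_A_nonneg[OF is_val_ptmult mult_pt_chart[OF l ij ch] f _ ij]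
    unfolding R_pt_iff[OF l] by blast
qed

lemma C_subset_R_pt:
  assumes l: "l \<in> {1..r}" and ij: "i \<le> n" "j \<le> m" and ch: "in_chart i j (P l)"
    and w: "w \<in> gens l i j" "w \<noteq> 0"
  shows "C l i j w \<subseteq> R_pt l"
  unfolding C_def
proof (rule generate_ring_on_subset[OF R_pt_subring[OF l]], rule Un_least[OF A_subset_R_pt[OF assms(1-4)]], safe)
  interpret discrete_valuation L "vK (mult_pt l)" by (rule pt_valuation[OF l])
  fix g assume g: "g \<in> gens l i j"
  have gw: "g \<in> L" "w \<in> L" using g w gens_subset_A[of l i j] A_subset_L[OF ij] by blast+
  show "g / w \<in> R_pt l"
  proof (cases "g = 0")
    case False
    then show ?thesis
      using vK_gens[OF l ij ch g False] vK_gens[OF l ij ch w] gw w nu_divide[OF gw False w(2)] L_divide[OF gw]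
      by (simp add: R_pt_iff[OF l])
  qed (use is_subringD(2)[OF R_pt_subring[OF l]] in simp)
qed

text \<open>
  Write an element of the valuation ring as \<open>g / h\<close> with functions on the chart, and let \<open>e\<close> be
  the value of \<open>h\<close>. By \<open>taylor\<close>, both \<open>g\<close> and \<open>h\<close> can be divided by \<open>w\<^sup>e\<close> in \<open>C\<close>, after which the
  denominator has value \<open>0\<close>.
\<close>

lemma R_pt_local_of_C:
  assumes l: "l \<in> {1..r}" and ij: "i \<le> n" "j \<le> m" and ch: "in_chart i j (P l)"
    and w: "w \<in> gens l i j" "w \<noteq> 0"
  shows "local_of (C l i j w) (R_pt l)"
  unfolding local_of_def
proof (intro conjI ballI C_subset_R_pt[OF assms] R_pt_local[OF l])
  interpret discrete_valuation L "vK (mult_pt l)" by (rule pt_valuation[OF l])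
  fix f assume f: "f \<in> R_pt l"
  show "\<exists>a\<in>C l i j w. \<exists>s\<in>C l i j w. s \<notin> nonunits (R_pt l) \<and> f = a / s"
  proof (cases "f = 0")
    case True
    then show ?thesis
      using is_subringD(1,2)[OF C_subring] one_notin_nonunits[OF R_pt_subring[OF l]]
      by (intro bexI[of _ 0] bexI[of _ 1]) auto
  next
    case False
    have fL: "f \<in> L" "0 \<le> vK (mult_pt l) f" using f False by (auto simp: R_pt_iff[OF l])
    obtain g h where gh: "g \<in> A i j" "h \<in> A i j" "h \<noteq> 0" "f = g / h" using L_frac_A[OF fL(1)] by blast
    then have g: "g \<noteq> 0" using False by auto
    have ghL: "g \<in> L" "h \<in> L" "w \<in> L" using gh w gens_subset_A[of l i j] A_subset_L[OF ij] by blast+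
    define e where "e = nat (vK (mult_pt l) h)"
    have e: "int e = vK (mult_pt l) h"
      using vK_A_nonneg[OF is_val_ptmult mult_pt_chart[OF l ij ch] gh(2,3) ij] by (simp add: e_def)
    have "int e \<le> vK (mult_pt l) g" using fL(2) nu_divide[OF ghL(1,2) g gh(3)] e gh(4) by simp
    then have 1: "g / w ^ e \<in> C l i j w" by (rule taylor[OF l ij ch gh(1) g _ w])
    have 2: "h / w ^ e \<in> C l i j w" using taylor[OF l ij ch gh(2,3) _ w] e by simp
    have wL: "w ^ e \<in> L" "vK (mult_pt l) (w ^ e) = int e"
      using is_subring_power[OF L_subring ghL(3)] nu_power[OF ghL(3) w(2)] vK_gens[OF l ij ch w] by auto
    have "vK (mult_pt l) (h / w ^ e) = 0"
      using nu_divide[OF ghL(2) wL(1) gh(3)] w(2) wL(2) e by simp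
    then have "h / w ^ e \<notin> nonunits (R_pt l)" using gh(3) w(2) by (simp add: nonunits_R_pt_iff[OF l])
    moreover have "f = (g / w ^ e) / (h / w ^ e)" using gh w by simp
    ultimately show ?thesis using 1 2 by blast
  qed
qed

text \<open>
  Clearing denominators, \<open>c w\<^sup>d\<close> is a function on the chart of multiplicity at least \<open>d + 1\<close>, and
  \<open>taylor\<close> divides it by \<open>w\<^bsup>d + 1\<^esup>\<close>.
\<close>

lemma C_divide:
  assumes l: "l \<in> {1..r}" and ij: "i \<le> n" "j \<le> m" and ch: "in_chart i j (P l)"
    and w: "w \<in> gens l i j" "w \<noteq> 0"
    and c: "c \<in> C l i j w" "c \<noteq> 0" "1 \<le> vK (mult_pt l) c"
  shows "c / w \<in> C l i j w"
proof -
  interpret discrete_valuation L "vK (mult_pt l)" by (rule pt_valuation[OF l])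
  have CL: "C l i j w \<subseteq> L" using C_subset_R_pt[OF assms(1-6)] by (auto simp: R_pt_iff[OF l])
  have wA: "w \<in> A i j" using w gens_subset_A by blast
  have wL: "w \<in> L" using wA A_subset_L[OF ij] by blast
  have "\<exists>d. h * w ^ d \<in> A i j" if "h \<in> C l i j w" for h
    using that unfolding C_def
  proof (induction rule: generate_ring_on_induct)
    case one
    then show ?case using is_subringD(1)[OF A_subring] by (intro exI[of _ 0]) simp
  next
    case (incl h)
    then show ?case
    proof
      assume "h \<in> A i j"
      then show ?thesis by (intro exI[of _ 0]) simp
    next
      assume "h \<in> {g / w | g. g \<in> gens l i j}"
      then obtain g where "g \<in> gens l i j" "h = g / w" by blast
      then have "h * w ^ 1 \<in> A i j" using w gens_subset_A[of l i j] by auto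
      then show ?thesis ..
    qed
  next
    case (diff a b)
    then obtain d e where "a * w ^ d \<in> A i j" "b * w ^ e \<in> A i j" by blast
    then have "(a * w ^ d) * w ^ e - (b * w ^ e) * w ^ d \<in> A i j"
      using is_subringD(3)[OF A_subring _ is_subring_power[OF A_subring wA]] is_subringD(4)[OF A_subring] by blast
    then show ?case by (intro exI[of _ "d + e"]) (simp add: algebra_simps power_add)
  next
    case (mult a b)
    then obtain d e where "a * w ^ d \<in> A i j" "b * w ^ e \<in> A i j" by blast
    then have "(a * w ^ d) * (b * w ^ e) \<in> A i j" by (rule is_subringD(3)[OF A_subring])
    then show ?case by (intro exI[of _ "d + e"]) (simp add: algebra_simps power_add)
  qed
  then obtain d where d: "c * w ^ d \<in> A i j" using c by blast
  have "vK (mult_pt l) (c * w ^ d) = vK (mult_pt l) c + int d"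
    using nu_mult[of c "w ^ d"] nu_power[OF wL w(2), of d] vK_gens[OF l ij ch w] c CL w is_subring_power[OF L_subring wL]
    by auto
  then have "int (Suc d) \<le> vK (mult_pt l) (c * w ^ d)" using c by simp
  moreover have "c * w ^ d \<noteq> 0" using c w by simp
  ultimately have "c * w ^ d / w ^ Suc d \<in> C l i j w" using taylor[OF l ij ch d _ _ w] by blast
  then show ?thesis using w(2) by simp
qed

end

section \<open>The prime divisors of the blow-up\<close>

lemma units_mult:
  assumes "is_local R" "s \<in> R" "t \<in> R" "s \<notin> nonunits R" "t \<notin> nonunits R"
  shows "s * t \<notin> nonunits R"
proof -
  have "is_subring R" using assms(1) by (simp add: is_local_def)
  then show ?thesis
    using prime_nonunits_Int[OF assms(1), of R] is_subringD(3)[of R s t] assms unfolding prime_in_def by blast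
qed

text \<open>
  If all generators of an algebra are fractions over \<open>D\<close> with denominators that are units of \<open>R\<close>,
  then so are all elements of the algebra and of its localization \<open>R\<close>.
\<close>

lemma local_of_subring:
  assumes D: "is_subring D" "D \<subseteq> R" and R: "local_of (generate_ring (ring_on UNIV) S) R"
    and S: "\<And>g. g \<in> S \<Longrightarrow> \<exists>a\<in>D. \<exists>s\<in>D. s \<notin> nonunits R \<and> g = a / s"
  shows "local_of D R"
proof -
  have lR: "is_local R" and fr: "\<And>f. f \<in> R \<Longrightarrow> \<exists>a\<in>generate_ring (ring_on UNIV) S. \<exists>s\<in>generate_ring (ring_on UNIV) S. s \<notin> nonunits R \<and> f = a / s"
    and BR: "generate_ring (ring_on UNIV) S \<subseteq> R"
    using R by (auto simp: local_of_def)
  have sR: "is_subring R" using lR by (simp add: is_local_def)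
  note Ds = is_subringD[OF D(1)]
  have 0: "0 \<in> nonunits R" using is_subringD(2)[OF sR] by (simp add: nonunits_def)
  have B: "\<exists>a\<in>D. \<exists>s\<in>D. s \<notin> nonunits R \<and> g = a / s" if "g \<in> generate_ring (ring_on UNIV) S" for g
    using that
  proof (induction rule: generate_ring_on_induct)
    case one
    then show ?case using Ds(1) one_notin_nonunits[OF sR] by (intro bexI[of _ 1]) auto
  next
    case (diff x y)
    then obtain a s b t where *: "a \<in> D" "s \<in> D" "s \<notin> nonunits R" "x = a / s" "b \<in> D" "t \<in> D" "t \<notin> nonunits R" "y = b / t"
      by blast
    have "s \<noteq> 0" "t \<noteq> 0" using * 0 by auto
    then have "x - y = (a * t - b * s) / (s * t)" using * by (simp add: diff_frac_eq)
    moreover have "s * t \<notin> nonunits R" using units_mult[OF lR] * D(2) by blast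
    moreover have "a * t - b * s \<in> D" "s * t \<in> D" using * Ds(3,4) by blast+
    ultimately show ?case by blast
  next
    case (mult x y)
    then obtain a s b t where *: "a \<in> D" "s \<in> D" "s \<notin> nonunits R" "x = a / s" "b \<in> D" "t \<in> D" "t \<notin> nonunits R" "y = b / t"
      by blast
    then have "x * y = (a * b) / (s * t)" by simp
    moreover have "s * t \<notin> nonunits R" using units_mult[OF lR] * D(2) by blast
    moreover have "a * b \<in> D" "s * t \<in> D" using * Ds(3,4) by blast+
    ultimately show ?case by blast
  qed (rule S)
  have "\<exists>a\<in>D. \<exists>s\<in>D. s \<notin> nonunits R \<and> f = a / s" if "f \<in> R" for f
  proof -
    obtain b t where bt: "b \<in> generate_ring (ring_on UNIV) S" "t \<in> generate_ring (ring_on UNIV) S"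
      "t \<notin> nonunits R" "f = b / t" using fr \<open>f \<in> R\<close> by blast
    obtain b1 b2 t1 t2 where *: "b1 \<in> D" "b2 \<in> D" "b2 \<notin> nonunits R" "b = b1 / b2"
      "t1 \<in> D" "t2 \<in> D" "t2 \<notin> nonunits R" "t = t1 / t2" using B bt by blast
    have t2: "t2 \<noteq> 0" using * 0 by auto
    then have "t1 = t * t2" using * by simp
    moreover have "t * t2 \<notin> nonunits R" using units_mult[OF lR] * bt BR D(2) by blast
    ultimately have "t1 \<notin> nonunits R" by simp
    then have "b2 * t1 \<notin> nonunits R" using units_mult[OF lR] * D(2) by blast
    moreover have "f = (b1 * t2) / (b2 * t1)" using bt * t2 by simp
    moreover have "b1 * t2 \<in> D" "b2 * t1 \<in> D" using * Ds(3) by blast+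
    ultimately show ?thesis by blast
  qed
  then show ?thesis unfolding local_of_def using lR D(2) by blast
qed

context blowup_points
begin

definition Lc :: "nat \<Rightarrow> nat \<Rightarrow> nat set" where
  "Lc i j = {l \<in> {1..r}. in_chart i j (P l)}"

lemma LcD: "l \<in> Lc i j \<Longrightarrow> l \<in> {1..r}" "l \<in> Lc i j \<Longrightarrow> in_chart i j (P l)"
  by (auto simp: Lc_def)

lemma const_unit:
  assumes "A i j \<subseteq> R" "c \<noteq> 0" shows "const c \<notin> nonunits R"
  using assms A_const[of "inverse c" i j] by (auto simp: nonunits_def const_inverse)

lemma gens_nonunits:
  assumes l: "l \<in> {1..r}" and ij: "i \<le> n" "j \<le> m" and ch: "in_chart i j (P l)"
  shows "gens l i j \<subseteq> A i j \<inter> nonunits (R_pt l)"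
proof
  fix g assume g: "g \<in> gens l i j"
  then have "g \<in> A i j" using gens_subset_A by blast
  moreover from this have "g \<in> L" using A_subset_L[OF ij] by blast
  moreover have "g = 0 \<or> 1 \<le> vK (mult_pt l) g" using vK_gens[OF assms g] by (cases "g = 0") auto
  ultimately show "g \<in> A i j \<inter> nonunits (R_pt l)" by (simp add: nonunits_R_pt_iff[OF l])
qed

text \<open>
  The chart is generated as an algebra by the coordinates, each of which is congruent to a
  constant.
\<close>

lemma const_mod_gens:
  assumes J: "ideal_in J (A i j)" "gens l i j \<subseteq> J" and f: "f \<in> A i j"
  shows "\<exists>c. f - const c \<in> J"
proof -
  have Jp: "0 \<in> J" "a \<in> J \<Longrightarrow> b \<in> J \<Longrightarrow> a + b \<in> J" "a \<in> A i j \<Longrightarrow> b \<in> J \<Longrightarrow> a * b \<in> J" for a b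
    using J(1) by (auto simp: ideal_in_def)
  have Jd: "a - b \<in> J" if "a \<in> J" "b \<in> J" for a b
    using Jp(2)[OF that(1) Jp(3)[OF is_subringD(5)[OF A_subring is_subringD(1)[OF A_subring]] that(2)]] by simp
  have "f \<in> generate_ring (ring_on UNIV) (Set.range const \<union> {x_coord k / x_coord i | k. k \<le> n} \<union> {y_coord k / y_coord j | k. k \<le> m})"
    using f by (simp add: chart_def)
  then have "f \<in> A i j \<and> (\<exists>c. f - const c \<in> J)"
  proof (induction rule: generate_ring_on_induct)
    case one
    then show ?case using is_subringD(1)[OF A_subring] Jp(1) by (auto intro!: exI[of _ 1] simp: const_hom)
  next
    case (incl h)
    then consider c where "h = const c" | k where "k \<le> n" "h = x_coord k / x_coord i" | k where "k \<le> m" "h = y_coord k / y_coord j"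
      by auto
    then show ?case
    proof cases
      case 1
      then show ?thesis using Jp(1) A_const by (auto intro!: exI[of _ c])
    next
      case 2
      then have "h - const (fst (P l) k / fst (P l) i) \<in> J" using J(2) by (auto simp: gens_def)
      then show ?thesis using A_x 2 by blast
    next
      case 3
      then have "h - const (snd (P l) k / snd (P l) j) \<in> J" using J(2) by (auto simp: gens_def)
      then show ?thesis using A_y 3 by blast
    qed
  next
    case (diff a b)
    then obtain c d where *: "a \<in> A i j" "a - const c \<in> J" "b \<in> A i j" "b - const d \<in> J" by blast
    then have "(a - const c) - (b - const d) \<in> J" using Jd by blast
    then have "(a - b) - const (c - d) \<in> J" by (simp add: const_hom algebra_simps)
    then show ?case using is_subringD(4)[OF A_subring] * by blast
  next
    case (mult a b)
    then obtain c d where *: "a \<in> A i j" "a - const c \<in> J" "b \<in> A i j" "b - const d \<in> J" by blast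
    then have "a * (b - const d) + const d * (a - const c) \<in> J" using Jp A_const by blast
    then have "a * b - const (c * d) \<in> J" by (simp add: const_hom algebra_simps)
    then show ?case using is_subringD(3)[OF A_subring] * by blast
  qed
  then show ?thesis by blast
qed

text \<open>
  A function on the chart is congruent to a constant modulo any ideal that contains the local
  coordinates, in particular modulo the intersection of \<open>J\<close> with the functions vanishing at the
  point. For such a function the constant vanishes too, as nonzero constants are units.
\<close>

lemma maximal_point_ideal:
  assumes l: "l \<in> {1..r}" and ij: "i \<le> n" "j \<le> m" and ch: "in_chart i j (P l)"
    and J: "ideal_in J (A i j)" "gens l i j \<subseteq> J"
  shows "A i j \<inter> nonunits (R_pt l) \<subseteq> J"
proof
  fix f assume f: "f \<in> A i j \<inter> nonunits (R_pt l)"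
  let ?M = "A i j \<inter> nonunits (R_pt l)"
  have M: "ideal_in ?M (A i j)"
    using prime_nonunits_Int[OF R_pt_local[OF l] A_subring A_subset_R_pt[OF assms(1-4)]] by (simp add: prime_in_def)
  have "ideal_in (J \<inter> ?M) (A i j)" using J(1) M unfolding ideal_in_def by blast
  moreover have "gens l i j \<subseteq> J \<inter> ?M" using J(2) gens_nonunits[OF assms(1-4)] by blast
  ultimately obtain c where c: "f - const c \<in> J" "f - const c \<in> nonunits (R_pt l)"
    using const_mod_gens[of "J \<inter> ?M" i j l f] f by blast
  have "c = 0"
  proof (rule ccontr)
    assume "c \<noteq> 0"
    have "f \<in> L" "f - const c \<in> L" using f c(2) nonunits_R_pt_iff[OF l] by auto
    have "- 1 \<in> R_pt l" using R_pt_subring[OF l] is_subringD(1,5) by blast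
    then have "(- 1) * (f - const c) \<in> nonunits (R_pt l)" using nonunits_mult[OF R_pt_subring[OF l] _ c(2)] by blast
    then have "f + (- 1) * (f - const c) \<in> nonunits (R_pt l)" using R_pt_local[OF l] f unfolding is_local_def by blast
    then show False using const_unit[OF A_subset_R_pt[OF assms(1-4)] \<open>c \<noteq> 0\<close>] by simp
  qed
  then show "f \<in> J" using c(1) by (simp add: const_hom)
qed

lemma point_ideal_eq:
  assumes l: "l \<in> {1..r}" and ij: "i \<le> n" "j \<le> m" and ch: "in_chart i j (P l)"
  shows "point_ideal n m i j (P l) = A i j \<inter> nonunits (R_pt l)"
proof -
  have "point_ideal n m i j (P l) = \<Inter> {J. ideal_in J (A i j) \<and> gens l i j \<subseteq> J}"
    unfolding point_ideal_def genideal_def gens_def[symmetric] ideal_ring_on_iff[OF A_subring] ..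
  moreover have "ideal_in (A i j \<inter> nonunits (R_pt l)) (A i j)"
    using prime_nonunits_Int[OF R_pt_local[OF l] A_subring A_subset_R_pt[OF assms]] by (simp add: prime_in_def)
  ultimately show ?thesis
    using gens_nonunits[OF assms] maximal_point_ideal[OF assms] by blast
qed

abbreviation I :: "nat \<Rightarrow> nat \<Rightarrow> 'k ambient set" where "I \<equiv> points_ideal n m r P"

lemma I_iff:
  assumes ij: "i \<le> n" "j \<le> m"
  shows "f \<in> I i j \<longleftrightarrow> f \<in> A i j \<and> (\<forall>l\<in>Lc i j. f \<in> nonunits (R_pt l))"
  using point_ideal_eq[OF LcD(1) ij LcD(2)] unfolding points_ideal_def Lc_def[symmetric] by auto

definition B :: "nat \<Rightarrow> nat \<Rightarrow> 'k ambient \<Rightarrow> 'k ambient set" where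
  "B i j f = blowup_algebra (A i j) (I i j) f"

lemma B_subring: "is_subring (B i j f)"
  unfolding B_def blowup_algebra_def by (rule is_subring_generate)

lemma A_subset_B: "A i j \<subseteq> B i j f" and I_B: "g \<in> I i j \<Longrightarrow> g / f \<in> B i j f"
  unfolding B_def blowup_algebra_def by (auto intro: generate_ring.incl)

lemma B_subset:
  assumes "is_subring R" "A i j \<subseteq> R" "\<And>g. g \<in> I i j \<Longrightarrow> g / f \<in> R" shows "B i j f \<subseteq> R"
  unfolding B_def blowup_algebra_def using assms by (intro generate_ring_on_subset) auto

definition X :: "'k ambient set set" where "X = blowup n m r P"

lemma X_iff: "R \<in> X \<longleftrightarrow> (\<exists>i\<le>n. \<exists>j\<le>m. \<exists>f\<in>I i j - {0}. local_of (B i j f) R)"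
  unfolding X_def blowup_def B_def[symmetric] by (auto simp: spec_local_rings_iff[OF B_subring] Bex_def)

text \<open>
  The case of a point of \<open>X\<close> that does not lie over a blown-up point. There the ideal of the
  points becomes the unit ideal, \<open>f\<close> is a unit, and \<open>R\<close> is a local ring of the chart of the
  product. A nonunit of \<open>R\<close> gives a form whose dehomogenization is a nonunit; by induction on the
  degree one of its irreducible factors has the same property, and its dehomogenization is the
  local equation required by \<open>one_dimensional_eq_vring\<close>.
\<close>

lemma center_outside:
  assumes R: "local_of (B i j f) R" "one_dimensional_local R" and ij: "i \<le> n" "j \<le> m"
    and f: "f \<in> I i j" "f \<noteq> 0" and out: "\<not> I i j \<subseteq> nonunits R"
  shows "\<exists>d e p. bprime d e p \<and> R = R_prime p"
proof -
  have lR: "is_local R" and BR: "B i j f \<subseteq> R" using R(1) by (auto simp: local_of_def)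
  have sR: "is_subring R" using lR by (simp add: is_local_def)
  have AR: "A i j \<subseteq> R" using A_subset_B BR by blast
  obtain g where g: "g \<in> I i j" "g \<notin> nonunits R" using out by blast
  have IA: "I i j \<subseteq> A i j" by (auto simp: points_ideal_def)
  have fu: "f \<notin> nonunits R"
  proof
    assume "f \<in> nonunits R"
    then have "g / f * f \<in> nonunits R" using nonunits_mult[OF sR] I_B[OF g(1)] BR by blast
    then show False using g f by simp
  qed
  have lA: "local_of (A i j) R"
  proof (rule local_of_subring[OF A_subring AR])
    show "local_of (generate_ring (ring_on UNIV) (A i j \<union> {g / f | g. g \<in> I i j})) R"
      using R(1) by (simp add: B_def blowup_algebra_def)
    fix h assume "h \<in> A i j \<union> {g / f | g. g \<in> I i j}"
    then show "\<exists>a\<in>A i j. \<exists>s\<in>A i j. s \<notin> nonunits R \<and> h = a / s"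
    proof
      assume "h \<in> A i j"
      then show ?thesis using is_subringD(1)[OF A_subring] one_notin_nonunits[OF sR]
        by (intro bexI[of _ h] bexI[of _ 1]) auto
    next
      assume "h \<in> {g / f | g. g \<in> I i j}"
      then show ?thesis using IA f fu by blast
    qed
  qed
  have pr: "a \<in> nonunits R \<or> b \<in> nonunits R" if "a \<in> A i j" "b \<in> A i j" "a * b \<in> nonunits R" for a b
    using units_mult[OF lR, of a b] that AR by blast
  have fac: "\<exists>d e p. bprime d e p \<and> emb p / (x_coord i ^ d * y_coord j ^ e) \<in> nonunits R"
    if "bih a b G" "G \<noteq> 0" "emb G / (x_coord i ^ a * y_coord j ^ b) \<in> nonunits R" for a b G
    using that
  proof (induction "tdeg G" arbitrary: a b G rule: less_induct)
    case less
    show ?case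
    proof (cases "irreducible G")
      case True
      then show ?thesis using less.prems by (auto simp: bprime_def)
    next
      case False
      have nu: "\<not> G dvd 1"
      proof
        assume "G dvd 1"
        then have "tdeg G = 0" using unit_iff_tdeg[OF less.prems(2)] by blast
        then obtain c where c: "G = Cst c" using tdeg_eq_0_imp_Cst by blast
        then have "a = 0" "b = 0" using bih_unique[OF less.prems(1) _ less.prems(2), of 0 0] bih_Cst by auto
        then show False using less.prems c const_unit[OF AR, of c] by (simp add: emb_Cst)
      qed
      then obtain G1 G2 where G: "G = G1 * G2" "\<not> G1 dvd 1" "\<not> G2 dvd 1"
        using False less.prems(2) by (auto simp: irreducible_def)
      then have nz: "G1 \<noteq> 0" "G2 \<noteq> 0" using less.prems(2) by auto
      obtain a1 b1 a2 b2 where bi: "bih a1 b1 G1" "bih a2 b2 G2" "a = a1 + a2" "b = b1 + b2"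
        using bih_factor[of a b G1 G2] less.prems G(1) by blast
      let ?h = "\<lambda>G a b. emb G / (x_coord i ^ a * y_coord j ^ b)"
      have "?h G1 a1 b1 * ?h G2 a2 b2 \<in> nonunits R"
        using less.prems(3) by (simp add: G(1) bi(3,4) emb_hom power_add ac_simps)
      then have "?h G1 a1 b1 \<in> nonunits R \<or> ?h G2 a2 b2 \<in> nonunits R"
        by (intro pr A_I bi)
      moreover have "tdeg G1 < tdeg G" "tdeg G2 < tdeg G"
        using G unit_iff_tdeg[OF nz(1)] unit_iff_tdeg[OF nz(2)] nz by (auto simp: wd_mult)
      ultimately show ?thesis using less.hyps bi(1,2) nz by blast
    qed
  qed
  obtain x where x: "x \<in> nonunits R" "x \<noteq> 0"
  proof -
    have "0 \<in> nonunits R" using is_subringD(2)[OF sR] by (simp add: nonunits_def)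
    moreover have "nonunits R \<noteq> {0}" using R(2) unfolding one_dimensional_local_def by blast
    ultimately show ?thesis using that by blast
  qed
  then have "x \<in> R" by (simp add: nonunits_def)
  then obtain a s where as: "a \<in> A i j" "s \<in> A i j" "s \<notin> nonunits R" "x = a / s"
    using lA unfolding local_of_def by blast
  have anu: "a \<in> nonunits R" "a \<noteq> 0"
    using as x nonunits_mult[OF sR, of s x] AR is_subringD(2)[OF sR] by (auto simp: nonunits_def[of R])
  obtain a' b' G where G: "bih a' b' G" "a = emb G / (x_coord i ^ a' * y_coord j ^ b')"
    using A_E[OF as(1) ij] by blast
  have "G \<noteq> 0" using G anu by (auto simp: emb_hom)
  then obtain d e p where p: "bprime d e p" "emb p / (x_coord i ^ d * y_coord j ^ e) \<in> nonunits R"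
    using fac[OF G(1)] anu G(2) by blast
  have prp: "prime_elem p" by (rule bprime_prime[OF p(1)])
  have bp: "bih d e p" and pnz: "p \<noteq> 0" using p(1) prp by (auto simp: bprime_def prime_elem_def)
  \<comment> \<open>a prime with a nonunit local equation on the chart divides no chart denominator\<close>
  have avoid: "\<not> p dvd F" if F: "bih a1 b1 F" "F \<noteq> 0" "emb F = x_coord i ^ a1 * y_coord j ^ b1" for F a1 b1
  proof
    assume "p dvd F"
    then obtain q where q: "F = p * q" by (auto simp: dvd_def)
    obtain a2 b2 a3 b3 where bq: "bih a2 b2 p" "bih a3 b3 q" "a1 = a2 + a3" "b1 = b2 + b3"
      using bih_factor[of a1 b1 p q] F q by metis
    have de: "a2 = d" "b2 = e" using bih_unique[OF bq(1) bp pnz] by auto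
    have "emb q / (x_coord i ^ a3 * y_coord j ^ b3) * (emb p / (x_coord i ^ d * y_coord j ^ e)) \<in> nonunits R"
      using nonunits_mult[OF sR _ p(2)] A_I[OF bq(2)] AR by blast
    moreover have "emb q / (x_coord i ^ a3 * y_coord j ^ b3) * (emb p / (x_coord i ^ d * y_coord j ^ e))
       = emb F / (x_coord i ^ a1 * y_coord j ^ b1)"
      by (simp add: q emb_hom bq(3,4) de power_add ac_simps)
    ultimately show False using F(3) one_notin_nonunits[OF sR] by simp
  qed
  have good: "pmult p (xv i) = 0" "pmult p (yv j) = 0"
    using avoid[OF bih_xv[OF ij(1)]] avoid[OF bih_yv[OF ij(2)]] pmult_eq_0_iff[OF prp, OF Var_nonzero] by auto
  interpret discrete_valuation L "vK (pmult p)" by (rule bprime_valuation[OF p(1)])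
  have "R = R_prime p"
    unfolding R_prime_def
  proof (rule one_dimensional_eq_vring[OF R(2) lA])
    show "local_of (A i j) vring" using R_prime_local_of[OF p(1) ij good] by (simp add: R_prime_def)
    show "emb p / (x_coord i ^ d * y_coord j ^ e) \<in> A i j" by (rule A_I[OF bp])
    show "emb p / (x_coord i ^ d * y_coord j ^ e) \<noteq> 0" using pnz by simp
    show "1 \<le> vK (pmult p) (emb p / (x_coord i ^ d * y_coord j ^ e))" using bprime_local_equation[OF p(1) good] by simp
    show "\<And>c. c \<in> A i j \<Longrightarrow> c \<noteq> 0 \<Longrightarrow> 1 \<le> vK (pmult p) c \<Longrightarrow> c / (emb p / (x_coord i ^ d * y_coord j ^ e)) \<in> A i j"
      by (rule A_divide_prime[OF p(1) ij good])
  qed (rule A_subring, rule p(2))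
  then show ?thesis using p(1) by blast
qed

lemma finite_Lc: "finite (Lc i j)"
  by (simp add: Lc_def)

lemma I_subset_A: "I i j \<subseteq> A i j"
  by (auto simp: points_ideal_def)

lemma prod_in_I:
  assumes ij: "i \<le> n" "j \<le> m" and g: "\<And>l. l \<in> Lc i j \<Longrightarrow> g l \<in> A i j \<and> g l \<in> nonunits (R_pt l)"
  shows "(\<Prod>l\<in>Lc i j. g l) \<in> I i j"
  unfolding I_iff[OF ij]
proof (intro conjI ballI)
  show "(\<Prod>l\<in>Lc i j. g l) \<in> A i j" using g by (intro is_subring_prod[OF A_subring]) auto
  fix l assume l: "l \<in> Lc i j"
  have AR: "A i j \<subseteq> R_pt l" by (rule A_subset_R_pt[OF LcD(1)[OF l] ij LcD(2)[OF l]])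
  have "(\<Prod>l\<in>Lc i j - {l}. g l) \<in> R_pt l"
    using g AR by (intro is_subring_prod R_pt_subring[OF LcD(1)[OF l]]) auto
  then have "(\<Prod>l\<in>Lc i j - {l}. g l) * g l \<in> nonunits (R_pt l)"
    using nonunits_mult[OF R_pt_subring[OF LcD(1)[OF l]]] g[OF l] by blast
  then show "(\<Prod>l\<in>Lc i j. g l) \<in> nonunits (R_pt l)"
    using prod.remove[OF finite_Lc l, of g] by (simp add: mult.commute)
qed

text \<open>
  Distinct points of a chart differ in one of its coordinates.
\<close>

lemma separate_points:
  assumes l: "l \<in> Lc i j" "l' \<in> Lc i j" "l \<noteq> l'" and ij: "i \<le> n" "j \<le> m"
  shows "\<exists>g\<in>gens l' i j. g \<noteq> 0 \<and> g \<notin> nonunits (R_pt l)"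
proof -
  note ch = LcD(2)[OF l(1)] LcD(2)[OF l(2)]
  have nz: "fst (P l) i \<noteq> 0" "fst (P l') i \<noteq> 0" "snd (P l) j \<noteq> 0" "snd (P l') j \<noteq> 0"
    using ch by (auto simp: in_chart_def)
  have AR: "A i j \<subseteq> R_pt l" by (rule A_subset_R_pt[OF LcD(1)[OF l(1)] ij ch(1)])
  have R: "is_subring (R_pt l)" "is_local (R_pt l)" using R_pt_subring R_pt_local LcD(1)[OF l(1)] by auto
  have sep: "g \<notin> nonunits (R_pt l)" if "g' \<in> gens l i j" "g = g' + const c" "c \<noteq> 0" for g g' c
  proof
    assume g: "g \<in> nonunits (R_pt l)"
    have g': "g' \<in> nonunits (R_pt l)" using gens_nonunits[OF LcD(1)[OF l(1)] ij ch(1)] that by blast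
    have "- 1 \<in> R_pt l" using R(1) is_subringD(1,5) by blast
    then have "(- 1) * g' \<in> nonunits (R_pt l)" using nonunits_mult[OF R(1) _ g'] by blast
    then have "g + (- 1) * g' \<in> nonunits (R_pt l)" using R(2) g unfolding is_local_def by blast
    then show False using const_unit[OF AR that(3)] that(2) by simp
  qed
  have "0 \<in> nonunits (R_pt l)" using is_subringD(2)[OF R(1)] by (simp add: nonunits_def)
  then have ne0: "g \<noteq> 0" if "g \<notin> nonunits (R_pt l)" for g using that by auto
  consider (x) k where "k \<le> n" "fst (P l) k / fst (P l) i \<noteq> fst (P l') k / fst (P l') i"
    | (y) k where "k \<le> m" "snd (P l) k / snd (P l) j \<noteq> snd (P l') k / snd (P l') j"
  proof -
    have "fst (P l) k * fst (P l') k' = fst (P l) k' * fst (P l') k"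
      if "\<forall>k\<le>n. fst (P l) k / fst (P l) i = fst (P l') k / fst (P l') i" "k \<le> n" "k' \<le> n" for k k'
    proof -
      define c where "c = fst (P l) i / fst (P l') i"
      have "fst (P l) k = c * fst (P l') k" "fst (P l) k' = c * fst (P l') k'"
        using that nz by (auto simp: c_def field_simps)
      then show ?thesis by simp
    qed
    moreover have "snd (P l) k * snd (P l') k' = snd (P l) k' * snd (P l') k"
      if "\<forall>k\<le>m. snd (P l) k / snd (P l) j = snd (P l') k / snd (P l') j" "k \<le> m" "k' \<le> m" for k k'
    proof -
      define c where "c = snd (P l) j / snd (P l') j"
      have "snd (P l) k = c * snd (P l') k" "snd (P l) k' = c * snd (P l') k'"
        using that nz by (auto simp: c_def field_simps)
      then show ?thesis by simp
    qed
    ultimately show ?thesis using distinct[OF LcD(1)[OF l(1)] LcD(1)[OF l(2)] l(3)] that by meson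
  qed
  then show ?thesis
  proof cases
    case (x k)
    let ?g = "\<lambda>l. x_coord k / x_coord i - const (fst (P l) k / fst (P l) i)"
    have "?g l' = ?g l + const (fst (P l) k / fst (P l) i - fst (P l') k / fst (P l') i)" by (simp add: const_hom)
    moreover have "?g l \<in> gens l i j" "?g l' \<in> gens l' i j" using x by (auto simp: gens_def)
    ultimately show ?thesis using sep ne0 x by (metis eq_iff_diff_eq_0)
  next
    case (y k)
    let ?g = "\<lambda>l. y_coord k / y_coord j - const (snd (P l) k / snd (P l) j)"
    have "?g l' = ?g l + const (snd (P l) k / snd (P l) j - snd (P l') k / snd (P l') j)" by (simp add: const_hom)
    moreover have "?g l \<in> gens l i j" "?g l' \<in> gens l' i j" using y by (auto simp: gens_def)
    ultimately show ?thesis using sep ne0 y by (metis eq_iff_diff_eq_0)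
  qed
qed

text \<open>
  Near \<open>P\<^sub>l\<close> the ideal of all the points coincides with the maximal ideal of \<open>P\<^sub>l\<close>: the factor \<open>s\<close>
  is a product of functions vanishing at the other points of the chart but not at \<open>P\<^sub>l\<close>.
\<close>

lemma vanish_at_others:
  assumes l: "l \<in> Lc i j" and ij: "i \<le> n" "j \<le> m"
  shows "\<exists>s\<in>A i j. s \<noteq> 0 \<and> s \<notin> nonunits (R_pt l) \<and> (\<forall>g\<in>gens l i j. s * g \<in> I i j)"
proof -
  have AR: "A i j \<subseteq> R_pt l" by (rule A_subset_R_pt[OF LcD(1)[OF l] ij LcD(2)[OF l]])
  have "\<forall>l'\<in>Lc i j - {l}. \<exists>g\<in>gens l' i j. g \<noteq> 0 \<and> g \<notin> nonunits (R_pt l)"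
    using separate_points[OF l _ _ ij] by auto
  then obtain h where h: "\<And>l'. l' \<in> Lc i j - {l} \<Longrightarrow> h l' \<in> gens l' i j \<and> h l' \<noteq> 0 \<and> h l' \<notin> nonunits (R_pt l)"
    by metis
  define s where "s = (\<Prod>l'\<in>Lc i j - {l}. h l')"
  have hA: "h l' \<in> A i j" if "l' \<in> Lc i j - {l}" for l' using h[OF that] gens_subset_A by blast
  have "s \<in> A i j" unfolding s_def by (rule is_subring_prod[OF A_subring hA])
  moreover have "s \<noteq> 0" using h finite_Lc by (auto simp: s_def)
  moreover have "s \<notin> nonunits (R_pt l)"
  proof -
    have sub: "finite S \<Longrightarrow> S \<subseteq> Lc i j - {l} \<Longrightarrow> (\<Prod>l'\<in>S. h l') \<notin> nonunits (R_pt l)" for S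
    proof (induction S rule: finite_induct)
      case empty
      then show ?case using one_notin_nonunits[OF R_pt_subring[OF LcD(1)[OF l]]] by simp
    next
      case (insert x S)
      have "h x \<in> R_pt l" "(\<Prod>l'\<in>S. h l') \<in> R_pt l"
        using hA insert AR by (auto intro!: is_subring_prod[OF R_pt_subring[OF LcD(1)[OF l]]])
      moreover have "h x \<notin> nonunits (R_pt l)" "(\<Prod>l'\<in>S. h l') \<notin> nonunits (R_pt l)"
        using h[of x] insert by auto
      ultimately have "h x * (\<Prod>l'\<in>S. h l') \<notin> nonunits (R_pt l)"
        by (rule units_mult[OF R_pt_local[OF LcD(1)[OF l]]])
      then show ?case using insert by simp
    qed
    show ?thesis unfolding s_def by (rule sub) (simp_all add: finite_Lc)
  qed
  moreover have "s * g \<in> I i j" if g: "g \<in> gens l i j" for g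
  proof -
    have "(\<Prod>l'\<in>Lc i j. if l' = l then g else h l') \<in> I i j"
    proof (rule prod_in_I[OF ij])
      fix l' assume l': "l' \<in> Lc i j"
      have "(if l' = l then g else h l') \<in> gens l' i j" using g h l' by auto
      then show "(if l' = l then g else h l') \<in> A i j \<and> (if l' = l then g else h l') \<in> nonunits (R_pt l')"
        using gens_nonunits[OF LcD(1)[OF l'] ij LcD(2)[OF l']] by blast
    qed
    moreover have "(\<Prod>l'\<in>Lc i j. if l' = l then g else h l') = g * (\<Prod>l'\<in>Lc i j - {l}. if l' = l then g else h l')"
      using prod.remove[OF finite_Lc l, of "\<lambda>l'. if l' = l then g else h l'"] by simp
    moreover have "(\<Prod>l'\<in>Lc i j - {l}. if l' = l then g else h l') = s"
      unfolding s_def by (rule prod.cong) auto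
    ultimately show ?thesis by (simp add: mult.commute)
  qed
  ultimately show ?thesis by blast
qed

lemma I_pt:
  assumes ij: "i \<le> n" "j \<le> m" and l: "l \<in> Lc i j" and g: "g \<in> I i j"
  shows "g \<in> A i j" "g \<in> nonunits (R_pt l)"
  using g l unfolding I_iff[OF ij] by auto

text \<open>
  The case of a point of \<open>X\<close> over a blown-up point. A product of local coordinates, one at each
  point of the chart, is in the ideal of the points, hence a nonunit of \<open>R\<close>; so all local
  coordinates at some point \<open>P\<^sub>l\<close> are nonunits, and \<open>R\<close> lies over \<open>P\<^sub>l\<close>. By \<open>vanish_at_others\<close> the
  quotients \<open>g / f\<close> of the local coordinates by \<open>f\<close> are in \<open>R\<close>, and one of them, \<open>w / f\<close>, is a
  unit. So \<open>R\<close> is also a local ring of the algebra \<open>C\<close> belonging to \<open>w\<close>.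
\<close>

lemma center_inside:
  assumes R: "local_of (B i j f) R" "one_dimensional_local R" and ij: "i \<le> n" "j \<le> m"
    and f: "f \<in> I i j" "f \<noteq> 0" and ins: "I i j \<subseteq> nonunits R"
  shows "\<exists>l\<in>{1..r}. R = R_pt l"
proof -
  have lR: "is_local R" and BR: "B i j f \<subseteq> R" using R(1) by (auto simp: local_of_def)
  have sR: "is_subring R" using lR by (simp add: is_local_def)
  have AR: "A i j \<subseteq> R" using A_subset_B BR by blast
  have "\<exists>l\<in>Lc i j. gens l i j \<subseteq> nonunits R"
  proof (rule ccontr)
    assume "\<not> ?thesis"
    then have "\<forall>l\<in>Lc i j. \<exists>g\<in>gens l i j. g \<notin> nonunits R" by blast
    then obtain g where g: "\<And>l. l \<in> Lc i j \<Longrightarrow> g l \<in> gens l i j \<and> g l \<notin> nonunits R" by metis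
    have gA: "g l \<in> A i j \<and> g l \<in> nonunits (R_pt l)" if "l \<in> Lc i j" for l
      using g[OF that] gens_nonunits[OF LcD(1)[OF that] ij LcD(2)[OF that]] by blast
    have sub: "finite S \<Longrightarrow> S \<subseteq> Lc i j \<Longrightarrow> (\<Prod>l\<in>S. g l) \<notin> nonunits R" for S
    proof (induction S rule: finite_induct)
      case empty
      then show ?case using one_notin_nonunits[OF sR] by simp
    next
      case (insert x S)
      have "g x \<in> R" "(\<Prod>l\<in>S. g l) \<in> R"
        using gA insert AR by (auto intro!: is_subring_prod[OF sR])
      moreover have "g x \<notin> nonunits R" "(\<Prod>l\<in>S. g l) \<notin> nonunits R"
        using g[of x] insert by auto
      ultimately have "g x * (\<Prod>l\<in>S. g l) \<notin> nonunits R"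
        by (rule units_mult[OF lR])
      then show ?case using insert by simp
    qed
    have "(\<Prod>l\<in>Lc i j. g l) \<notin> nonunits R" by (rule sub) (simp_all add: finite_Lc)
    then show False using prod_in_I[OF ij, of g] gA ins by blast
  qed
  then obtain l where l: "l \<in> Lc i j" "gens l i j \<subseteq> nonunits R" by blast
  note l1 = LcD(1)[OF l(1)] and ch = LcD(2)[OF l(1)]
  let ?M = "A i j \<inter> nonunits (R_pt l)"
  have "ideal_in (A i j \<inter> nonunits R) (A i j)"
    using prime_nonunits_Int[OF lR A_subring AR] by (simp add: prime_in_def)
  then have MR: "?M \<subseteq> nonunits R"
    using maximal_point_ideal[OF l1 ij ch, of "A i j \<inter> nonunits R"] l(2) gens_subset_A by blast
  have AMR: "A i j \<inter> nonunits R = ?M"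
  proof (rule ccontr)
    assume "A i j \<inter> nonunits R \<noteq> ?M"
    then obtain x where x: "x \<in> A i j" "x \<in> nonunits R" "x \<notin> nonunits (R_pt l)" using MR by blast
    have "ideal_in (A i j \<inter> nonunits R) (A i j)" "gens l i j \<subseteq> A i j \<inter> nonunits R"
      using prime_nonunits_Int[OF lR A_subring AR] l(2) gens_subset_A by (auto simp: prime_in_def)
    have "ideal_in ?M (A i j)"
      using prime_nonunits_Int[OF R_pt_local[OF l1] A_subring A_subset_R_pt[OF l1 ij ch]] by (simp add: prime_in_def)
    then obtain c where c: "x - const c \<in> ?M"
      using const_mod_gens[of ?M i j l x] gens_nonunits[OF l1 ij ch] x by blast
    then have "c \<noteq> 0" using x by (auto simp: const_hom)
    have "- 1 \<in> R" using sR is_subringD(1,5) by blast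
    then have "(- 1) * (x - const c) \<in> nonunits R" using nonunits_mult[OF sR] c MR by blast
    then have "x + (- 1) * (x - const c) \<in> nonunits R" using lR x unfolding is_local_def by blast
    then show False using const_unit[OF AR \<open>c \<noteq> 0\<close>] by simp
  qed
  obtain s where s: "s \<in> A i j" "s \<noteq> 0" "s \<notin> nonunits (R_pt l)" "\<And>g. g \<in> gens l i j \<Longrightarrow> s * g \<in> I i j"
    using vanish_at_others[OF l(1) ij] by blast
  have su: "s \<notin> nonunits R" "s \<in> R" using s AMR AR by blast+
  have gf: "g / f \<in> R" if "g \<in> gens l i j" for g
  proof -
    have "s * g / f \<in> R" using I_B[OF s(4)[OF that]] BR by blast
    then have "(s * g / f) / s \<in> R" by (rule unit_divide(1)[OF sR _ su(2,1)])
    then show ?thesis using s(2) by simp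
  qed
  \<comment> \<open>otherwise the functions \<open>g\<close> with \<open>g / f\<close> a nonunit would form an ideal containing the maximal ideal of the point, and with it \<open>f\<close>\<close>
  have "\<exists>w\<in>gens l i j. w / f \<notin> nonunits R"
  proof (rule ccontr)
    assume neg: "\<not> ?thesis"
    have "ideal_in {g \<in> A i j. g / f \<in> nonunits R} (A i j)"
      unfolding ideal_in_def
    proof (intro conjI ballI subsetI)
      show "0 \<in> {g \<in> A i j. g / f \<in> nonunits R}"
        using is_subringD(2)[OF A_subring] is_subringD(2)[OF sR] by (simp add: nonunits_def)
      fix a b assume ab: "b \<in> {g \<in> A i j. g / f \<in> nonunits R}"
      { assume "a \<in> {g \<in> A i j. g / f \<in> nonunits R}"
        then show "a + b \<in> {g \<in> A i j. g / f \<in> nonunits R}"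
          using ab lR is_subringD(6)[OF A_subring] by (simp add: add_divide_distrib is_local_def) }
      { assume "a \<in> A i j"
        then show "a * b \<in> {g \<in> A i j. g / f \<in> nonunits R}"
          using ab AR is_subringD(3)[OF A_subring] nonunits_mult[OF sR, of a "b / f"] by auto }
    qed auto
    moreover have "gens l i j \<subseteq> {g \<in> A i j. g / f \<in> nonunits R}" using neg gens_subset_A by blast
    ultimately have "?M \<subseteq> {g \<in> A i j. g / f \<in> nonunits R}" by (rule maximal_point_ideal[OF l1 ij ch])
    moreover have "f \<in> ?M" using I_pt[OF ij l(1) f(1)] by blast
    ultimately have "f / f \<in> nonunits R" by blast
    then show False using one_notin_nonunits[OF sR] f by simp
  qed
  then obtain w where w: "w \<in> gens l i j" "w / f \<notin> nonunits R" by blast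
  have wf: "w / f \<in> R" using gf w by blast
  have w0: "w \<noteq> 0" using w is_subringD(2)[OF sR] by (auto simp: nonunits_def)
  have fw: "f / w \<in> R" using unit_divide(1)[OF sR is_subringD(1)[OF sR] wf w(2)] by simp
  have fwu: "f / w \<notin> nonunits R"
  proof
    assume "f / w \<in> nonunits R"
    then have "w / f * (f / w) \<in> nonunits R" using nonunits_mult[OF sR wf] by blast
    then show False using f w0 one_notin_nonunits[OF sR] by simp
  qed
  have CR: "C l i j w \<subseteq> R"
    unfolding C_def
  proof (rule generate_ring_on_subset[OF sR], rule Un_least[OF AR], safe)
    fix g assume "g \<in> gens l i j"
    then have "(g / f) * (f / w) \<in> R" using gf fw is_subringD(3)[OF sR] by blast
    then show "g / w \<in> R" using f by simp
  qed
  have MC: "g / w \<in> C l i j w" if "g \<in> ?M" for g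
  proof (cases "g = 0")
    case False
    then show ?thesis using taylor[OF l1 ij ch, of g 1 w] that w(1) w0 nonunits_R_pt_iff[OF l1] by auto
  qed (use is_subringD(2)[OF C_subring] in simp)
  have lC: "local_of (C l i j w) R"
  proof (rule local_of_subring[OF C_subring CR])
    show "local_of (generate_ring (ring_on UNIV) (A i j \<union> {g / f | g. g \<in> I i j})) R"
      using R(1) by (simp add: B_def blowup_algebra_def)
    fix h assume "h \<in> A i j \<union> {g / f | g. g \<in> I i j}"
    then show "\<exists>a\<in>C l i j w. \<exists>s\<in>C l i j w. s \<notin> nonunits R \<and> h = a / s"
    proof
      assume "h \<in> A i j"
      then have "h \<in> C l i j w" using A_subset_C by blast
      then show ?thesis using is_subringD(1)[OF C_subring] one_notin_nonunits[OF sR] by (metis div_by_1)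
    next
      assume "h \<in> {g / f | g. g \<in> I i j}"
      then obtain g where g: "g \<in> I i j" "h = g / f" by blast
      then have "h = (g / w) / (f / w)" using w0 by simp
      moreover have "g / w \<in> C l i j w" "f / w \<in> C l i j w" using MC I_pt[OF ij l(1)] g f by blast+
      ultimately show ?thesis using fwu by blast
    qed
  qed
  interpret discrete_valuation L "vK (mult_pt l)" by (rule pt_valuation[OF l1])
  have "R = R_pt l"
    unfolding R_pt_def
  proof (rule one_dimensional_eq_vring[OF R(2) lC])
    show "local_of (C l i j w) vring" using R_pt_local_of_C[OF l1 ij ch w(1) w0] by (simp add: R_pt_def)
    show "w \<in> C l i j w" using w gens_subset_A A_subset_C by blast
    show "w \<in> nonunits R" using w l by blast
    show "1 \<le> vK (mult_pt l) w" using vK_gens[OF l1 ij ch w(1) w0] by simp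
    show "\<And>c. c \<in> C l i j w \<Longrightarrow> c \<noteq> 0 \<Longrightarrow> 1 \<le> vK (mult_pt l) c \<Longrightarrow> c / w \<in> C l i j w"
      by (rule C_divide[OF l1 ij ch w(1) w0])
  qed (rule C_subring, rule w0)
  then show ?thesis using l1 by blast
qed

text \<open>
  The function \<open>f = s w\<close>, where \<open>s\<close> is supplied by \<open>vanish_at_others\<close>, has multiplicity one at
  \<open>P\<^sub>l\<close>. Its blow-up algebra lies between \<open>C\<close> and the valuation ring.
\<close>

lemma R_pt_in_X:
  assumes l: "l \<in> {1..r}" shows "R_pt l \<in> X"
proof -
  obtain i j where ij: "i \<le> n" "j \<le> m" and ch: "in_chart i j (P l)" using pt_chart[OF l] by blast
  have lL: "l \<in> Lc i j" using l ch by (simp add: Lc_def)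
  obtain s where s: "s \<in> A i j" "s \<noteq> 0" "s \<notin> nonunits (R_pt l)" "\<And>g. g \<in> gens l i j \<Longrightarrow> s * g \<in> I i j"
    using vanish_at_others[OF lL ij] by blast
  obtain w where w: "w \<in> gens l i j" "w \<noteq> 0" using gens_nonzero[OF l ij ch] by blast
  interpret discrete_valuation L "vK (mult_pt l)" by (rule pt_valuation[OF l])
  have AL: "A i j \<subseteq> L" by (rule A_subset_L[OF ij])
  have wA: "w \<in> A i j" using w gens_subset_A by blast
  have sL: "s \<in> L" "w \<in> L" using s wA AL by blast+
  have "vK (mult_pt l) s = 0"
    using s(1-3) A_subset_R_pt[OF l ij ch] nonunits_R_pt_iff[OF l, of s] R_pt_iff[OF l, of s] sL by force
  then have vf: "vK (mult_pt l) (s * w) = 1" using nu_mult[OF sL s(2) w(2)] vK_gens[OF l ij ch w] by simp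
  let ?f = "s * w"
  have f: "?f \<in> I i j" "?f \<noteq> 0" using s w by auto
  have BR: "B i j ?f \<subseteq> R_pt l"
  proof (rule B_subset[OF R_pt_subring[OF l] A_subset_R_pt[OF l ij ch]])
    fix g assume "g \<in> I i j"
    then have g: "g \<in> A i j" "g \<in> nonunits (R_pt l)" using I_pt[OF ij lL] by auto
    have fL: "?f \<in> L" "g \<in> L" using f g I_subset_A AL by blast+
    show "g / ?f \<in> R_pt l"
      using g(2) f vf nu_divide[OF fL(2,1)] L_divide[OF fL(2,1)] unfolding R_pt_iff[OF l] nonunits_R_pt_iff[OF l]
      by (cases "g = 0") auto
  qed
  have "C l i j w \<subseteq> B i j ?f"
    unfolding C_def
  proof (rule generate_ring_on_subset[OF B_subring], rule Un_least[OF A_subset_B], safe)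
    fix g assume "g \<in> gens l i j"
    then have "s * g / ?f \<in> B i j ?f" using s(4) I_B by blast
    then show "g / w \<in> B i j ?f" using s(2) by simp
  qed
  then have "local_of (B i j ?f) (R_pt l)"
    using local_of_mono[OF R_pt_local_of_C[OF l ij ch w]] BR by blast
  then show ?thesis unfolding X_iff using ij f by blast
qed

text \<open>
  Among the local coordinates at a point there are dehomogenizations of a form of bidegree
  \<open>(1, 0)\<close> and of one of bidegree \<open>(0, 1)\<close>; a common divisor of them is constant.
\<close>

lemma gens_avoid_prime:
  assumes p: "bprime d e p" and ij: "i \<le> n" "j \<le> m" "pmult p (xv i) = 0" "pmult p (yv j) = 0"
    and l: "l \<in> {1..r}" "in_chart i j (P l)"
  shows "\<exists>g\<in>gens l i j. g \<noteq> 0 \<and> vK (pmult p) g = 0"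
proof -
  have prp: "prime_elem p" by (rule bprime_prime[OF p])
  have bp: "bih d e p" and pnz: "p \<noteq> 0" using p prp by (auto simp: bprime_def prime_elem_def)
  obtain k where k: "k \<le> n" "k \<noteq> i" using n by (cases "i = 0") auto
  obtain k' where k': "k' \<le> m" "k' \<noteq> j" using m by (cases "j = 0") auto
  let ?F = "xv k - Cst (fst (P l) k / fst (P l) i) * xv i" and ?G = "yv k' - Cst (snd (P l) k' / snd (P l) j) * yv j"
  have u: "u_coord l i j (2 * k) = emb ?F / (x_coord i ^ 1 * y_coord j ^ 0)"
    "u_coord l i j (Suc (2 * k')) = emb ?G / (x_coord i ^ 0 * y_coord j ^ 1)"
    by (simp_all add: u_coord_def emb_hom emb_Cst diff_divide_distrib)
  have nz: "u_coord l i j (2 * k) \<noteq> 0" "u_coord l i j (Suc (2 * k')) \<noteq> 0"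
    using k k' by (intro u_coord_nonzero[OF l(1) ij(1,2) l(2)]; presburger)+
  have FG: "?F \<noteq> 0" "?G \<noteq> 0" using nz unfolding u by (metis emb_eq_0_iff div_0)+
  have bi: "bih 1 0 ?F" "bih 0 1 ?G"
    by (intro bih_diff bih_Cst_mult bih_xv bih_yv k k' ij)+
  have "\<not> p dvd ?F \<or> \<not> p dvd ?G"
  proof (rule ccontr)
    assume "\<not> ?thesis"
    then obtain q q' where q: "?F = p * q" "?G = p * q'" by (meson dvd_def)
    obtain a2 b2 a3 b3 where 1: "bih a2 b2 p" "bih a3 b3 q" "1 = a2 + a3" "0 = b2 + b3"
      using bih_factor[of 1 0 p q] bi(1) FG(1) unfolding q(1) by blast
    obtain a4 b4 a5 b5 where 2: "bih a4 b4 p" "bih a5 b5 q'" "0 = a4 + a5" "1 = b4 + b5"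
      using bih_factor[of 0 1 p q'] bi(2) FG(2) unfolding q(2) by blast
    have "a2 = a4" "b2 = b4" using bih_unique[OF 1(1) 2(1) pnz] by auto
    then have "tdeg p = 0" using bih_tdeg[OF 1(1) pnz] 1 2 by simp
    then show False using prime_tdeg[OF prp] by simp
  qed
  then have "vK (pmult p) (u_coord l i j (2 * k)) = 0 \<or> vK (pmult p) (u_coord l i j (Suc (2 * k'))) = 0"
    unfolding u using vK_A[OF is_val_pmult[OF prp] ij(3,4) FG(1), of 1 0] vK_A[OF is_val_pmult[OF prp] ij(3,4) FG(2), of 0 1]
      pmult_eq_0_iff[OF prp FG(1)] pmult_eq_0_iff[OF prp FG(2)] by auto
  moreover have "u_coord l i j (2 * k) \<in> gens l i j" "u_coord l i j (Suc (2 * k')) \<in> gens l i j"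
    unfolding gens_eq using xv_XV[OF k(1)] yv_XV[OF k'(1)] by blast+
  ultimately show ?thesis using nz by blast
qed

text \<open>
  By \<open>gens_avoid_prime\<close>, some element \<open>f\<close> of the ideal of the points is a unit of the valuation
  ring, so that the blow-up algebra of \<open>f\<close> is contained in it.
\<close>

lemma R_prime_in_X:
  assumes p: "bprime d e p" shows "R_prime p \<in> X"
proof -
  obtain i j where ij: "i \<le> n" "j \<le> m" "pmult p (xv i) = 0" "pmult p (yv j) = 0" using bprime_good_chart[OF p] .
  interpret discrete_valuation L "vK (pmult p)" by (rule bprime_valuation[OF p])
  have "\<forall>l\<in>Lc i j. \<exists>g\<in>gens l i j. g \<noteq> 0 \<and> vK (pmult p) g = 0"
    using gens_avoid_prime[OF p ij] LcD by blast
  then obtain g where g: "\<And>l. l \<in> Lc i j \<Longrightarrow> g l \<in> gens l i j \<and> g l \<noteq> 0 \<and> vK (pmult p) (g l) = 0" by metis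
  let ?f = "\<Prod>l\<in>Lc i j. g l"
  have AL: "A i j \<subseteq> L" by (rule A_subset_L[OF ij(1,2)])
  have gA: "g l \<in> A i j" if "l \<in> Lc i j" for l using g[OF that] gens_subset_A by blast
  have f: "?f \<in> I i j"
    using g gens_nonunits[OF LcD(1) ij(1,2) LcD(2)] by (intro prod_in_I[OF ij(1,2)]) blast
  have fv: "S \<subseteq> Lc i j \<Longrightarrow> (\<Prod>l\<in>S. g l) \<noteq> 0 \<and> vK (pmult p) (\<Prod>l\<in>S. g l) = 0 \<and> (\<Prod>l\<in>S. g l) \<in> L" if "finite S" for S
    using that
  proof (induction S rule: finite_induct)
    case empty
    then show ?case using nu_1 is_subringD(1)[OF L_subring] by simp
  next
    case (insert x S)
    then show ?case using g[of x] gA[of x] AL nu_mult[of "g x" "\<Prod>l\<in>S. g l"] is_subringD(3)[OF L_subring, of "g x" "\<Prod>l\<in>S. g l"]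
      by auto
  qed
  note fv = fv[OF finite_Lc subset_refl]
  have sR: "is_subring (R_prime p)" unfolding R_prime_def by (rule vring_subring)
  have BR: "B i j ?f \<subseteq> R_prime p"
  proof (rule B_subset[OF sR A_subset_R_prime[OF p ij]])
    fix h assume h: "h \<in> I i j"
    then have "h \<in> R_prime p" using I_subset_A A_subset_R_prime[OF p ij] by blast
    then have hL: "h \<in> L" "h = 0 \<or> 0 \<le> vK (pmult p) h" by (auto simp: R_prime_iff[OF p])
    then show "h / ?f \<in> R_prime p"
      using fv nu_divide[OF hL(1), of ?f] L_divide[OF hL(1), of ?f] unfolding R_prime_iff[OF p] by (cases "h = 0") auto
  qed
  have "local_of (B i j ?f) (R_prime p)"
    by (rule local_of_mono[OF R_prime_local_of[OF p ij] A_subset_B BR])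
  then show ?thesis unfolding X_iff using ij f fv by blast
qed

theorem prime_divisors_X:
  "R \<in> prime_divisors X \<longleftrightarrow> (\<exists>d e p. bprime d e p \<and> R = R_prime p) \<or> (\<exists>l\<in>{1..r}. R = R_pt l)"
proof
  assume "R \<in> prime_divisors X"
  then have R: "R \<in> X" "one_dimensional_local R" by (auto simp: prime_divisors_def)
  then obtain i j f where "i \<le> n" "j \<le> m" "f \<in> I i j" "f \<noteq> 0" "local_of (B i j f) R" unfolding X_iff by blast
  then show "(\<exists>d e p. bprime d e p \<and> R = R_prime p) \<or> (\<exists>l\<in>{1..r}. R = R_pt l)"
    using center_outside[of i j f R] center_inside[of i j f R] R(2) by blast
next
  have "one_dimensional_local (R_prime p)" if "bprime d e p" for d e p
    unfolding R_prime_def by (rule discrete_valuation.vring_one_dimensional[OF bprime_valuation[OF that]])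
  moreover have "one_dimensional_local (R_pt l)" if "l \<in> {1..r}" for l
    unfolding R_pt_def by (rule discrete_valuation.vring_one_dimensional[OF pt_valuation[OF that]])
  moreover assume "(\<exists>d e p. bprime d e p \<and> R = R_prime p) \<or> (\<exists>l\<in>{1..r}. R = R_pt l)"
  ultimately show "R \<in> prime_divisors X"
    unfolding prime_divisors_def using R_pt_in_X R_prime_in_X by blast
qed

lemma function_field_X: "function_field X = L"
proof
  show "function_field X \<subseteq> L"
  proof
    fix f assume "f \<in> function_field X"
    then obtain R where "R \<in> X" "f \<in> R" by (auto simp: function_field_def)
    then obtain i j g where ij: "i \<le> n" "j \<le> m" and g: "g \<in> I i j" and R: "local_of (B i j g) R" unfolding X_iff by blast
    have IL: "I i j \<subseteq> L" using I_subset_A A_subset_L[OF ij] by blast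
    have div: "a / b \<in> L" if "a \<in> L" "b \<in> L" for a b
      using that L_inverse is_subringD(3)[OF L_subring] by (simp add: divide_inverse)
    have "B i j g \<subseteq> L" by (rule B_subset[OF L_subring A_subset_L[OF ij]]) (use div g IL in blast)
    moreover obtain a s where "a \<in> B i j g" "s \<in> B i j g" "f = a / s" using R \<open>f \<in> R\<close> unfolding local_of_def by blast
    ultimately show "f \<in> L" using div by blast
  qed
  have nuL: "x \<in> nonunits L \<longleftrightarrow> x = 0" for x
    using L_inverse is_subringD(2)[OF L_subring] by (auto simp: nonunits_def)
  have "is_local L" unfolding is_local_def by (simp add: L_subring nuL)
  obtain f where f: "f \<in> I 0 0" "f \<noteq> 0"
  proof -
    have "\<forall>l\<in>Lc 0 0. \<exists>w\<in>gens l 0 0. w \<noteq> 0" using gens_nonzero[OF LcD(1) _ _ LcD(2)] by blast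
    then obtain g where g: "\<And>l. l \<in> Lc 0 0 \<Longrightarrow> g l \<in> gens l 0 0 \<and> g l \<noteq> 0" by metis
    have "(\<Prod>l\<in>Lc 0 0. g l) \<in> I 0 0" 
      using g gens_nonunits[OF LcD(1) _ _ LcD(2)] by (intro prod_in_I) (auto, blast+)
    moreover have "(\<Prod>l\<in>Lc 0 0. g l) \<noteq> 0" using g finite_Lc by simp
    ultimately show ?thesis using that by blast
  qed
  have AL: "A 0 0 \<subseteq> L" by (rule A_subset_L) auto
  have "local_of (A 0 0) L"
    unfolding local_of_def using \<open>is_local L\<close> AL L_frac_A nuL by blast
  moreover have "B 0 0 f \<subseteq> L"
  proof (rule B_subset[OF L_subring AL])
    fix g assume "g \<in> I 0 0"
    then have "g \<in> L" "f \<in> L" using f I_subset_A AL by blast+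
    then show "g / f \<in> L" using L_inverse is_subringD(3)[OF L_subring] by (simp add: divide_inverse)
  qed
  ultimately have "local_of (B 0 0 f) L" using local_of_mono A_subset_B by blast
  then have "L \<in> X" unfolding X_iff using f by blast
  then show "L \<subseteq> function_field X" unfolding function_field_def by blast
qed

section \<open>Divisors of forms\<close>

lemma val_chart_0:
  assumes v: "is_val v" and dv: "discrete_valuation L (vK v)" and sub: "A i j \<subseteq> discrete_valuation.vring L (vK v)"
    and ij: "i \<le> n" "j \<le> m" and k: "k \<le> n" "v (xv k) = 0" "k' \<le> m" "v (yv k') = 0"
  shows "v (xv i) = 0" "v (yv j) = 0"
proof -
  interpret discrete_valuation L "vK v" by (rule dv)
  have "x_coord k / x_coord i \<in> vring" "y_coord k' / y_coord j \<in> vring" using sub A_x k A_y by blast+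
  then have "0 \<le> vK v (emb (xv k) / emb (xv i))" "0 \<le> vK v (emb (yv k') / emb (yv j))"
    by (auto simp: vring_iff)
  then show "v (xv i) = 0" "v (yv j) = 0"
    using vK_quotient[OF v Var_nonzero Var_nonzero, of "2 * k" "2 * i"] vK_quotient[OF v Var_nonzero Var_nonzero, of "Suc (2 * k')" "Suc (2 * j)"] k
    by (simp_all del: emb_xv_yv)
qed

lemma pt_val_0:
  assumes l: "l \<in> {1..r}" shows "\<exists>k\<le>n. mult_pt l (xv k) = 0" "\<exists>k\<le>m. mult_pt l (yv k) = 0"
  using pt_chart[OF l] mult_pt_chart[OF l] by blast+

lemma R_prime_neq_R_pt:
  assumes p: "bprime d e p" and l: "l \<in> {1..r}" and ij: "i \<le> n" "j \<le> m" and ch: "in_chart i j (P l)"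
  shows "\<not> (A i j \<subseteq> R_prime p \<and> gens l i j \<subseteq> nonunits (R_prime p))"
proof
  assume *: "A i j \<subseteq> R_prime p \<and> gens l i j \<subseteq> nonunits (R_prime p)"
  obtain k k' where k: "k \<le> n" "k' \<le> m" "pmult p (xv k) = 0" "pmult p (yv k') = 0" using bprime_good_chart[OF p] .
  have "pmult p (xv i) = 0" "pmult p (yv j) = 0"
    using val_chart_0[OF is_val_pmult[OF bprime_prime[OF p]] bprime_valuation[OF p], of i j k k'] * k ij by (auto simp: R_prime_def)
  then obtain g where "g \<in> gens l i j" "g \<noteq> 0" "vK (pmult p) g = 0" using gens_avoid_prime[OF p ij _ _ l ch] by blast
  then show False using * nonunits_R_prime_iff[OF p, of g] by fastforce
qed

lemma R_pt_inj:
  assumes l: "l \<in> {1..r}" "l' \<in> {1..r}" "l \<noteq> l'" and ij: "i \<le> n" "j \<le> m" and ch: "in_chart i j (P l)"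
  shows "\<not> (A i j \<subseteq> R_pt l' \<and> gens l i j \<subseteq> nonunits (R_pt l'))"
proof
  assume *: "A i j \<subseteq> R_pt l' \<and> gens l i j \<subseteq> nonunits (R_pt l')"
  obtain k k' where k: "k \<le> n" "mult_pt l' (xv k) = 0" "k' \<le> m" "mult_pt l' (yv k') = 0" using pt_val_0[OF l(2)] by blast
  have "mult_pt l' (xv i) = 0" "mult_pt l' (yv j) = 0"
    using val_chart_0[OF is_val_ptmult pt_valuation[OF l(2)], of i j k k'] * k ij by (auto simp: R_pt_def)
  then have "in_chart i j (P l')"
    using ptmult_pos_iff[of "xv i" "pcoord (P l')"] ptmult_pos_iff[of "yv j" "pcoord (P l')"]
    by (auto simp: in_chart_def peval_Var[OF rhom_id])
  then have "l \<in> Lc i j" "l' \<in> Lc i j" using l ch by (auto simp: Lc_def)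
  then show False using separate_points[of l' i j l] l ij * by blast
qed

text \<open>
  The maximal ideal of the valuation ring of another prime divisor does not contain all the local
  coordinates at \<open>P\<^sub>l\<close>: see \<open>gens_avoid_prime\<close> for prime forms and \<open>separate_points\<close> for the other
  points.
\<close>

lemma lies_over_iff:
  assumes R: "R \<in> prime_divisors X" and l: "l \<in> {1..r}"
  shows "lies_over n m R (P l) \<longleftrightarrow> R = R_pt l"
proof
  assume "lies_over n m R (P l)"
  then obtain i j where ij: "i \<le> n" "j \<le> m" "in_chart i j (P l)" "A i j \<subseteq> R"
    "nonunits R \<inter> A i j = point_ideal n m i j (P l)" by (auto simp: lies_over_def)
  have g: "gens l i j \<subseteq> nonunits R"
    using gens_nonunits[OF l ij(1,2,3)] point_ideal_eq[OF l ij(1,2,3)] ij(5) by blast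
  show "R = R_pt l"
    using R unfolding prime_divisors_X
  proof (elim disjE exE conjE bexE)
    fix d e p assume "bprime d e p" "R = R_prime p"
    then show ?thesis using R_prime_neq_R_pt[OF _ l ij(1,2,3)] ij(4) g by blast
  next
    fix l' assume "l' \<in> {1..r}" "R = R_pt l'"
    then show ?thesis using R_pt_inj[OF l _ _ ij(1,2,3), of l'] ij(4) g by blast
  qed
next
  assume R: "R = R_pt l"
  obtain i j where ij: "i \<le> n" "j \<le> m" "in_chart i j (P l)" using pt_chart[OF l] by blast
  then show "lies_over n m R (P l)"
    unfolding lies_over_def R using A_subset_R_pt[OF l ij] point_ideal_eq[OF l ij] by (auto simp: Int_commute)
qed

lemma R_pt_prime_divisor: "l \<in> {1..r} \<Longrightarrow> R_pt l \<in> prime_divisors X"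
  and R_prime_prime_divisor: "bprime d e p \<Longrightarrow> R_prime p \<in> prime_divisors X"
  by (auto simp: prime_divisors_X)

lemma exceptional_divisor_eq:
  assumes l: "l \<in> {1..r}" shows "exceptional_divisor n m X (P l) = frag_of (R_pt l)"
proof -
  have "(THE R. R \<in> prime_divisors X \<and> lies_over n m R (P l)) = R_pt l"
    by (rule the_equality) (use lies_over_iff[OF _ l] R_pt_prime_divisor[OF l] in blast)+
  then show ?thesis by (simp add: exceptional_divisor_def)
qed

lemma R_pt_eq_iff:
  assumes l: "l \<in> {1..r}" "l' \<in> {1..r}" shows "R_pt l = R_pt l' \<longleftrightarrow> l = l'"
proof (rule ccontr)
  assume "\<not> ?thesis"
  then have eq: "R_pt l = R_pt l'" and ne: "l \<noteq> l'" by auto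
  obtain i j where ij: "i \<le> n" "j \<le> m" "in_chart i j (P l)" using pt_chart[OF l(1)] by blast
  have "A i j \<subseteq> R_pt l" by (rule A_subset_R_pt[OF l(1) ij])
  moreover have "gens l i j \<subseteq> nonunits (R_pt l)" using gens_nonunits[OF l(1) ij] by blast
  ultimately show False using R_pt_inj[OF l ne ij] unfolding eq by blast
qed

lemma R_prime_R_pt:
  assumes p: "bprime d e p" and l: "l \<in> {1..r}" shows "R_prime p \<noteq> R_pt l"
proof
  assume eq: "R_prime p = R_pt l"
  obtain i j where ij: "i \<le> n" "j \<le> m" "in_chart i j (P l)" using pt_chart[OF l] by blast
  have "A i j \<subseteq> R_pt l" by (rule A_subset_R_pt[OF l ij])
  moreover have "gens l i j \<subseteq> nonunits (R_pt l)" using gens_nonunits[OF l ij] by blast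
  ultimately show False using R_prime_neq_R_pt[OF p l ij] unfolding eq by blast
qed

lemma irreducible_dvd_associated:
  assumes "irreducible p" "irreducible q" "p dvd (q :: 'k mpoly)"
  shows "\<exists>c. c \<noteq> 0 \<and> q = Cst c * p"
proof -
  obtain s where s: "q = p * s" using assms(3) by (auto simp: dvd_def)
  then have "s dvd 1" "s \<noteq> 0" using assms by (auto simp: irreducible_def)
  then obtain c where "s = Cst c" using unit_iff_tdeg[of s] tdeg_eq_0_imp_Cst by blast
  then show ?thesis using s \<open>s \<noteq> 0\<close> by (auto simp: mult.commute)
qed

lemma R_prime_eqD:
  assumes p: "bprime d e p" and q: "bprime d' e' q" and eq: "R_prime p = R_prime q"
  shows "\<exists>c. c \<noteq> 0 \<and> p = Cst c * q"
proof -
  obtain i j where ij: "i \<le> n" "j \<le> m" "pmult p (xv i) = 0" "pmult p (yv j) = 0" using bprime_good_chart[OF p] .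
  let ?t = "emb p / (x_coord i ^ d * y_coord j ^ e)"
  have prq: "prime_elem q" by (rule bprime_prime[OF q])
  have pnz: "p \<noteq> 0" using bprime_prime[OF p] by (auto simp: prime_elem_def)
  have t: "?t \<in> L" "?t \<noteq> 0" using A_I[of d e p i j] A_subset_L[OF ij(1,2)] p pnz by (auto simp: bprime_def)
  have "vK (pmult q) ?t = 1"
    using discrete_valuation.ord_at_vring[OF bprime_valuation[OF p] t] discrete_valuation.ord_at_vring[OF bprime_valuation[OF q] t]
      bprime_local_equation[OF p ij(3,4)] eq unfolding R_prime_def by simp
  moreover have "vK (pmult q) ?t = int (pmult q p) - int (pmult q (xv i ^ d * yv j ^ e))"
    unfolding emb_monomial[symmetric] by (rule vK_quotient[OF is_val_pmult[OF prq] pnz]) simp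
  ultimately have "1 \<le> pmult q p" by linarith
  then have "q dvd p" using pmult_ge_iff[OF prq pnz, of 1] by simp
  then show ?thesis using irreducible_dvd_associated p q by (auto simp: bprime_def)
qed

definition PP :: "'k ambient set set" where
  "PP = {R. \<exists>d e p. bprime d e p \<and> R = R_prime p}"

text \<open>
  An irreducible form defining the prime divisor; it is unique up to a constant factor.
\<close>

definition rep :: "'k ambient set \<Rightarrow> 'k mpoly" where
  "rep R = (SOME p. \<exists>d e. bprime d e p \<and> R = R_prime p)"

lemma rep: "R \<in> PP \<Longrightarrow> \<exists>d e. bprime d e (rep R) \<and> R = R_prime (rep R)"
  unfolding PP_def rep_def by (rule someI_ex) blast

definition pt_of :: "'k ambient set \<Rightarrow> nat" where
  "pt_of R = (THE l. l \<in> {1..r} \<and> R = R_pt l)"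

lemma pt_of [simp]: "l \<in> {1..r} \<Longrightarrow> pt_of (R_pt l) = l"
  unfolding pt_of_def by (rule the_equality) (auto simp: R_pt_eq_iff)

lemma R_pt_notin_PP: "l \<in> {1..r} \<Longrightarrow> R_pt l \<notin> PP"
  unfolding PP_def using R_prime_R_pt by fastforce

text \<open>
  The valuation of a prime divisor on forms, rather than on quotients of forms.
\<close>

definition vR :: "'k ambient set \<Rightarrow> 'k mpoly \<Rightarrow> nat" where
  "vR R = (if R \<in> PP then pmult (rep R) else mult_pt (pt_of R))"

lemma prime_divisors_cases:
  assumes "R \<in> prime_divisors X"
  obtains (prime) "R \<in> PP" | (pt) l where "l \<in> {1..r}" "R = R_pt l" "R \<notin> PP"
  using assms R_pt_notin_PP unfolding prime_divisors_X PP_def by blast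

lemma PP_prime_divisors: "R \<in> PP \<Longrightarrow> R \<in> prime_divisors X"
  unfolding prime_divisors_X PP_def by blast

lemma is_val_vR: "R \<in> prime_divisors X \<Longrightarrow> is_val (vR R)"
  using is_val_pmult[OF bprime_prime] rep is_val_ptmult by (metis vR_def)

lemma vR_pt: "l \<in> {1..r} \<Longrightarrow> vR (R_pt l) = mult_pt l"
  by (simp add: vR_def R_pt_notin_PP)

lemma dv_vR:
  assumes "R \<in> prime_divisors X"
  shows "discrete_valuation L (vK (vR R))" "R = discrete_valuation.vring L (vK (vR R))"
proof -
  have "discrete_valuation L (vK (vR R)) \<and> R = discrete_valuation.vring L (vK (vR R))"
    using assms
  proof (cases rule: prime_divisors_cases)
    case prime
    then show ?thesis using rep[OF prime] bprime_valuation by (auto simp: vR_def R_prime_def)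
  next
    case (pt l)
    then show ?thesis using pt_valuation vR_pt by (simp add: R_pt_def)
  qed
  then show "discrete_valuation L (vK (vR R))" "R = discrete_valuation.vring L (vK (vR R))" by auto
qed

lemma ord_at_vR: "R \<in> prime_divisors X \<Longrightarrow> f \<in> L \<Longrightarrow> f \<noteq> 0 \<Longrightarrow> ord_at R f = vK (vR R) f"
  using discrete_valuation.ord_at_vring[OF dv_vR(1)] dv_vR(2) by metis

lemma pmult_irreducible:
  assumes "irreducible p" "irreducible (q :: 'k mpoly)"
  shows "pmult p q = (if p dvd q then 1 else 0)"
proof (cases "p dvd q")
  case True
  then obtain c where c: "c \<noteq> 0" "q = p ^ 1 * Cst c" using irreducible_dvd_associated[OF assms] by (auto simp: mult.commute)
  moreover have "\<not> p dvd Cst c" using is_unit_Cst[OF c(1)] assms by (meson dvd_trans irreducible_def)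
  ultimately show ?thesis using True pmult_unique[OF irreducible_imp_prime_mpoly[OF assms(1)]] by metis
next
  case False
  then show ?thesis using pmult_eq_0_iff[OF irreducible_imp_prime_mpoly[OF assms(1)]] assms(2) by (auto simp: irreducible_def)
qed

lemma R_prime_Cst_mult:
  assumes p: "bprime d e p" and c: "c \<noteq> 0" and q: "q = Cst c * p" "bprime d' e' q"
  shows "R_prime p = R_prime q"
proof -
  have "pmult p F = pmult q F" if F: "F \<noteq> 0" for F
  proof -
    have "p ^ k dvd F \<longleftrightarrow> q ^ k dvd F" for k
    proof -
      have cu: "(Cst c ^ k :: 'k mpoly) dvd 1" using is_unit_Cst[OF c] by (metis dvd_power_same power_one)
      then have "q ^ k dvd p ^ k" "p ^ k dvd q ^ k"
      proof -
        show "p ^ k dvd q ^ k" by (simp add: q power_mult_distrib)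
        obtain s where s: "1 = Cst c ^ k * (s :: 'k mpoly)" using cu by (auto simp: dvd_def)
        then have "p ^ k = q ^ k * s" by (simp add: q(1) power_mult_distrib ac_simps)
        then show "q ^ k dvd p ^ k" by simp
      qed
      then show ?thesis using dvd_trans by blast
    qed
    then show ?thesis unfolding pmult_def by simp
  qed
  then have 1: "vK (pmult p) f = vK (pmult q) f" if "f \<noteq> 0" for f
  proof -
    obtain G H where *: "f = emb G / emb H" "H \<noteq> 0" using ambient_cases by metis
    then have "G \<noteq> 0" using that by (auto simp: emb_hom)
    then show ?thesis using * vK_quotient[OF is_val_pmult[OF bprime_prime[OF p]]] vK_quotient[OF is_val_pmult[OF bprime_prime[OF q(2)]]]
        \<open>\<And>F. F \<noteq> 0 \<Longrightarrow> pmult p F = pmult q F\<close> by simp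
  qed
  show ?thesis
  proof (rule Set.set_eqI)
    fix f show "f \<in> R_prime p \<longleftrightarrow> f \<in> R_prime q"
      using 1[of f] R_prime_iff[OF p, of f] R_prime_iff[OF q(2), of f] by auto
  qed
qed

lemma vR_irreducible:
  assumes p: "bprime d e p" and R: "R \<in> PP"
  shows "vR R p = (if R = R_prime p then 1 else 0)"
proof -
  obtain d' e' where q: "bprime d' e' (rep R)" "R = R_prime (rep R)" using rep[OF R] by blast
  have "rep R dvd p \<longleftrightarrow> R_prime (rep R) = R_prime p"
  proof
    assume "rep R dvd p"
    then show "R_prime (rep R) = R_prime p"
      using irreducible_dvd_associated[of "rep R" p] R_prime_Cst_mult[OF q(1) _ _ p] p q(1) by (auto simp: bprime_def)
  next
    assume "R_prime (rep R) = R_prime p"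
    then show "rep R dvd p" using R_prime_eqD[OF p q(1)] by auto
  qed
  then show ?thesis using pmult_irreducible[of "rep R" p] p q R by (auto simp: vR_def bprime_def)
qed

text \<open>
  Induction over the factorization of a form into irreducible forms, by the total degree.
\<close>

lemma form_induct [consumes 2, case_names Cst irreducible mult]:
  assumes "bih a b F" "F \<noteq> 0"
    and "\<And>c. c \<noteq> 0 \<Longrightarrow> Q (Cst c)" and "\<And>d e p. bprime d e p \<Longrightarrow> Q p"
    and "\<And>a b F a' b' G. bih a b F \<Longrightarrow> bih a' b' G \<Longrightarrow> F \<noteq> 0 \<Longrightarrow> G \<noteq> 0 \<Longrightarrow> Q F \<Longrightarrow> Q G \<Longrightarrow> Q (F * G)"
  shows "Q F"
  using assms(1,2)
proof (induction "tdeg F" arbitrary: a b F rule: less_induct)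
  case less
  show ?case
  proof (cases "irreducible F \<or> F dvd 1")
    case True
    then show ?thesis
    proof
      assume "irreducible F"
      then show ?thesis using less.prems assms(4) by (auto simp: bprime_def)
    next
      assume "F dvd 1"
      then obtain c where "F = Cst c" using unit_iff_tdeg[OF less.prems(2)] tdeg_eq_0_imp_Cst by blast
      then show ?thesis using assms(3) less.prems by auto
    qed
  next
    case False
    then obtain G1 G2 where G: "F = G1 * G2" "\<not> G1 dvd 1" "\<not> G2 dvd 1"
      using less.prems(2) by (auto simp: irreducible_def)
    then have nz: "G1 \<noteq> 0" "G2 \<noteq> 0" using less.prems(2) by auto
    obtain a1 b1 a2 b2 where bi: "bih a1 b1 G1" "bih a2 b2 G2"
      by (rule bih_factor[OF less.prems(1,2)[unfolded G(1)]])
    have t: "tdeg G1 < tdeg F" "tdeg G2 < tdeg F"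
      using G unit_iff_tdeg[OF nz(1)] unit_iff_tdeg[OF nz(2)] nz by (auto simp: wd_mult)
    have "Q G1" "Q G2" by (rule less.hyps[OF t(1) bi(1) nz(1)], rule less.hyps[OF t(2) bi(2) nz(2)])
    then show ?thesis unfolding G(1) by (rule assms(5)[OF bi nz])
  qed
qed

lemma vR_Cst: "R \<in> prime_divisors X \<Longrightarrow> c \<noteq> 0 \<Longrightarrow> vR R (Cst c) = 0"
  and vR_mult: "R \<in> prime_divisors X \<Longrightarrow> F \<noteq> 0 \<Longrightarrow> G \<noteq> 0 \<Longrightarrow> vR R (F * G) = vR R F + vR R G"
  using is_valD[OF is_val_vR] by blast+

definition supp :: "'k mpoly \<Rightarrow> 'k ambient set set" where
  "supp F = {R \<in> prime_divisors X. vR R F \<noteq> 0}"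

lemma prime_divisors_subset: "prime_divisors X = PP \<union> R_pt ` {1..r}"
  by (rule Set.set_eqI) (simp only: prime_divisors_X PP_def Un_iff mem_Collect_eq image_iff)

lemma finite_supp: "bih a b F \<Longrightarrow> F \<noteq> 0 \<Longrightarrow> finite (supp F)"
proof (induction rule: form_induct)
  case (irreducible d e p)
  have "supp p \<subseteq> {R_prime p} \<union> R_pt ` {1..r}"
    using vR_irreducible[OF irreducible] by (auto simp: supp_def prime_divisors_subset split: if_splits)
  then show ?case by (rule finite_subset) simp
next
  case (mult a b F a' b' G)
  have "supp (F * G) \<subseteq> supp F \<union> supp G" using mult vR_mult by (auto simp: supp_def)
  then show ?case using mult finite_subset by blast
next
  case (Cst c)
  then have "supp (Cst c) = {}" using vR_Cst by (force simp: supp_def)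
  then show ?case by simp
qed

text \<open>
  By unique factorization, an additive function of forms is determined by its values on
  irreducible ones. It is applied to the two degrees and to the multiplicities.
\<close>

lemma additive_on_forms:
  fixes \<mu> :: "'k mpoly \<Rightarrow> nat"
  assumes F: "bih a b F" "F \<noteq> 0"
    and lam: "\<And>F G. F \<noteq> 0 \<Longrightarrow> G \<noteq> 0 \<Longrightarrow> \<mu> (F * G) = \<mu> F + \<mu> G" "\<And>c. c \<noteq> 0 \<Longrightarrow> \<mu> (Cst c) = 0"
    and T: "finite T" "supp F \<subseteq> T" "T \<subseteq> prime_divisors X"
  shows "\<mu> F = (\<Sum>R\<in>T \<inter> PP. vR R F * \<mu> (rep R))"
  using F T(2)
proof (induction rule: form_induct)
  case (Cst c)
  then show ?case using lam vR_Cst T(3) by (simp add: subset_iff)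
next
  case (irreducible d e p)
  have R: "R_prime p \<in> PP" using irreducible by (auto simp: PP_def)
  then have "vR (R_prime p) p = 1" using vR_irreducible[OF irreducible(1) R] by simp
  then have RT: "R_prime p \<in> T \<inter> PP" using irreducible R PP_prime_divisors by (auto simp: supp_def)
  have "(\<Sum>R\<in>T \<inter> PP. vR R p * \<mu> (rep R)) = (\<Sum>R\<in>T \<inter> PP. if R = R_prime p then \<mu> (rep R) else 0)"
    using vR_irreducible[OF irreducible(1)] by (intro sum.cong) auto
  also have "\<dots> = \<mu> (rep (R_prime p))" using RT T(1) by simp
  also have "\<dots> = \<mu> p"
  proof -
    obtain d' e' where q: "bprime d' e' (rep (R_prime p))" "R_prime p = R_prime (rep (R_prime p))" using rep[OF R] by blast
    then obtain c where "c \<noteq> 0" "p = Cst c * rep (R_prime p)" using R_prime_eqD[OF irreducible(1) q] by blast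
    moreover have "rep (R_prime p) \<noteq> 0" using bprime_prime[OF q(1)] by (auto simp: prime_elem_def)
    ultimately show ?thesis using lam(1)[of "Cst c" "rep (R_prime p)"] lam(2)[of c] by simp
  qed
  finally show ?case by simp
next
  case (mult a b F a' b' G)
  have sub: "supp F \<subseteq> T" "supp G \<subseteq> T" using mult.prems vR_mult mult.hyps by (auto simp: supp_def)
  have "(\<Sum>R\<in>T \<inter> PP. vR R (F * G) * \<mu> (rep R)) = (\<Sum>R\<in>T \<inter> PP. vR R F * \<mu> (rep R) + vR R G * \<mu> (rep R))"
    using vR_mult mult.hyps T(3) by (intro sum.cong) (auto simp: algebra_simps)
  then show ?case using mult sub lam(1) by (simp add: sum.distrib)
qed

text \<open>
  The divisor on \<open>X\<close> of (the pullback of) a form; it includes the exceptional divisors over the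
  points where the form vanishes.
\<close>

definition pdiv :: "'k mpoly \<Rightarrow> 'k ambient set \<Rightarrow>\<^sub>0 int" where
  "pdiv F = weil_divisor X (\<lambda>R. int (vR R F))"

lemma lookup_weil_divisor:
  assumes "finite {R \<in> prime_divisors X. v R \<noteq> 0}"
  shows "Poly_Mapping.lookup (weil_divisor X v) R = (if R \<in> prime_divisors X then v R else 0)"
proof -
  have "{R. (if R \<in> prime_divisors X then v R else 0) \<noteq> 0} = {R \<in> prime_divisors X. v R \<noteq> 0}" by auto
  then have "finite {R. (if R \<in> prime_divisors X then v R else 0) \<noteq> 0}" using assms by simp
  from lookup_Abs_poly_mapping[OF this] show ?thesis by (simp add: weil_divisor_def)
qed

lemma lookup_pdiv:
  assumes "bih a b F" "F \<noteq> 0"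
  shows "Poly_Mapping.lookup (pdiv F) R = (if R \<in> prime_divisors X then int (vR R F) else 0)"
  unfolding pdiv_def by (rule lookup_weil_divisor) (use finite_supp[OF assms] in \<open>simp add: supp_def\<close>)

lemma principal_divisor_quotient:
  assumes "bih a b G" "bih a b H" "G \<noteq> 0" "H \<noteq> 0"
  shows "principal_divisor X (emb G / emb H) = pdiv G - pdiv H"
proof (rule poly_mapping_eqI)
  fix R
  have ord: "ord_at R (emb G / emb H) = int (vR R G) - int (vR R H)" if "R \<in> prime_divisors X" for R
    using ord_at_vR[OF that L_I[OF assms(1,2,4)]] vK_quotient[OF is_val_vR[OF that] assms(3,4)] assms by simp
  have "{R \<in> prime_divisors X. ord_at R (emb G / emb H) \<noteq> 0} \<subseteq> supp G \<union> supp H"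
  proof
    fix R assume "R \<in> {R \<in> prime_divisors X. ord_at R (emb G / emb H) \<noteq> 0}"
    then have "R \<in> prime_divisors X" "int (vR R G) - int (vR R H) \<noteq> 0" using ord[of R] by auto
    then show "R \<in> supp G \<union> supp H" by (auto simp: supp_def)
  qed
  moreover have "finite (supp G \<union> supp H)" using finite_supp assms by blast
  ultimately have "finite {R \<in> prime_divisors X. ord_at R (emb G / emb H) \<noteq> 0}" by (rule finite_subset)
  then show "Poly_Mapping.lookup (principal_divisor X (emb G / emb H)) R = Poly_Mapping.lookup (pdiv G - pdiv H) R"
    unfolding principal_divisor_def by (simp add: lookup_weil_divisor lookup_minus lookup_pdiv assms ord
      lookup_pdiv[OF assms(1,3)] lookup_pdiv[OF assms(2,4)])
qed

text \<open>
  On each prime divisor some \<open>x\<^sub>k\<close> and some \<open>y\<^sub>k\<close> do not vanish identically, so that the local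
  equations in the definition of the hyperplane pullbacks are quotients by coordinates of value
  \<open>0\<close>.
\<close>

lemma vR_xy_0:
  assumes R: "R \<in> prime_divisors X"
  shows "\<exists>k\<le>n. vR R (xv k) = 0" "\<exists>k\<le>m. vR R (yv k) = 0"
proof -
  show "\<exists>k\<le>n. vR R (xv k) = 0"
    using R
  proof (cases rule: prime_divisors_cases)
    case prime
    then obtain d e where "bprime d e (rep R)" using rep by blast
    then obtain i j where "i \<le> n" "j \<le> m" "pmult (rep R) (xv i) = 0" "pmult (rep R) (yv j) = 0"
      by (rule bprime_good_chart)
    then show ?thesis using prime unfolding vR_def by auto
  next
    case (pt l)
    then show ?thesis using pt_val_0[OF pt(1)] vR_pt[OF pt(1)] by simp
  qed
  show "\<exists>k\<le>m. vR R (yv k) = 0"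
    using R
  proof (cases rule: prime_divisors_cases)
    case prime
    then obtain d e where "bprime d e (rep R)" using rep by blast
    then obtain i j where "i \<le> n" "j \<le> m" "pmult (rep R) (xv i) = 0" "pmult (rep R) (yv j) = 0"
      by (rule bprime_good_chart)
    then show ?thesis using prime unfolding vR_def by auto
  next
    case (pt l)
    then show ?thesis using pt_val_0[OF pt(1)] vR_pt[OF pt(1)] by simp
  qed
qed

lemma vK_ratio:
  assumes "R \<in> prime_divisors X"
  shows "vK (vR R) (x_coord k / x_coord i) = int (vR R (xv k)) - int (vR R (xv i))"
    "vK (vR R) (y_coord k / y_coord i) = int (vR R (yv k)) - int (vR R (yv i))"
  using vK_quotient[OF is_val_vR[OF assms] Var_nonzero Var_nonzero, of "2 * k" "2 * i"]
    vK_quotient[OF is_val_vR[OF assms] Var_nonzero Var_nonzero, of "Suc (2 * k)" "Suc (2 * i)"] by simp_all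

lemma mem_iff_vK: "R \<in> prime_divisors X \<Longrightarrow> f \<in> R \<longleftrightarrow> f \<in> L \<and> (f = 0 \<or> 0 \<le> vK (vR R) f)"
  using discrete_valuation.vring_iff[OF dv_vR(1)] dv_vR(2) by metis

lemma hyperplane_pullback1_eq: "hyperplane_pullback1 n X = pdiv (xv 0)"
proof -
  have "ord_at R (x_coord 0 / x_coord (SOME i. i \<le> n \<and> (\<forall>k\<le>n. x_coord k / x_coord i \<in> R))) = int (vR R (xv 0))"
    if R: "R \<in> prime_divisors X" for R
  proof -
    let ?Q = "\<lambda>i. i \<le> n \<and> (\<forall>k\<le>n. x_coord k / x_coord i \<in> R)"
    obtain i0 where i0: "i0 \<le> n" "vR R (xv i0) = 0" using vR_xy_0[OF R] by blast
    have "?Q i0" using i0 x_in_L by (simp add: mem_iff_vK[OF R] vK_ratio[OF R])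
    then have "?Q (SOME i. ?Q i)" by (rule someI)
    then obtain i where i: "i = (SOME i. ?Q i)" "?Q i" by blast
    have "vR R (xv i) = 0" using i(2) i0 by (auto simp: mem_iff_vK[OF R] vK_ratio[OF R])
    then have "ord_at R (x_coord 0 / x_coord i) = int (vR R (xv 0))"
      using ord_at_vR[OF R x_in_L, of 0 i] i(2) by (simp add: vK_ratio[OF R])
    then show ?thesis using i(1) by simp
  qed
  then show ?thesis unfolding hyperplane_pullback1_def pdiv_def weil_divisor_def
    by (intro arg_cong[of _ _ Abs_poly_mapping]) auto
qed

lemma hyperplane_pullback2_eq: "hyperplane_pullback2 m X = pdiv (yv 0)"
proof -
  have "ord_at R (y_coord 0 / y_coord (SOME i. i \<le> m \<and> (\<forall>k\<le>m. y_coord k / y_coord i \<in> R))) = int (vR R (yv 0))"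
    if R: "R \<in> prime_divisors X" for R
  proof -
    let ?Q = "\<lambda>i. i \<le> m \<and> (\<forall>k\<le>m. y_coord k / y_coord i \<in> R)"
    obtain i0 where i0: "i0 \<le> m" "vR R (yv i0) = 0" using vR_xy_0[OF R] by blast
    have "?Q i0" using i0 y_in_L by (simp add: mem_iff_vK[OF R] vK_ratio[OF R])
    then have "?Q (SOME i. ?Q i)" by (rule someI)
    then obtain i where i: "i = (SOME i. ?Q i)" "?Q i" by blast
    have "vR R (yv i) = 0" using i(2) i0 by (auto simp: mem_iff_vK[OF R] vK_ratio[OF R])
    then have "ord_at R (y_coord 0 / y_coord i) = int (vR R (yv 0))"
      using ord_at_vR[OF R y_in_L, of 0 i] i(2) by (simp add: vK_ratio[OF R])
    then show ?thesis using i(1) by simp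
  qed
  then show ?thesis unfolding hyperplane_pullback2_def pdiv_def weil_divisor_def
    by (intro arg_cong[of _ _ Abs_poly_mapping]) auto
qed

end

section \<open>Splitting a vector into indicator functions\<close>

text \<open>
  Let \<open>s\<close> bound all entries. If \<open>J\<close> contains the positions where the entry is \<open>s\<close> and only
  positions where it is positive, one can subtract a positive multiple \<open>\<epsilon>\<close> of the indicator
  function of \<open>J\<close> and lower the bound to \<open>s - \<epsilon>\<close>. For the largest possible \<open>\<epsilon> \<le> d\<close>, either
  \<open>\<epsilon> = d\<close>, or an entry strictly between the bounds reaches \<open>0\<close> or the new upper bound. Entries
  that have reached one of the bounds stay there.
\<close>

lemma greedy_step:
  fixes m :: "'i \<Rightarrow> 'a::linordered_idom"
  assumes S: "finite S" and d: "0 < d" "d \<le> s" and m: "\<forall>i\<in>S. 0 \<le> m i \<and> m i \<le> s"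
    and J: "J \<subseteq> S" "\<forall>i\<in>J. 0 < m i" "\<forall>i\<in>S. m i = s \<longrightarrow> i \<in> J"
  shows "\<exists>\<epsilon>. 0 < \<epsilon> \<and> \<epsilon> \<le> d \<and> (\<forall>i\<in>J. \<epsilon> \<le> m i) \<and> (\<forall>i\<in>S - J. m i \<le> s - \<epsilon>) \<and>
    (\<epsilon> = d \<or> {i \<in> S. 0 < (if i \<in> J then m i - \<epsilon> else m i) \<and> (if i \<in> J then m i - \<epsilon> else m i) < s - \<epsilon>}
      \<subset> {i \<in> S. 0 < m i \<and> m i < s}) \<and>
    {i \<in> S. 0 < (if i \<in> J then m i - \<epsilon> else m i) \<and> (if i \<in> J then m i - \<epsilon> else m i) < s - \<epsilon>}
      \<subseteq> {i \<in> S. 0 < m i \<and> m i < s}"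
proof -
  define E where "E = {d} \<union> m ` J \<union> (\<lambda>i. s - m i) ` (S - J)"
  define \<epsilon> where "\<epsilon> = Min E"
  have fE: "finite E" "E \<noteq> {}" using S J(1) by (auto simp: E_def intro: finite_subset)
  have in_E: "\<epsilon> \<in> E" unfolding \<epsilon>_def by (rule Min_in[OF fE])
  have le: "\<epsilon> \<le> x" if "x \<in> E" for x unfolding \<epsilon>_def by (rule Min_le[OF fE(1) that])
  have pos: "0 < x" if x: "x \<in> E" for x
  proof -
    consider "x = d" | i where "i \<in> J" "x = m i" | i where "i \<in> S - J" "x = s - m i" using x unfolding E_def by blast
    then show ?thesis
    proof cases
      case (3 i)
      then have "m i \<noteq> s" "m i \<le> s" using J(3) m by auto
      then show ?thesis using 3 by simp
    qed (use d J in auto)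
  qed
  have e0: "0 < \<epsilon>" using pos[OF in_E] .
  have ed: "\<epsilon> \<le> d" by (rule le) (simp add: E_def)
  have eJ: "\<epsilon> \<le> m i" if "i \<in> J" for i by (rule le) (use that in \<open>auto simp: E_def\<close>)
  have eS: "m i \<le> s - \<epsilon>" if "i \<in> S - J" for i
  proof -
    have "\<epsilon> \<le> s - m i" by (rule le) (use that in \<open>auto simp: E_def\<close>)
    then show ?thesis by (simp add: algebra_simps)
  qed
  let ?m' = "\<lambda>i. if i \<in> J then m i - \<epsilon> else m i"
  have sub: "{i \<in> S. 0 < ?m' i \<and> ?m' i < s - \<epsilon>} \<subseteq> {i \<in> S. 0 < m i \<and> m i < s}"
    using e0 by (auto split: if_splits)
  have "\<exists>i\<in>S. 0 < m i \<and> m i < s \<and> \<not> (0 < ?m' i \<and> ?m' i < s - \<epsilon>)" if ne: "\<epsilon> \<noteq> d"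
  proof -
    have lt: "\<epsilon> < s" using ne ed d by simp
    consider i where "i \<in> J" "\<epsilon> = m i" | i where "i \<in> S - J" "\<epsilon> = s - m i"
      using in_E ne by (auto simp: E_def)
    then show ?thesis
    proof cases
      case (1 i)
      then show ?thesis using J(1,2) lt by (intro bexI[of _ i]) auto
    next
      case (2 i)
      then show ?thesis using lt e0 by (intro bexI[of _ i]) auto
    qed
  qed
  then have strict: "\<epsilon> = d \<or> {i \<in> S. 0 < ?m' i \<and> ?m' i < s - \<epsilon>} \<subset> {i \<in> S. 0 < m i \<and> m i < s}"
    using sub by blast
  show ?thesis using e0 ed eJ eS strict sub by blast
qed

text \<open>
  A fractional version of the fact that a nonnegative integer vector with entries at most \<open>d\<close> and
  sum at most \<open>N d\<close> is a sum of \<open>d\<close> indicator functions of sets of size at most \<open>N\<close>, with two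
  kinds of sets; it covers the integers and the reals at once. At most \<open>N\<close> entries can attain the
  bound \<open>d1 + d2\<close> while \<open>d1 > 0\<close>, as otherwise the sum would be too large; so the set \<open>J\<close> for
  \<open>greedy_step\<close> can be chosen to have exactly \<open>N\<close> elements, or to be the set of all nonzero
  entries if there are fewer. In both cases the bound on the sum is preserved. When \<open>d1\<close> is used
  up, the same is done with \<open>d2\<close> and \<open>N + 1\<close>. Each step uses up \<open>d1\<close> or \<open>d2\<close> or decreases the
  number of entries strictly between the bounds. The predicate \<open>Q\<close> stands for the property of
  being a sum of the required form.
\<close>

lemma split_into_indicators:
  fixes d1 d2 :: "'a::linordered_idom" and m :: "'i \<Rightarrow> 'a" and N :: nat
  assumes S: "finite S"
    and Q0: "Q 0 0 (\<lambda>_. 0)"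
    and Q1: "\<And>\<epsilon> J d1 d2 m. 0 \<le> \<epsilon> \<Longrightarrow> J \<subseteq> S \<Longrightarrow> card J \<le> N \<Longrightarrow> Q d1 d2 m \<Longrightarrow>
      Q (d1 + \<epsilon>) d2 (\<lambda>i. if i \<in> J then m i + \<epsilon> else m i)"
    and Q2: "\<And>\<epsilon> J d1 d2 m. 0 \<le> \<epsilon> \<Longrightarrow> J \<subseteq> S \<Longrightarrow> card J \<le> N + 1 \<Longrightarrow> Q d1 d2 m \<Longrightarrow>
      Q d1 (d2 + \<epsilon>) (\<lambda>i. if i \<in> J then m i + \<epsilon> else m i)"
    and "0 \<le> d1" "0 \<le> d2" "\<And>i. i \<in> S \<Longrightarrow> 0 \<le> m i \<and> m i \<le> d1 + d2" "\<And>i. i \<notin> S \<Longrightarrow> m i = 0"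
    and "(\<Sum>i\<in>S. m i) \<le> of_nat N * d1 + of_nat (N + 1) * d2"
  shows "Q d1 d2 m"
  using assms(5-)
proof (induction "card {i \<in> S. 0 < m i \<and> m i < d1 + d2} + (if 0 < d1 then 1 else 0) + (if 0 < d2 then 1 else 0)"
    arbitrary: d1 d2 m rule: less_induct)
  case (less d1 d2 m)
  let ?s = "d1 + d2"
  let ?T = "{i \<in> S. m i = ?s}" and ?Z = "{i \<in> S. 0 < m i}"
  have fin: "finite ?T" "finite ?Z" using S by auto
  have mpos: "0 \<le> m i" "m i \<le> ?s" if "i \<in> S" for i using less.prems(3) that by auto
  show ?case
  proof (cases "?s = 0")
    case True
    then have "d1 = 0" "d2 = 0" using less.prems(1,2) by (auto simp: add_nonneg_eq_0_iff)
    moreover have "m = (\<lambda>_. 0)"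
    proof
      fix i show "m i = 0" using mpos[of i] less.prems(4)[of i] True by (cases "i \<in> S") auto
    qed
    ultimately show ?thesis using Q0 by simp
  next
    case False
    then have spos: "0 < ?s" using less.prems(1,2) by simp
    have TZ: "?T \<subseteq> ?Z" using spos by auto
    have sumT: "of_nat (card ?T) * ?s \<le> (\<Sum>i\<in>S. m i)"
    proof -
      have "of_nat (card ?T) * ?s = (\<Sum>i\<in>?T. m i)" by simp
      also have "\<dots> \<le> (\<Sum>i\<in>S. m i)" by (rule sum_mono2[OF S]) (use mpos in auto)
      finally show ?thesis .
    qed
    have pick: "\<exists>J. ?T \<subseteq> J \<and> J \<subseteq> ?Z \<and> card J \<le> K \<and> (card J = K \<or> J = ?Z)" if K: "card ?T \<le> K" for K
    proof (cases "card ?Z \<le> K")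
      case True
      then show ?thesis using TZ by blast
    next
      case False
      then obtain J where "?T \<subseteq> J" "J \<subseteq> ?Z" "card J = K"
        using exists_subset_between[OF K _ TZ fin(2)] by auto
      then show ?thesis by auto
    qed
    have step: "\<exists>\<epsilon> m'. 0 < \<epsilon> \<and> \<epsilon> \<le> d \<and> m = (\<lambda>i. if i \<in> J then m' i + \<epsilon> else m' i) \<and>
        (\<forall>i\<in>S. 0 \<le> m' i \<and> m' i \<le> ?s - \<epsilon>) \<and> (\<forall>i. i \<notin> S \<longrightarrow> m' i = 0) \<and>
        (\<Sum>i\<in>S. m' i) = (\<Sum>i\<in>S. m i) - of_nat (card J) * \<epsilon> \<and>
        (J = ?Z \<longrightarrow> (\<Sum>i\<in>S. m' i) \<le> of_nat (card J) * (?s - \<epsilon>)) \<and>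
        card {i \<in> S. 0 < m' i \<and> m' i < ?s - \<epsilon>} \<le> card {i \<in> S. 0 < m i \<and> m i < ?s} \<and>
        (\<epsilon> = d \<or> card {i \<in> S. 0 < m' i \<and> m' i < ?s - \<epsilon>} < card {i \<in> S. 0 < m i \<and> m i < ?s})"
      if d: "0 < d" "d \<le> ?s" and J: "?T \<subseteq> J" "J \<subseteq> ?Z" for d J
    proof -
      have JS: "J \<subseteq> S" using J by auto
      have c1: "\<forall>i\<in>S. 0 \<le> m i \<and> m i \<le> ?s" using mpos by blast
      have c2: "\<forall>i\<in>J. 0 < m i" and c3: "\<forall>i\<in>S. m i = ?s \<longrightarrow> i \<in> J" using J by blast+
      obtain \<epsilon> where e: "0 < \<epsilon>" "\<epsilon> \<le> d" "\<And>i. i \<in> J \<Longrightarrow> \<epsilon> \<le> m i" "\<And>i. i \<in> S - J \<Longrightarrow> m i \<le> ?s - \<epsilon>"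
        "\<epsilon> = d \<or> {i \<in> S. 0 < (if i \<in> J then m i - \<epsilon> else m i) \<and> (if i \<in> J then m i - \<epsilon> else m i) < ?s - \<epsilon>}
          \<subset> {i \<in> S. 0 < m i \<and> m i < ?s}"
        "{i \<in> S. 0 < (if i \<in> J then m i - \<epsilon> else m i) \<and> (if i \<in> J then m i - \<epsilon> else m i) < ?s - \<epsilon>}
          \<subseteq> {i \<in> S. 0 < m i \<and> m i < ?s}"
        using greedy_step[OF S d c1 JS c2 c3] by (elim exE conjE) blast
      define m' where "m' i = (if i \<in> J then m i - \<epsilon> else m i)" for i
      have fS: "finite {i \<in> S. 0 < m i \<and> m i < ?s}" using S by simp
      have "(\<Sum>i\<in>S. m' i) = (\<Sum>i\<in>S. m i - (if i \<in> J then \<epsilon> else 0))"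
        unfolding m'_def by (rule sum.cong) auto
      also have "\<dots> = (\<Sum>i\<in>S. m i) - of_nat (card J) * \<epsilon>"
        using JS S by (simp add: sum_subtractf sum.If_cases Int_absorb1)
      finally have sm: "(\<Sum>i\<in>S. m' i) = (\<Sum>i\<in>S. m i) - of_nat (card J) * \<epsilon>" .
      have bd: "0 \<le> m' i \<and> m' i \<le> ?s - \<epsilon>" if "i \<in> S" for i
        using mpos[OF that] e(3,4)[of i] that by (auto simp: m'_def)
      have Zs: "(\<Sum>i\<in>S. m' i) \<le> of_nat (card J) * (?s - \<epsilon>)" if "J = ?Z"
      proof -
        have "(\<Sum>i\<in>S. m' i) = (\<Sum>i\<in>J. m' i)"
        proof (rule sum.mono_neutral_right[OF S JS], rule ballI)
          fix i assume i: "i \<in> S - J"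
          then have "\<not> 0 < m i" using that by simp
          then show "m' i = 0" using mpos(1)[of i] i by (simp add: m'_def)
        qed
        also have "\<dots> \<le> of_nat (card J) * (?s - \<epsilon>)"
          by (rule sum_bounded_above) (use bd JS in auto)
        finally show ?thesis .
      qed
      show ?thesis
      proof (intro exI[of _ \<epsilon>] exI[of _ m'] conjI)
        show "m = (\<lambda>i. if i \<in> J then m' i + \<epsilon> else m' i)" by (auto simp: m'_def fun_eq_iff)
        show "\<forall>i. i \<notin> S \<longrightarrow> m' i = 0" using less.prems(4) JS by (auto simp: m'_def)
        show "card {i \<in> S. 0 < m' i \<and> m' i < ?s - \<epsilon>} \<le> card {i \<in> S. 0 < m i \<and> m i < ?s}"
          unfolding m'_def by (rule card_mono[OF fS e(6)])
        show "\<epsilon> = d \<or> card {i \<in> S. 0 < m' i \<and> m' i < ?s - \<epsilon>} < card {i \<in> S. 0 < m i \<and> m i < ?s}"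
          unfolding m'_def using e(5)
          by (rule disj_forward) (assumption, erule psubset_card_mono[OF fS])
      qed (use e sm bd Zs in auto)
    qed
    show ?thesis
    proof (cases "0 < d1")
      case True
      have "card ?T \<le> N"
      proof (rule ccontr)
        assume "\<not> card ?T \<le> N"
        then have "of_nat (N + 1) \<le> (of_nat (card ?T) :: 'a)" by (simp add: of_nat_mono del: of_nat_add of_nat_Suc)
        then have "of_nat (N + 1) * ?s \<le> of_nat (card ?T) * ?s" using spos by (intro mult_right_mono) auto
        also note sumT
        also note less.prems(5)
        finally show False using True by (simp add: algebra_simps)
      qed
      from pick[OF this] obtain J where J: "?T \<subseteq> J" "J \<subseteq> ?Z" "card J \<le> N" "card J = N \<or> J = ?Z" by blast
      have "d1 \<le> ?s" using less.prems(2) by simp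
      from step[OF True this J(1,2)] obtain \<epsilon> m' where e: "0 < \<epsilon>" "\<epsilon> \<le> d1"
        "m = (\<lambda>i. if i \<in> J then m' i + \<epsilon> else m' i)"
        "\<forall>i\<in>S. 0 \<le> m' i \<and> m' i \<le> ?s - \<epsilon>" "\<forall>i. i \<notin> S \<longrightarrow> m' i = 0"
        "(\<Sum>i\<in>S. m' i) = (\<Sum>i\<in>S. m i) - of_nat (card J) * \<epsilon>"
        "J = ?Z \<longrightarrow> (\<Sum>i\<in>S. m' i) \<le> of_nat (card J) * (?s - \<epsilon>)"
        "card {i \<in> S. 0 < m' i \<and> m' i < ?s - \<epsilon>} \<le> card {i \<in> S. 0 < m i \<and> m i < ?s}"
        "\<epsilon> = d1 \<or> card {i \<in> S. 0 < m' i \<and> m' i < ?s - \<epsilon>} < card {i \<in> S. 0 < m i \<and> m i < ?s}"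
        by blast
      have eq: "(d1 - \<epsilon>) + d2 = ?s - \<epsilon>" by simp
      have "Q (d1 - \<epsilon>) d2 m'"
      proof (rule less.hyps)
        show "card {i \<in> S. 0 < m' i \<and> m' i < d1 - \<epsilon> + d2} + (if 0 < d1 - \<epsilon> then 1 else 0) + (if 0 < d2 then 1 else 0)
          < card {i \<in> S. 0 < m i \<and> m i < d1 + d2} + (if 0 < d1 then 1 else 0) + (if 0 < d2 then 1 else 0)"
          using e(8,9) True unfolding eq by auto
        show "(\<Sum>i\<in>S. m' i) \<le> of_nat N * (d1 - \<epsilon>) + of_nat (N + 1) * d2"
          using J(4)
        proof
          assume "card J = N"
          then show ?thesis using e(6) less.prems(5) by (simp add: algebra_simps)
        next
          assume "J = ?Z"
          then have "(\<Sum>i\<in>S. m' i) \<le> of_nat (card J) * (?s - \<epsilon>)" using e(7) by simp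
          also have "\<dots> \<le> of_nat N * (?s - \<epsilon>)"
            using J(3) e(2) less.prems(2) by (intro mult_right_mono) auto
          finally show ?thesis using less.prems(2) by (simp add: algebra_simps)
        qed
      qed (use e less.prems in \<open>auto simp: eq\<close>)
      then have "Q (d1 - \<epsilon> + \<epsilon>) d2 (\<lambda>i. if i \<in> J then m' i + \<epsilon> else m' i)"
        using e(1) J by (intro Q1) auto
      then show ?thesis using e(3) by simp
    next
      case False
      then have d1: "d1 = 0" using less.prems(1) by simp
      have d2: "0 < d2" using spos d1 by simp
      have "card ?T \<le> N + 1"
      proof (rule ccontr)
        assume "\<not> card ?T \<le> N + 1"
        then have "of_nat (N + 2) \<le> (of_nat (card ?T) :: 'a)" by (simp add: of_nat_mono del: of_nat_add of_nat_Suc)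
        then have "of_nat (N + 2) * ?s \<le> of_nat (card ?T) * ?s" using spos by (intro mult_right_mono) auto
        also note sumT
        also note less.prems(5)
        finally show False using d1 d2 by (simp add: algebra_simps)
      qed
      from pick[OF this] obtain J where J: "?T \<subseteq> J" "J \<subseteq> ?Z" "card J \<le> N + 1" "card J = N + 1 \<or> J = ?Z" by blast
      have "d2 \<le> ?s" using less.prems(1) by simp
      from step[OF d2 this J(1,2)] obtain \<epsilon> m' where e: "0 < \<epsilon>" "\<epsilon> \<le> d2"
        "m = (\<lambda>i. if i \<in> J then m' i + \<epsilon> else m' i)"
        "\<forall>i\<in>S. 0 \<le> m' i \<and> m' i \<le> ?s - \<epsilon>" "\<forall>i. i \<notin> S \<longrightarrow> m' i = 0"
        "(\<Sum>i\<in>S. m' i) = (\<Sum>i\<in>S. m i) - of_nat (card J) * \<epsilon>"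
        "J = ?Z \<longrightarrow> (\<Sum>i\<in>S. m' i) \<le> of_nat (card J) * (?s - \<epsilon>)"
        "card {i \<in> S. 0 < m' i \<and> m' i < ?s - \<epsilon>} \<le> card {i \<in> S. 0 < m i \<and> m i < ?s}"
        "\<epsilon> = d2 \<or> card {i \<in> S. 0 < m' i \<and> m' i < ?s - \<epsilon>} < card {i \<in> S. 0 < m i \<and> m i < ?s}"
        by blast
      have eq: "d1 + (d2 - \<epsilon>) = ?s - \<epsilon>" by simp
      have "Q d1 (d2 - \<epsilon>) m'"
      proof (rule less.hyps)
        show "card {i \<in> S. 0 < m' i \<and> m' i < d1 + (d2 - \<epsilon>)} + (if 0 < d1 then 1 else 0) + (if 0 < d2 - \<epsilon> then 1 else 0)
          < card {i \<in> S. 0 < m i \<and> m i < d1 + d2} + (if 0 < d1 then 1 else 0) + (if 0 < d2 then 1 else 0)"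
          using e(8,9) d2 unfolding eq by auto
        show "(\<Sum>i\<in>S. m' i) \<le> of_nat N * d1 + of_nat (N + 1) * (d2 - \<epsilon>)"
          using J(4)
        proof
          assume "card J = N + 1"
          then show ?thesis using e(6) less.prems(5) by (simp add: algebra_simps)
        next
          assume "J = ?Z"
          then have "(\<Sum>i\<in>S. m' i) \<le> of_nat (card J) * (?s - \<epsilon>)" using e(7) by simp
          also have "\<dots> \<le> of_nat (N + 1) * (?s - \<epsilon>)"
            using J(3) e(2) d1 by (intro mult_right_mono of_nat_mono) auto
          finally show ?thesis using d1 by (simp add: algebra_simps)
        qed
      qed (use e less.prems in \<open>auto simp: eq\<close>)
      then have "Q d1 (d2 - \<epsilon> + \<epsilon>) (\<lambda>i. if i \<in> J then m' i + \<epsilon> else m' i)"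
        using e(1) J by (intro Q2) auto
      then show ?thesis using e(3) by simp
    qed
  qed
qed

section \<open>Nonvanishing of polynomials over infinite fields\<close>

lemma exists_nonzero_value:
  fixes F :: "'k::field mpoly"
  assumes inf: "infinite (UNIV :: 'k set)" and F: "F \<noteq> 0"
  shows "\<exists>a. peval (\<lambda>c. c) a F \<noteq> 0"
proof -
  have "finite V \<Longrightarrow> in_vars V F \<Longrightarrow> F \<noteq> 0 \<Longrightarrow> \<exists>a. peval (\<lambda>c. c) a F \<noteq> 0" for V and F :: "'k mpoly"
  proof (induction V arbitrary: F rule: finite_induct)
    case empty
    then obtain c where "F = Cst c" using in_vars_empty by blast
    then show ?case using empty by (simp add: rhom_id)
  next
    case (insert v V)
    let ?p = "uni v F"
    have "?p \<noteq> 0" using insert by simp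
    then obtain i where i: "coeff ?p i \<noteq> 0" by (metis leading_coeff_0_iff)
    have cV: "in_vars V (coeff ?p k)" for k by (rule in_vars_coeff_uni[OF insert.prems(1)])
    obtain a where a: "peval (\<lambda>c. c) a (coeff ?p i) \<noteq> 0" using insert.IH[OF cV i] by blast
    let ?q = "map_poly (peval (\<lambda>c. c) a) ?p"
    have h0: "peval (\<lambda>c. c) a 0 = (0::'k)" by (simp add: peval_def)
    have "coeff ?q i \<noteq> 0" using a by (simp add: coeff_map_poly h0)
    then have "?q \<noteq> 0" by auto
    then obtain t where t: "poly ?q t \<noteq> 0"
      using poly_roots_finite[of ?q] inf by (metis (mono_tags, lifting) UNIV_I finite_subset mem_Collect_eq subsetI)
    let ?b = "a(v := t)"
    have rh: "rhom (\<lambda>G. poly (map_poly (peval (\<lambda>c. c) a) (uni v G)) t)"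
      by (intro rhom_compose[OF rhom_poly] rhom_compose[OF rhom_map_poly] rhom_peval rhom_id rhom_uni)
    have "peval (\<lambda>c. c) ?b F = poly ?q t"
    proof (rule rhom_eqI[OF rhom_peval[OF rhom_id] rh])
      show "\<And>c. peval (\<lambda>c. c) ?b (Cst c) = poly (map_poly (peval (\<lambda>c. c) a) (uni v (Cst c))) t"
        by (simp add: rhom_id map_poly_pCons h0)
      show "\<And>u. peval (\<lambda>c. c) ?b (Var u) = poly (map_poly (peval (\<lambda>c. c) a) (uni v (Var u))) t"
        by (simp add: rhom_id uni_Var map_poly_pCons h0 rhom_1[OF rhom_peval[OF rhom_id]])
    qed
    then have "peval (\<lambda>c. c) ?b F \<noteq> 0" using t by simp
    then show ?case by blast
  qed
  then show ?thesis using finite_in_vars[of F] F by blast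
qed

section \<open>Curves through the points\<close>

lemma bih_scale:
  fixes \<phi> :: "nat \<Rightarrow> 'a::comm_ring_1"
  assumes "homog wx a F" "homog wy b F" "rhom h"
  shows "peval h (\<lambda>v. (if even v then c else d) * \<phi> v) F = c ^ a * d ^ b * peval h \<phi> F"
proof -
  have "(\<lambda>v. (if even v then c else d) * \<phi> v) = (\<lambda>v. c ^ wx v * (d ^ wy v * \<phi> v))" by auto
  then show ?thesis using peval_homog_scale[OF assms(1,3), of c "\<lambda>v. d ^ wy v * \<phi> v"] peval_homog_scale[OF assms(2,3), of d \<phi>]
    by (simp add: mult.assoc)
qed

text \<open>
  Near the parameter \<open>t\<close> the curve is \<open>w + (T - t) q(T)\<close> up to rescaling the homogeneous
  coordinates, so the restriction of \<open>F\<close> is obtained from its expansion at \<open>w\<close> by substituting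
  \<open>T - t\<close> for the expansion parameter.
\<close>

lemma order_on_curve:
  fixes F :: "'k::field mpoly" and \<gamma> :: "nat \<Rightarrow> 'k poly"
  assumes F: "homog wx a F" "homog wy b F" "F \<noteq> 0" and V: "in_vars V F"
    and c: "c \<noteq> 0" "d \<noteq> 0" and g: "\<And>v. v \<in> V \<Longrightarrow> poly (\<gamma> v) t = (if even v then c else d) * w v"
  shows "[:- t, 1:] ^ ptmult w F dvd peval (\<lambda>c. [:c:]) \<gamma> F"
proof -
  let ?l = "\<lambda>v::nat. if even v then c else d"
  have "\<exists>q. \<gamma> v = smult (?l v) ([:w v:] + [:- t, 1:] * q)" if "v \<in> V" for v
  proof -
    let ?p = "smult (inverse (?l v)) (\<gamma> v) - [:w v:]"
    have l: "?l v \<noteq> 0" using c by simp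
    have "poly ?p t = 0" using g[OF that] l by simp
    then have "[:- t, 1:] dvd ?p" by (simp only: poly_eq_0_iff_dvd)
    then obtain q where q: "?p = [:- t, 1:] * q" by (auto simp: dvd_def)
    have "\<gamma> v = smult (?l v) (smult (inverse (?l v)) (\<gamma> v))" using l by simp
    also have "smult (inverse (?l v)) (\<gamma> v) = [:w v:] + [:- t, 1:] * q"
      using q by (metis add.commute diff_add_cancel)
    finally show ?thesis by blast
  qed
  then obtain q where q: "\<And>v. v \<in> V \<Longrightarrow> \<gamma> v = smult (?l v) ([:w v:] + [:- t, 1:] * q v)" by metis
  have cp: "rhom (\<lambda>c::'k. [:c:])" by (rule rhom_const_poly)
  have "peval (\<lambda>c. [:c:]) \<gamma> F = peval (\<lambda>c. [:c:]) (\<lambda>v. (if even v then [:c:] else [:d:]) * ([:w v:] + [:- t, 1:] * q v)) F"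
    by (rule peval_cong_vars[OF cp V]) (use q in \<open>auto simp: smult_add_right\<close>)
  also have "\<dots> = [:c:] ^ a * [:d:] ^ b * peval (\<lambda>c. [:c:]) (\<lambda>v. [:w v:] + [:- t, 1:] * q v) F"
    by (rule bih_scale[OF F(1,2) cp])
  also have "peval (\<lambda>c. [:c:]) (\<lambda>v. [:w v:] + [:- t, 1:] * q v) F
      = poly (map_poly (peval (\<lambda>c. [:c:]) q) (shift w F)) [:- t, 1:]"
  proof -
    let ?H = "peval (\<lambda>c. [:c:]) q"
    have rH: "rhom ?H" by (rule rhom_peval[OF cp])
    have "rhom (\<lambda>F. poly (map_poly ?H (shift w F)) [:- t, 1:])"
      by (intro rhom_compose[OF rhom_poly] rhom_compose[OF rhom_map_poly[OF rH]] rhom_shift)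
    then show ?thesis
      by (intro peval_eq[symmetric] cp) (simp_all add: map_poly_pCons rhom_0[OF rH] cp del: pCons_0_0)
  qed
  finally have eq: "peval (\<lambda>c. [:c:]) \<gamma> F = [:c:] ^ a * [:d:] ^ b * poly (map_poly (peval (\<lambda>c. [:c:]) q) (shift w F)) [:- t, 1:]" .
  have "[:0, 1:] ^ ptmult w F dvd shift w F" using ptmult_ge_iff[OF F(3), of "ptmult w F" w] by simp
  then have "poly (map_poly (peval (\<lambda>c. [:c:]) q) ([:0, 1:] ^ ptmult w F)) [:- t, 1:]
     dvd poly (map_poly (peval (\<lambda>c. [:c:]) q) (shift w F)) [:- t, 1:]"
    by (intro rhom_dvd[OF rhom_poly] rhom_dvd[OF rhom_map_poly[OF rhom_peval[OF cp]]])
  moreover have "poly (map_poly (peval (\<lambda>c. [:c:]) q) ([:0, 1:] ^ k)) [:- t, 1:] = [:- t, 1:] ^ k" for k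
    unfolding rhom_power[OF rhom_map_poly[OF rhom_peval[OF cp]]]
    by (simp add: map_poly_pCons rhom_0[OF rhom_peval[OF cp]] rhom_1[OF rhom_peval[OF cp]])
  ultimately show ?thesis unfolding eq by simp
qed

lemma degree_on_curve:
  fixes F :: "'k::field mpoly"
  assumes F: "homog wx a F" "homog wy b F" and V: "in_vars V F"
    and d: "\<And>v. v \<in> V \<Longrightarrow> Polynomial.degree (\<gamma> v) \<le> (if even v then N else M)"
  shows "Polynomial.degree (peval (\<lambda>c. [:c:]) \<gamma> F) \<le> N * a + M * b"
  unfolding peval_def
proof (rule degree_sum_le)
  fix e assume e: "e \<in> Poly_Mapping.keys F"
  have eV: "Poly_Mapping.keys e \<subseteq> V" using V e by (auto simp: in_vars_def)
  have "Polynomial.degree (\<Prod>v\<in>A. \<gamma> v ^ f v) \<le> (\<Sum>v\<in>A. f v * (N * wx v + M * wy v))" if "A \<subseteq> V" for A f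
    using that
  proof (induction A rule: infinite_finite_induct)
    case (insert v A)
    have "Polynomial.degree (\<gamma> v ^ f v) \<le> f v * (N * wx v + M * wy v)"
      using degree_power_le[of "\<gamma> v" "f v"] d[of v] insert.prems
      by (auto intro!: order_trans[OF degree_power_le] simp: mult.commute)
    then show ?case using insert by (auto intro!: order_trans[OF degree_mult_le] add_mono)
  qed auto
  from this[OF eV, of "Poly_Mapping.lookup e"]
  have "Polynomial.degree (power_product \<gamma> e) \<le> N * wdeg wx e + M * wdeg wy e"
    by (simp add: power_product_def wdeg_def sum_distrib_left sum.distrib[symmetric] algebra_simps)
  moreover have "wdeg wx e = a" "wdeg wy e = b" using F e by (auto simp: homog_def)
  moreover have "Polynomial.degree ([:Poly_Mapping.lookup F e:] * power_product \<gamma> e) \<le> Polynomial.degree (power_product \<gamma> e)"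
    by (auto intro: degree_smult_le)
  ultimately show "Polynomial.degree ([:Poly_Mapping.lookup F e:] * power_product \<gamma> e) \<le> N * a + M * b"
    by simp
qed simp

lemma sum_orders_le_degree:
  fixes p :: "'k::field poly"
  assumes p: "p \<noteq> 0" and S: "finite S" and inj: "inj_on t S"
    and dvd: "\<And>l. l \<in> S \<Longrightarrow> [:- t l, 1:] ^ k l dvd p"
  shows "(\<Sum>l\<in>S. k l) \<le> Polynomial.degree p"
proof -
  let ?M = "proots p"
  have "(\<Sum>l\<in>S. k l) \<le> (\<Sum>l\<in>S. count ?M (t l))"
    using dvd p order_divides by (intro sum_mono) (auto simp: order_divides)
  also have "\<dots> = (\<Sum>x\<in>t ` S. count ?M x)"
    using inj by (simp add: sum.reindex)
  also have "\<dots> \<le> (\<Sum>x\<in>t ` S \<union> set_mset ?M. count ?M x)"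
    using S by (intro sum_mono2) auto
  also have "\<dots> = (\<Sum>x\<in>set_mset ?M. count ?M x)"
    using S by (intro sum.mono_neutral_right) (auto simp: not_in_iff)
  also have "\<dots> = size ?M" by (simp add: size_multiset_overloaded_eq)
  also have "\<dots> \<le> Polynomial.degree p" by (rule size_proots_le)
  finally show ?thesis .
qed

text \<open>
  For general scalars \<open>u\<^sub>l\<close>, \<open>v\<^sub>l\<close> and distinct parameters \<open>t\<^sub>l\<close>, consider the curve with
  \<open>x(T) = \<Sum>\<^sub>l \<alpha>\<^sub>l x(P\<^sub>l) W\<^sub>l(T)\<close> and \<open>y(T) = \<Sum>\<^sub>l v\<^sub>l y(P\<^sub>l) W\<^sub>l(T)\<close>, where \<open>W\<^sub>l = \<Prod>\<^sub>j (T - t\<^sub>j)\<close>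
  over \<open>j \<noteq> l\<close>. At \<open>t\<^sub>l\<close> it passes through the \<open>l\<close>-th point. The \<open>W\<^sub>l\<close> are monic of degree
  \<open>n + 1\<close>, so the linear relation between the vectors \<open>x(P\<^sub>l)\<close> lowers the degree of \<open>x(T)\<close> to \<open>n\<close>.
  At \<open>T = 0\<close>, the curve passes through the point \<open>Q\<close> with \<open>x = \<Sum> \<alpha>\<^sub>l s\<^sub>l x(P\<^sub>l)\<close>,
  \<open>y = \<Sum> \<beta>\<^sub>l y(P\<^sub>l)\<close>, where \<open>s\<^sub>l = 1 / t\<^sub>l\<close> and \<open>v\<^sub>l = \<beta>\<^sub>l t\<^sub>l\<close>. As the points span, any point is
  of this form, so \<open>s\<close> and \<open>\<beta>\<close> can be chosen such that \<open>F\<close> does not vanish at \<open>Q\<close>.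
\<close>

lemma curve_inequality:
  fixes F :: "'k::field mpoly" and P :: "nat \<Rightarrow> 'k point"
  assumes inf: "infinite (UNIV :: 'k set)"
    and F: "homog wx a F" "homog wy b F" "in_vars ({2 * i | i. i \<le> n} \<union> {2 * j + 1 | j. j \<le> n + 1}) F" "F \<noteq> 0"
    and al: "\<And>l. l \<in> {1..n + 2} \<Longrightarrow> \<alpha> l \<noteq> 0" "\<And>k. k \<le> n \<Longrightarrow> (\<Sum>l\<in>{1..n + 2}. \<alpha> l * fst (P l) k) = 0"
    and sx: "\<And>q. \<exists>s. \<forall>k\<le>n. q k = (\<Sum>l\<in>{1..n + 2}. s l * fst (P l) k)"
    and sy: "\<And>q. \<exists>s. \<forall>k\<le>n + 1. q k = (\<Sum>l\<in>{1..n + 2}. s l * snd (P l) k)"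
  shows "(\<Sum>l\<in>{1..n + 2}. ptmult (pcoord (P l)) F) \<le> n * a + (n + 1) * b"
proof -
  define S where "S = {1..n + 2}"
  define V where "V = {2 * i | i. i \<le> n} \<union> {2 * j + 1 | j. j \<le> n + 1}"
  have S: "finite S" "card S = n + 2" by (auto simp: S_def)
  note FV = F(3)[folded V_def]
  have al': "\<And>l. l \<in> S \<Longrightarrow> \<alpha> l \<noteq> 0" using al(1) by (simp add: S_def)
  have id: "rhom (\<lambda>c::'k. c)" by (rule rhom_id)
  have Vc: thesis if "v \<in> V" "\<And>k. k \<le> n \<Longrightarrow> v = 2 * k \<Longrightarrow> thesis" "\<And>k. k \<le> n + 1 \<Longrightarrow> v = Suc (2 * k) \<Longrightarrow> thesis" for v thesis
    using that by (auto simp: V_def)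
  \<comment> \<open>the point of the product with parameters \<open>s\<close>, \<open>\<beta>\<close>\<close>
  define Q where "Q s \<beta> v = (if even v then \<Sum>l\<in>S. \<alpha> l * s l * fst (P l) (v div 2) else \<Sum>l\<in>S. \<beta> l * snd (P l) (v div 2))"
    for s \<beta> :: "nat \<Rightarrow> 'k" and v :: nat
  \<comment> \<open>the same point with indeterminate parameters, \<open>s\<^sub>l\<close> and \<open>\<beta>\<^sub>l\<close> being the variables \<open>2 l\<close> and \<open>2 l + 1\<close>\<close>
  define \<Psi> :: "nat \<Rightarrow> 'k mpoly" where
    "\<Psi> v = (if even v then \<Sum>l\<in>S. Cst (\<alpha> l * fst (P l) (v div 2)) * Var (2 * l) else \<Sum>l\<in>S. Cst (snd (P l) (v div 2)) * Var (Suc (2 * l)))" for v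
  have evQ: "peval (\<lambda>c. c) z (peval Cst \<Psi> F) = peval (\<lambda>c. c) (Q (\<lambda>l. z (2 * l)) (\<lambda>l. z (Suc (2 * l)))) F" for z
  proof -
    have "peval (\<lambda>c. c) z (\<Psi> v) = Q (\<lambda>l. z (2 * l)) (\<lambda>l. z (Suc (2 * l))) v" for v
      by (simp add: \<Psi>_def Q_def peval_sum[OF id] peval_mult[OF id] peval_Cst[OF id] peval_Var[OF id] ac_simps)
    then show ?thesis using rhom_peval_comp[OF rhom_peval[OF id] rhom_Cst, of z \<Psi> F] by (simp add: id)
  qed
  have Fnz: "peval Cst \<Psi> F \<noteq> 0"
  proof
    assume 0: "peval Cst \<Psi> F = 0"
    obtain q where q: "peval (\<lambda>c. c) q F \<noteq> 0" using exists_nonzero_value[OF inf F(4)] by blast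
    obtain s where s: "\<And>k. k \<le> n \<Longrightarrow> q (2 * k) = (\<Sum>l\<in>S. s l * fst (P l) k)"
      using sx[of "\<lambda>k. q (2 * k)"] by (auto simp: S_def)
    obtain \<beta> where \<beta>: "\<And>k. k \<le> n + 1 \<Longrightarrow> q (Suc (2 * k)) = (\<Sum>l\<in>S. \<beta> l * snd (P l) k)"
      using sy[of "\<lambda>k. q (Suc (2 * k))"] by (auto simp: S_def)
    define z where "z v = (if even v then s (v div 2) / \<alpha> (v div 2) else \<beta> (v div 2))" for v
    have "Q (\<lambda>l. z (2 * l)) (\<lambda>l. z (Suc (2 * l))) v = q v" if "v \<in> V" for v
      using that
    proof (rule Vc)
      fix k assume k: "k \<le> n" "v = 2 * k"
      have "Q (\<lambda>l. z (2 * l)) (\<lambda>l. z (Suc (2 * l))) v = (\<Sum>l\<in>S. s l * fst (P l) k)"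
        using k al' by (simp add: Q_def z_def)
      then show ?thesis using s[OF k(1)] k by simp
    next
      fix k assume k: "k \<le> n + 1" "v = Suc (2 * k)"
      have "Q (\<lambda>l. z (2 * l)) (\<lambda>l. z (Suc (2 * l))) v = (\<Sum>l\<in>S. \<beta> l * snd (P l) k)"
        using k by (simp add: Q_def z_def)
      then show ?thesis using \<beta>[OF k(1)] k by simp
    qed
    then have "peval (\<lambda>c. c) z (peval Cst \<Psi> F) = peval (\<lambda>c. c) q F"
      unfolding evQ by (rule peval_cong_vars[OF id FV])
    then show False using q 0 by (simp add: peval_def)
  qed
  \<comment> \<open>the conditions that the parameters be nonzero and the \<open>s\<^sub>l\<close> be distinct\<close>
  define D1 :: "'k mpoly" where "D1 = (\<Prod>l\<in>S. Var (2 * l) * Var (Suc (2 * l)))"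
  define D2 :: "'k mpoly" where "D2 = (\<Prod>l\<in>S. \<Prod>j\<in>S - {l}. Var (2 * l) - Var (2 * j))"
  have D1: "D1 \<noteq> 0" using S by (simp add: D1_def)
  have "(Var (2 * l) :: 'k mpoly) - Var (2 * j) \<noteq> 0" if "l \<noteq> j" for l j :: nat
  proof
    assume "(Var (2 * l) :: 'k mpoly) - Var (2 * j) = 0"
    then have "peval (\<lambda>c. c) (\<lambda>v. if v = 2 * l then 1 else 0) ((Var (2 * l) :: 'k mpoly) - Var (2 * j)) = 0"
      by (simp add: peval_def)
    then show False using that by (simp add: rhom_diff[OF rhom_peval[OF id]] peval_Var[OF id])
  qed
  then have D2: "D2 \<noteq> 0" using S by (auto simp: D2_def)
  have "peval Cst \<Psi> F * D1 * D2 \<noteq> 0" using Fnz D1 D2 by simp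
  then obtain z where "peval (\<lambda>c. c) z (peval Cst \<Psi> F * D1 * D2) \<noteq> 0" using exists_nonzero_value[OF inf] by blast
  then have z: "peval (\<lambda>c. c) z (peval Cst \<Psi> F) \<noteq> 0" "peval (\<lambda>c. c) z D1 \<noteq> 0" "peval (\<lambda>c. c) z D2 \<noteq> 0"
    by (auto simp: peval_mult[OF id])
  define s where "s l = z (2 * l)" for l
  define \<beta> where "\<beta> l = z (Suc (2 * l))" for l
  have s0: "s l \<noteq> 0" "\<beta> l \<noteq> 0" if "l \<in> S" for l
    using z(2) that S by (auto simp: D1_def rhom_prod[OF rhom_peval[OF id]] peval_mult[OF id] peval_Var[OF id] s_def \<beta>_def)
  have sd: "s l \<noteq> s j" if "l \<in> S" "j \<in> S" "l \<noteq> j" for l j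
    using z(3) that S by (auto simp: D2_def rhom_prod[OF rhom_peval[OF id]] rhom_diff[OF rhom_peval[OF id]] peval_Var[OF id] s_def)
  have FQ: "peval (\<lambda>c. c) (Q s \<beta>) F \<noteq> 0" using z(1) unfolding evQ s_def \<beta>_def .
  define t where "t l = inverse (s l)" for l
  have t0: "t l \<noteq> 0" if "l \<in> S" for l using s0[OF that] by (simp add: t_def)
  have inj: "inj_on t S" using sd by (auto simp: inj_on_def t_def)
  define W where "W l = (\<Prod>j\<in>S - {l}. [:- t j, 1:])" for l
  define \<gamma> where "\<gamma> v = (if even v then \<Sum>l\<in>S. smult (\<alpha> l * fst (P l) (v div 2)) (W l)
    else \<Sum>l\<in>S. smult (\<beta> l * t l * snd (P l) (v div 2)) (W l))" for v
  have W: "Polynomial.degree (W l) = n + 1" "coeff (W l) (n + 1) = 1" if "l \<in> S" for l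
  proof -
    show 1: "Polynomial.degree (W l) = n + 1"
      unfolding W_def using S that by (subst degree_prod_eq_sum_degree) auto
    have "lead_coeff (W l) = 1" unfolding W_def by (simp add: lead_coeff_prod)
    then show "coeff (W l) (n + 1) = 1" by (simp add: 1)
  qed
  define D where "D = (\<Prod>j\<in>S. - t j)"
  have D: "D \<noteq> 0" using t0 S by (simp add: D_def)
  have W0: "poly (W l) 0 = - D * s l" if "l \<in> S" for l
  proof -
    have "D = - t l * (\<Prod>j\<in>S - {l}. - t j)" unfolding D_def by (rule prod.remove[OF S(1) that])
    then show ?thesis using s0[OF that] by (simp add: W_def poly_prod t_def)
  qed
  have Wt: "poly (W l') (t l) = 0" if "l \<in> S" "l' \<in> S" "l \<noteq> l'" for l l'
    using that S by (auto simp: W_def poly_prod)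
  have Wtl: "poly (W l) (t l) \<noteq> 0" if "l \<in> S" for l
    using inj that S by (auto simp: W_def poly_prod inj_on_def)
  have g0: "poly (\<gamma> v) 0 = (if even v then - D else - D) * Q s \<beta> v" for v
    using s0 by (auto simp: \<gamma>_def Q_def poly_sum W0 sum_distrib_left t_def intro!: sum.cong simp flip: sum_negf)
  let ?p = "peval (\<lambda>c. [:c:]) \<gamma> F"
  have "poly ?p 0 = peval (\<lambda>c. c) (\<lambda>v. poly (\<gamma> v) 0) F"
    using rhom_peval_comp[OF rhom_poly[of 0] rhom_const_poly, of \<gamma> F] by simp
  also have "\<dots> = (- D) ^ a * (- D) ^ b * peval (\<lambda>c. c) (Q s \<beta>) F"
    unfolding g0 by (rule bih_scale[OF F(1,2) id])
  finally have pnz: "?p \<noteq> 0" using FQ D by auto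
  have "(\<Sum>l\<in>S. ptmult (pcoord (P l)) F) \<le> Polynomial.degree ?p"
  proof (rule sum_orders_le_degree[OF pnz S(1) inj])
    fix l assume l: "l \<in> S"
    have single: "(\<Sum>l'\<in>S. c l' * poly (W l') (t l)) = c l * poly (W l) (t l)" for c
      using Wt[OF l] S(1) l by (subst sum.remove[OF S(1) l]) (auto intro!: sum.neutral)
    show "[:- t l, 1:] ^ ptmult (pcoord (P l)) F dvd ?p"
    proof (rule order_on_curve[OF F(1,2,4) FV])
      show "\<alpha> l * poly (W l) (t l) \<noteq> 0" "\<beta> l * t l * poly (W l) (t l) \<noteq> 0"
        using al'[OF l] Wtl[OF l] s0[OF l] t0[OF l] by auto
      fix v
      show "poly (\<gamma> v) (t l) = (if even v then \<alpha> l * poly (W l) (t l) else \<beta> l * t l * poly (W l) (t l)) * pcoord (P l) v"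
        using single[of "\<lambda>l. \<alpha> l * fst (P l) (v div 2)"] single[of "\<lambda>l. \<beta> l * t l * snd (P l) (v div 2)"]
        by (simp add: \<gamma>_def poly_sum pcoord_def)
    qed
  qed
  also have "Polynomial.degree ?p \<le> n * a + (n + 1) * b"
  proof (rule degree_on_curve[OF F(1,2) FV])
    fix v assume "v \<in> V"
    then show "Polynomial.degree (\<gamma> v) \<le> (if even v then n else n + 1)"
    proof (rule Vc)
      fix k assume k: "k \<le> n" "v = 2 * k"
      have "Polynomial.degree (\<gamma> v) \<le> n + 1"
        unfolding \<gamma>_def using W k S by (auto intro!: degree_sum_le order_trans[OF degree_smult_le])
      moreover have "coeff (\<gamma> v) (n + 1) = 0"
        using k W al(2)[OF k(1)] by (simp add: \<gamma>_def coeff_sum S_def)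
      ultimately have "Polynomial.degree (\<gamma> v) \<le> n"
        by (metis Suc_eq_plus1 degree_0 le_SucE leading_coeff_0_iff zero_le)
      then show ?thesis using k by simp
    next
      fix k assume k: "k \<le> n + 1" "v = Suc (2 * k)"
      have "Polynomial.degree (\<gamma> v) \<le> n + 1"
        unfolding \<gamma>_def using W k S by (auto intro!: degree_sum_le order_trans[OF degree_smult_le])
      then show ?thesis using k by simp
    qed
  qed
  finally show ?thesis by (simp add: S_def)
qed

section \<open>Multihomogeneous functions of a configuration\<close>

definition config_coord :: "(nat \<Rightarrow> 'k point) \<Rightarrow> nat \<times> (nat + nat) \<Rightarrow> 'k" where
  "config_coord P = (\<lambda>(l, z). case z of Inl i \<Rightarrow> fst (P l) i | Inr j \<Rightarrow> snd (P l) j)"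

lemma config_eval_eq_peval: "config_eval P F = peval (\<lambda>c. c) (config_coord P) F"
  unfolding config_eval_def peval_def power_product_def config_coord_def
  by (intro sum.cong refl arg_cong2[of _ _ _ _ "(*)"] prod.cong) (auto split: sum.splits)

definition multideg :: "nat \<Rightarrow> nat \<Rightarrow> nat \<Rightarrow> (nat \<Rightarrow> nat) \<Rightarrow> (nat \<Rightarrow> nat) \<Rightarrow> (nat \<times> (nat + nat) \<Rightarrow>\<^sub>0 nat) \<Rightarrow> bool" where
  "multideg n m r a b e \<longleftrightarrow> Poly_Mapping.keys e \<subseteq> {1..r} \<times> (Inl ` {..n} \<union> Inr ` {..m}) \<and>
        (\<forall>l\<in>{1..r}. (\<Sum>i\<le>n. Poly_Mapping.lookup e (l, Inl i)) = a l \<and>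
                   (\<Sum>j\<le>m. Poly_Mapping.lookup e (l, Inr j)) = b l)"

text \<open>
  Functions of the configuration that are given by a multihomogeneous polynomial of the stated
  degrees. They are closed under the operations that occur in a determinant, so no polynomial has
  to be written down.
\<close>

definition multihom_fun :: "nat \<Rightarrow> nat \<Rightarrow> nat \<Rightarrow> (nat \<Rightarrow> nat) \<Rightarrow> (nat \<Rightarrow> nat) \<Rightarrow> ((nat \<Rightarrow> 'k::field point) \<Rightarrow> 'k) \<Rightarrow> bool" where
  "multihom_fun n m r a b f \<longleftrightarrow> (\<exists>F. (\<forall>e\<in>Poly_Mapping.keys F. multideg n m r a b e) \<and> (\<forall>P. config_eval P F = f P))"

lemma multideg_add: "multideg n m r a b e \<Longrightarrow> multideg n m r a' b' e' \<Longrightarrow> multideg n m r (\<lambda>l. a l + a' l) (\<lambda>l. b l + b' l) (e + e')"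
  unfolding multideg_def lookup_add sum.distrib
  by (intro conjI ballI order_trans[OF keys_add] Un_least) auto

lemma multihom_0: "multihom_fun n m r a b (\<lambda>P. 0)"
  unfolding multihom_fun_def by (rule exI[of _ 0]) (simp add: config_eval_def)

lemma multihom_const: "multihom_fun n m r (\<lambda>_. 0) (\<lambda>_. 0) (\<lambda>P. c)"
  unfolding multihom_fun_def config_eval_eq_peval
proof (intro exI[of _ "Cst c"] conjI)
  show "\<forall>e\<in>Poly_Mapping.keys (Cst c). multideg n m r (\<lambda>_. 0) (\<lambda>_. 0) e"
    by (auto simp: Cst_def multideg_def split: if_splits)
qed (simp add: peval_Cst[OF rhom_id])

lemma multihom_coord:
  assumes "l \<in> {1..r}"
  shows "i \<le> n \<Longrightarrow> multihom_fun n m r (\<lambda>l'. if l' = l then 1 else 0) (\<lambda>_. 0) (\<lambda>P. fst (P l) i :: 'a::field)"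
    "j \<le> m \<Longrightarrow> multihom_fun n m r (\<lambda>_. 0) (\<lambda>l'. if l' = l then 1 else 0) (\<lambda>P. snd (P l) j :: 'a::field)"
proof -
  assume "i \<le> n"
  show "multihom_fun n m r (\<lambda>l'. if l' = l then 1 else 0) (\<lambda>_. 0) (\<lambda>P. fst (P l) i :: 'a::field)"
    unfolding multihom_fun_def config_eval_eq_peval
  proof (intro exI[of _ "Var (l, Inl i)"] conjI)
    show "\<forall>e\<in>Poly_Mapping.keys (Var (l, Inl i) :: 'a config_poly). multideg n m r (\<lambda>l'. if l' = l then 1 else 0) (\<lambda>_. 0) e"
      using assms \<open>i \<le> n\<close> by (auto simp: Var_def multideg_def lookup_single when_def)
  qed (simp add: peval_Var[OF rhom_id] config_coord_def)
next
  assume "j \<le> m"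
  show "multihom_fun n m r (\<lambda>_. 0) (\<lambda>l'. if l' = l then 1 else 0) (\<lambda>P. snd (P l) j :: 'a::field)"
    unfolding multihom_fun_def config_eval_eq_peval
  proof (intro exI[of _ "Var (l, Inr j)"] conjI)
    show "\<forall>e\<in>Poly_Mapping.keys (Var (l, Inr j) :: 'a config_poly). multideg n m r (\<lambda>_. 0) (\<lambda>l'. if l' = l then 1 else 0) e"
      using assms \<open>j \<le> m\<close> by (auto simp: Var_def multideg_def lookup_single when_def)
  qed (simp add: peval_Var[OF rhom_id] config_coord_def)
qed

lemma multihom_add:
  assumes "multihom_fun n m r a b f" "multihom_fun n m r a b g"
  shows "multihom_fun n m r a b (\<lambda>P. f P + g P)"
proof -
  obtain F G where *: "\<forall>e\<in>Poly_Mapping.keys F. multideg n m r a b e" "\<forall>P. config_eval P F = f P"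
    "\<forall>e\<in>Poly_Mapping.keys G. multideg n m r a b e" "\<forall>P. config_eval P G = g P"
    using assms by (auto simp: multihom_fun_def)
  then show ?thesis unfolding multihom_fun_def
    using keys_add[of F G] by (intro exI[of _ "F + G"]) (auto simp: config_eval_eq_peval peval_add[OF rhom_id])
qed

lemma multihom_mult:
  assumes "multihom_fun n m r a b f" "multihom_fun n m r a' b' g"
  shows "multihom_fun n m r (\<lambda>l. a l + a' l) (\<lambda>l. b l + b' l) (\<lambda>P. f P * g P)"
proof -
  obtain F G where *: "\<forall>e\<in>Poly_Mapping.keys F. multideg n m r a b e" "\<forall>P. config_eval P F = f P"
    "\<forall>e\<in>Poly_Mapping.keys G. multideg n m r a' b' e" "\<forall>P. config_eval P G = g P"
    using assms by (auto simp: multihom_fun_def)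
  have "\<forall>e\<in>Poly_Mapping.keys (F * G). multideg n m r (\<lambda>l. a l + a' l) (\<lambda>l. b l + b' l) e"
    using keys_mult[of F G] *(1,3) multideg_add by blast
  then show ?thesis unfolding multihom_fun_def
    using * by (intro exI[of _ "F * G"]) (auto simp: config_eval_eq_peval peval_mult[OF rhom_id])
qed

lemma multihom_sum: "(\<And>x. x \<in> A \<Longrightarrow> multihom_fun n m r a b (f x)) \<Longrightarrow> multihom_fun n m r a b (\<lambda>P. \<Sum>x\<in>A. f x P)"
  by (induction A rule: infinite_finite_induct) (auto intro: multihom_0 multihom_add)

lemma multihom_prod:
  "finite A \<Longrightarrow> (\<And>x. x \<in> A \<Longrightarrow> multihom_fun n m r (a x) (b x) (f x)) \<Longrightarrow>
    multihom_fun n m r (\<lambda>l. \<Sum>x\<in>A. a x l) (\<lambda>l. \<Sum>x\<in>A. b x l) (\<lambda>P. \<Prod>x\<in>A. f x P)"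
  by (induction A rule: finite_induct) (auto intro: multihom_const multihom_mult)

text \<open>
  Each permutation term of the determinant takes one entry from each row, so the degrees of the
  rows add up.
\<close>

lemma multihom_det:
  assumes "\<And>i j. i < N \<Longrightarrow> j < N \<Longrightarrow> multihom_fun n m r (a i) (b i) (\<lambda>P. w P i j)"
  shows "multihom_fun n m r (\<lambda>l. \<Sum>i<N. a i l) (\<lambda>l. \<Sum>i<N. b i l) (\<lambda>P. det (mat N N (\<lambda>(i, j). w P i j)))"
proof -
  have "det (mat N N (\<lambda>(i, j). w P i j)) = (\<Sum>p\<in>{p. p permutes {0..<N}}. signof p * (\<Prod>i<N. w P i (p i)))" for P
    unfolding det_def by (simp add: atLeast0LessThan permutes_in_image cong: prod.cong)
      (intro sum.cong refl arg_cong2[of _ _ _ _ "(*)"] prod.cong; simp add: permutes_in_image[of _ "{0..<N}"] flip: atLeast0LessThan)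
  moreover have "multihom_fun n m r (\<lambda>l. \<Sum>i<N. a i l) (\<lambda>l. \<Sum>i<N. b i l) (\<lambda>P. signof p * (\<Prod>i<N. w P i (p i)))"
    if p: "p permutes {0..<N}" for p
  proof -
    have "p i < N" if "i < N" for i using permutes_in_image[OF p, of i] that by simp
    then have "multihom_fun n m r (\<lambda>l. \<Sum>i<N. a i l) (\<lambda>l. \<Sum>i<N. b i l) (\<lambda>P. \<Prod>i<N. w P i (p i))"
      using assms by (intro multihom_prod) auto
    from multihom_mult[OF multihom_const this] show ?thesis by simp
  qed
  ultimately show ?thesis by (auto intro!: multihom_sum)
qed

section \<open>Bases and dual bases\<close>

text \<open>
  The rows of an invertible matrix form a basis; the columns of the inverse are the dual basis.
  The second part is the expansion of a vector in that basis.
\<close>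

lemma dual_basis_of_det:
  fixes w :: "nat \<Rightarrow> nat \<Rightarrow> 'k::field"
  assumes "det (mat N N (\<lambda>(i, j). w i j)) \<noteq> 0"
  shows "\<exists>b. (\<forall>i<N. \<forall>s<N. (\<Sum>c<N. w i c * b s c) = (if i = s then 1 else 0)) \<and>
    (\<forall>q. \<forall>d<N. q d = (\<Sum>s<N. (\<Sum>c<N. q c * b s c) * w s d))"
proof -
  let ?M = "mat N N (\<lambda>(i, j). w i j)"
  have M: "?M \<in> carrier_mat N N" by simp
  define B where "B = inverse (det ?M) \<cdot>\<^sub>m adj_mat ?M"
  have B: "B \<in> carrier_mat N N" using adj_mat(1)[OF M] by (simp add: B_def)
  have "?M * B = inverse (det ?M) \<cdot>\<^sub>m (?M * adj_mat ?M)"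
    unfolding B_def by (rule mult_smult_distrib[OF M adj_mat(1)[OF M]])
  also have "\<dots> = 1\<^sub>m N" unfolding adj_mat(2)[OF M] using assms by (intro eq_matI) auto
  finally have MB: "?M * B = 1\<^sub>m N" .
  have "B * ?M = inverse (det ?M) \<cdot>\<^sub>m (adj_mat ?M * ?M)"
    unfolding B_def by (rule mult_smult_assoc_mat[OF adj_mat(1)[OF M] M])
  also have "\<dots> = 1\<^sub>m N" unfolding adj_mat(3)[OF M] using assms by (intro eq_matI) auto
  finally have BM: "B * ?M = 1\<^sub>m N" .
  have 1: "(\<Sum>c<N. w i c * B $$ (c, s)) = (if i = s then 1 else 0)" if "i < N" "s < N" for i s
  proof -
    have "(?M * B) $$ (i, s) = (\<Sum>c<N. w i c * B $$ (c, s))"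
      using that B by (simp add: scalar_prod_def atLeast0LessThan)
    then show ?thesis using that by (simp add: MB)
  qed
  have 2: "(\<Sum>s<N. B $$ (c, s) * w s d) = (if c = d then 1 else 0)" if "c < N" "d < N" for c d
  proof -
    have "(B * ?M) $$ (c, d) = (\<Sum>s<N. B $$ (c, s) * w s d)"
      using that B by (simp add: scalar_prod_def atLeast0LessThan)
    then show ?thesis using that by (simp add: BM)
  qed
  have "q d = (\<Sum>s<N. (\<Sum>c<N. q c * B $$ (c, s)) * w s d)" if d: "d < N" for q d
  proof -
    have "(\<Sum>s<N. (\<Sum>c<N. q c * B $$ (c, s)) * w s d) = (\<Sum>c<N. q c * (\<Sum>s<N. B $$ (c, s) * w s d))"
      unfolding sum_distrib_left sum_distrib_right by (subst sum.swap) (simp add: mult.assoc)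
    also have "\<dots> = (\<Sum>c<N. if c = d then q c else 0)" using 2 d by (intro sum.cong) auto
    also have "\<dots> = q d" using d by simp
    finally show ?thesis by simp
  qed
  then show ?thesis using 1 by (intro exI[of _ "\<lambda>s c. B $$ (c, s)"]) auto
qed

lemma det_nonzero_if_dual:
  fixes w :: "nat \<Rightarrow> nat \<Rightarrow> 'k::field"
  assumes "\<And>i s. i < N \<Longrightarrow> s < N \<Longrightarrow> (\<Sum>c<N. w i c * b s c) = (if i = s then 1 else 0)"
  shows "det (mat N N (\<lambda>(i, j). w i j)) \<noteq> 0"
proof -
  let ?M = "mat N N (\<lambda>(i, j). w i j)" and ?B = "mat N N (\<lambda>(i, j). b j i)"
  have "?M * ?B = 1\<^sub>m N"
    using assms by (intro eq_matI) (auto simp: scalar_prod_def atLeast0LessThan)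
  then have "det ?M * det ?B = 1" using det_mult[of ?M N ?B] by simp
  then show ?thesis by auto
qed

lemma dual_basis:
  fixes w :: "nat \<Rightarrow> nat \<Rightarrow> 'k::field"
  assumes g: "bij_betw g {..<N} J" and D: "det (mat N N (\<lambda>(i, j). w (g i) j)) \<noteq> 0"
  shows "\<exists>b. \<forall>l\<in>J. \<forall>l'\<in>J. (\<Sum>c<N. w l c * b l' c) = (if l = l' then 1 else 0)"
    "\<exists>s. \<forall>d<N. q d = (\<Sum>l\<in>J. s l * w l d)"
proof -
  obtain b where b: "\<And>i s. i < N \<Longrightarrow> s < N \<Longrightarrow> (\<Sum>c<N. w (g i) c * b s c) = (if i = s then 1 else 0)"
    "\<And>q d. d < N \<Longrightarrow> q d = (\<Sum>s<N. (\<Sum>c<N. q c * b s c) * w (g s) d)"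
    using dual_basis_of_det[OF D] by blast
  define h where "h = inv_into {..<N} g"
  have h: "h l < N" "g (h l) = l" if "l \<in> J" for l
    using that g unfolding h_def
    by (metis bij_betw_def inv_into_into lessThan_iff, metis bij_betw_inv_into_right)
  have hg: "h (g i) = i" if "i < N" for i
    using that g unfolding h_def by (simp add: bij_betw_inv_into_left)
  show "\<exists>b. \<forall>l\<in>J. \<forall>l'\<in>J. (\<Sum>c<N. w l c * b l' c) = (if l = l' then 1 else 0)"
  proof (intro exI[of _ "\<lambda>l. b (h l)"] ballI)
    fix l l' assume l: "l \<in> J" "l' \<in> J"
    have "h l = h l' \<longleftrightarrow> l = l'" using h(2) l by metis
    then show "(\<Sum>c<N. w l c * b (h l') c) = (if l = l' then 1 else 0)"
      using b(1)[of "h l" "h l'"] h l by simp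
  qed
  show "\<exists>s. \<forall>d<N. q d = (\<Sum>l\<in>J. s l * w l d)"
  proof (intro exI[of _ "\<lambda>l. \<Sum>c<N. q c * b (h l) c"] allI impI)
    fix d assume d: "d < N"
    have "(\<Sum>l\<in>J. (\<Sum>c<N. q c * b (h l) c) * w l d) = (\<Sum>i<N. (\<Sum>c<N. q c * b (h (g i)) c) * w (g i) d)"
      by (rule sum.reindex_bij_betw[OF g, symmetric])
    also have "\<dots> = (\<Sum>i<N. (\<Sum>c<N. q c * b i c) * w (g i) d)" using hg by (intro sum.cong) auto
    also have "\<dots> = q d" using b(2)[OF d, of q] by simp
    finally show "q d = (\<Sum>l\<in>J. (\<Sum>c<N. q c * b (h l) c) * w l d)" by simp
  qed
qed

section \<open>Configurations in linearly general position\<close>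

text \<open>
  An enumeration of \<open>{1..n + 2} - {k}\<close> by \<open>{..<n + 1}\<close>.
\<close>

definition skip :: "nat \<Rightarrow> nat \<Rightarrow> nat" where
  "skip k i = (if Suc i < k then Suc i else Suc (Suc i))"

lemma bij_skip:
  assumes "k \<in> {1..n + 2}" shows "bij_betw (skip k) {..<n + 1} ({1..n + 2} - {k})"
proof (rule bij_betw_byWitness[where f' = "\<lambda>l. if l < k then l - 1 else l - 2"])
qed (use assms in \<open>auto simp: skip_def\<close>)

lemma bij_Suc: "bij_betw Suc {..<n + 2} {1..n + 2}"
  by (rule bij_betw_byWitness[where f' = "\<lambda>l. l - 1"]) auto

definition minor_x :: "nat \<Rightarrow> (nat \<Rightarrow> 'k::field point) \<Rightarrow> nat \<Rightarrow> 'k" where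
  "minor_x n P k = det (mat (n + 1) (n + 1) (\<lambda>(i, j). fst (P (skip k i)) j))"

definition minor_y :: "nat \<Rightarrow> (nat \<Rightarrow> 'k::field point) \<Rightarrow> 'k" where
  "minor_y n P = det (mat (n + 2) (n + 2) (\<lambda>(i, j). snd (P (Suc i)) j))"

text \<open>
  It is nonzero exactly if every \<open>n + 1\<close> of the vectors \<open>x(P\<^sub>l)\<close> form a basis and the vectors
  \<open>y(P\<^sub>l)\<close> form a basis.
\<close>

definition discriminant :: "nat \<Rightarrow> (nat \<Rightarrow> 'k::field point) \<Rightarrow> 'k" where
  "discriminant n P = (\<Prod>k\<in>{1..n + 2}. minor_x n P k) * minor_y n P"

lemma multihom_discriminant: "\<exists>a b. multihom_fun n (n + 1) (n + 2) a b (\<lambda>P :: nat \<Rightarrow> 'k::field point. discriminant n P)"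
proof -
  have sk: "skip k i \<in> {1..n + 2}" if "k \<in> {1..n + 2}" "i < n + 1" for k i
    using that by (auto simp: skip_def)
  have x1: "multihom_fun n (n + 1) (n + 2) (\<lambda>l. \<Sum>i<n + 1. if l = skip k i then 1 else 0) (\<lambda>l. \<Sum>i<n + 1. 0)
      (\<lambda>P :: nat \<Rightarrow> 'k point. minor_x n P k)" if k: "k \<in> {1..n + 2}" for k
    unfolding minor_x_def by (rule multihom_det, rule multihom_coord(1)[OF sk[OF k]]) auto
  obtain a b where x: "multihom_fun n (n + 1) (n + 2) a b (\<lambda>P :: nat \<Rightarrow> 'k point. \<Prod>k\<in>{1..n + 2}. minor_x n P k)"
  proof -
    have "\<exists>a b. multihom_fun n (n + 1) (n + 2) a b (\<lambda>P :: nat \<Rightarrow> 'k point. \<Prod>k\<in>{1..n + 2}. minor_x n P k)"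
      by (intro exI, rule multihom_prod[OF finite_atLeastAtMost x1])
    then show ?thesis using that by (elim exE)
  qed
  obtain c d where y: "multihom_fun n (n + 1) (n + 2) c d (\<lambda>P :: nat \<Rightarrow> 'k point. minor_y n P)"
  proof -
    have "\<exists>a b. multihom_fun n (n + 1) (n + 2) a b (\<lambda>P :: nat \<Rightarrow> 'k point. minor_y n P)"
    unfolding minor_y_def
    by (intro exI, rule multihom_det, rule multihom_coord(2)) auto
    then show ?thesis using that by (elim exE)
  qed
  show ?thesis unfolding discriminant_def by (intro exI, rule multihom_mult[OF x y])
qed

lemma zariski_open_discriminant:
  "zariski_open n (n + 1) (n + 2) {P \<in> configurations n (n + 1) (n + 2). discriminant n P \<noteq> (0 :: 'k::field)}"
proof -
  obtain a b and F :: "'k config_poly" where F: "\<forall>e\<in>Poly_Mapping.keys F. multideg n (n + 1) (n + 2) a b e"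
    "\<forall>P. config_eval P F = discriminant n P"
    using multihom_discriminant[of n, where 'k='k] unfolding multihom_fun_def by blast
  have "multihomogeneous n (n + 1) (n + 2) F"
    using F(1) unfolding multihomogeneous_def multideg_def by blast
  then show ?thesis unfolding zariski_open_def using F(2) by (intro exI[of _ "{F}"]) auto
qed

text \<open>
  The witness consists of the \<open>n + 1\<close> unit vectors and the vector \<open>(1, \<dots>, 1)\<close> for \<open>x\<close>, and of the
  unit vectors for \<open>y\<close>. The nonvanishing of each minor is seen from an explicit dual basis.
\<close>

lemma discriminant_nonzero_witness:
  "\<exists>P \<in> configurations n (n + 1) (n + 2). discriminant n P \<noteq> (0 :: 'k::field)"
proof -
  define P :: "nat \<Rightarrow> 'k point" where
    "P l = (\<lambda>c. if l \<le> n + 1 then (if Suc c = l then 1 else 0) else 1, \<lambda>c. if Suc c = l then 1 else 0)" for l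
  have D: "(\<Sum>c<N. w c * (if Suc c = k then 1 else (0::'k))) = (if k \<in> {1..N} then w (k - 1) else 0)" for N w k
  proof -
    have "(\<Sum>c<N. w c * (if Suc c = k then 1 else (0::'k))) = (\<Sum>c<N. if c = k - 1 \<and> 1 \<le> k then w c else 0)"
      by (rule sum.cong) auto
    also have "\<dots> = (if k \<in> {1..N} then w (k - 1) else 0)" by (auto simp: sum.delta)
    finally show ?thesis .
  qed
  have y: "minor_y n P \<noteq> 0"
    unfolding minor_y_def
  proof (rule det_nonzero_if_dual[of _ "\<lambda>i j. snd (P (Suc i)) j" "\<lambda>s c. if Suc c = Suc s then 1 else 0"])
    fix i s assume "i < n + 2" "s < n + 2"
    then show "(\<Sum>c<n + 2. snd (P (Suc i)) c * (if Suc c = Suc s then 1 else 0)) = (if i = s then 1 else 0)"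
      unfolding D by (auto simp: P_def)
  qed
  have x: "minor_x n P k \<noteq> 0" if k: "k \<in> {1..n + 2}" for k
    unfolding minor_x_def
  proof (rule det_nonzero_if_dual[of _ "\<lambda>i j. fst (P (skip k i)) j"
      \<comment> \<open>if unit vector \<open>k\<close> is omitted, the dual of \<open>(1, \<dots>, 1)\<close> is coordinate \<open>k\<close>, which is subtracted from the others; for \<open>k = n + 2\<close> it is zero\<close>
      "\<lambda>s c. if skip k s = n + 2 then (if Suc c = k then 1 else 0)
        else (if Suc c = skip k s then 1 else 0) - (if Suc c = k then 1 else 0)"])
    fix i s assume ii: "i < n + 1" "s < n + 1"
    let ?l = "skip k i" and ?l' = "skip k s"
    have l: "?l \<in> {1..n + 2}" "?l \<noteq> k" "?l' \<in> {1..n + 2}" "?l' \<noteq> k" "?l = ?l' \<longleftrightarrow> i = s"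
      using ii k by (auto simp: skip_def)
    have eq: "(\<Sum>c<n + 1. fst (P ?l) c * (if ?l' = n + 2 then (if Suc c = k then 1 else 0)
        else (if Suc c = ?l' then 1 else 0) - (if Suc c = k then 1 else 0)))
      = (if ?l' = n + 2 then (\<Sum>c<n + 1. fst (P ?l) c * (if Suc c = k then 1 else 0))
        else (\<Sum>c<n + 1. fst (P ?l) c * (if Suc c = ?l' then 1 else 0)) - (\<Sum>c<n + 1. fst (P ?l) c * (if Suc c = k then 1 else 0)))"
      by (auto simp: right_diff_distrib sum_subtractf)
    show "(\<Sum>c<n + 1. fst (P ?l) c * (if ?l' = n + 2 then (if Suc c = k then 1 else 0)
        else (if Suc c = ?l' then 1 else 0) - (if Suc c = k then 1 else 0))) = (if i = s then 1 else 0)"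
      unfolding eq D l(5)[symmetric] using l(1-4) k by (auto simp: P_def)
  qed
  have "P \<in> configurations n (n + 1) (n + 2)"
    unfolding configurations_def is_point_def
  proof (intro CollectI ballI conjI)
    fix l assume "l \<in> {1..n + 2}"
    then show "\<exists>j\<le>n + 1. snd (P l) j \<noteq> 0"
      by (intro exI[of _ "l - 1"]) (auto simp: P_def)
    show "\<exists>i\<le>n. fst (P l) i \<noteq> 0"
      using \<open>l \<in> {1..n + 2}\<close> by (intro exI[of _ "if l \<le> n + 1 then l - 1 else 0"]) (auto simp: P_def)
  qed
  moreover have "discriminant n P \<noteq> 0" unfolding discriminant_def using x y by simp
  ultimately show ?thesis by blast
qed

context blowup_points
begin

section \<open>Divisor classes\<close>

abbreviation PD :: "('k ambient set \<Rightarrow>\<^sub>0 int) set" where "PD \<equiv> principal_divisors X"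
abbreviation Ex :: "nat \<Rightarrow> ('k ambient set \<Rightarrow>\<^sub>0 int)" where "Ex l \<equiv> frag_of (R_pt l)"
abbreviation H1 :: "'k ambient set \<Rightarrow>\<^sub>0 int" where "H1 \<equiv> pdiv (xv 0)"
abbreviation H2 :: "'k ambient set \<Rightarrow>\<^sub>0 int" where "H2 \<equiv> pdiv (yv 0)"
abbreviation cl :: "('k ambient set \<Rightarrow>\<^sub>0 int) \<Rightarrow> ('k ambient set \<Rightarrow>\<^sub>0 int) set" where "cl \<equiv> divisor_class X"

lemma keys_pdiv:
  assumes "bih a b F" "F \<noteq> 0" shows "Poly_Mapping.keys (pdiv F) = supp F"
  using lookup_pdiv[OF assms] by (auto simp: supp_def in_keys_iff split: if_splits)

lemma pdiv_mult:
  assumes "bih a b F" "bih a' b' G" "F \<noteq> 0" "G \<noteq> 0"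
  shows "pdiv (F * G) = pdiv F + pdiv G"
proof (rule poly_mapping_eqI)
  fix R
  have "F * G \<noteq> 0" using assms by simp
  then show "Poly_Mapping.lookup (pdiv (F * G)) R = Poly_Mapping.lookup (pdiv F + pdiv G) R"
    using lookup_pdiv[OF bih_mult[OF assms(1,2)]] lookup_pdiv[OF assms(1,3)] lookup_pdiv[OF assms(2,4)] vR_mult[OF _ assms(3,4)]
    by (simp add: lookup_add)
qed

lemma pdiv_1: "pdiv 1 = 0"
  using lookup_pdiv[OF bih_1] is_val_1[OF is_val_vR] by (intro poly_mapping_eqI) simp

lemma pdiv_power:
  assumes "bih a b F" "F \<noteq> 0" shows "pdiv (F ^ k) = frag_cmul (int k) (pdiv F)"
proof (induction k)
  case (Suc k)
  have "pdiv (F ^ Suc k) = pdiv F + pdiv (F ^ k)"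
    using pdiv_mult[OF assms(1) bih_power[OF assms(1)] assms(2)] assms(2) by simp
  then show ?case using Suc frag_cmul_distrib[of 1 "int k" "pdiv F"] by simp
qed (simp add: pdiv_1)

lemma PD_iff: "D \<in> PD \<longleftrightarrow> (\<exists>a b G H. bih a b G \<and> bih a b H \<and> G \<noteq> 0 \<and> H \<noteq> 0 \<and> D = pdiv G - pdiv H)"
proof
  assume "D \<in> PD"
  then obtain f where f: "f \<in> L" "f \<noteq> 0" "D = principal_divisor X f"
    by (auto simp: principal_divisors_def function_field_X)
  obtain a b G H where *: "bih a b G" "bih a b H" "H \<noteq> 0" "f = emb G / emb H" using L_E[OF f(1)] .
  then have "G \<noteq> 0" using f(2) by (auto simp: emb_hom)
  then show "\<exists>a b G H. bih a b G \<and> bih a b H \<and> G \<noteq> 0 \<and> H \<noteq> 0 \<and> D = pdiv G - pdiv H"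
    using * f(3) principal_divisor_quotient by blast
next
  assume "\<exists>a b G H. bih a b G \<and> bih a b H \<and> G \<noteq> 0 \<and> H \<noteq> 0 \<and> D = pdiv G - pdiv H"
  then obtain a b G H where *: "bih a b G" "bih a b H" "G \<noteq> 0" "H \<noteq> 0" "D = pdiv G - pdiv H" by blast
  then have "D = principal_divisor X (emb G / emb H)" "emb G / emb H \<in> L" "emb G / emb H \<noteq> 0"
    using principal_divisor_quotient[OF *(1-4)] L_I[OF *(1,2,4)] by auto
  then show "D \<in> PD" by (auto simp: principal_divisors_def function_field_X)
qed

lemma pdiv_carrier: "bih a b F \<Longrightarrow> F \<noteq> 0 \<Longrightarrow> pdiv F \<in> carrier (Div X)"
  by (auto simp: keys_pdiv supp_def)

lemma carrier_add: "D \<in> carrier (Div X) \<Longrightarrow> D' \<in> carrier (Div X) \<Longrightarrow> D + D' \<in> carrier (Div X)"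
  and carrier_diff: "D \<in> carrier (Div X) \<Longrightarrow> D' \<in> carrier (Div X) \<Longrightarrow> D - D' \<in> carrier (Div X)"
  and carrier_cmul: "D \<in> carrier (Div X) \<Longrightarrow> frag_cmul c D \<in> carrier (Div X)"
  and carrier_0: "0 \<in> carrier (Div X)"
  using keys_add[of D D'] keys_diff[of D D'] keys_cmul[of c D] by auto

lemma carrier_sum: "(\<And>x. x \<in> J \<Longrightarrow> f x \<in> carrier (Div X)) \<Longrightarrow> sum f J \<in> carrier (Div X)"
  by (rule sum_closed_free_Abelian_group)

lemma Ex_carrier: "l \<in> {1..r} \<Longrightarrow> Ex l \<in> carrier (Div X)"
  using R_pt_prime_divisor by simp

lemma H_carrier: "H1 \<in> carrier (Div X)" "H2 \<in> carrier (Div X)"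
  by (rule pdiv_carrier[OF bih_xv], simp, simp, rule pdiv_carrier[OF bih_yv], simp, simp)

lemma PD_carrier: "D \<in> PD \<Longrightarrow> D \<in> carrier (Div X)"
  unfolding PD_iff using pdiv_carrier carrier_diff by blast

lemma PD_closed: "0 \<in> PD" "D \<in> PD \<Longrightarrow> - D \<in> PD" "D \<in> PD \<Longrightarrow> D' \<in> PD \<Longrightarrow> D + D' \<in> PD"
proof -
  show "0 \<in> PD" unfolding PD_iff using bih_1 by (intro exI[of _ 0] exI[of _ 0] exI[of _ 1]) auto
  show "- D \<in> PD" if "D \<in> PD"
  proof -
    obtain a b G H where "bih a b G" "bih a b H" "G \<noteq> 0" "H \<noteq> 0" "D = pdiv G - pdiv H"
      using \<open>D \<in> PD\<close> unfolding PD_iff by blast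
    then show ?thesis unfolding PD_iff by (intro exI[of _ a] exI[of _ b] exI[of _ H] exI[of _ G]) auto
  qed
  show "D + D' \<in> PD" if "D \<in> PD" "D' \<in> PD"
  proof -
    obtain a b G H where 1: "bih a b G" "bih a b H" "G \<noteq> 0" "H \<noteq> 0" "D = pdiv G - pdiv H"
      using \<open>D \<in> PD\<close> unfolding PD_iff by blast
    obtain a' b' G' H' where 2: "bih a' b' G'" "bih a' b' H'" "G' \<noteq> 0" "H' \<noteq> 0" "D' = pdiv G' - pdiv H'"
      using \<open>D' \<in> PD\<close> unfolding PD_iff by blast
    have "D + D' = pdiv (G * G') - pdiv (H * H')"
      using pdiv_mult[OF 1(1) 2(1) 1(3) 2(3)] pdiv_mult[OF 1(2) 2(2) 1(4) 2(4)] 1(5) 2(5) by simp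
    then show ?thesis unfolding PD_iff
      using bih_mult[OF 1(1) 2(1)] bih_mult[OF 1(2) 2(2)] 1 2
      by (intro exI[of _ "a + a'"] exI[of _ "b + b'"] exI[of _ "G * G'"] exI[of _ "H * H'"]) auto
  qed
qed

lemma PD_subgroup: "subgroup PD (Div X)"
proof (rule group.subgroupI[OF group_free_Abelian_group])
  show "PD \<subseteq> carrier (Div X)" using PD_carrier by blast
  show "PD \<noteq> {}" using PD_closed(1) by blast
  fix D assume D: "D \<in> PD"
  then show "inv\<^bsub>Div X\<^esub> D \<in> PD" using PD_closed(2)[OF D] PD_carrier[OF D] by simp
qed (simp add: PD_closed)

lemma PD_normal: "PD \<lhd> Div X"
  using comm_group.normal_iff_subgroup[OF abelian_free_Abelian_group] PD_subgroup by blast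

lemma cl_mem_iff: "D' \<in> cl D \<longleftrightarrow> D' - D \<in> PD"
  unfolding divisor_class_def r_coset_def by (auto intro!: bexI[of _ "D' - D"])

lemma cl_eqI: assumes "D - D' \<in> PD" shows "cl D = cl D'"
proof (rule Set.set_eqI)
  fix E
  show "E \<in> cl D \<longleftrightarrow> E \<in> cl D'"
    unfolding cl_mem_iff using PD_closed(3)[of "E - D" "D - D'"] PD_closed(3)[of "E - D'" "- (D - D')"] PD_closed(2)[OF assms] assms
    by auto
qed

lemma cl_refl: "D \<in> cl D"
  using PD_closed(1) by (simp add: cl_mem_iff)

lemma cl_carrier: "D \<in> carrier (Div X) \<Longrightarrow> cl D \<in> carrier (Cl X)"
  unfolding Cl_def divisor_class_def FactGroup_def by (auto simp: RCOSETS_def)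

lemma carrier_Cl_E: "\<alpha> \<in> carrier (Cl X) \<Longrightarrow> \<exists>D\<in>carrier (Div X). \<alpha> = cl D"
  unfolding Cl_def divisor_class_def FactGroup_def by (auto simp: RCOSETS_def)

lemma cl_mult: "D \<in> carrier (Div X) \<Longrightarrow> D' \<in> carrier (Div X) \<Longrightarrow> cl D \<otimes>\<^bsub>Cl X\<^esub> cl D' = cl (D + D')"
  using normal.rcos_sum[OF PD_normal, of D D'] unfolding Cl_def divisor_class_def FactGroup_def by simp

lemma cl_one: "\<one>\<^bsub>Cl X\<^esub> = cl 0"
proof -
  have "cl 0 = PD" by (rule Set.set_eqI) (simp add: cl_mem_iff)
  then show ?thesis by (simp add: Cl_def FactGroup_def)
qed

lemma effective_classes_iff:
  "\<alpha> \<in> effective_classes X \<longleftrightarrow> (\<exists>D\<in>effective_divisors X. \<alpha> = cl D)"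
proof
  assume "\<alpha> \<in> effective_classes X"
  then obtain D where D: "\<alpha> \<in> carrier (Cl X)" "D \<in> effective_divisors X" "D \<in> \<alpha>" by (auto simp: effective_classes_def)
  then obtain D' where "\<alpha> = cl D'" using carrier_Cl_E by blast
  then have "\<alpha> = cl D" using D(3) cl_eqI[of D D'] by (simp add: cl_mem_iff)
  then show "\<exists>D\<in>effective_divisors X. \<alpha> = cl D" using D(2) by blast
next
  assume "\<exists>D\<in>effective_divisors X. \<alpha> = cl D"
  then show "\<alpha> \<in> effective_classes X"
    using cl_refl cl_carrier unfolding effective_classes_def by (auto simp: effective_divisors_def)
qed

text \<open>
  The difference is the divisor of the rational function \<open>F / (x\<^sub>0\<^sup>a y\<^sub>0\<^sup>b)\<close>.
\<close>

lemma pdiv_form_equiv: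
  assumes "bih a b F" "F \<noteq> 0"
  shows "pdiv F - (frag_cmul (int a) H1 + frag_cmul (int b) H2) \<in> PD"
proof -
  have x: "bih 1 0 (xv 0)" "bih 0 1 (yv 0)" using bih_xv[of 0] bih_yv[of 0] by auto
  have "pdiv (xv 0 ^ a * yv 0 ^ b) = frag_cmul (int a) H1 + frag_cmul (int b) H2"
    using pdiv_mult[OF bih_power[OF x(1)] bih_power[OF x(2)], of a b] pdiv_power[OF x(1)] pdiv_power[OF x(2)] by simp
  moreover have "bih a b (xv 0 ^ a * yv 0 ^ b)"
    using bih_mult[OF bih_power[OF x(1), of a] bih_power[OF x(2), of b]] by simp
  ultimately show ?thesis unfolding PD_iff using assms
    by (intro exI[of _ a] exI[of _ b] exI[of _ F] exI[of _ "xv 0 ^ a * yv 0 ^ b"]) auto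
qed

lemma pdiv_bprime:
  assumes p: "bprime d e p"
  shows "pdiv p = frag_of (R_prime p) + (\<Sum>l\<in>{1..r}. frag_cmul (int (mult_pt l p)) (Ex l))"
proof (rule poly_mapping_eqI)
  fix R
  have bp: "bih d e p" "p \<noteq> 0" using p bprime_prime[OF p] by (auto simp: bprime_def prime_elem_def)
  have PPp: "R_prime p \<in> PP" using p by (auto simp: PP_def)
  have sum: "Poly_Mapping.lookup (\<Sum>l\<in>{1..r}. frag_cmul (int (mult_pt l p)) (Ex l)) R
    = (\<Sum>l\<in>{1..r}. if R_pt l = R then int (mult_pt l p) else 0)"
    unfolding lookup_sum by (intro sum.cong) (auto simp: lookup_single when_def)
  consider (pp) "R \<in> PP" | (pt) l where "l \<in> {1..r}" "R = R_pt l" "R \<notin> PP" | (no) "R \<notin> prime_divisors X"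
    using prime_divisors_cases by blast
  then show "Poly_Mapping.lookup (pdiv p) R = Poly_Mapping.lookup (frag_of (R_prime p) + (\<Sum>l\<in>{1..r}. frag_cmul (int (mult_pt l p)) (Ex l))) R"
  proof cases
    case pp
    have "(\<Sum>l\<in>{1..r}. if R_pt l = R then int (mult_pt l p) else 0) = 0"
      using pp R_pt_notin_PP by (intro sum.neutral) auto
    then show ?thesis unfolding lookup_add sum lookup_pdiv[OF bp]
      using PP_prime_divisors[OF pp] vR_irreducible[OF p pp] by (auto simp: lookup_single when_def)
  next
    case (pt l)
    have "(\<Sum>l'\<in>{1..r}. if R_pt l' = R then int (mult_pt l' p) else 0) = (\<Sum>l'\<in>{1..r}. if l' = l then int (mult_pt l p) else 0)"
      using pt R_pt_eq_iff by (intro sum.cong) auto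
    also have "\<dots> = int (mult_pt l p)" using pt(1) by simp
    finally show ?thesis unfolding lookup_add sum lookup_pdiv[OF bp]
      using pt PPp vR_pt[OF pt(1)] R_pt_prime_divisor by (auto simp: lookup_single when_def)
  next
    case no
    have "(\<Sum>l\<in>{1..r}. if R_pt l = R then int (mult_pt l p) else 0) = 0"
      using no R_pt_prime_divisor by (intro sum.neutral) auto
    then show ?thesis unfolding lookup_add sum lookup_pdiv[OF bp]
      using no PP_prime_divisors[OF PPp] by (auto simp: lookup_single when_def)
  qed
qed

section \<open>Numerical functions on divisors\<close>

text \<open>
  A real function on prime divisors extends to a linear functional on divisors. The functionals
  given by \<open>wt1\<close>, \<open>wt2\<close> and \<open>wtm l\<close> below vanish on principal divisors, and read off the
  coefficients \<open>d\<^sub>1\<close>, \<open>d\<^sub>2\<close> and \<open>m\<^sub>l\<close> of a class.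
\<close>

definition pair :: "('k ambient set \<Rightarrow> real) \<Rightarrow> ('k ambient set \<Rightarrow>\<^sub>0 int) \<Rightarrow> real" where
  "pair \<psi> D = (\<Sum>R\<in>Poly_Mapping.keys D. real_divisor D R * \<psi> R)"

lemma pair_superset:
  assumes "finite T" "Poly_Mapping.keys D \<subseteq> T" shows "pair \<psi> D = (\<Sum>R\<in>T. real_divisor D R * \<psi> R)"
  unfolding pair_def by (rule sum.mono_neutral_left) (use assms in \<open>auto simp: real_divisor_def in_keys_iff\<close>)

lemma pair_diff: "pair \<psi> (D - D') = pair \<psi> D - pair \<psi> D'"
proof -
  let ?T = "Poly_Mapping.keys D \<union> Poly_Mapping.keys D'"
  have "pair \<psi> (D - D') = (\<Sum>R\<in>?T. real_divisor (D - D') R * \<psi> R)"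
    by (rule pair_superset) (use keys_diff[of D D'] in auto)
  then show ?thesis using pair_superset[of ?T D \<psi>] pair_superset[of ?T D' \<psi>]
    by (simp add: real_divisor_def lookup_minus left_diff_distrib sum_subtractf)
qed

lemma pair_frag_of: "pair \<psi> (frag_of R) = \<psi> R"
  by (simp add: pair_def keys_frag_of real_divisor_def)

lemma pair_nonneg:
  assumes "D \<in> effective_divisors X" "\<And>R. R \<in> prime_divisors X \<Longrightarrow> 0 \<le> \<psi> R" shows "0 \<le> pair \<psi> D"
  unfolding pair_def using assms by (intro sum_nonneg mult_nonneg_nonneg) (auto simp: effective_divisors_def real_divisor_def)

definition wt1 :: "'k ambient set \<Rightarrow> real" where "wt1 R = (if R \<in> PP then real (wd wx (rep R)) else 0)"
definition wt2 :: "'k ambient set \<Rightarrow> real" where "wt2 R = (if R \<in> PP then real (wd wy (rep R)) else 0)"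
definition wtm :: "nat \<Rightarrow> 'k ambient set \<Rightarrow> real" where
  "wtm l R = (if R \<in> PP then real (mult_pt l (rep R)) else if R = R_pt l then - 1 else 0)"

lemma pair_additive:
  assumes F: "bih a b F" "F \<noteq> 0" and T: "finite T" "supp F \<subseteq> T" "T \<subseteq> prime_divisors X"
    and lam: "\<And>F G. F \<noteq> 0 \<Longrightarrow> G \<noteq> 0 \<Longrightarrow> \<mu> (F * G) = \<mu> F + \<mu> G" "\<And>c. c \<noteq> 0 \<Longrightarrow> \<mu> (Cst c) = (0::nat)"
  shows "(\<Sum>R\<in>T \<inter> PP. real_divisor (pdiv F) R * real (\<mu> (rep R))) = real (\<mu> F)"
proof -
  have "real (\<mu> F) = (\<Sum>R\<in>T \<inter> PP. real (vR R F) * real (\<mu> (rep R)))"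
    using additive_on_forms[OF F, of \<mu> T] lam T by simp
  also have "\<dots> = (\<Sum>R\<in>T \<inter> PP. real_divisor (pdiv F) R * real (\<mu> (rep R)))"
    using T(3) by (intro sum.cong) (auto simp: real_divisor_def lookup_pdiv[OF F])
  finally show ?thesis by simp
qed

text \<open>
  The divisor of a form is the sum of its prime factors, whose degrees and multiplicities add up
  to those of the form (\<open>additive_on_forms\<close>). For \<open>wtm l\<close> the multiplicities of the factors cancel
  against the coefficient of \<open>E\<^sub>l\<close>.
\<close>

lemma pair_wt:
  assumes F: "bih a b F" "F \<noteq> 0"
  shows "pair wt1 (pdiv F) = real a" "pair wt2 (pdiv F) = real b" "l \<in> {1..r} \<Longrightarrow> pair (wtm l) (pdiv F) = 0"
proof -
  have T: "finite (supp F)" "supp F \<subseteq> prime_divisors X" using finite_supp[OF F] by (auto simp: supp_def)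
  have "pair wt1 (pdiv F) = (\<Sum>R\<in>supp F \<inter> PP. real_divisor (pdiv F) R * real (wd wx (rep R)))"
    unfolding pair_def keys_pdiv[OF F] by (rule sum.mono_neutral_cong_right) (use T in \<open>auto simp: wt1_def\<close>)
  also have "\<dots> = real (wd wx F)" by (rule pair_additive[OF F T(1) subset_refl T(2)]) (simp_all add: wd_mult)
  also have "wd wx F = a" using F wd_homog by (auto simp: bih_def)
  finally show "pair wt1 (pdiv F) = real a" .
  have "pair wt2 (pdiv F) = (\<Sum>R\<in>supp F \<inter> PP. real_divisor (pdiv F) R * real (wd wy (rep R)))"
    unfolding pair_def keys_pdiv[OF F] by (rule sum.mono_neutral_cong_right) (use T in \<open>auto simp: wt2_def\<close>)
  also have "\<dots> = real (wd wy F)" by (rule pair_additive[OF F T(1) subset_refl T(2)]) (simp_all add: wd_mult)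
  also have "wd wy F = b" using F wd_homog by (auto simp: bih_def)
  finally show "pair wt2 (pdiv F) = real b" .
  assume l: "l \<in> {1..r}"
  let ?T = "insert (R_pt l) (supp F)"
  have T': "finite ?T" "?T \<subseteq> prime_divisors X" using T R_pt_prime_divisor[OF l] by auto
  have "pair (wtm l) (pdiv F) = (\<Sum>R\<in>?T. real_divisor (pdiv F) R * wtm l R)"
    by (rule pair_superset) (use T' keys_pdiv[OF F] in auto)
  also have "\<dots> = (\<Sum>R\<in>?T \<inter> PP. real_divisor (pdiv F) R * wtm l R) + (\<Sum>R\<in>?T - PP. real_divisor (pdiv F) R * wtm l R)"
    using sum.Int_Diff[OF T'(1)] by blast
  also have "(\<Sum>R\<in>?T \<inter> PP. real_divisor (pdiv F) R * wtm l R) = (\<Sum>R\<in>?T \<inter> PP. real_divisor (pdiv F) R * real (mult_pt l (rep R)))"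
    by (rule sum.cong) (auto simp: wtm_def)
  also have "\<dots> = real (mult_pt l F)"
    by (rule pair_additive[OF F T'(1) _ T'(2)]) (auto simp: is_valD[OF is_val_ptmult])
  also have "(\<Sum>R\<in>?T - PP. real_divisor (pdiv F) R * wtm l R) = (\<Sum>R\<in>{R_pt l}. real_divisor (pdiv F) R * wtm l R)"
    by (rule sum.mono_neutral_right) (use T' R_pt_notin_PP[OF l] in \<open>auto simp: wtm_def\<close>)
  also have "\<dots> = - real (mult_pt l F)"
    using R_pt_notin_PP[OF l] R_pt_prime_divisor[OF l] vR_pt[OF l] by (simp add: wtm_def real_divisor_def lookup_pdiv[OF F])
  finally show "pair (wtm l) (pdiv F) = 0" by simp
qed

lemma pair_lin: "pair (\<lambda>R. x * \<phi> R + y * \<psi> R - (\<Sum>i\<in>J. \<chi> i R)) D = x * pair \<phi> D + y * pair \<psi> D - (\<Sum>i\<in>J. pair (\<chi> i) D)"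
proof -
  have "(\<Sum>i\<in>J. pair (\<chi> i) D) = (\<Sum>R\<in>Poly_Mapping.keys D. \<Sum>i\<in>J. real_divisor D R * \<chi> i R)"
    unfolding pair_def by (rule sum.swap)
  then show ?thesis unfolding pair_def
    by (simp add: algebra_simps sum.distrib sum_subtractf sum_distrib_left)
qed

end

text \<open>
  What is used of the general position of the points: hyperplanes through \<open>n\<close> and \<open>n + 1\<close> points,
  which make the generators effective, and the bound that comes from the rational curves through
  all points.
\<close>

locale general_points = blowup_points n m r P
  for n m r :: nat and P :: "nat \<Rightarrow> 'k::field point" +
  assumes m_eq: "m = n + 1" and r_eq: "r = n + 2"
    and forms_x: "J \<subseteq> {1..r} \<Longrightarrow> card J = n \<Longrightarrow>
      \<exists>F. bih 1 0 F \<and> F \<noteq> 0 \<and> (\<forall>l\<in>J. 1 \<le> mult_pt l F)"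
    and forms_y: "J \<subseteq> {1..r} \<Longrightarrow> card J = n + 1 \<Longrightarrow>
      \<exists>F. bih 0 1 F \<and> F \<noteq> 0 \<and> (\<forall>l\<in>J. 1 \<le> mult_pt l F)"
    and curve: "bih a b F \<Longrightarrow> F \<noteq> 0 \<Longrightarrow> (\<Sum>l\<in>{1..r}. mult_pt l F) \<le> n * a + (n + 1) * b"
begin

section \<open>The monoid of effective classes\<close>

definition Gens :: "('k ambient set \<Rightarrow>\<^sub>0 int) set" where
  "Gens = {Ex i | i. i \<in> {1..r}} \<union>
           {H1 - (\<Sum>i\<in>I. Ex i) | I. I \<subseteq> {1..r} \<and> card I = n} \<union>
           {H2 - (\<Sum>i\<in>I. Ex i) | I. I \<subseteq> {1..r} \<and> card I = n + 1}"

lemma sum_Ex_carrier: "J \<subseteq> {1..r} \<Longrightarrow> (\<Sum>i\<in>J. Ex i) \<in> carrier (Div X)"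
  using Ex_carrier by (intro carrier_sum) blast

lemma Gens_carrier: "D \<in> Gens \<Longrightarrow> D \<in> carrier (Div X)"
  unfolding Gens_def using Ex_carrier H_carrier sum_Ex_carrier carrier_diff by blast

lemma effective_of_form:
  assumes F: "bih a b F" "F \<noteq> 0" and J: "J \<subseteq> {1..r}" "\<And>l. l \<in> J \<Longrightarrow> 1 \<le> mult_pt l F"
  shows "pdiv F - (\<Sum>i\<in>J. Ex i) \<in> effective_divisors X"
proof -
  have fin: "finite J" using J(1) finite_subset by blast
  have "0 \<le> Poly_Mapping.lookup (pdiv F - (\<Sum>i\<in>J. Ex i)) R" for R
  proof -
    have s: "Poly_Mapping.lookup (\<Sum>i\<in>J. Ex i) R = (\<Sum>i\<in>J. if R_pt i = R then 1 else 0)"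
      unfolding lookup_sum by (intro sum.cong) (auto simp: lookup_single when_def)
    show ?thesis
    proof (cases "\<exists>l\<in>J. R = R_pt l")
      case True
      then obtain l where l: "l \<in> J" "R = R_pt l" by blast
      then have l1: "l \<in> {1..r}" using J(1) by blast
      have "(\<Sum>i\<in>J. if R_pt i = R then 1 else 0) = (\<Sum>i\<in>J. if i = l then 1 else (0::int))"
        using l J(1) R_pt_eq_iff[OF _ l1] by (intro sum.cong) auto
      then have "Poly_Mapping.lookup (\<Sum>i\<in>J. Ex i) R = 1" using s l(1) fin by simp
      then show ?thesis using J(2)[OF l(1)] vR_pt[OF l1] R_pt_prime_divisor[OF l1] l(2)
        by (simp add: lookup_minus lookup_pdiv[OF F])
    next
      case False
      then have "(\<Sum>i\<in>J. if R_pt i = R then 1 else 0) = (0::int)" by (intro sum.neutral) auto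
      then show ?thesis using s by (simp add: lookup_minus lookup_pdiv[OF F])
    qed
  qed
  then show ?thesis unfolding effective_divisors_def
    using carrier_diff[OF pdiv_carrier[OF F] sum_Ex_carrier[OF J(1)]] by blast
qed

lemma Ex_effective: "l \<in> {1..r} \<Longrightarrow> Ex l \<in> effective_divisors X"
  using Ex_carrier[of l] by (auto simp: effective_divisors_def lookup_single when_def)

lemma Gens_equiv_effective:
  assumes "D \<in> Gens" shows "\<exists>D'\<in>effective_divisors X. D' - D \<in> PD"
proof -
  consider i where "i \<in> {1..r}" "D = Ex i"
    | I where "I \<subseteq> {1..r}" "card I = n" "D = H1 - (\<Sum>i\<in>I. Ex i)"
    | I where "I \<subseteq> {1..r}" "card I = n + 1" "D = H2 - (\<Sum>i\<in>I. Ex i)"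
    using assms unfolding Gens_def by blast
  then show ?thesis
  proof cases
    case (1 i)
    then show ?thesis using Ex_effective PD_closed(1) by (intro bexI[of _ "Ex i"]) auto
  next
    case (2 I)
    obtain F where F: "bih 1 0 F" "F \<noteq> 0" "\<forall>l\<in>I. 1 \<le> mult_pt l F" using forms_x[OF 2(1,2)] by blast
    have "pdiv F - H1 \<in> PD" using pdiv_form_equiv[OF F(1,2)] by simp
    then show ?thesis using effective_of_form[OF F(1,2) 2(1)] F(3) 2(3)
      by (intro bexI[of _ "pdiv F - (\<Sum>i\<in>I. Ex i)"]) auto
  next
    case (3 I)
    obtain F where F: "bih 0 1 F" "F \<noteq> 0" "\<forall>l\<in>I. 1 \<le> mult_pt l F" using forms_y[OF 3(1,2)] by blast
    have "pdiv F - H2 \<in> PD" using pdiv_form_equiv[OF F(1,2)] by simp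
    then show ?thesis using effective_of_form[OF F(1,2) 3(1)] F(3) 3(3)
      by (intro bexI[of _ "pdiv F - (\<Sum>i\<in>I. Ex i)"]) auto
  qed
qed

lemma effective_add: "D \<in> effective_divisors X \<Longrightarrow> D' \<in> effective_divisors X \<Longrightarrow> D + D' \<in> effective_divisors X"
  using carrier_add[of D D'] unfolding effective_divisors_def by (simp add: lookup_add)

lemma zero_effective: "0 \<in> effective_divisors X"
  by (simp add: effective_divisors_def)

lemma generated_subset_effective:
  "submonoid_generated (Cl X) (cl ` Gens) \<subseteq> effective_classes X"
proof
  fix \<alpha> assume "\<alpha> \<in> submonoid_generated (Cl X) (cl ` Gens)"
  then show "\<alpha> \<in> effective_classes X"
  proof induction
    case one
    then show ?case unfolding cl_one effective_classes_iff using zero_effective by blast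
  next
    case (incl a)
    then obtain D where D: "D \<in> Gens" "a = cl D" by blast
    obtain D' where "D' \<in> effective_divisors X" "D' - D \<in> PD" using Gens_equiv_effective[OF D(1)] by blast
    then show ?case unfolding effective_classes_iff using cl_eqI[of D' D] D(2) by blast
  next
    case (mult a b)
    then obtain D D' where *: "D \<in> effective_divisors X" "a = cl D" "D' \<in> effective_divisors X" "b = cl D'"
      unfolding effective_classes_iff by blast
    then have "a \<otimes>\<^bsub>Cl X\<^esub> b = cl (D + D')" using cl_mult[of D D'] by (simp add: effective_divisors_def)
    then show ?case unfolding effective_classes_iff using effective_add * by blast
  qed
qed

text \<open>
  For a monoid \<open>N\<close> that contains the generators, \<open>H\<^sub>1 - \<Sum> E\<^sub>i\<close> is in \<open>N\<close> also for fewer than \<open>n\<close>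
  points, since one can add classes \<open>E\<^sub>i\<close>, and likewise for \<open>H\<^sub>2\<close>. The splitting of \<open>m\<close> into
  indicator functions does the rest.
\<close>

lemma int_combination_in_monoid:
  assumes N0: "0 \<in> N" and Nadd: "\<And>D D'. D \<in> N \<Longrightarrow> D' \<in> N \<Longrightarrow> D + D' \<in> N" and NG: "Gens \<subseteq> N"
    and d: "0 \<le> d1" "0 \<le> d2" and mm: "\<And>l. l \<in> {1..r} \<Longrightarrow> 0 \<le> mm l \<and> mm l \<le> d1 + d2"
    and sm: "(\<Sum>l\<in>{1..r}. mm l) \<le> int n * d1 + int (n + 1) * d2"
  shows "frag_cmul d1 H1 + frag_cmul d2 H2 - (\<Sum>l\<in>{1..r}. frag_cmul (mm l) (Ex l)) \<in> N"
proof -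
  let ?S = "{1..r}"
  have Nsum: "(\<Sum>x\<in>A. f x) \<in> N" if "\<And>x. x \<in> A \<Longrightarrow> f x \<in> N" for A :: "nat set" and f
    using that by (induction A rule: infinite_finite_induct) (auto intro: N0 Nadd)
  have Nmul: "frag_cmul \<epsilon> D \<in> N" if "D \<in> N" "0 \<le> \<epsilon>" for \<epsilon> D
  proof -
    have "frag_cmul (int k) D \<in> N" for k
    proof (induction k)
      case (Suc k)
      have "frag_cmul (int (Suc k)) D = D + frag_cmul (int k) D" using frag_cmul_distrib[of 1 "int k" D] by simp
      then show ?case using Suc Nadd that(1) by simp
    qed (simp add: N0)
    from this[of "nat \<epsilon>"] show ?thesis using that(2) by simp
  qed
  have sub: "\<exists>J'. J \<subseteq> J' \<and> J' \<subseteq> ?S \<and> card J' = k" if "J \<subseteq> ?S" "card J \<le> k" "k \<le> n + 2" for J k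
    using exists_subset_between[of J k ?S] that r_eq by auto
  have split: "H - (\<Sum>i\<in>J. Ex i) = (H - (\<Sum>i\<in>J'. Ex i)) + (\<Sum>i\<in>J' - J. Ex i)" if "J \<subseteq> J'" "J' \<subseteq> ?S" for H J J'
    using sum.subset_diff[OF that(1) finite_subset[OF that(2)], of Ex] by simp
  have ExN: "Ex l \<in> N" if "l \<in> ?S" for l using that NG unfolding Gens_def by blast
  have G1: "H1 - (\<Sum>i\<in>J. Ex i) \<in> N" if J: "J \<subseteq> ?S" "card J \<le> n" for J
  proof -
    obtain J' where J': "J \<subseteq> J'" "J' \<subseteq> ?S" "card J' = n" using sub[OF J] by auto
    have "H1 - (\<Sum>i\<in>J'. Ex i) \<in> N" using J' NG unfolding Gens_def by blast
    moreover have "(\<Sum>i\<in>J' - J. Ex i) \<in> N" using J' ExN by (intro Nsum) blast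
    ultimately show ?thesis unfolding split[OF J'(1,2)] by (rule Nadd)
  qed
  have G2: "H2 - (\<Sum>i\<in>J. Ex i) \<in> N" if J: "J \<subseteq> ?S" "card J \<le> n + 1" for J
  proof -
    obtain J' where J': "J \<subseteq> J'" "J' \<subseteq> ?S" "card J' = n + 1" using sub[OF J] by auto
    have "H2 - (\<Sum>i\<in>J'. Ex i) \<in> N" using J' NG unfolding Gens_def by blast
    moreover have "(\<Sum>i\<in>J' - J. Ex i) \<in> N" using J' ExN by (intro Nsum) blast
    ultimately show ?thesis unfolding split[OF J'(1,2)] by (rule Nadd)
  qed
  have cmul_diff: "frag_cmul \<epsilon> (D - D') = frag_cmul \<epsilon> D - frag_cmul \<epsilon> D'" for \<epsilon> and D D' :: "'k ambient set \<Rightarrow>\<^sub>0 int"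
    by (rule poly_mapping_eqI) (simp add: lookup_minus right_diff_distrib)
  define Q where "Q d1 d2 mm \<longleftrightarrow> frag_cmul d1 H1 + frag_cmul d2 H2 - (\<Sum>l\<in>?S. frag_cmul (mm l) (Ex l)) \<in> N"
    for d1 d2 :: int and mm :: "nat \<Rightarrow> int"
  have step: "(\<Sum>l\<in>?S. frag_cmul (if l \<in> J then mm l + \<epsilon> else mm l) (Ex l))
      = (\<Sum>l\<in>?S. frag_cmul (mm l) (Ex l)) + frag_cmul \<epsilon> (\<Sum>i\<in>J. Ex i)" if "J \<subseteq> ?S" for J \<epsilon> mm
  proof -
    have "(\<Sum>l\<in>?S. frag_cmul (if l \<in> J then mm l + \<epsilon> else mm l) (Ex l))
      = (\<Sum>l\<in>?S. frag_cmul (mm l) (Ex l) + (if l \<in> J then frag_cmul \<epsilon> (Ex l) else 0))"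
      by (rule sum.cong) (auto simp: frag_cmul_distrib)
    moreover have "(\<Sum>l\<in>?S. (if l \<in> J then frag_cmul \<epsilon> (Ex l) else 0)) = (\<Sum>l\<in>J. frag_cmul \<epsilon> (Ex l))"
      using that by (simp add: sum.If_cases Int_absorb1)
    ultimately show ?thesis using finite_subset[OF that] by (simp add: sum.distrib frag_cmul_sum)
  qed
  define m' where "m' l = (if l \<in> ?S then mm l else 0)" for l
  have "Q d1 d2 m'"
  proof (rule split_into_indicators[of ?S Q n])
    show "Q 0 0 (\<lambda>_. 0)" by (simp add: Q_def N0)
    fix \<epsilon> d1 d2 :: int and J and mm :: "nat \<Rightarrow> int"
    assume e: "0 \<le> \<epsilon>" "J \<subseteq> ?S" and q: "Q d1 d2 mm"
    { assume c: "card J \<le> n"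
      have "frag_cmul \<epsilon> (H1 - (\<Sum>i\<in>J. Ex i)) \<in> N" by (rule Nmul[OF G1[OF e(2) c] e(1)])
      then have "(frag_cmul d1 H1 + frag_cmul d2 H2 - (\<Sum>l\<in>?S. frag_cmul (mm l) (Ex l)))
          + frag_cmul \<epsilon> (H1 - (\<Sum>i\<in>J. Ex i)) \<in> N"
        using Nadd q unfolding Q_def by blast
      then show "Q (d1 + \<epsilon>) d2 (\<lambda>i. if i \<in> J then mm i + \<epsilon> else mm i)"
        unfolding Q_def step[OF e(2)] by (simp add: frag_cmul_distrib cmul_diff algebra_simps) }
    { assume c: "card J \<le> n + 1"
      have "frag_cmul \<epsilon> (H2 - (\<Sum>i\<in>J. Ex i)) \<in> N" by (rule Nmul[OF G2[OF e(2) c] e(1)])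
      then have "(frag_cmul d1 H1 + frag_cmul d2 H2 - (\<Sum>l\<in>?S. frag_cmul (mm l) (Ex l)))
          + frag_cmul \<epsilon> (H2 - (\<Sum>i\<in>J. Ex i)) \<in> N"
        using Nadd q unfolding Q_def by blast
      then show "Q d1 (d2 + \<epsilon>) (\<lambda>i. if i \<in> J then mm i + \<epsilon> else mm i)"
        unfolding Q_def step[OF e(2)] by (simp add: frag_cmul_distrib cmul_diff algebra_simps) }
  next
    show "(\<Sum>i\<in>?S. m' i) \<le> of_nat n * d1 + of_nat (n + 1) * d2" using sm by (simp add: m'_def)
  qed (use d mm in \<open>auto simp: m'_def\<close>)
  then show ?thesis by (simp add: Q_def m'_def)
qed

text \<open>
  It suffices to consider prime divisors. The class of a strict transform satisfies the
  assumptions of \<open>int_combination_in_monoid\<close>: the multiplicities are bounded by the total degree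
  and by \<open>curve\<close>.
\<close>

lemma effective_subset_generated:
  "effective_classes X \<subseteq> submonoid_generated (Cl X) (cl ` Gens)"
proof
  let ?M = "submonoid_generated (Cl X) (cl ` Gens)"
  define N where "N = {D \<in> carrier (Div X). cl D \<in> ?M}"
  have N0: "0 \<in> N" using submonoid_generated.one[of "Cl X" "cl ` Gens"] by (simp add: N_def cl_one carrier_0)
  have Nadd: "D + D' \<in> N" if "D \<in> N" "D' \<in> N" for D D'
    using submonoid_generated.mult[of "cl D" "Cl X" "cl ` Gens" "cl D'"] cl_mult[of D D'] carrier_add[of D D'] that
    by (simp add: N_def)
  have NG: "Gens \<subseteq> N" using Gens_carrier submonoid_generated.incl[of _ "cl ` Gens" "Cl X"] by (auto simp: N_def)
  have prime: "frag_of R \<in> N" if R: "R \<in> prime_divisors X" for R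
    using R
  proof (cases rule: prime_divisors_cases)
    case prime
    then obtain d e where p: "bprime d e (rep R)" "R = R_prime (rep R)" using rep by blast
    let ?p = "rep R" and ?S = "{1..r}"
    have bp: "bih d e ?p" "?p \<noteq> 0" using p(1) bprime_prime[OF p(1)] by (auto simp: bprime_def prime_elem_def)
    let ?D = "frag_cmul (int d) H1 + frag_cmul (int e) H2 - (\<Sum>l\<in>?S. frag_cmul (int (mult_pt l ?p)) (Ex l))"
    have "?D \<in> N"
    proof (rule int_combination_in_monoid[OF N0 Nadd NG])
      show "0 \<le> int (mult_pt l ?p) \<and> int (mult_pt l ?p) \<le> int d + int e" for l
        using ptmult_le_tdeg[OF bp(2), of "pcoord (P l)"] bih_tdeg[OF bp] by simp
      have "int (\<Sum>l\<in>?S. mult_pt l ?p) \<le> int (n * d + (n + 1) * e)" using curve[OF bp] by (simp only: of_nat_le_iff)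
      then show "(\<Sum>l\<in>?S. int (mult_pt l ?p)) \<le> int n * int d + int (n + 1) * int e" by (simp add: algebra_simps)
    qed auto
    moreover have "frag_of R - ?D \<in> PD"
      using pdiv_form_equiv[OF bp] pdiv_bprime[OF p(1)] p(2) by (simp add: algebra_simps)
    then have "cl (frag_of R) = cl ?D" by (rule cl_eqI)
    ultimately show ?thesis using R by (simp add: N_def)
  next
    case (pt l)
    then show ?thesis using NG unfolding Gens_def by blast
  qed
  have eff: "D \<in> N" if "D \<in> effective_divisors X" for D
  proof -
    have D: "Poly_Mapping.keys D \<subseteq> prime_divisors X" "\<And>R. 0 \<le> Poly_Mapping.lookup D R"
      using that by (auto simp: effective_divisors_def)
    have mul: "frag_cmul (int k) (frag_of R) \<in> N" if "R \<in> prime_divisors X" for k R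
    proof (induction k)
      case (Suc k)
      have "frag_cmul (int (Suc k)) (frag_of R) = frag_of R + frag_cmul (int k) (frag_of R)"
        using frag_cmul_distrib[of 1 "int k" "frag_of R"] by simp
      then show ?case using Suc Nadd prime[OF that] by simp
    qed (simp add: N0)
    have "(\<Sum>R\<in>T. frag_cmul (Poly_Mapping.lookup D R) (frag_of R)) \<in> N" if "finite T" "T \<subseteq> prime_divisors X" for T
      using that
    proof (induction T rule: finite_induct)
      case (insert R T)
      have "frag_cmul (int (nat (Poly_Mapping.lookup D R))) (frag_of R) \<in> N" using mul insert by blast
      then show ?case using insert D(2)[of R] Nadd by simp
    qed (simp add: N0)
    from this[OF _ D(1)] have "(\<Sum>R\<in>Poly_Mapping.keys D. frag_cmul (Poly_Mapping.lookup D R) (frag_of R)) \<in> N" by simp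
    then show ?thesis using frag_expansion[of D] by (simp add: frag_extend_def)
  qed
  fix \<alpha> assume "\<alpha> \<in> effective_classes X"
  then show "\<alpha> \<in> ?M" using eff unfolding effective_classes_iff by (auto simp: N_def)
qed

theorem effective_monoid: "effective_classes X = submonoid_generated (Cl X) (cl ` Gens)"
  using generated_subset_effective effective_subset_generated by (rule subset_antisym[rotated])

section \<open>The effective cone\<close>

text \<open>
  Linear combinations, with nonnegative coefficients if \<open>pos\<close> is set; the two cases are used for
  the cone generated by effective divisors and for the space spanned by principal divisors.
\<close>

definition combinations :: "bool \<Rightarrow> 'b set \<Rightarrow> ('b \<Rightarrow> 'k ambient set \<Rightarrow> real) \<Rightarrow> ('k ambient set \<Rightarrow> real) set" where
  "combinations pos S \<phi> = {\<lambda>R. \<Sum>x\<in>T. c x * \<phi> x R | T c. finite T \<and> T \<subseteq> S \<and> (pos \<longrightarrow> (\<forall>x\<in>T. 0 \<le> c x))}"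

lemma combinations_add:
  assumes "g \<in> combinations pos S \<phi>" "h \<in> combinations pos S \<phi>"
  shows "(\<lambda>R. g R + h R) \<in> combinations pos S \<phi>"
proof -
  obtain T c T' c' where *: "g = (\<lambda>R. \<Sum>x\<in>T. c x * \<phi> x R)" "finite T" "T \<subseteq> S" "pos \<longrightarrow> (\<forall>x\<in>T. 0 \<le> c x)"
    "h = (\<lambda>R. \<Sum>x\<in>T'. c' x * \<phi> x R)" "finite T'" "T' \<subseteq> S" "pos \<longrightarrow> (\<forall>x\<in>T'. 0 \<le> c' x)"
    using assms unfolding combinations_def by blast
  define d where "d x = (if x \<in> T then c x else 0) + (if x \<in> T' then c' x else 0)" for x
  have "g R + h R = (\<Sum>x\<in>T \<union> T'. d x * \<phi> x R)" for R
  proof -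
    have "g R = (\<Sum>x\<in>T \<union> T'. (if x \<in> T then c x else 0) * \<phi> x R)"
      unfolding *(1) by (rule sum.mono_neutral_cong_left) (use * in auto)
    moreover have "h R = (\<Sum>x\<in>T \<union> T'. (if x \<in> T' then c' x else 0) * \<phi> x R)"
      unfolding *(5) by (rule sum.mono_neutral_cong_left) (use * in auto)
    ultimately show ?thesis by (simp add: d_def distrib_right sum.distrib)
  qed
  moreover have "pos \<longrightarrow> (\<forall>x\<in>T \<union> T'. 0 \<le> d x)" using * by (auto simp: d_def)
  ultimately show ?thesis unfolding combinations_def using *(2,3,6,7)
    by (intro CollectI exI[of _ "T \<union> T'"] exI[of _ d]) auto
qed

lemma combinations_scale:
  assumes "g \<in> combinations pos S \<phi>" "pos \<longrightarrow> 0 \<le> a"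
  shows "(\<lambda>R. a * g R) \<in> combinations pos S \<phi>"
proof -
  obtain T c where *: "g = (\<lambda>R. \<Sum>x\<in>T. c x * \<phi> x R)" "finite T" "T \<subseteq> S" "pos \<longrightarrow> (\<forall>x\<in>T. 0 \<le> c x)"
    using assms unfolding combinations_def by blast
  then have "(\<lambda>R. a * g R) = (\<lambda>R. \<Sum>x\<in>T. (a * c x) * \<phi> x R)" by (simp add: sum_distrib_left mult.assoc)
  then show ?thesis unfolding combinations_def using * assms(2)
    by (intro CollectI exI[of _ T] exI[of _ "\<lambda>x. a * c x"]) auto
qed

lemma combinations_0: "(\<lambda>R. 0) \<in> combinations pos S \<phi>"
  unfolding combinations_def by (intro CollectI exI[of _ "{}"]) auto

lemma combinations_incl: "x \<in> S \<Longrightarrow> \<phi> x \<in> combinations pos S \<phi>"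
  unfolding combinations_def by (intro CollectI exI[of _ "{x}"] exI[of _ "\<lambda>_. 1"]) auto

abbreviation RP :: "('k ambient set \<Rightarrow> real) set" where
  "RP \<equiv> combinations False (L - {0}) (\<lambda>f. real_divisor (principal_divisor X f))"

abbreviation RE :: "('k ambient set \<Rightarrow> real) set" where
  "RE \<equiv> combinations True (effective_divisors X) real_divisor"

lemma RP_uminus: "p \<in> RP \<Longrightarrow> (\<lambda>R. - p R) \<in> RP"
  using combinations_scale[of p False _ _ "- 1"] by simp

lemma real_divisor_class_eq: "real_divisor_class X D = {\<lambda>R. D R + p R | p. p \<in> RP}"
proof (rule Set.set_eqI)
  fix h
  show "h \<in> real_divisor_class X D \<longleftrightarrow> h \<in> {\<lambda>R. D R + p R | p. p \<in> RP}"
  proof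
    assume "h \<in> real_divisor_class X D"
    then obtain F c where h: "h = (\<lambda>R. D R + (\<Sum>f\<in>F. c f * real_divisor (principal_divisor X f) R))" "finite F" "F \<subseteq> L - {0}"
      unfolding real_divisor_class_def function_field_X by blast
    then have "(\<lambda>R. \<Sum>f\<in>F. c f * real_divisor (principal_divisor X f) R) \<in> RP" unfolding combinations_def by blast
    then show "h \<in> {\<lambda>R. D R + p R | p. p \<in> RP}" using h(1) by (intro CollectI exI conjI)
  next
    assume "h \<in> {\<lambda>R. D R + p R | p. p \<in> RP}"
    then obtain p where p: "h = (\<lambda>R. D R + p R)" "p \<in> RP" by blast
    then obtain F c where "p = (\<lambda>R. \<Sum>f\<in>F. c f * real_divisor (principal_divisor X f) R)" "finite F" "F \<subseteq> L - {0}"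
      unfolding combinations_def by blast
    then show "h \<in> real_divisor_class X D" unfolding real_divisor_class_def function_field_X p(1) by blast
  qed
qed

lemma effective_cone_iff:
  "real_divisor_class X D \<in> effective_cone X \<longleftrightarrow> (\<exists>g\<in>RE. \<exists>p\<in>RP. D = (\<lambda>R. g R + p R))"
proof
  assume "real_divisor_class X D \<in> effective_cone X"
  then obtain g where g: "g \<in> RE" "real_divisor_class X D = real_divisor_class X g"
    unfolding effective_cone_def combinations_def by auto
  have "D \<in> real_divisor_class X D"
    unfolding real_divisor_class_eq using combinations_0 by force
  then show "\<exists>g\<in>RE. \<exists>p\<in>RP. D = (\<lambda>R. g R + p R)" using g unfolding g(2) real_divisor_class_eq by blast
next
  assume "\<exists>g\<in>RE. \<exists>p\<in>RP. D = (\<lambda>R. g R + p R)"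
  then obtain g p where g: "g \<in> RE" "p \<in> RP" "D = (\<lambda>R. g R + p R)" by blast
  have "real_divisor_class X D = real_divisor_class X g"
  proof (rule Set.set_eqI)
    fix h
    show "h \<in> real_divisor_class X D \<longleftrightarrow> h \<in> real_divisor_class X g"
    proof
      assume "h \<in> real_divisor_class X D"
      then obtain q where q: "q \<in> RP" "h = (\<lambda>R. D R + q R)" unfolding real_divisor_class_eq by blast
      then have "h = (\<lambda>R. g R + (p R + q R))" by (simp add: g(3) add.assoc)
      then show "h \<in> real_divisor_class X g" unfolding real_divisor_class_eq
        by (intro CollectI exI[of _ "\<lambda>R. p R + q R"] conjI combinations_add[OF g(2) q(1)])
    next
      assume "h \<in> real_divisor_class X g"
      then obtain q where q: "q \<in> RP" "h = (\<lambda>R. g R + q R)" unfolding real_divisor_class_eq by blast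
      then have "h = (\<lambda>R. D R + (q R + - p R))" by (simp add: g(3))
      then show "h \<in> real_divisor_class X D" unfolding real_divisor_class_eq
        by (intro CollectI exI[of _ "\<lambda>R. q R + - p R"] conjI combinations_add[OF q(1) RP_uminus[OF g(2)]])
    qed
  qed
  moreover have "real_divisor_class X g \<in> effective_cone X"
    using g(1) unfolding effective_cone_def combinations_def by auto
  ultimately show "real_divisor_class X D \<in> effective_cone X" by simp
qed

text \<open>
  The real divisors whose class is in the effective cone (\<open>effective_cone_iff\<close>).
\<close>

definition RN :: "('k ambient set \<Rightarrow> real) set" where
  "RN = {D. \<exists>g\<in>RE. \<exists>p\<in>RP. D = (\<lambda>R. g R + p R)}"

lemma RN_I: "g \<in> RE \<Longrightarrow> p \<in> RP \<Longrightarrow> D = (\<lambda>R. g R + p R) \<Longrightarrow> D \<in> RN"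
  unfolding RN_def by blast

lemma RN_add: "D \<in> RN \<Longrightarrow> D' \<in> RN \<Longrightarrow> (\<lambda>R. D R + D' R) \<in> RN"
proof -
  assume "D \<in> RN" "D' \<in> RN"
  then obtain g p g' p' where *: "g \<in> RE" "p \<in> RP" "D = (\<lambda>R. g R + p R)" "g' \<in> RE" "p' \<in> RP" "D' = (\<lambda>R. g' R + p' R)"
    unfolding RN_def by blast
  have "(\<lambda>R. D R + D' R) = (\<lambda>R. (g R + g' R) + (p R + p' R))" by (simp add: * algebra_simps)
  then show ?thesis by (rule RN_I[OF combinations_add[OF *(1,4)] combinations_add[OF *(2,5)]])
qed

lemma RN_scale: "D \<in> RN \<Longrightarrow> 0 \<le> a \<Longrightarrow> (\<lambda>R. a * D R) \<in> RN"
proof -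
  assume "D \<in> RN" and a: "0 \<le> a"
  then obtain g p where *: "g \<in> RE" "p \<in> RP" "D = (\<lambda>R. g R + p R)"
    unfolding RN_def by blast
  have "(\<lambda>R. a * D R) = (\<lambda>R. a * g R + a * p R)" by (simp add: * algebra_simps)
  then show ?thesis using combinations_scale[OF *(1), of a] combinations_scale[OF *(2), of a] a by (intro RN_I) auto
qed

lemma RN_0: "(\<lambda>R. 0) \<in> RN"
  by (rule RN_I[OF combinations_0 combinations_0]) simp

lemma RN_sum: "(\<And>x. x \<in> J \<Longrightarrow> f x \<in> RN) \<Longrightarrow> (\<lambda>R. \<Sum>x\<in>J. f x R) \<in> RN"
  by (induction J rule: infinite_finite_induct) (auto intro: RN_0 RN_add)

lemma Gens_RN: "D \<in> Gens \<Longrightarrow> real_divisor D \<in> RN"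
proof -
  assume "D \<in> Gens"
  then obtain D' where D': "D' \<in> effective_divisors X" "D' - D \<in> PD" using Gens_equiv_effective by blast
  then obtain f where f: "f \<in> L - {0}" "D' - D = principal_divisor X f"
    by (auto simp: principal_divisors_def function_field_X)
  have "real_divisor D = (\<lambda>R. real_divisor D' R + - real_divisor (principal_divisor X f) R)"
    by (simp add: real_divisor_def fun_eq_iff lookup_minus flip: f(2))
  then show ?thesis by (rule RN_I[OF combinations_incl[OF D'(1)] RP_uminus[OF combinations_incl[OF f(1)]]])
qed

lemma real_divisor_minus: "real_divisor (D - D') R = real_divisor D R - real_divisor D' R"
  and real_divisor_sum: "real_divisor (sum f J) R = (\<Sum>x\<in>J. real_divisor (f x) R)"
  by (simp_all add: real_divisor_def lookup_minus lookup_sum)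

text \<open>
  Negative \<open>m\<^sub>i\<close> are replaced by \<open>0\<close>, at the cost of adding multiples of \<open>E\<^sub>i\<close>. The sum of the
  positive \<open>m\<^sub>i\<close> is bounded as required for the splitting: if there are at least \<open>n + 1\<close> of them,
  by assumption, and otherwise because each is at most \<open>d\<^sub>1 + d\<^sub>2\<close>.
\<close>

lemma inequalities_imp_effective:
  fixes d1 d2 :: real and mm :: "nat \<Rightarrow> real"
  assumes d: "0 \<le> d1" "0 \<le> d2" and I1: "\<And>i. i \<in> {1..r} \<Longrightarrow> mm i \<le> d1 + d2"
    and I2: "\<And>J. J \<subseteq> {1..r} \<Longrightarrow> card J \<in> {n + 1, n + 2} \<Longrightarrow> (\<Sum>i\<in>J. mm i) \<le> real n * d1 + real (n + 1) * d2"
  shows "(\<lambda>R. d1 * real_divisor H1 R + d2 * real_divisor H2 R - (\<Sum>i\<in>{1..r}. mm i * real_divisor (Ex i) R)) \<in> RN"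
proof -
  let ?S = "{1..r}"
  have ExN: "real_divisor (Ex l) \<in> RN" if "l \<in> ?S" for l using that Gens_RN unfolding Gens_def by blast
  have sub: "\<exists>J'. J \<subseteq> J' \<and> J' \<subseteq> ?S \<and> card J' = k" if "J \<subseteq> ?S" "card J \<le> k" "k \<le> n + 2" for J k
    using exists_subset_between[of J k ?S] that r_eq by auto
  have G: "(\<lambda>R. real_divisor H R - (\<Sum>i\<in>J. real_divisor (Ex i) R)) \<in> RN"
    if J: "J \<subseteq> ?S" "card J \<le> k" "k \<le> n + 2" and H: "\<And>J. J \<subseteq> ?S \<Longrightarrow> card J = k \<Longrightarrow> H - (\<Sum>i\<in>J. Ex i) \<in> Gens" for H J k
  proof -
    obtain J' where J': "J \<subseteq> J'" "J' \<subseteq> ?S" "card J' = k" using sub[OF J] by auto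
    have "real_divisor (H - (\<Sum>i\<in>J'. Ex i)) \<in> RN" using H[OF J'(2,3)] by (rule Gens_RN)
    moreover have "(\<lambda>R. \<Sum>i\<in>J' - J. real_divisor (Ex i) R) \<in> RN" using J' ExN by (intro RN_sum) blast
    ultimately have "(\<lambda>R. real_divisor (H - (\<Sum>i\<in>J'. Ex i)) R + (\<Sum>i\<in>J' - J. real_divisor (Ex i) R)) \<in> RN" by (rule RN_add)
    moreover have "real_divisor (H - (\<Sum>i\<in>J'. Ex i)) R + (\<Sum>i\<in>J' - J. real_divisor (Ex i) R)
      = real_divisor H R - (\<Sum>i\<in>J. real_divisor (Ex i) R)" for R
      using sum.subset_diff[OF J'(1) finite_subset[OF J'(2)], of "\<lambda>i. real_divisor (Ex i) R"]
      by (simp add: real_divisor_minus real_divisor_sum)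
    ultimately show ?thesis by simp
  qed
  define Q where "Q d1 d2 mm \<longleftrightarrow>
    (\<lambda>R. d1 * real_divisor H1 R + d2 * real_divisor H2 R - (\<Sum>i\<in>?S. mm i * real_divisor (Ex i) R)) \<in> RN"
    for d1 d2 :: real and mm :: "nat \<Rightarrow> real"
  have step: "(\<Sum>l\<in>?S. (if l \<in> J then mm l + \<epsilon> else mm l) * real_divisor (Ex l) R)
      = (\<Sum>l\<in>?S. mm l * real_divisor (Ex l) R) + \<epsilon> * (\<Sum>i\<in>J. real_divisor (Ex i) R)" if "J \<subseteq> ?S" for J \<epsilon> mm R
  proof -
    have "(\<Sum>l\<in>?S. (if l \<in> J then mm l + \<epsilon> else mm l) * real_divisor (Ex l) R)
      = (\<Sum>l\<in>?S. mm l * real_divisor (Ex l) R + (if l \<in> J then \<epsilon> * real_divisor (Ex l) R else 0))"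
      by (rule sum.cong) (auto simp: distrib_right)
    also have "\<dots> = (\<Sum>l\<in>?S. mm l * real_divisor (Ex l) R) + (\<Sum>l\<in>J. \<epsilon> * real_divisor (Ex l) R)"
      using that by (simp add: sum.distrib sum.If_cases Int_absorb1)
    finally show ?thesis by (simp add: sum_distrib_left)
  qed
  define m' where "m' l = (if l \<in> ?S then max 0 (mm l) else 0)" for l
  have "Q d1 d2 m'"
  proof (rule split_into_indicators[of ?S Q n])
    show "Q 0 0 (\<lambda>_. 0)" by (simp add: Q_def RN_0)
    fix \<epsilon> d1 d2 :: real and J and mm :: "nat \<Rightarrow> real"
    assume e: "0 \<le> \<epsilon>" "J \<subseteq> ?S" and q: "Q d1 d2 mm"
    { assume c: "card J \<le> n"
      have "(\<lambda>R. real_divisor H1 R - (\<Sum>i\<in>J. real_divisor (Ex i) R)) \<in> RN"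
        by (rule G[OF e(2) c]) (auto simp: Gens_def)
      from RN_add[OF q[unfolded Q_def] RN_scale[OF this e(1)]]
      show "Q (d1 + \<epsilon>) d2 (\<lambda>i. if i \<in> J then mm i + \<epsilon> else mm i)"
        unfolding Q_def step[OF e(2)] by (simp add: algebra_simps) }
    { assume c: "card J \<le> n + 1"
      have "(\<lambda>R. real_divisor H2 R - (\<Sum>i\<in>J. real_divisor (Ex i) R)) \<in> RN"
        by (rule G[OF e(2) c]) (auto simp: Gens_def)
      from RN_add[OF q[unfolded Q_def] RN_scale[OF this e(1)]]
      show "Q d1 (d2 + \<epsilon>) (\<lambda>i. if i \<in> J then mm i + \<epsilon> else mm i)"
        unfolding Q_def step[OF e(2)] by (simp add: algebra_simps) }
  next
    let ?J = "{i \<in> ?S. 0 < mm i}"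
    have J: "?J \<subseteq> ?S" "finite ?J" by auto
    have eq: "(\<Sum>i\<in>?S. m' i) = (\<Sum>i\<in>?J. mm i)"
      by (rule sum.mono_neutral_cong_right) (auto simp: m'_def max_def)
    have "card ?J \<le> card ?S" by (rule card_mono) auto
    then have "card ?J \<le> n + 2" using r_eq by simp
    then consider "card ?J \<in> {n + 1, n + 2}" | "card ?J \<le> n" by fastforce
    then show "(\<Sum>i\<in>?S. m' i) \<le> of_nat n * d1 + of_nat (n + 1) * d2"
    proof cases
      case 1
      then show ?thesis unfolding eq using I2[OF J(1)] by simp
    next
      case 2
      have "(\<Sum>i\<in>?J. mm i) \<le> of_nat (card ?J) * (d1 + d2)" by (rule sum_bounded_above) (use I1 in auto)
      also have "\<dots> \<le> real n * (d1 + d2)" using 2 d by (intro mult_right_mono) auto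
      finally show ?thesis unfolding eq using d by (simp add: algebra_simps)
    qed
  qed (use d I1 in \<open>auto simp: m'_def\<close>)
  then have 1: "(\<lambda>R. d1 * real_divisor H1 R + d2 * real_divisor H2 R - (\<Sum>i\<in>?S. m' i * real_divisor (Ex i) R)) \<in> RN"
    by (simp add: Q_def)
  have 2: "(\<lambda>R. \<Sum>i\<in>?S. (m' i - mm i) * real_divisor (Ex i) R) \<in> RN"
    by (intro RN_sum RN_scale ExN) (auto simp: m'_def)
  from RN_add[OF 1 2] show ?thesis
    by (simp add: algebra_simps sum_subtractf)
qed

text \<open>
  The functional \<open>x d\<^sub>1 + y d\<^sub>2 - \<Sum> m\<^sub>i\<close>, with the sum over \<open>J\<close>, vanishes on principal divisors.
  It is nonnegative on strict transforms by assumption, and its value on an exceptional divisor is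
  \<open>0\<close> or \<open>1\<close>. So it is nonnegative on the effective cone.
\<close>

lemma effective_imp_inequality:
  fixes d1 d2 x y :: real and mm :: "nat \<Rightarrow> real"
  assumes D: "(\<lambda>R. d1 * real_divisor H1 R + d2 * real_divisor H2 R - (\<Sum>i\<in>{1..r}. mm i * real_divisor (Ex i) R)) \<in> RN"
    and J: "J \<subseteq> {1..r}"
    and pos: "\<And>a b F. bih a b F \<Longrightarrow> F \<noteq> 0 \<Longrightarrow> (\<Sum>i\<in>J. real (mult_pt i F)) \<le> x * real a + y * real b"
  shows "(\<Sum>i\<in>J. mm i) \<le> x * d1 + y * d2"
proof -
  let ?S = "{1..r}"
  define \<psi> where "\<psi> R = x * wt1 R + y * wt2 R - (\<Sum>i\<in>J. wtm i R)" for R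
  have fJ: "finite J" using J finite_subset by blast
  have pair\<psi>: "pair \<psi> D = x * pair wt1 D + y * pair wt2 D - (\<Sum>i\<in>J. pair (wtm i) D)" for D
    unfolding \<psi>_def by (rule pair_lin)
  have JS: "i \<in> ?S" if "i \<in> J" for i using that J by blast
  have pF: "pair \<psi> (pdiv F) = x * real a + y * real b" if "bih a b F" "F \<noteq> 0" for a b F
    unfolding pair\<psi> using pair_wt[OF that] JS by simp
  have psi0: "0 \<le> \<psi> R" if R: "R \<in> prime_divisors X" for R
    using R
  proof (cases rule: prime_divisors_cases)
    case prime
    then obtain d e where p: "bprime d e (rep R)" "R = R_prime (rep R)" using rep by blast
    have bp: "bih d e (rep R)" "rep R \<noteq> 0" using p(1) bprime_prime[OF p(1)] by (auto simp: bprime_def prime_elem_def)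
    have "wd wx (rep R) = d" "wd wy (rep R) = e" using bp wd_homog by (auto simp: bih_def)
    then show ?thesis using pos[OF bp] prime by (simp add: \<psi>_def wt1_def wt2_def wtm_def)
  next
    case (pt l)
    have "(\<Sum>i\<in>J. wtm i R) \<le> 0" using pt(3) by (intro sum_nonpos) (simp add: wtm_def)
    then show ?thesis using pt(3) by (simp add: \<psi>_def wt1_def wt2_def)
  qed
  have pE: "pair \<psi> (Ex l) = (if l \<in> J then 1 else 0)" if l: "l \<in> ?S" for l
  proof -
    have "(\<Sum>i\<in>J. wtm i (R_pt l)) = (\<Sum>i\<in>J. if i = l then - 1 else 0)"
      using l JS R_pt_notin_PP[OF l] R_pt_eq_iff[OF l] by (intro sum.cong) (auto simp: wtm_def)
    also have "\<dots> = (if l \<in> J then - 1 else 0)" using fJ by simp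
    finally show ?thesis using R_pt_notin_PP[OF l] by (simp add: pair_frag_of \<psi>_def wt1_def wt2_def)
  qed
  have pP: "pair \<psi> (principal_divisor X f) = 0" if f: "f \<in> L - {0}" for f
  proof -
    have "principal_divisor X f \<in> PD" using f by (auto simp: principal_divisors_def function_field_X)
    then obtain a b G H where "bih a b G" "bih a b H" "G \<noteq> 0" "H \<noteq> 0" "principal_divisor X f = pdiv G - pdiv H"
      unfolding PD_iff by blast
    then show ?thesis using pF by (simp add: pair_diff)
  qed
  obtain g p where gp: "g \<in> RE" "p \<in> RP"
    "\<And>R. d1 * real_divisor H1 R + d2 * real_divisor H2 R - (\<Sum>i\<in>?S. mm i * real_divisor (Ex i) R) = g R + p R"
    using D unfolding RN_def by (auto simp: fun_eq_iff)
  obtain Ds c where g: "g = (\<lambda>R. \<Sum>D\<in>Ds. c D * real_divisor D R)" "finite Ds" "Ds \<subseteq> effective_divisors X" "\<forall>D\<in>Ds. 0 \<le> c D"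
    using gp(1) unfolding combinations_def by auto
  obtain Fs c' where p: "p = (\<lambda>R. \<Sum>f\<in>Fs. c' f * real_divisor (principal_divisor X f) R)" "finite Fs" "Fs \<subseteq> L - {0}"
    using gp(2) unfolding combinations_def by auto
  define T where "T = Poly_Mapping.keys H1 \<union> Poly_Mapping.keys H2 \<union> R_pt ` ?S \<union> (\<Union>D\<in>Ds. Poly_Mapping.keys D)
    \<union> (\<Union>f\<in>Fs. Poly_Mapping.keys (principal_divisor X f))"
  have T: "finite T" using g(2) p(2) by (simp add: T_def)
  have pT: "(\<Sum>R\<in>T. real_divisor D R * \<psi> R) = pair \<psi> D" if "Poly_Mapping.keys D \<subseteq> T" for D
    using pair_superset[OF T that] by simp
  have sw: "(\<Sum>R\<in>T. (\<Sum>x\<in>Y. c x * real_divisor (\<phi> x) R) * \<psi> R) = (\<Sum>x\<in>Y. c x * pair \<psi> (\<phi> x))"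
    if "\<And>x. x \<in> Y \<Longrightarrow> Poly_Mapping.keys (\<phi> x) \<subseteq> T" for Y c and \<phi> :: "'y \<Rightarrow> ('k ambient set \<Rightarrow>\<^sub>0 int)"
  proof -
    have "(\<Sum>R\<in>T. (\<Sum>x\<in>Y. c x * real_divisor (\<phi> x) R) * \<psi> R) = (\<Sum>x\<in>Y. c x * (\<Sum>R\<in>T. real_divisor (\<phi> x) R * \<psi> R))"
      unfolding sum_distrib_right sum_distrib_left by (subst sum.swap) (simp add: mult.assoc)
    also have "\<dots> = (\<Sum>x\<in>Y. c x * pair \<psi> (\<phi> x))" using pT that by (intro sum.cong) auto
    finally show ?thesis .
  qed
  have H: "pair \<psi> H1 = x" "pair \<psi> H2 = y"
    using pF[OF bih_xv, of 0] pF[OF bih_yv, of 0] by auto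
  have "(\<Sum>R\<in>T. (d1 * real_divisor H1 R + d2 * real_divisor H2 R - (\<Sum>i\<in>?S. mm i * real_divisor (Ex i) R)) * \<psi> R)
    = d1 * (\<Sum>R\<in>T. real_divisor H1 R * \<psi> R) + d2 * (\<Sum>R\<in>T. real_divisor H2 R * \<psi> R)
      - (\<Sum>R\<in>T. (\<Sum>i\<in>?S. mm i * real_divisor (Ex i) R) * \<psi> R)"
    by (simp add: left_diff_distrib distrib_right sum.distrib sum_subtractf sum_distrib_left mult.assoc)
  also have "\<dots> = d1 * x + d2 * y - (\<Sum>i\<in>?S. mm i * pair \<psi> (Ex i))"
  proof -
    have "(\<Sum>R\<in>T. (\<Sum>i\<in>?S. mm i * real_divisor (Ex i) R) * \<psi> R) = (\<Sum>i\<in>?S. mm i * pair \<psi> (Ex i))"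
      by (rule sw) (auto simp: T_def)
    moreover have "(\<Sum>R\<in>T. real_divisor H1 R * \<psi> R) = x" "(\<Sum>R\<in>T. real_divisor H2 R * \<psi> R) = y"
      using pT[of H1] pT[of H2] H by (auto simp: T_def)
    ultimately show ?thesis by simp
  qed
  also have "(\<Sum>i\<in>?S. mm i * pair \<psi> (Ex i)) = (\<Sum>i\<in>J. mm i)"
    by (rule sum.mono_neutral_cong_right) (use pE J JS in auto)
  finally have lhs: "(\<Sum>R\<in>T. (d1 * real_divisor H1 R + d2 * real_divisor H2 R - (\<Sum>i\<in>?S. mm i * real_divisor (Ex i) R)) * \<psi> R)
    = d1 * x + d2 * y - (\<Sum>i\<in>J. mm i)" .
  have "(\<Sum>R\<in>T. (g R + p R) * \<psi> R) = (\<Sum>R\<in>T. (\<Sum>D\<in>Ds. c D * real_divisor D R) * \<psi> R)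
     + (\<Sum>R\<in>T. (\<Sum>f\<in>Fs. c' f * real_divisor (principal_divisor X f) R) * \<psi> R)"
    by (simp add: g(1) p(1) distrib_right sum.distrib)
  also have "(\<Sum>R\<in>T. (\<Sum>D\<in>Ds. c D * real_divisor D R) * \<psi> R) = (\<Sum>D\<in>Ds. c D * pair \<psi> D)"
    by (rule sw[of Ds "\<lambda>D. D" c]) (auto simp: T_def)
  also have "(\<Sum>R\<in>T. (\<Sum>f\<in>Fs. c' f * real_divisor (principal_divisor X f) R) * \<psi> R) = (\<Sum>f\<in>Fs. c' f * pair \<psi> (principal_divisor X f))"
    by (rule sw) (auto simp: T_def)
  also have "\<dots> = 0" using pP p(3) by (intro sum.neutral) auto
  finally have "(\<Sum>R\<in>T. (g R + p R) * \<psi> R) = (\<Sum>D\<in>Ds. c D * pair \<psi> D)" by simp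
  moreover have "0 \<le> (\<Sum>D\<in>Ds. c D * pair \<psi> D)"
    using g(3,4) pair_nonneg[OF _ psi0] by (intro sum_nonneg mult_nonneg_nonneg) auto
  ultimately have "0 \<le> d1 * x + d2 * y - (\<Sum>i\<in>J. mm i)" using lhs gp(3) by simp
  then show ?thesis by (simp add: mult.commute)
qed

text \<open>
  The necessity of the inequalities is \<open>effective_imp_inequality\<close> for \<open>(x, y, J)\<close> equal to
  \<open>(1, 0, {})\<close>, \<open>(0, 1, {})\<close>, \<open>(1, 1, {i})\<close> and \<open>(n, n + 1, J)\<close>.
\<close>

theorem effective_cone_inequalities:
  fixes d1 d2 :: real and mm :: "nat \<Rightarrow> real"
  shows "real_divisor_class X (\<lambda>R. d1 * real_divisor H1 R + d2 * real_divisor H2 R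
                  - (\<Sum>i\<in>{1..r}. mm i * real_divisor (Ex i) R)) \<in> effective_cone X
     \<longleftrightarrow> d1 \<ge> 0 \<and> d2 \<ge> 0 \<and> (\<forall>i\<in>{1..r}. d1 + d2 \<ge> mm i) \<and>
          (\<forall>I. I \<subseteq> {1..r} \<and> card I \<in> {n + 1, n + 2} \<longrightarrow>
            real n * d1 + real (n + 1) * d2 \<ge> (\<Sum>i\<in>I. mm i))"
    (is "?L \<longleftrightarrow> ?R")
proof
  let ?D = "\<lambda>R. d1 * real_divisor H1 R + d2 * real_divisor H2 R - (\<Sum>i\<in>{1..r}. mm i * real_divisor (Ex i) R)"
  assume ?L
  then have D: "?D \<in> RN" unfolding effective_cone_iff RN_def by simp
  note ineq = effective_imp_inequality[OF D]
  show ?R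
  proof (intro conjI ballI allI impI)
    show "0 \<le> d1" using ineq[of "{}" 1 0] by simp
    show "0 \<le> d2" using ineq[of "{}" 0 1] by simp
    fix i assume i: "i \<in> {1..r}"
    have "(\<Sum>i\<in>{i}. mm i) \<le> 1 * d1 + 1 * d2"
    proof (rule ineq)
      fix a b F assume F: "bih a b F" "F \<noteq> 0"
      have "mult_pt i F \<le> a + b" using ptmult_le_tdeg[OF F(2), of "pcoord (P i)"] bih_tdeg[OF F] by simp
      then have "real (mult_pt i F) \<le> real (a + b)" by (simp only: of_nat_le_iff)
      then show "(\<Sum>i\<in>{i}. real (mult_pt i F)) \<le> 1 * real a + 1 * real b" by simp
    qed (use i in simp)
    then show "mm i \<le> d1 + d2" by simp
  next
    fix J assume J: "J \<subseteq> {1..r} \<and> card J \<in> {n + 1, n + 2}"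
    show "(\<Sum>i\<in>J. mm i) \<le> real n * d1 + real (n + 1) * d2"
    proof (rule ineq)
      fix a b F assume F: "bih a b F" "F \<noteq> 0"
      have "(\<Sum>i\<in>J. mult_pt i F) \<le> (\<Sum>i\<in>{1..r}. mult_pt i F)" using J by (intro sum_mono2) auto
      also have "\<dots> \<le> n * a + (n + 1) * b" by (rule curve[OF F])
      finally have "real (\<Sum>i\<in>J. mult_pt i F) \<le> real (n * a + (n + 1) * b)" by (simp only: of_nat_le_iff)
      then show "(\<Sum>i\<in>J. real (mult_pt i F)) \<le> real n * real a + real (n + 1) * real b" by (simp add: algebra_simps)
    qed (use J in simp)
  qed
next
  assume ?R
  then show ?L unfolding effective_cone_iff RN_def[symmetric]
    using inequalities_imp_effective[of d1 d2 mm] unfolding RN_def by blast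
qed

end

section \<open>Points in general position\<close>

lemma (in blowup_points) bih_sum: "(\<And>i. i \<in> S \<Longrightarrow> bih a b (f i)) \<Longrightarrow> bih a b (sum f S)"
  by (induction S rule: infinite_finite_induct) (auto intro: bih_0 bih_add)

lemma discriminant_dual_bases:
  fixes P :: "nat \<Rightarrow> 'k::field point"
  assumes D: "discriminant n P \<noteq> 0"
  shows "k \<in> {1..n + 2} \<Longrightarrow> \<exists>b. \<forall>l\<in>{1..n + 2} - {k}. \<forall>l'\<in>{1..n + 2} - {k}.
      (\<Sum>c<n + 1. fst (P l) c * b l' c) = (if l = l' then 1 else 0)"
    and "k \<in> {1..n + 2} \<Longrightarrow> \<exists>s. \<forall>d<n + 1. q d = (\<Sum>l\<in>{1..n + 2} - {k}. s l * fst (P l) d)"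
    and "\<exists>b. \<forall>l\<in>{1..n + 2}. \<forall>l'\<in>{1..n + 2}. (\<Sum>c<n + 2. snd (P l) c * b l' c) = (if l = l' then 1 else 0)"
    and "\<exists>s. \<forall>d<n + 2. q d = (\<Sum>l\<in>{1..n + 2}. s l * snd (P l) d)"
proof -
  have x: "minor_x n P k \<noteq> 0" if "k \<in> {1..n + 2}" for k
  proof -
    have "(\<Prod>k\<in>{1..n + 2}. minor_x n P k) \<noteq> 0" using D unfolding discriminant_def by (metis mult_zero_left)
    then show ?thesis using that unfolding prod_zero_iff[OF finite_atLeastAtMost] by blast
  qed
  have y: "minor_y n P \<noteq> 0" using D by (auto simp: discriminant_def)
  show "\<exists>b. \<forall>l\<in>{1..n + 2} - {k}. \<forall>l'\<in>{1..n + 2} - {k}.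
      (\<Sum>c<n + 1. fst (P l) c * b l' c) = (if l = l' then 1 else 0)" if k: "k \<in> {1..n + 2}"
    by (rule dual_basis(1)[OF bij_skip[OF k], where w = "\<lambda>l. fst (P l)"]) (use x[OF k] in \<open>simp add: minor_x_def\<close>)
  show "\<exists>s. \<forall>d<n + 1. q d = (\<Sum>l\<in>{1..n + 2} - {k}. s l * fst (P l) d)" if k: "k \<in> {1..n + 2}"
    by (rule dual_basis(2)[OF bij_skip[OF k], where w = "\<lambda>l. fst (P l)"]) (use x[OF k] in \<open>simp add: minor_x_def\<close>)
  show "\<exists>b. \<forall>l\<in>{1..n + 2}. \<forall>l'\<in>{1..n + 2}. (\<Sum>c<n + 2. snd (P l) c * b l' c) = (if l = l' then 1 else 0)"
    by (rule dual_basis(1)[OF bij_Suc, where w = "\<lambda>l. snd (P l)"]) (use y in \<open>simp add: minor_y_def\<close>)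
  show "\<exists>s. \<forall>d<n + 2. q d = (\<Sum>l\<in>{1..n + 2}. s l * snd (P l) d)"
    by (rule dual_basis(2)[OF bij_Suc, where w = "\<lambda>l. snd (P l)"]) (use y in \<open>simp add: minor_y_def\<close>)
qed

text \<open>
  The last vector is a combination of the others, which form a basis. If a coefficient vanished,
  the vectors other than the corresponding one would be dependent.
\<close>

lemma discriminant_relation:
  fixes P :: "nat \<Rightarrow> 'k::field point"
  assumes D: "discriminant n P \<noteq> 0"
  shows "\<exists>\<alpha>. (\<forall>l\<in>{1..n + 2}. \<alpha> l \<noteq> 0) \<and> (\<forall>k\<le>n. (\<Sum>l\<in>{1..n + 2}. \<alpha> l * fst (P l) k) = 0)"
proof -
  let ?S = "{1..n + 2}" and ?o = "n + 2"
  have o: "?o \<in> ?S" by simp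
  obtain t where t: "\<And>d. d < n + 1 \<Longrightarrow> fst (P ?o) d = (\<Sum>l\<in>?S - {?o}. t l * fst (P l) d)"
    using discriminant_dual_bases(2)[OF D o, of "fst (P ?o)"] by blast
  have t0: "t l0 \<noteq> 0" if l0: "l0 \<in> ?S - {?o}" for l0
  proof
    assume 0: "t l0 = 0"
    obtain b where b: "\<And>l l'. l \<in> ?S - {l0} \<Longrightarrow> l' \<in> ?S - {l0} \<Longrightarrow>
      (\<Sum>c<n + 1. fst (P l) c * b l' c) = (if l = l' then 1 else 0)"
      using discriminant_dual_bases(1)[OF D, of l0] l0 by blast
    have "(1::'k) = (\<Sum>c<n + 1. fst (P ?o) c * b ?o c)" using b[of ?o ?o] l0 by auto
    also have "\<dots> = (\<Sum>c<n + 1. (\<Sum>l\<in>?S - {?o}. t l * fst (P l) c) * b ?o c)"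
      using t by (intro sum.cong) auto
    also have "\<dots> = (\<Sum>l\<in>?S - {?o}. t l * (\<Sum>c<n + 1. fst (P l) c * b ?o c))"
      unfolding sum_distrib_left sum_distrib_right by (subst sum.swap) (simp add: mult.assoc)
    also have "\<dots> = 0"
    proof (rule sum.neutral, rule ballI)
      fix l assume l: "l \<in> ?S - {?o}"
      show "t l * (\<Sum>c<n + 1. fst (P l) c * b ?o c) = 0"
      proof (cases "l = l0")
        case False
        then have "(\<Sum>c<n + 1. fst (P l) c * b ?o c) = 0" using b[of l ?o] l l0 by auto
        then show ?thesis by simp
      qed (simp add: 0)
    qed
    finally show False by simp
  qed
  define \<alpha> where "\<alpha> l = (if l = ?o then - 1 else t l)" for l
  have "(\<Sum>l\<in>?S. \<alpha> l * fst (P l) k) = 0" if k: "k \<le> n" for k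
  proof -
    have "(\<Sum>l\<in>?S. \<alpha> l * fst (P l) k) = \<alpha> ?o * fst (P ?o) k + (\<Sum>l\<in>?S - {?o}. \<alpha> l * fst (P l) k)"
      using o by (intro sum.remove) auto
    also have "(\<Sum>l\<in>?S - {?o}. \<alpha> l * fst (P l) k) = (\<Sum>l\<in>?S - {?o}. t l * fst (P l) k)"
      by (rule sum.cong) (auto simp: \<alpha>_def)
    also have "\<dots> = fst (P ?o) k" using t[of k] k by simp
    finally show ?thesis by (simp add: \<alpha>_def)
  qed
  moreover have "\<alpha> l \<noteq> 0" if "l \<in> ?S" for l using t0[of l] that by (auto simp: \<alpha>_def)
  ultimately show ?thesis by blast
qed

text \<open>
  The points are distinct because already the linearly independent vectors \<open>y(P\<^sub>l)\<close> are pairwise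
  not proportional.
\<close>

lemma blowup_points_of_discriminant:
  fixes P :: "nat \<Rightarrow> 'k::field point"
  assumes n: "1 \<le> n" and D: "discriminant n P \<noteq> 0" and P: "P \<in> configurations n (n + 1) (n + 2)"
  shows "blowup_points n (n + 1) (n + 2) P"
proof
  let ?S = "{1..n + 2}"
  show "1 \<le> n" "1 \<le> n + 1" using n by auto
  show "is_point n (n + 1) (P l)" if "l \<in> ?S" for l using P that by (auto simp: configurations_def)
  fix l l' assume l: "l \<in> ?S" "l' \<in> ?S" "l \<noteq> l'"
  obtain b where b: "\<And>l l'. l \<in> ?S \<Longrightarrow> l' \<in> ?S \<Longrightarrow> (\<Sum>c<n + 2. snd (P l) c * b l' c) = (if l = l' then 1 else 0)"
    using discriminant_dual_bases(3)[OF D] by blast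
  have "\<exists>k\<le>n + 1. \<exists>k'\<le>n + 1. snd (P l) k * snd (P l') k' \<noteq> snd (P l) k' * snd (P l') k"
  proof (rule ccontr)
    assume "\<not> ?thesis"
    then have eq: "snd (P l) k * snd (P l') k' = snd (P l) k' * snd (P l') k" if "k \<le> n + 1" "k' \<le> n + 1" for k k'
      using that by blast
    have 0: "snd (P l') k' = 0" if k': "k' \<le> n + 1" for k'
    proof -
      have "snd (P l') k' = (\<Sum>c<n + 2. snd (P l) c * b l c) * snd (P l') k'" using b[OF l(1) l(1)] by simp
      also have "\<dots> = (\<Sum>c<n + 2. (snd (P l) c * snd (P l') k') * b l c)"
        unfolding sum_distrib_right by (simp add: ac_simps)
      also have "\<dots> = (\<Sum>c<n + 2. (snd (P l) k' * snd (P l') c) * b l c)"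
        using eq k' by (intro sum.cong) auto
      also have "\<dots> = snd (P l) k' * (\<Sum>c<n + 2. snd (P l') c * b l c)"
        unfolding sum_distrib_left by (simp add: mult.assoc)
      also have "\<dots> = 0" using b[OF l(2,1)] l(3) by simp
      finally show ?thesis .
    qed
    have "(1::'k) = (\<Sum>c<n + 2. snd (P l') c * b l' c)" using b[OF l(2) l(2)] by simp
    also have "\<dots> = 0" using 0 by (intro sum.neutral) auto
    finally show False by simp
  qed
  then show "(\<exists>k\<le>n. \<exists>k'\<le>n. fst (P l) k * fst (P l') k' \<noteq> fst (P l) k' * fst (P l') k) \<or>
      (\<exists>k\<le>n + 1. \<exists>k'\<le>n + 1. snd (P l) k * snd (P l') k' \<noteq> snd (P l) k' * snd (P l') k)" by blast
qed

text \<open>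
  The hyperplanes through given points are elements of dual bases. For the \<open>x\<close>-coordinates, one of
  the two remaining points is omitted to obtain a basis, and the hyperplane is dual to the other
  one.
\<close>

lemma general_points_of_discriminant:
  fixes P :: "nat \<Rightarrow> 'k::field point"
  assumes inf: "infinite (UNIV :: 'k set)"
    and n: "1 \<le> n" and D: "discriminant n P \<noteq> 0" and P: "P \<in> configurations n (n + 1) (n + 2)"
  shows "general_points n (n + 1) (n + 2) P"
proof -
  interpret blowup_points n "n + 1" "n + 2" P by (rule blowup_points_of_discriminant[OF n D P])
  let ?S = "{1..n + 2}"
  have id: "rhom (\<lambda>c::'k. c)" by (rule rhom_id)
  note pe = peval_sum[OF id] peval_mult[OF id] peval_Cst[OF id] peval_Var[OF id]
  show ?thesis
  proof unfold_locales
    fix J assume J: "J \<subseteq> ?S" "card J = n"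
    have fJ: "finite J" using J(1) finite_subset by blast
    have "card (?S - J) = 2" using J fJ by (simp add: card_Diff_subset)
    then obtain o' l' where ol: "?S - J = {o', l'}" "o' \<noteq> l'" by (auto simp: card_2_iff)
    then have o: "o' \<in> ?S" "l' \<in> ?S - {o'}" "o' \<notin> J" "l' \<notin> J" by blast+
    obtain b where b: "\<And>l l'. l \<in> ?S - {o'} \<Longrightarrow> l' \<in> ?S - {o'} \<Longrightarrow>
      (\<Sum>c<n + 1. fst (P l) c * b l' c) = (if l = l' then 1 else 0)"
      using discriminant_dual_bases(1)[OF D o(1)] by blast
    define F :: "'k mpoly" where "F = (\<Sum>c<n + 1. Cst (b l' c) * xv c)"
    have ev: "peval (\<lambda>c. c) (pcoord (P l)) F = (if l = l' then 1 else 0)" if "l \<in> ?S - {o'}" for l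
      using b[OF that o(2)] unfolding F_def pe pcoord_simps by (simp only: mult.commute)
    have F0: "F \<noteq> 0" using ev[OF o(2)] by (auto simp: peval_def)
    have "bih 1 0 F" unfolding F_def by (intro bih_sum bih_Cst_mult bih_xv) simp
    moreover have "1 \<le> mult_pt l F" if "l \<in> J" for l
    proof -
      have "l \<in> ?S - {o'}" "l \<noteq> l'" using that J(1) o by auto
      then show ?thesis using ev[of l] ptmult_pos_iff[OF F0] by simp
    qed
    ultimately show "\<exists>F. bih 1 0 F \<and> F \<noteq> 0 \<and> (\<forall>l\<in>J. 1 \<le> mult_pt l F)" using F0 by blast
  next
    fix J assume J: "J \<subseteq> ?S" "card J = n + 1"
    have "J \<noteq> ?S" using J(2) by auto
    then obtain l' where l': "l' \<in> ?S" "l' \<notin> J" using J(1) by blast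
    obtain b where b: "\<And>l l'. l \<in> ?S \<Longrightarrow> l' \<in> ?S \<Longrightarrow>
      (\<Sum>c<n + 2. snd (P l) c * b l' c) = (if l = l' then 1 else 0)"
      using discriminant_dual_bases(3)[OF D] by blast
    define F :: "'k mpoly" where "F = (\<Sum>c<n + 2. Cst (b l' c) * yv c)"
    have ev: "peval (\<lambda>c. c) (pcoord (P l)) F = (if l = l' then 1 else 0)" if "l \<in> ?S" for l
      using b[OF that l'(1)] unfolding F_def pe pcoord_simps by (simp only: mult.commute)
    have F0: "F \<noteq> 0" using ev[OF l'(1)] by (auto simp: peval_def)
    have "bih 0 1 F" unfolding F_def by (intro bih_sum bih_Cst_mult bih_yv) simp
    moreover have "1 \<le> mult_pt l F" if "l \<in> J" for l
    proof -
      have "l \<in> ?S" "l \<noteq> l'" using that J(1) l' by auto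
      then show ?thesis using ev[of l] ptmult_pos_iff[OF F0] by simp
    qed
    ultimately show "\<exists>F. bih 0 1 F \<and> F \<noteq> 0 \<and> (\<forall>l\<in>J. 1 \<le> mult_pt l F)" using F0 by blast
  next
    fix a b F assume F: "bih a b F" "F \<noteq> 0"
    obtain \<alpha> where \<alpha>: "\<And>l. l \<in> ?S \<Longrightarrow> \<alpha> l \<noteq> 0" "\<And>k. k \<le> n \<Longrightarrow> (\<Sum>l\<in>?S. \<alpha> l * fst (P l) k) = 0"
      using discriminant_relation[OF D] by blast
    have sx: "\<exists>s. \<forall>k\<le>n. q k = (\<Sum>l\<in>?S. s l * fst (P l) k)" for q
    proof -
      have 1: "1 \<in> ?S" by simp
      obtain s where s: "\<And>d. d < n + 1 \<Longrightarrow> q d = (\<Sum>l\<in>?S - {1}. s l * fst (P l) d)"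
        using discriminant_dual_bases(2)[OF D 1, of q] by blast
      have "(\<Sum>l\<in>?S. (if l = 1 then 0 else s l) * fst (P l) k) = (\<Sum>l\<in>?S - {1}. s l * fst (P l) k)" for k
        by (rule sum.mono_neutral_cong_right) auto
      then show ?thesis using s by (intro exI[of _ "\<lambda>l. if l = 1 then 0 else s l"]) auto
    qed
    have sy: "\<exists>s. \<forall>k\<le>n + 1. q k = (\<Sum>l\<in>?S. s l * snd (P l) k)" for q
    proof -
      obtain s where "\<And>d. d < n + 2 \<Longrightarrow> q d = (\<Sum>l\<in>?S. s l * snd (P l) d)"
        using discriminant_dual_bases(4)[OF D, of q] by blast
      then show ?thesis by (intro exI[of _ s]) auto
    qed
    show "(\<Sum>l\<in>?S. mult_pt l F) \<le> n * a + (n + 1) * b"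
      using F unfolding bih_def XV_def by (intro curve_inequality[OF inf _ _ _ F(2) \<alpha> sx sy]) auto
  qed simp_all
qed

theorem theorem5p1:
  fixes n :: nat
  assumes "n \<ge> 1"
  shows "holds_in_general_position n (n + 1) (n + 2)
    (\<lambda>P :: nat \<Rightarrow> 'k::{alg_closed_field, field_char_0} point.
      let X = blowup n (n + 1) (n + 2) P;
          H1 = hyperplane_pullback1 n X;
          H2 = hyperplane_pullback2 (n + 1) X;
          E = (\<lambda>i. exceptional_divisor n (n + 1) X (P i))
      in
        effective_classes X = submonoid_generated (Cl X) (divisor_class X `
          ({E i | i. i \<in> {1..n + 2}} \<union>
           {H1 - (\<Sum>i\<in>I. E i) | I. I \<subseteq> {1..n + 2} \<and> card I = n} \<union>
           {H2 - (\<Sum>i\<in>I. E i) | I. I \<subseteq> {1..n + 2} \<and> card I = n + 1})) \<and>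
        (\<forall>(d1::real) (d2::real) (m :: nat \<Rightarrow> real).
          real_divisor_class X
            (\<lambda>R. d1 * real_divisor H1 R + d2 * real_divisor H2 R
                  - (\<Sum>i = 1..n + 2. m i * real_divisor (E i) R)) \<in> effective_cone X
          \<longleftrightarrow>
          d1 \<ge> 0 \<and> d2 \<ge> 0 \<and>
          (\<forall>i\<in>{1..n + 2}. d1 + d2 \<ge> m i) \<and>
          (\<forall>I. I \<subseteq> {1..n + 2} \<and> card I \<in> {n + 1, n + 2} \<longrightarrow>
            real n * d1 + real (n + 1) * d2 \<ge> (\<Sum>i\<in>I. m i))))"
  unfolding holds_in_general_position_def
proof (intro exI conjI ballI)
  let ?U = "{P \<in> configurations n (n + 1) (n + 2). discriminant n P \<noteq> (0 :: 'k)}"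
  show "zariski_open n (n + 1) (n + 2) ?U" by (rule zariski_open_discriminant)
  show "?U \<noteq> {}" using discriminant_nonzero_witness[of n, where 'k='k] by blast
  have inf: "infinite (UNIV :: 'k set)" by (rule infinite_UNIV_char_0)
  fix P :: "nat \<Rightarrow> 'k point" assume P: "P \<in> ?U"
  interpret general_points n "n + 1" "n + 2" P
    using general_points_of_discriminant[OF inf assms] P by blast
  have E: "exceptional_divisor n (n + 1) X (P i) = Ex i" if "i \<in> {1..n + 2}" for i
    by (rule exceptional_divisor_eq[OF that])
  have EI: "(\<Sum>i\<in>I. exceptional_divisor n (n + 1) X (P i)) = (\<Sum>i\<in>I. Ex i)" if "I \<subseteq> {1..n + 2}" for I
    using E that by (intro sum.cong) auto
  have c1: "(D = exceptional_divisor n (n + 1) X (P i) \<and> i \<in> {1..n + 2}) = (D = Ex i \<and> i \<in> {1..n + 2})" for D i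
    using E[of i] by metis
  have c2: "(D = H - (\<Sum>i\<in>I. exceptional_divisor n (n + 1) X (P i)) \<and> I \<subseteq> {1..n + 2} \<and> card I = k)
      = (D = H - (\<Sum>i\<in>I. Ex i) \<and> I \<subseteq> {1..n + 2} \<and> card I = k)" for D H I k
    using EI[of I] by metis
  have G: "{exceptional_divisor n (n + 1) X (P i) | i. i \<in> {1..n + 2}} \<union>
           {H1 - (\<Sum>i\<in>I. exceptional_divisor n (n + 1) X (P i)) | I. I \<subseteq> {1..n + 2} \<and> card I = n} \<union>
           {H2 - (\<Sum>i\<in>I. exceptional_divisor n (n + 1) X (P i)) | I. I \<subseteq> {1..n + 2} \<and> card I = n + 1} = Gens"
    unfolding Gens_def c1 c2 ..
  have S: "(\<lambda>R. d1 * real_divisor H1 R + d2 * real_divisor H2 R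
                  - (\<Sum>i = 1..n + 2. m i * real_divisor (exceptional_divisor n (n + 1) X (P i)) R))
      = (\<lambda>R. d1 * real_divisor H1 R + d2 * real_divisor H2 R - (\<Sum>i = 1..n + 2. m i * real_divisor (Ex i) R))" for d1 d2 m
    using E by (intro ext arg_cong2[of _ _ _ _ "(-)"] sum.cong refl) simp
  show "let X = blowup n (n + 1) (n + 2) P;
          H1 = hyperplane_pullback1 n X;
          H2 = hyperplane_pullback2 (n + 1) X;
          E = (\<lambda>i. exceptional_divisor n (n + 1) X (P i))
      in
        effective_classes X = submonoid_generated (Cl X) (divisor_class X `
          ({E i | i. i \<in> {1..n + 2}} \<union>
           {H1 - (\<Sum>i\<in>I. E i) | I. I \<subseteq> {1..n + 2} \<and> card I = n} \<union>
           {H2 - (\<Sum>i\<in>I. E i) | I. I \<subseteq> {1..n + 2} \<and> card I = n + 1})) \<and>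
        (\<forall>(d1::real) (d2::real) (m :: nat \<Rightarrow> real).
          real_divisor_class X
            (\<lambda>R. d1 * real_divisor H1 R + d2 * real_divisor H2 R
                  - (\<Sum>i = 1..n + 2. m i * real_divisor (E i) R)) \<in> effective_cone X
          \<longleftrightarrow>
          d1 \<ge> 0 \<and> d2 \<ge> 0 \<and>
          (\<forall>i\<in>{1..n + 2}. d1 + d2 \<ge> m i) \<and>
          (\<forall>I. I \<subseteq> {1..n + 2} \<and> card I \<in> {n + 1, n + 2} \<longrightarrow>
            real n * d1 + real (n + 1) * d2 \<ge> (\<Sum>i\<in>I. m i)))"
    unfolding Let_def X_def[symmetric] hyperplane_pullback1_eq hyperplane_pullback2_eq G S
    by (intro conjI allI effective_monoid effective_cone_inequalities)
qed

end
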